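(* Let $C\ge1$, let $Q$ be an interval, and let the Bellman functions $\boldsymbol b_{p,C},\boldsymbol B_{2,C},\boldsymbol A_{\delta,C},\boldsymbol D_{\lambda,C}$ and the explicit candidates $b_{p,C},B_{2,C},A_{\delta,C},D_{\lambda,C}$ on $\Omega_C$ be as defined in the context. (1) If $p\in(1,2]$ and $C\ge\frac{e^{p-2}}{p-1}$, then $\boldsymbol b_{p,C}=b_{p,C}$. In particular, for any $C\ge1$, $\boldsymbol b_{2,C}=b_{2,C}$. (2) $\boldsymbol b_{1,C}=b_{1,C}$. (3) $\boldsymbol B_{2,C}=B_{2,C}$. (4) If $1\le\delta<1/\xi^+$, then $\boldsymbol A_{\delta,C}=A_{\delta,C}$. If $\delta\ge1/\xi^+$, then $\boldsymbol A_{\delta,C}(x)=e^{\delta x_1}$ if $x_2=e^{x_1}$, and $\boldsymbol A_{\delta,C}(x)=\infty$ if $x_2>e^{x_1}$. (5) For any $\lambda\in\mathbb R$, $\boldsymbol D_{\lambda,C}=D_{\lambda,C}$.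
   Context: **Basic notation.** For an interval $J$, $\langle\varphi\rangle_J=\frac1{|J|}\int_J\varphi$. For an a.e. positive $w$ on an interval $Q$ with $w,\log w$ locally integrable, $[w]_{A_\infty(Q)}=\sup_{J\subset Q}\langle w\rangle_Je^{-\langle\log w\rangle_J}$ (supremum over all subintervals $J$ of $Q$). For $C\ge1$, $\Omega_C=\{x\in\mathbb R^2:\ e^{x_1}\le x_2\le Ce^{x_1}\}$, and for $x\in\Omega_C$ $$E_{x,C,Q}=\{\varphi\in L^1(Q):\ \langle\varphi\rangle_Q=x_1,\ \langle e^\varphi\rangle_Q=x_2,\ [e^\varphi]_{A_\infty(Q)}\le C\}.$$ **Bellman functions.** For $p\in[1,2]$, $\delta\ge1$, $\lambda\in\mathbb R$, $x\in\Omega_C$ (these do not depend on $Q$): $\boldsymbol b_{p,C}(x)=\inf\{\langle|\varphi|^p\rangle_Q:\varphi\in E_{x,C,Q}\}$, $\boldsymbol B_{2,C}(x)=\sup\{\langle\varphi^2\rangle_Q:\varphi\in E_{x,C,Q}\}$, $\boldsymbol A_{\delta,C}(x)=\sup\{\langle e^{\delta\varphi}\rangle_Q:\varphi\in E_{x,C,Q}\}$, $\boldsymbol D_{\lambda,C}(x)=\sup\{\frac1{|Q|}|\{t\in Q:\varphi(t)\ge\lambda\}|:\varphi\in E_{x,C,Q}\}$. **Auxiliary functions.** $\xi^\pm=\xi^\pm(C)$ are the two solutions of $e^{-\xi}=C(1-\xi)$ with $-\infty<\xi^-\le0\le\xi^+<1$ (both $0$ when $C=1$, and then $1/\xi^+=\infty$).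 The functions $u^\pm=u^\pm(x)$ on $\Omega_C$ are defined implicitly by $$x_2=e^{u^\pm}\Big(\frac{x_1-u^\pm}{1-\xi^\pm}+1\Big),\qquad x_1-\xi^+\le u^+\le x_1,\qquad x_1\le u^-\le x_1-\xi^-.$$ (Geometrically, $u^\pm$ is the horizontal coordinate of the starting point on $x_2=e^{x_1}$ of the line segment through $x$ tangent to $x_2=Ce^{x_1}$ at the point with horizontal coordinate $u^\pm+\xi^\pm$.) **Candidates** (for $C>1$). For $p\in(1,2]$: $$b_{p,C}(x)=\frac p{\xi^+}\,e^{u^+/\xi^+}\Big[\int_{u^+}^\infty|s|^{p-1}\operatorname{sgn}(s)\,e^{-s/\xi^+}ds\Big](x_1-u^+)+|u^+|^p;$$ for $p=2$ this is $b_{2,C}(x)=2u^+x_1-(u^+)^2+2\xi^+(x_1-u^+)$. $$B_{2,C}(x)=2u^-x_1-(u^-)^2+2\xi^-(x_1-u^-).$$ $b_{1,C}$: write $\Omega_C=\Omega_-\cup\Omega_0\cup\Omega_+$ with $\Omega_-=\{x_1\le\xi^-,\ e^{x_1}\le x_2\le Ce^{x_1}\}\cup\{\xi^-\le x_1\le0,\ e^{x_1}\le x_2\le Ce^{\xi^-}x_1+1\}$, $\Omega_0=\{\xi^-\le x_1\le0,\ Ce^{\xi^-}x_1+1\le x_2\le Ce^{x_1}\}\cup\{0\le x_1\le\xi^+,\ Ce^{\xi^+}x_1+1\le x_2\le Ce^{x_1}\}$, $\Omega_+=\{0\le x_1\le\xi^+,\ e^{x_1}\le x_2\le Ce^{\xi^+}x_1+1\}\cup\{x_1\ge\xi^+,\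 e^{x_1}\le x_2\le Ce^{x_1}\}$. Then $b_{1,C}(x)=-x_1$ on $\Omega_-$, $b_{1,C}(x)=x_1$ on $\Omega_+$, and on $\Omega_0$ $$b_{1,C}(x)=2\,\frac{(1-\xi^-)(1-\xi^+)}{\xi^+-\xi^-}\,(x_2-1)+\frac{\xi^++\xi^--2}{\xi^+-\xi^-}\,x_1.$$ For $1\le\delta<1/\xi^+$: $$A_{\delta,C}(x)=e^{\delta u^+}\Big(\frac{\delta}{1-\delta\xi^+}(x_1-u^+)+1\Big).$$ $D_{\lambda,C}$: write $\Omega_C=\bigcup_{k=1}^4\Omega_k(\lambda)$ with $\Omega_1(\lambda)=\{x_1\le\lambda+\xi^--\xi^+,\ e^{x_1}\le x_2\le Ce^{x_1}\}\cup\{\lambda+\xi^--\xi^+\le x_1\le\lambda+\xi^-,\ e^\lambda(Ce^{\xi^-}(x_1-\lambda)+1)\le x_2\le Ce^{x_1}\}$, $\Omega_2(\lambda)=\{\lambda+\xi^--\xi^+\le x_1<\lambda,\ e^{x_1}\le x_2\le e^\lambda(Ce^{\xi^-}(x_1-\lambda)+1)\}$, $\Omega_3(\lambda)=\{\lambda+\xi^-\le x_1\le\lambda,\ e^\lambda(Ce^{\xi^-}(x_1-\lambda)+1)\le x_2\le Ce^{x_1}\}\cup\{\lambda\le x_1\le\lambda+\xi^+,\ e^\lambda(Ce^{\xi^+}(x_1-\lambda)+1)\le x_2\le Ce^{x_1}\}$, $\Omega_4(\lambda)=\{\lambda\le x_1\le\lambda+\xi^+,\ e^{x_1}\le x_2\le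 e^\lambda(Ce^{\xi^+}(x_1-\lambda)+1)\}\cup\{x_1\ge\lambda+\xi^+,\ e^{x_1}\le x_2\le Ce^{x_1}\}$. For $x\in\Omega_2(\lambda)$ let $v=v(x)<\lambda$ be the horizontal coordinate of the second point where the line through $(\lambda,e^\lambda)$ and $x$ meets the curve $x_2=e^{x_1}$, i.e. $\frac{e^v-e^\lambda}{v-\lambda}=\frac{x_2-e^\lambda}{x_1-\lambda}$. Then $$D_{\lambda,C}(x)=\begin{cases}1,&x\in\Omega_4(\lambda),\\ \frac{1-\xi^-}{(\xi^+-\xi^-)^2}\big[x_1-\lambda+(1-x_2e^{-\lambda})(1-\xi^+)\big]+1,&x\in\Omega_3(\lambda),\\ \frac{x_1-v}{\lambda-v},&x\in\Omega_2(\lambda),\\ \frac{1}{\xi^+-\xi^-}\,e^{(\xi^+-\xi^-+u^+-\lambda)/\xi^+}\,(x_1-u^+),&x\in\Omega_1(\lambda).\end{cases}$$ **Case $C=1$.** Then $\Omega_1=\{x_2=e^{x_1}\}$ and the candidates are understood as $b_{p,1}(t,e^t)=|t|^p$, $B_{2,1}(t,e^t)=t^2$, $A_{\delta,1}(t,e^t)=e^{\delta t}$, $D_{\lambda,1}(t,e^t)=\chi_{[\lambda,\infty)}(t)$. *)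

theory Defs
  imports "HOL-Analysis.Analysis"
begin

definition bdd_interval :: "real set \<Rightarrow> bool" where
  "bdd_interval J \<longleftrightarrow> is_interval J \<and> bounded J \<and> interior J \<noteq> {}"

definition avg :: "real set \<Rightarrow> (real \<Rightarrow> real) \<Rightarrow> real" where
  "avg J f = (LINT t:J|lebesgue. f t) / measure lebesgue J"

text \<open>The average of a nonnegative function, with value \<open>\<infinity>\<close> if the function is not integrable.\<close>

definition eavg :: "real set \<Rightarrow> (real \<Rightarrow> real) \<Rightarrow> ereal" where
  "eavg J f = enn2ereal ((\<integral>\<^sup>+ t\<in>J. ennreal (f t) \<partial>lebesgue) / emeasure lebesgue J)"

text \<open>The following is meaningful only for positive \<open>w\<close> such that \<open>w\<close> and \<open>ln \<circ> w\<close> are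
  integrable on all the intervals \<open>J\<close>; it is only applied to such \<open>w\<close> below.\<close>

definition Ainf :: "real set \<Rightarrow> (real \<Rightarrow> real) \<Rightarrow> ereal" where
  "Ainf Q w = (SUP J\<in>{J. bdd_interval J \<and> J \<subseteq> Q}.
     ereal (avg J w * exp (- avg J (\<lambda>t. ln (w t)))))"

definition Omega :: "real \<Rightarrow> (real \<times> real) set" where
  "Omega C = {(x1, x2). exp x1 \<le> x2 \<and> x2 \<le> C * exp x1}"

definition E_class :: "real \<times> real \<Rightarrow> real \<Rightarrow> real set \<Rightarrow> (real \<Rightarrow> real) set" where
  "E_class x C Q = {\<phi>. set_integrable lebesgue Q \<phi> \<and> set_integrable lebesgue Q (\<lambda>t. exp (\<phi> t)) \<and>
     avg Q \<phi> = fst x \<and> avg Q (\<lambda>t. exp (\<phi> t)) = snd x \<and>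
     Ainf Q (\<lambda>t. exp (\<phi> t)) \<le> ereal C}"


subsection \<open>Bellman functions\<close>

definition bell_b :: "real \<Rightarrow> real \<Rightarrow> real set \<Rightarrow> real \<times> real \<Rightarrow> ereal" where
  "bell_b p C Q x = (INF \<phi>\<in>E_class x C Q. eavg Q (\<lambda>t. \<bar>\<phi> t\<bar> powr p))"

definition bell_B2 :: "real \<Rightarrow> real set \<Rightarrow> real \<times> real \<Rightarrow> ereal" where
  "bell_B2 C Q x = (SUP \<phi>\<in>E_class x C Q. eavg Q (\<lambda>t. (\<phi> t)\<^sup>2))"

definition bell_A :: "real \<Rightarrow> real \<Rightarrow> real set \<Rightarrow> real \<times> real \<Rightarrow> ereal" where
  "bell_A \<delta> C Q x = (SUP \<phi>\<in>E_class x C Q. eavg Q (\<lambda>t. exp (\<delta> * \<phi> t)))"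

definition bell_D :: "real \<Rightarrow> real \<Rightarrow> real set \<Rightarrow> real \<times> real \<Rightarrow> ereal" where
  "bell_D lam C Q x = (SUP \<phi>\<in>E_class x C Q.
     ereal (measure lebesgue {t\<in>Q. \<phi> t \<ge> lam} / measure lebesgue Q))"


subsection \<open>Auxiliary functions\<close>

definition xi_plus :: "real \<Rightarrow> real" where
  "xi_plus C = (THE \<xi>. 0 \<le> \<xi> \<and> \<xi> < 1 \<and> exp (- \<xi>) = C * (1 - \<xi>))"

definition xi_minus :: "real \<Rightarrow> real" where
  "xi_minus C = (THE \<xi>. \<xi> \<le> 0 \<and> exp (- \<xi>) = C * (1 - \<xi>))"

definition u_plus :: "real \<Rightarrow> real \<times> real \<Rightarrow> real" where
  "u_plus C x = (THE u. snd x = exp u * ((fst x - u) / (1 - xi_plus C) + 1) \<and>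
     fst x - xi_plus C \<le> u \<and> u \<le> fst x)"

definition u_minus :: "real \<Rightarrow> real \<times> real \<Rightarrow> real" where
  "u_minus C x = (THE u. snd x = exp u * ((fst x - u) / (1 - xi_minus C) + 1) \<and>
     fst x \<le> u \<and> u \<le> fst x - xi_minus C)"


subsection \<open>Candidates\<close>

text \<open>The closed formulas are for \<open>C > 1\<close>; for \<open>C = 1\<close> the domain degenerates to the
  graph of \<open>exp\<close> and the candidates are the boundary values.\<close>

definition b_cand :: "real \<Rightarrow> real \<Rightarrow> real \<times> real \<Rightarrow> real" where
  "b_cand p C x = (if C = 1 then \<bar>fst x\<bar> powr p else
     (let \<xi> = xi_plus C; u = u_plus C x in
       p / \<xi> * exp (u / \<xi>) * (LINT s:{u..}|lebesgue. \<bar>s\<bar> powr (p - 1) * sgn s * exp (- s / \<xi>))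
         * (fst x - u) + \<bar>u\<bar> powr p))"

definition B2_cand :: "real \<Rightarrow> real \<times> real \<Rightarrow> real" where
  "B2_cand C x = (if C = 1 then (fst x)\<^sup>2 else
     (let u = u_minus C x in 2 * u * fst x - u\<^sup>2 + 2 * xi_minus C * (fst x - u)))"

definition b1_Omega_minus :: "real \<Rightarrow> (real \<times> real) set" where
  "b1_Omega_minus C =
     {(x1, x2). x1 \<le> xi_minus C \<and> exp x1 \<le> x2 \<and> x2 \<le> C * exp x1} \<union>
     {(x1, x2). xi_minus C \<le> x1 \<and> x1 \<le> 0 \<and> exp x1 \<le> x2 \<and> x2 \<le> C * exp (xi_minus C) * x1 + 1}"

definition b1_Omega_zero :: "real \<Rightarrow> (real \<times> real) set" where
  "b1_Omega_zero C =
     {(x1, x2). xi_minus C \<le> x1 \<and> x1 \<le> 0 \<and>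
        C * exp (xi_minus C) * x1 + 1 \<le> x2 \<and> x2 \<le> C * exp x1} \<union>
     {(x1, x2). 0 \<le> x1 \<and> x1 \<le> xi_plus C \<and>
        C * exp (xi_plus C) * x1 + 1 \<le> x2 \<and> x2 \<le> C * exp x1}"

definition b1_Omega_plus :: "real \<Rightarrow> (real \<times> real) set" where
  "b1_Omega_plus C =
     {(x1, x2). 0 \<le> x1 \<and> x1 \<le> xi_plus C \<and> exp x1 \<le> x2 \<and> x2 \<le> C * exp (xi_plus C) * x1 + 1} \<union>
     {(x1, x2). xi_plus C \<le> x1 \<and> exp x1 \<le> x2 \<and> x2 \<le> C * exp x1}"

text \<open>The three regions cover \<open>Omega C\<close> and overlap only in common boundary points, where the
  respective formulas agree; so the order of the case distinction does not matter. The same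
  holds for the four regions used in \<open>D_cand\<close>.\<close>

definition b1_cand :: "real \<Rightarrow> real \<times> real \<Rightarrow> real" where
  "b1_cand C x = (if C = 1 then \<bar>fst x\<bar>
     else if x \<in> b1_Omega_minus C then - fst x
     else if x \<in> b1_Omega_plus C then fst x
     else if x \<in> b1_Omega_zero C then
       2 * ((1 - xi_minus C) * (1 - xi_plus C) / (xi_plus C - xi_minus C)) * (snd x - 1)
         + (xi_plus C + xi_minus C - 2) / (xi_plus C - xi_minus C) * fst x
     else undefined)"

definition A_cand :: "real \<Rightarrow> real \<Rightarrow> real \<times> real \<Rightarrow> real" where
  "A_cand \<delta> C x = (if C = 1 then exp (\<delta> * fst x) else
     (let \<xi> = xi_plus C; u = u_plus C x in
       exp (\<delta> * u) * (\<delta> / (1 - \<delta> * \<xi>) * (fst x - u) + 1)))"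

definition D_Omega1 :: "real \<Rightarrow> real \<Rightarrow> (real \<times> real) set" where
  "D_Omega1 lam C =
     {(x1, x2). x1 \<le> lam + xi_minus C - xi_plus C \<and> exp x1 \<le> x2 \<and> x2 \<le> C * exp x1} \<union>
     {(x1, x2). lam + xi_minus C - xi_plus C \<le> x1 \<and> x1 \<le> lam + xi_minus C \<and>
        exp lam * (C * exp (xi_minus C) * (x1 - lam) + 1) \<le> x2 \<and> x2 \<le> C * exp x1}"

definition D_Omega2 :: "real \<Rightarrow> real \<Rightarrow> (real \<times> real) set" where
  "D_Omega2 lam C =
     {(x1, x2). lam + xi_minus C - xi_plus C \<le> x1 \<and> x1 < lam \<and>
        exp x1 \<le> x2 \<and> x2 \<le> exp lam * (C * exp (xi_minus C) * (x1 - lam) + 1)}"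

definition D_Omega3 :: "real \<Rightarrow> real \<Rightarrow> (real \<times> real) set" where
  "D_Omega3 lam C =
     {(x1, x2). lam + xi_minus C \<le> x1 \<and> x1 \<le> lam \<and>
        exp lam * (C * exp (xi_minus C) * (x1 - lam) + 1) \<le> x2 \<and> x2 \<le> C * exp x1} \<union>
     {(x1, x2). lam \<le> x1 \<and> x1 \<le> lam + xi_plus C \<and>
        exp lam * (C * exp (xi_plus C) * (x1 - lam) + 1) \<le> x2 \<and> x2 \<le> C * exp x1}"

definition D_Omega4 :: "real \<Rightarrow> real \<Rightarrow> (real \<times> real) set" where
  "D_Omega4 lam C =
     {(x1, x2). lam \<le> x1 \<and> x1 \<le> lam + xi_plus C \<and>
        exp x1 \<le> x2 \<and> x2 \<le> exp lam * (C * exp (xi_plus C) * (x1 - lam) + 1)} \<union>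
     {(x1, x2). lam + xi_plus C \<le> x1 \<and> exp x1 \<le> x2 \<and> x2 \<le> C * exp x1}"

definition D_v :: "real \<Rightarrow> real \<times> real \<Rightarrow> real" where
  "D_v lam x = (THE v. v < lam \<and>
     (exp v - exp lam) / (v - lam) = (snd x - exp lam) / (fst x - lam))"

definition D_cand :: "real \<Rightarrow> real \<Rightarrow> real \<times> real \<Rightarrow> real" where
  "D_cand lam C x = (if C = 1 then indicator {lam..} (fst x)
     else if x \<in> D_Omega4 lam C then 1
     else if x \<in> D_Omega3 lam C then
       (1 - xi_minus C) / (xi_plus C - xi_minus C)\<^sup>2
         * (fst x - lam + (1 - snd x * exp (- lam)) * (1 - xi_plus C)) + 1
     else if x \<in> D_Omega2 lam C then (fst x - D_v lam x) / (lam - D_v lam x)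
     else if x \<in> D_Omega1 lam C then
       1 / (xi_plus C - xi_minus C)
         * exp ((xi_plus C - xi_minus C + u_plus C x - lam) / xi_plus C) * (fst x - u_plus C x)
     else undefined)"

lemma inverse_xi_plus_1: "1 / ereal (xi_plus 1) = \<infinity>"
proof -
  have "xi_plus 1 = 0" unfolding xi_plus_def
  proof (rule the_equality)
    fix z :: real assume z: "0 \<le> z \<and> z < 1 \<and> exp (- z) = 1 * (1 - z)"
    then have "ln (1 - z) = (1 - z) - 1" by (metis add_diff_cancel_left' diff_add_cancel ln_exp mult_1 uminus_add_conv_diff)
    with z show "z = 0" using ln_eq_minus_one[of "1 - z"] by simp
  qed simp
  then show ?thesis by (simp add: divide_ereal_def)
qed

lemma xi_plus_props:
  assumes "C > 1"
  shows "0 < xi_plus C" "xi_plus C < 1" "exp (- xi_plus C) = C * (1 - xi_plus C)"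
proof -
  let ?P = "\<lambda>\<xi>. 0 \<le> \<xi> \<and> \<xi> < 1 \<and> exp (- \<xi>) = C * (1 - \<xi>)"
  have "\<exists>\<xi>\<ge>0. \<xi> \<le> 1 \<and> exp (- \<xi>) - C * (1 - \<xi>) = (0::real)"
    by (rule IVT') (use assms in \<open>auto intro!: continuous_intros\<close>)
  then obtain z where z: "0 \<le> z" "z \<le> 1" "exp (- z) = C * (1 - z)" by auto
  have "z \<noteq> 1" using z(3) by auto
  then have Pz: "?P z" using z by simp
  have anti: "(1 - b) * exp b < (1 - a) * exp a" if "0 \<le> a" "a < b" for a b :: real
  proof (rule DERIV_neg_imp_decreasing_open[OF that(2)])
    fix y assume "a < y" "y < b"
    then have "y > 0" using that by simp
    then show "\<exists>d. ((\<lambda>x. (1 - x) * exp x) has_real_derivative d) (at y) \<and> d < 0"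
      by (intro exI[of _ "- y * exp y"]) (auto intro!: derivative_eq_intros simp: algebra_simps)
  qed (auto intro!: continuous_intros)
  have h: "C * ((1 - y) * exp y) = 1" if "?P y" for y
  proof -
    have "C * ((1 - y) * exp y) = exp (- y) * exp y" using that by simp
    then show ?thesis by (simp flip: exp_add)
  qed
  have "y = z" if "?P y" for y
  proof -
    have "(1 - y) * exp y = (1 - z) * exp z"
      using h[OF that] h[OF Pz] assms by (metis mult_cancel_left mult_zero_left zero_neq_one)
    then show ?thesis using anti[of y z] anti[of z y] that Pz by (cases y z rule: linorder_cases) auto
  qed
  with Pz have "?P (xi_plus C)" unfolding xi_plus_def by (rule theI[of ?P])
  moreover from this have "xi_plus C \<noteq> 0" using assms by auto
  ultimately show "0 < xi_plus C" "xi_plus C < 1" "exp (- xi_plus C) = C * (1 - xi_plus C)"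
    by auto
qed

lemma has_bochner_integral_FTC_atLeast:
  fixes f F :: "real \<Rightarrow> real"
  assumes "f \<in> borel_measurable borel"
    and "\<And>x. a \<le> x \<Longrightarrow> (F has_real_derivative f x) (at x)"
    and nn: "\<And>x. a \<le> x \<Longrightarrow> 0 \<le> f x"
    and lim: "(F \<longlongrightarrow> T) at_top"
  shows "has_bochner_integral lborel (\<lambda>x. f x * indicator {a..} x) (T - F a)"
proof (rule has_bochner_integral_nn_integral)
  have "F a \<le> F x" if "a \<le> x" for x
    by (rule DERIV_nonneg_imp_nondecreasing[OF that]) (use assms(2) nn in blast)
  then have "eventually (\<lambda>x. F a \<le> F x) at_top"
    by (rule eventually_mono[OF eventually_ge_at_top[of a]])
  from tendsto_lowerbound[OF lim this] show "0 \<le> T - F a" by simp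
  have "(\<integral>\<^sup>+x. ennreal (f x * indicator {a..} x) \<partial>lborel) =
      (\<integral>\<^sup>+x. ennreal (f x) * indicator {a..} x \<partial>lborel)"
    by (intro nn_integral_cong) (auto split: split_indicator)
  also have "\<dots> = T - F a"
    by (rule nn_integral_FTC_atLeast) fact+
  finally show "(\<integral>\<^sup>+x. ennreal (f x * indicator {a..} x) \<partial>lborel) = ennreal (T - F a)" .
  show "(\<lambda>x. f x * indicator {a..} x) \<in> borel_measurable lborel"
    using assms(1) by measurable
  show "AE x in lborel. 0 \<le> f x * indicator {a..} x"
    using nn by (intro AE_I2) (simp add: indicator_def)
qed

lemma b_cand_2:
  assumes "C > 1"
  shows "b_cand 2 C x =
    2 * u_plus C x * fst x - (u_plus C x)\<^sup>2 + 2 * xi_plus C * (fst x - u_plus C x)"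
proof -
  define \<xi> u where "\<xi> = xi_plus C" and "u = u_plus C x"
  have pos: "\<xi> > 0" using xi_plus_props[OF assms] by (simp add: \<xi>_def)
  have scale: "filterlim (\<lambda>s. s / \<xi>) at_top at_top"
    using filterlim_tendsto_pos_mult_at_top[OF tendsto_const _ filterlim_ident, of "1/\<xi>"] pos
    by simp
  then have lim0: "((\<lambda>s. exp (- s / \<xi>)) \<longlongrightarrow> 0) at_top"
    by (intro filterlim_compose[OF exp_at_bot]) (simp add: filterlim_uminus_at_bot)
  have "((\<lambda>y. y ^ 1 / exp y) \<longlongrightarrow> (0::real)) at_top" by (rule tendsto_power_div_exp_0)
  then have "((\<lambda>s. (s / \<xi>) ^ 1 / exp (s / \<xi>)) \<longlongrightarrow> 0) at_top"
    using scale by (rule filterlim_compose)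
  from tendsto_mult_left[OF this, of \<xi>]
  have lim1: "((\<lambda>s. s * exp (- s / \<xi>)) \<longlongrightarrow> 0) at_top"
    using pos by (simp add: exp_minus field_simps)
  have I1: "has_bochner_integral lborel (\<lambda>s. exp (- s / \<xi>) * indicator {u..} s)
      (0 - (- \<xi> * exp (- u / \<xi>)))"
    by (rule has_bochner_integral_FTC_atLeast[where F = "\<lambda>s. - \<xi> * exp (- s / \<xi>)"])
       (use pos tendsto_mult_left[OF lim0, of "- \<xi>"] in \<open>auto intro!: derivative_eq_intros\<close>)
  have I2: "has_bochner_integral lborel (\<lambda>s. (s - u) * exp (- s / \<xi>) * indicator {u..} s)
      (0 - (- \<xi> * (u - u + \<xi>) * exp (- u / \<xi>)))"
  proof (rule has_bochner_integral_FTC_atLeast[where F = "\<lambda>s. - \<xi> * (s - u + \<xi>) * exp (- s / \<xi>)"])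
    fix s :: real
    show "((\<lambda>s. - \<xi> * (s - u + \<xi>) * exp (- s / \<xi>)) has_real_derivative
        (s - u) * exp (- s / \<xi>)) (at s)"
      using pos by (auto intro!: derivative_eq_intros simp: field_simps)
    have "((\<lambda>s. - \<xi> * (s * exp (- s / \<xi>)) + \<xi> * (u - \<xi>) * exp (- s / \<xi>)) \<longlongrightarrow>
        - \<xi> * 0 + \<xi> * (u - \<xi>) * 0) at_top"
      by (intro tendsto_intros lim0 lim1)
    then show "((\<lambda>s. - \<xi> * (s - u + \<xi>) * exp (- s / \<xi>)) \<longlongrightarrow> 0) at_top"
      by (simp add: algebra_simps)
  qed auto
  have eq: "\<bar>s\<bar> powr (2 - 1) * sgn s * exp (- s / \<xi>) = s * exp (- s / \<xi>)" for s :: real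
    by (simp add: abs_mult_sgn)
  have "has_bochner_integral lborel (\<lambda>s. s * exp (- s / \<xi>) * indicator {u..} s)
      (\<xi> * (u + \<xi>) * exp (- u / \<xi>))"
    using has_bochner_integral_add[OF I2 has_bochner_integral_mult_right[OF I1, of u]]
    by (simp add: algebra_simps)
  then have "(LINT s:{u..}|lborel. s * exp (- s / \<xi>)) = \<xi> * (u + \<xi>) * exp (- u / \<xi>)"
    unfolding set_lebesgue_integral_def
    by (simp add: has_bochner_integral_iff mult.commute)
  moreover have "(LINT s:{u..}|lebesgue. s * exp (- s / \<xi>)) = (LINT s:{u..}|lborel. s * exp (- s / \<xi>))"
    unfolding set_lebesgue_integral_def by (rule integral_completion) auto
  ultimately have int: "(LINT s:{u..}|lebesgue. \<bar>s\<bar> powr (2 - 1) * sgn s * exp (- s / \<xi>)) =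
      \<xi> * (u + \<xi>) * exp (- u / \<xi>)"
    unfolding eq by simp
  have "exp (u / \<xi>) * exp (- u / \<xi>) = 1" by (simp flip: exp_add)
  then have "2 / \<xi> * exp (u / \<xi>) * (\<xi> * (u + \<xi>) * exp (- u / \<xi>)) = 2 * (u + \<xi>)"
    using pos by (simp add: field_simps)
  then have "b_cand 2 C x = 2 * (u + \<xi>) * (fst x - u) + u\<^sup>2"
    using assms unfolding b_cand_def Let_def \<xi>_def[symmetric] u_def[symmetric] int by simp
  then show ?thesis
    unfolding \<xi>_def[symmetric] u_def[symmetric] by (simp add: algebra_simps power2_eq_square)
qed

end

theory Submission
  imports Defs
begin

text \<open>The upper curve of \<open>Omega C\<close> has two tangents through each boundary point \<open>(w, exp w)\<close>, given by
  \<open>xi_plus C\<close> and \<open>xi_minus C\<close>. By the rising sun lemma the set where \<open>\<phi>\<close> exceeds the tangency abscissa is covered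
  by intervals on which the average of \<open>\<phi>\<close> is exactly that abscissa, and on each of them the \<open>A_\<infinity>\<close> condition says that
  the average point lies below the tangent. Hence the affine function \<open>ell \<xi> w\<close> vanishing on the tangent satisfies
  \<open>\<integral> ell \<xi> w (\<phi>) \<le> 0\<close> over \<open>{\<phi> > w}\<close> (respectively \<open>{\<phi> < w}\<close> for the other tangent).
  Where a candidate is affine along one family of tangents, the difference between the integrand and the
  tangent plane of the candidate at the given point is an integral of \<open>ell \<xi> w\<close> over \<open>w\<close> with a density of constant
  sign, and Fubini gives one half of each equality. The other half comes from
  explicit test functions: constants, two-valued functions and logarithmic tails \<open>u + \<xi> ln (\<tau> / (t - a))\<close>, cut off where necessary.\<close>

section \<open>The rising sun lemma\<close>

text \<open>The domain \<open>Omega C\<close> is not convex: the segment joining the average points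
  of two halves of an interval may cross the upper curve, so a bisection argument with a locally
  concave candidate has no direct start. The rising sun cover avoids this. All its intervals have
  average points on one vertical line, where tangent and upper curve have the same height, so one
  inequality at one point is enough. A tangent with parameter \<open>w\<close> is usable only if
  \<open>x1\<close> lies on the proper side of \<open>w + \<xi>\<close>, since the cover requires a
  total integral of the right sign. This is why the integration over \<open>w\<close> starts at
  \<open>u_plus\<close> or \<open>u_minus\<close>. In the angle between the two tangents from one
  boundary point there is no family to integrate; the two inequalities for that point suffice. In
  \<open>D_Omega2\<close> convexity of \<open>exp\<close> alone gives the bound. The lower bound on
  \<open>C\<close> for \<open>p < 2\<close> enters as \<open>2 - p \<le> xi_plus C\<close> and
  serves to fix the sign of the density. The logarithmic tails are extremal because the averages
  over their initial intervals move along the upper curve itself.\<close>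

lemma component_real_open:
  fixes G :: "real set"
  assumes "open G" "bounded G" "J \<in> components G"
  obtains c d where "c < d" "J = {c<..<d}" "c \<notin> G" "d \<notin> G"
proof -
  have J: "open J" "connected J" "J \<noteq> {}" "J \<subseteq> G" "bounded J"
    using open_components[OF assms(1,3)] in_components_connected[OF assms(3)] in_components_nonempty[OF assms(3)]
      in_components_subset[OF assms(3)] bounded_subset[OF assms(2)] by auto
  have bb: "bdd_below J" "bdd_above J"
    using J(5) bounded_imp_bdd_below bounded_imp_bdd_above by auto
  define c d where "c = Inf J" and "d = Sup J"
  have iv: "x \<in> J" if "p \<in> J" "q \<in> J" "p \<le> x" "x \<le> q" for p q x
    using J(2) that connectedD_interval by blast
  have cJ: "c \<notin> J"
  proof
    assume "c \<in> J"
    then obtain e where "e > 0" "ball c e \<subseteq> J" using J(1) openE by blast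
    then have "c - e/2 \<in> J" by (auto simp: dist_real_def subset_iff)
    then have "c \<le> c - e/2" unfolding c_def using bb cInf_lower by blast
    with \<open>e > 0\<close> show False by simp
  qed
  have dJ: "d \<notin> J"
  proof
    assume "d \<in> J"
    then obtain e where "e > 0" "ball d e \<subseteq> J" using J(1) openE by blast
    then have "d + e/2 \<in> J" by (auto simp: dist_real_def subset_iff)
    then have "d + e/2 \<le> d" unfolding d_def using bb cSup_upper by blast
    with \<open>e > 0\<close> show False by simp
  qed
  have eq: "J = {c<..<d}"
  proof (intro equalityI subsetI)
    fix x assume "x \<in> J"
    then have "c \<le> x" "x \<le> d" unfolding c_def d_def using bb cInf_lower[of x J] cSup_upper[of x J] by auto
    moreover have "x \<noteq> c" "x \<noteq> d" using \<open>x \<in> J\<close> cJ dJ by auto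
    ultimately show "x \<in> {c<..<d}" by auto
  next
    fix x assume x: "x \<in> {c<..<d}"
    obtain p where "p \<in> J" "p < x" using x cInf_lessD[OF J(3), of x] unfolding c_def by auto
    moreover obtain q where "q \<in> J" "x < q" using x less_cSupE[OF _ J(3), of x] unfolding d_def by auto
    ultimately show "x \<in> J" using iv[of p q x] by auto
  qed
  have "c < d" using eq J(3) by auto
  have "c \<notin> G"
  proof
    assume "c \<in> G"
    have "connected (insert c J)" unfolding eq using \<open>c < d\<close>
      by (metis connected_Ico ivl_disj_un_singleton(3) insert_is_Un)
    then have "insert c J \<subseteq> J"
      using components_maximal[OF assms(3), of "insert c J"] \<open>c \<in> G\<close> J by auto
    with cJ show False by auto
  qed
  moreover have "d \<notin> G"
  proof
    assume "d \<in> G"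
    have "connected (insert d J)" unfolding eq using \<open>c < d\<close>
      by (metis connected_Ioc ivl_disj_un_singleton(4) insert_is_Un Un_commute)
    then have "insert d J \<subseteq> J"
      using components_maximal[OF assms(3), of "insert d J"] \<open>d \<in> G\<close> J by auto
    with dJ show False by auto
  qed
  ultimately show ?thesis using that eq \<open>c < d\<close> by blast
qed

lemma integrable_imp_set_integrable:
  fixes f :: "_ \<Rightarrow> real"
  shows "integrable M f \<Longrightarrow> A \<in> sets M \<Longrightarrow> set_integrable M A f"
  unfolding set_integrable_def using integrable_mult_indicator by blast

text \<open>Countable additivity over the components. Boundedness makes every component an interval
  with two finite end points, both outside the set.\<close>

lemma set_integral_open_nonpos:
  fixes g :: "real \<Rightarrow> real"
  assumes G: "open G" "bounded G" and g: "integrable lebesgue g"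
    and le: "\<And>c d. c < d \<Longrightarrow> {c<..<d} \<subseteq> G \<Longrightarrow> c \<notin> G \<Longrightarrow> d \<notin> G \<Longrightarrow> (LINT t:{c<..<d}|lebesgue. g t) \<le> 0"
  shows "(LINT t:G|lebesgue. g t) \<le> 0"
proof -
  let ?K = "components G"
  have disj: "pairwise disjnt ?K" using pairwise_disjoint_components
    by (simp add: pairwise_def disjnt_def)
  have op: "open J" if "J \<in> ?K" for J using that G open_components by blast
  have cnt: "countable ?K" using countable_disjoint_open_subsets[OF op disj] .
  \<comment> \<open>The component with index \<open>n\<close>, or the empty set when no component
    has that index, so that finitely and infinitely many components are treated alike.\<close>
  define A where "A n = \<Union>{J \<in> ?K. to_nat_on ?K J = n}" for n
  have A_cases: "A n = {} \<or> A n \<in> ?K" for n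
  proof (cases "\<exists>J\<in>?K. to_nat_on ?K J = n")
    case True
    then obtain J where J: "J \<in> ?K" "to_nat_on ?K J = n" by blast
    have "{J \<in> ?K. to_nat_on ?K J = n} = {J}"
      using J inj_on_to_nat_on[OF cnt] by (auto simp: inj_on_def)
    then show ?thesis using J by (simp add: A_def)
  next
    case False then show ?thesis unfolding A_def by auto
  qed
  have UA: "(\<Union>n. A n) = G"
    proof -
    have "(\<Union>n. A n) = \<Union>?K" unfolding A_def by blast
    then show ?thesis using Union_components[of G] by simp
  qed
  have opA: "open (A n)" for n using A_cases[of n] op by auto
  have meas: "A n \<in> sets lebesgue" for n using opA by auto
  have dA: "A i \<inter> A j = {}" if "i \<noteq> j" for i j
  proof (rule ccontr)
    assume "A i \<inter> A j \<noteq> {}"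
    then obtain x where "x \<in> A i" "x \<in> A j" by auto
    then obtain J J' where J: "x \<in> J" "J \<in> ?K" "to_nat_on ?K J = i" "x \<in> J'" "J' \<in> ?K" "to_nat_on ?K J' = j"
      unfolding A_def by auto
    then have "J \<noteq> J'" using that by auto
    then have "disjnt J J'" using pairwiseD[OF disj J(2,5)] by simp
    with J show False by (auto simp: disjnt_def)
  qed
  have int: "set_integrable lebesgue (\<Union>n. A n) g"
    unfolding UA by (rule integrable_imp_set_integrable[OF g]) (use G in auto)
  have leA: "(LINT t:A n|lebesgue. g t) \<le> 0" for n
    using A_cases[of n]
  proof
    assume "A n \<in> ?K"
    then obtain c d where "c < d" "A n = {c<..<d}" "c \<notin> G" "d \<notin> G"
      using component_real_open[OF G] by blast
    then show ?thesis using le[of c d] UA by auto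
  qed (simp add: set_lebesgue_integral_def)
  have "(\<lambda>n. LINT t:(\<Union>i<n. A i)|lebesgue. g t) \<longlonglongrightarrow> (LINT t:(\<Union>n. \<Union>i<n. A i)|lebesgue. g t)"
    by (rule set_integral_cont_up)
       (use meas int in \<open>auto simp: incseq_def intro: set_integrable_subset less_le_trans\<close>)
  moreover have "(LINT t:(\<Union>i<n. A i)|lebesgue. g t) = (\<Sum>i<n. LINT t:A i|lebesgue. g t)" for n
    by (rule set_integral_finite_Union)
       (use meas dA int in \<open>auto simp: disjoint_family_on_def intro: set_integrable_subset\<close>)
  moreover have "(\<Union>n. \<Union>i<n. A i) = G" using UA by blast
  ultimately have "(\<lambda>n. LINT t:A n|lebesgue. g t) sums (LINT t:G|lebesgue. g t)"
    unfolding sums_def by simp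
  then show ?thesis by (rule sums_le[OF leA _ sums_zero])
qed

text \<open>Regularity takes the place of differentiation: outer regularity of the measure with
  density \<open>\<bar>h\<bar>\<close> approximates the set where \<open>h\<close> is positive by
  bounded open sets, and over these the integral is nonpositive by the previous lemma.\<close>

lemma AE_nonpos_if_interval_integrals_nonpos:
  fixes g :: "real \<Rightarrow> real"
  assumes g: "integrable lebesgue g"
    and le: "\<And>c d. c < d \<Longrightarrow> (LINT t:{c<..<d}|lebesgue. g t) \<le> 0"
  shows "AE x in lebesgue. g x \<le> 0"
proof -
  \<comment> \<open>A Borel representative, because outer regularity is applied to a Borel
    measure.\<close>
  obtain h where h[measurable]: "h \<in> borel_measurable lborel" and gh: "AE x in lborel. g x = h x"
    using completion_ex_borel_measurable_real[of g lborel] g by auto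
  have ghl: "AE x in lebesgue. g x = h x" using gh by (rule AE_completion)
  have hl: "integrable lebesgue h"
    using integrable_cong_AE_imp[OF g _ ghl] measurable_completion[OF h] by blast
  have hb: "integrable lborel h" using hl by (simp add: integrable_completion)
  have op: "(LINT t:U|lborel. h t) \<le> 0" if "open U" "bounded U" for U
  proof -
    have "(LINT t:U|lebesgue. h t) \<le> 0"
    proof (rule set_integral_open_nonpos[OF that hl])
      fix c d :: real assume "c < d"
      have "(LINT t:{c<..<d}|lebesgue. h t) = (LINT t:{c<..<d}|lebesgue. g t)"
        unfolding set_lebesgue_integral_def
        by (rule integral_cong_AE) (use ghl hl g in \<open>auto intro!: borel_measurable_times borel_measurable_indicator\<close>)
      then show "(LINT t:{c<..<d}|lebesgue. h t) \<le> 0" using le[OF \<open>c < d\<close>] by simp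
    qed
    moreover have "(LINT t:U|lebesgue. h t) = (LINT t:U|lborel. h t)"
      unfolding set_lebesgue_integral_def by (rule integral_completion) (use that h in \<open>auto intro!: borel_measurable_times borel_measurable_indicator\<close>)
    ultimately show ?thesis by simp
  qed
  have "AE x in lborel. h x \<le> 0"
  proof -
    have "AE x in lborel. \<not> (h x > 0 \<and> \<bar>x\<bar> < real n)" for n :: nat
    proof -
      define A where "A = {x. h x > 0 \<and> \<bar>x\<bar> < real n}"
      have A[measurable]: "A \<in> sets borel" unfolding A_def by measurable
      let ?N = "density lborel (\<lambda>x. ennreal \<bar>h x\<bar>)"
      have fin: "emeasure ?N (space ?N) \<noteq> \<infinity>"
        using hb by (simp add: emeasure_density integrable_iff_bounded)
      have outer: "emeasure ?N A = (INF U\<in>{U. A \<subseteq> U \<and> open U}. emeasure ?N U)"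
        by (rule outer_regular) (use fin A in auto)
      have NE: "emeasure ?N B = ennreal (LINT t:B|lborel. \<bar>h t\<bar>)" if [measurable]: "B \<in> sets borel" for B
      proof -
        have "emeasure ?N B = (\<integral>\<^sup>+x. ennreal (indicator B x *\<^sub>R \<bar>h x\<bar>) \<partial>lborel)"
          by (subst emeasure_density) (auto intro!: nn_integral_cong split: split_indicator)
        also have "\<dots> = ennreal (LINT x|lborel. indicator B x *\<^sub>R \<bar>h x\<bar>)"
          by (rule nn_integral_eq_integral) (use integrable_mult_indicator[of B lborel "\<lambda>x. \<bar>h x\<bar>"] hb in auto)
        finally show ?thesis by (simp add: set_lebesgue_integral_def)
      qed
      have int: "set_integrable lborel B h" "set_integrable lborel B (\<lambda>x. \<bar>h x\<bar>)" if "B \<in> sets borel" for B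
        using hb that by (auto intro: integrable_imp_set_integrable)
      have "(LINT t:A|lborel. h t) \<le> e" if "e > 0" for e
      proof -
        have "emeasure ?N A < emeasure ?N A + ennreal e"
          using that by (simp add: NE set_lebesgue_integral_def ennreal_plus[symmetric] ennreal_less_iff del: ennreal_plus)
        then obtain U where U: "A \<subseteq> U" "open U" "emeasure ?N U < emeasure ?N A + ennreal e"
          unfolding outer INF_less_iff by (metis (no_types, lifting) INF_less_iff mem_Collect_eq outer)
        \<comment> \<open>Cutting with an interval that already contains \<open>A\<close> makes
          \<open>op\<close> applicable without losing the estimate for \<open>U\<close>.\<close>
        define V where "V = U \<inter> {-real n<..<real n}"
        have V: "A \<subseteq> V" "open V" "bounded V" "V \<subseteq> U"
          using U bounded_subset[OF bounded_box(1)[of "-real n" "real n"]] unfolding V_def A_def by auto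
        have [measurable]: "V \<in> sets borel" "U \<in> sets borel" using V U by auto
        have "emeasure ?N V \<le> emeasure ?N U" by (rule emeasure_mono) (use V in auto)
        with U have "emeasure ?N V < emeasure ?N A + ennreal e" by simp
        then have "(LINT t:V|lborel. \<bar>h t\<bar>) < (LINT t:A|lborel. \<bar>h t\<bar>) + e"
          using that by (simp add: NE set_lebesgue_integral_def ennreal_plus[symmetric] ennreal_less_iff del: ennreal_plus)
        moreover have "(LINT t:V|lborel. \<bar>h t\<bar>) = (LINT t:A|lborel. \<bar>h t\<bar>) + (LINT t:V-A|lborel. \<bar>h t\<bar>)"
          using set_integral_Un[of A "V-A" lborel "\<lambda>t. \<bar>h t\<bar>"] V int by (auto simp: Un_absorb1)
        moreover have "(LINT t:V|lborel. h t) = (LINT t:A|lborel. h t) + (LINT t:V-A|lborel. h t)"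
          using set_integral_Un[of A "V-A" lborel h] V int by (auto simp: Un_absorb1)
        moreover have "- (LINT t:V-A|lborel. \<bar>h t\<bar>) \<le> (LINT t:V-A|lborel. h t)"
          using set_integral_mono[of lborel "V-A" "\<lambda>t. - \<bar>h t\<bar>" h] int by (auto simp: set_integral_uminus set_integrable_def)
        ultimately show ?thesis using op[OF V(2,3)] by linarith
      qed
      then have "(LINT t:A|lborel. h t) \<le> 0" by (rule field_le_epsilon[of _ "0::real", simplified])
      moreover have nn: "0 \<le> indicator A x *\<^sub>R h x" for x unfolding A_def by (auto split: split_indicator)
      ultimately have "(LINT t|lborel. indicator A t *\<^sub>R h t) = 0"
        unfolding set_lebesgue_integral_def using Bochner_Integration.integral_nonneg[of lborel "\<lambda>t. indicator A t *\<^sub>R h t"] by (intro antisym) auto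
      then have "AE x in lborel. indicator A x *\<^sub>R h x = 0"
        using integral_nonneg_eq_0_iff_AE[of lborel "\<lambda>t. indicator A t *\<^sub>R h t"] int[OF A] nn
        by (auto simp: set_integrable_def)
      then show ?thesis by eventually_elim (auto simp: A_def split: split_indicator_asm)
    qed
    then have "AE x in lborel. \<forall>n::nat. \<not> (h x > 0 \<and> \<bar>x\<bar> < real n)" unfolding AE_all_countable by blast
    then show ?thesis by eventually_elim (metis linorder_not_le reals_Archimedean2)
  qed
  then have "AE x in lebesgue. h x \<le> 0" by (rule AE_completion)
  with ghl show ?thesis by eventually_elim simp
qed

text \<open>On a component that starts at the left end point the classical statement gives only an
  inequality. Equality on every component is needed here, since the average has to be exactly the
  tangency abscissa. The hypothesis \<open>tot\<close> makes this possible: everything up to the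
  last zero of the primitive is absorbed into one component.\<close>

lemma rising_sun:
  fixes g :: "real \<Rightarrow> real"
  assumes ab: "a < b" and g: "integrable lebesgue g" and tot: "integral {a..b} g \<le> 0"
  obtains G where "open G" "G \<subseteq> {a<..<b}"
    "\<And>c d. c < d \<Longrightarrow> {c<..<d} \<subseteq> G \<Longrightarrow> c \<notin> G \<Longrightarrow> d \<notin> G \<Longrightarrow> integral {c..d} g = 0"
    "AE x in lebesgue. x \<in> {a<..<b} - G \<longrightarrow> g x \<le> 0"
proof -
  have si: "set_integrable lebesgue S g" if "S \<in> sets lebesgue" for S
    using integrable_imp_set_integrable[OF g that] .
  have hk: "g integrable_on S" "(LINT t:S|lebesgue. g t) = integral S g" if "S \<in> sets lebesgue" for S
    using set_lebesgue_integral_eq_integral[OF si[OF that]] by auto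
  define F where "F x = integral {a..x} g" for x
  have Fdiff: "integral {c..d} g = F d - F c" if "a \<le> c" "c \<le> d" for c d
    using Henstock_Kurzweil_Integration.integral_combine[OF that, of g] hk[of "{a..d}"] unfolding F_def by simp
  have contF: "continuous_on {a..b} F"
    unfolding F_def by (rule indefinite_integral_continuous_1) (use hk in auto)
  have Fa: "F a = 0" unfolding F_def by simp
  have Fb: "F b \<le> 0" using tot unfolding F_def .
  define T where "T = {y \<in> {a..b}. 0 \<le> F y}"
  have Tclosed: "closed T"
    using continuous_closed_preimage[OF contF closed_real_atLeastAtMost closed_atLeast[of 0]]
    by (simp add: T_def vimage_def Int_def)
  have aT: "a \<in> T" using Fa ab by (auto simp: T_def)
  have bT: "bdd_above T" by (rule bdd_aboveI[of _ b]) (auto simp: T_def)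
  \<comment> \<open>The last point at which the primitive \<open>F\<close> is nonnegative. As
    \<open>F b \<le> 0\<close>, it is a zero of \<open>F\<close>, and \<open>F\<close> is negative
    after it.\<close>
  define a' where "a' = Sup T"
  have a'T: "a' \<in> T" unfolding a'_def using closed_contains_Sup[OF _ bT Tclosed] aT by auto
  then have a': "a \<le> a'" "a' \<le> b" "0 \<le> F a'" by (auto simp: T_def)
  have after: "F y < 0" if "a' < y" "y \<le> b" for y
  proof (rule ccontr)
    assume "\<not> F y < 0"
    then have "y \<in> T" using that a' by (auto simp: T_def)
    then have "y \<le> a'" unfolding a'_def using bT by (rule cSup_upper)
    with that show False by simp
  qed
  have Fa': "F a' = 0"
  proof (rule ccontr)
    assume "F a' \<noteq> 0"
    then have pos: "F a' > 0" using a' by simp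
    then have "a' < b" using Fb a' by (cases "a' = b") auto
    have "\<exists>x\<ge>a'. x \<le> b \<and> F x = 0"
      by (rule IVT2') (use pos Fb a' in \<open>auto intro: continuous_on_subset[OF contF]\<close>)
    then obtain x where x: "a' \<le> x" "x \<le> b" "F x = 0" by auto
    then show False using after[of x] pos by (cases "x = a'") auto
  qed
  \<comment> \<open>The points in shadow to the right of \<open>a'\<close>: some later point has a
    larger value of \<open>F\<close>.\<close>
  define G1 where "G1 = {x \<in> {a'<..<b}. \<exists>y\<in>{x<..b}. F x < F y}"
  have G1op: "open G1"
  proof -
    have "\<exists>e>0. \<forall>z. dist z x < e \<longrightarrow> z \<in> G1" if x: "x \<in> G1" for x
    proof -
      obtain y where y: "x < y" "y \<le> b" "F x < F y" using x by (auto simp: G1_def)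
      have x': "a' < x" "x < b" using x by (auto simp: G1_def)
      have "continuous (at x within {a..b}) F" using contF x' a' by (simp add: continuous_on_eq_continuous_within)
      then have "isCont F x" using x' a' by (simp add: continuous_within at_within_Icc_at)
      then have "\<forall>\<^sub>F z in at x. F z < F y"
        using y(3) unfolding isCont_def by (rule order_tendstoD(2))
      then obtain e1 where e1: "e1 > 0" "\<And>z. z \<noteq> x \<Longrightarrow> dist z x < e1 \<Longrightarrow> F z < F y"
        unfolding eventually_at by auto
      define e where "e = min e1 (min (x - a') (y - x))"
      have "e > 0" using e1 x' y by (auto simp: e_def)
      moreover have "z \<in> G1" if "dist z x < e" for z
        using that e1(2)[of z] y x' unfolding G1_def e_def dist_real_def
        by (cases "z = x") (auto intro!: bexI[of _ y])
      ultimately show ?thesis by blast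
    qed
    then show ?thesis unfolding open_dist by blast
  qed
  \<comment> \<open>A point not in shadow dominates everything to its right. The point
    \<open>a'\<close> is included because \<open>F\<close> vanishes there and is negative
    afterwards.\<close>
  have outside: "F d \<le> F c" if "c \<in> {a'..b}" "c \<notin> G1" "c \<le> d" "d \<le> b" for c d
  proof (cases "c = d \<or> c = b")
    case False
    show ?thesis
    proof (cases "c = a'")
      case True then show ?thesis using after[of d] Fa' that False by force
    next
      case False then show ?thesis using that \<open>\<not> (c = d \<or> c = b)\<close> unfolding G1_def by force
    qed
  qed (use that in auto)
  have comp: "F c = F d" if cd: "c < d" "{c<..<d} \<subseteq> G1" "c \<notin> G1" "d \<notin> G1" for c d
  proof -
    have bnd: "a' \<le> c" "d \<le> b"
    proof -
      have "{c<..<d} \<subseteq> {a'..b}" using cd(2) by (auto simp: G1_def)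
      then show "a' \<le> c" "d \<le> b" using greaterThanLessThan_subseteq_atLeastAtMost_iff[of c d a' b] cd(1) by auto
    qed
    have "F d \<le> F c" using outside[of c d] bnd cd by auto
    moreover have "F c \<le> F d"
    proof -
      have le: "F x \<le> F d" if x: "x \<in> {c<..<d}" for x
      proof -
        have "continuous_on {x..b} F" by (rule continuous_on_subset[OF contF]) (use x bnd a' in auto)
        then obtain z where z: "z \<in> {x..b}" "\<And>y. y \<in> {x..b} \<Longrightarrow> F y \<le> F z"
          using continuous_attains_sup[of "{x..b}" F] x bnd by auto
        \<comment> \<open>A maximum point of \<open>F\<close> on \<open>{x..b}\<close> cannot be in
          shadow, so it lies at or beyond \<open>d\<close>, and \<open>outside\<close> compares it
          with \<open>F d\<close>.\<close>
        have "z \<notin> G1"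
        proof
          assume "z \<in> G1"
          then obtain y where "z < y" "y \<le> b" "F z < F y" by (auto simp: G1_def)
          then show False using z(1) z(2)[of y] by auto
        qed
        then have "d \<le> z" using z x cd(2) by (meson atLeastAtMost_iff greaterThanLessThan_iff less_le_trans not_le subsetD)
        then have "F z \<le> F d" using outside[of d z] bnd cd z by auto
        then show ?thesis using z(2)[of x] x bnd by auto
      qed
      have "continuous_on {c..d} F" by (rule continuous_on_subset[OF contF]) (use bnd a' in auto)
      then show ?thesis
        using continuous_ge_on_closure[of "{c<..<d}" "\<lambda>x. - F x" c "- F d"] le cd(1)
        by (auto intro!: continuous_intros)
    qed
    ultimately show ?thesis by simp
  qed
  define G where "G = {a<..<a'} \<union> G1"
  have Gop: "open G" unfolding G_def using G1op by auto
  have Gsub: "G \<subseteq> {a<..<b}" unfolding G_def G1_def using a' by auto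
  have a'G: "a' \<notin> G" unfolding G_def G1_def by auto
  have G_lt: "x \<in> G \<longleftrightarrow> x \<in> {a<..<a'}" if "x < a'" for x using that unfolding G_def G1_def by auto
  have G_gt: "x \<in> G \<longleftrightarrow> x \<in> G1" if "a' \<le> x" for x using that unfolding G_def by auto
  have compG: "integral {c..d} g = 0" if cd: "c < d" "{c<..<d} \<subseteq> G" "c \<notin> G" "d \<notin> G" for c d
  proof -
    have "{c<..<d} \<subseteq> {a..b}" using cd(2) Gsub by force
    then have bnd: "a \<le> c" "d \<le> b" using greaterThanLessThan_subseteq_atLeastAtMost_iff[of c d a b] cd(1) by auto
    have "a' \<notin> {c<..<d}" using a'G cd(2) by auto
    then consider "d \<le> a'" | "a' \<le> c" by fastforce
    then have "F c = F d"
    proof cases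
      case 1
      have "c = a" using G_lt[of c] cd 1 bnd by auto
      moreover have "d = a'" using G_lt[of d] cd 1 bnd by force
      ultimately show ?thesis using Fa Fa' by simp
    next
      case 2
      have "{c<..<d} \<subseteq> G1" using cd(2) 2 G_gt by auto
      then show ?thesis using comp[of c d] cd 2 G_gt[of c] G_gt[of d] by auto
    qed
    then show ?thesis using Fdiff[of c d] bnd cd by simp
  qed
  \<comment> \<open>The closed complement of the shadow. The sign of \<open>g\<close> on it follows
    once the part of \<open>g\<close> living on \<open>S\<close> has nonpositive integral over every
    interval.\<close>
  define S where "S = {a'..b} - G1"
  have Scl: "closed S" unfolding S_def using G1op by (auto intro: closed_Diff)
  define h where "h x = indicator S x * g x" for x
  have Smeas: "S \<in> sets lebesgue" using Scl by auto
  have h: "integrable lebesgue h"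
    using integrable_mult_indicator[OF Smeas g] by (simp add: h_def[abs_def])
  have "AE x in lebesgue. h x \<le> 0"
  proof (rule AE_nonpos_if_interval_integrals_nonpos[OF h])
    fix p q :: real assume "p < q"
    show "(LINT t:{p<..<q}|lebesgue. h t) \<le> 0"
    proof (cases "S \<inter> {p<..<q} = {}")
      case True
      then have "(\<lambda>t. indicator {p<..<q} t *\<^sub>R h t) = (\<lambda>t. 0)" by (intro ext) (auto simp: h_def indicator_def)
      then show ?thesis unfolding set_lebesgue_integral_def by (simp only: integral_zero)
    next
      case False
      let ?W = "S \<inter> {p<..<q}"
      \<comment> \<open>Shrinking \<open>{p<..<q}\<close> to the hull of its part of
        \<open>S\<close> makes both end points lie outside the shadow. Each component of the shadow
        in between then contributes zero, and the integral of \<open>h\<close> becomes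
        \<open>F d - F c\<close>.\<close>
      define c d where "c = Inf ?W" and "d = Sup ?W"
      have bd: "bdd_below ?W" "bdd_above ?W" by (auto intro: bdd_belowI[of _ p] bdd_aboveI[of _ q])
      have cS: "c \<in> S" "d \<in> S"
      proof -
        have "closure ?W \<subseteq> S" using closure_minimal[OF _ Scl, of ?W] by auto
        then show "c \<in> S" "d \<in> S"
          using closure_contains_Inf[OF False bd(1)] closure_contains_Sup[OF False bd(2)] by (auto simp: c_def d_def)
      qed
      have in_cd: "c \<le> x" "x \<le> d" if "x \<in> ?W" for x
        unfolding c_def d_def using that bd by (auto intro: cInf_lower cSup_upper)
      have pq: "p \<le> c" "d \<le> q" unfolding c_def d_def
        using False by (auto intro!: cInf_greatest cSup_least)
      have "c \<le> d" using False in_cd by fastforce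
      have bnd: "a' \<le> c" "d \<le> b" "c \<notin> G1" "d \<notin> G1" using cS by (auto simp: S_def)
      let ?U = "{c<..<d} \<inter> G1"
      have Uop: "open ?U" using G1op by auto
      have Ubd: "bounded ?U" by (rule bounded_subset[OF bounded_box(1)[of c d]]) auto
      have Ucomp: "(LINT t:{c1<..<d1}|lebesgue. g t) = 0"
        if *: "c1 < d1" "{c1<..<d1} \<subseteq> ?U" "c1 \<notin> ?U" "d1 \<notin> ?U" for c1 d1
      proof -
        have "{c1<..<d1} \<subseteq> {c..d}" using *(2) by auto
        then have b1: "c \<le> c1" "d1 \<le> d" using greaterThanLessThan_subseteq_atLeastAtMost_iff[of c1 d1 c d] *(1) by auto
        have "c1 \<notin> G1" using *(1,3) b1 bnd by (cases "c1 = c") auto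
        moreover have "d1 \<notin> G1" using *(1,4) b1 bnd by (cases "d1 = d") auto
        ultimately have "F c1 = F d1" using comp[of c1 d1] * by auto
        then show ?thesis using Fdiff[of c1 d1] b1 bnd a' *(1) hk(2)[of "{c1<..<d1}"] integral_open_interval_real[of c1 d1 g]
          by auto
      qed
      \<comment> \<open>The one-sided lemma, used for \<open>g\<close> and for \<open>- g\<close>,
        gives equality.\<close>
      have U0: "(LINT t:?U|lebesgue. g t) = 0"
      proof -
        have "(LINT t:?U|lebesgue. g t) \<le> 0"
          by (rule set_integral_open_nonpos[OF Uop Ubd g]) (use Ucomp in auto)
        moreover have "(LINT t:?U|lebesgue. - g t) \<le> 0"
        proof (rule set_integral_open_nonpos[OF Uop Ubd])
          fix c1 d1 :: real assume *: "c1 < d1" "{c1<..<d1} \<subseteq> ?U" "c1 \<notin> ?U" "d1 \<notin> ?U"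
          show "(LINT t:{c1<..<d1}|lebesgue. - g t) \<le> 0" using Ucomp[OF *] by (simp add: set_integral_uminus si)
        qed (use g in auto)
        ultimately show ?thesis using si[of ?U] Uop by (simp add: set_integral_uminus)
      qed
      have "(LINT t:{p<..<q}|lebesgue. h t) = (LINT t:{c<..<d} - G1|lebesgue. g t)"
        unfolding set_lebesgue_integral_def
      proof (rule integral_cong_AE)
        have "AE t in lborel. t \<noteq> c \<and> t \<noteq> d"
          using AE_lborel_singleton[of c] AE_lborel_singleton[of d] by eventually_elim auto
        then have "AE t in lebesgue. t \<noteq> c \<and> t \<noteq> d" by (rule AE_completion)
        then show "AE t in lebesgue. indicator {p<..<q} t *\<^sub>R h t = indicator ({c<..<d} - G1) t *\<^sub>R g t"
        proof eventually_elim
          case (elim t)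
          show ?case
          proof (cases "t \<in> {c<..<d} - G1")
            case True
            then have "t \<in> S" "t \<in> {p<..<q}" using bnd pq by (auto simp: S_def)
            then show ?thesis using True by (simp add: h_def)
          next
            case False
            then have "\<not> (t \<in> S \<and> t \<in> {p<..<q})" using in_cd[of t] elim by (force simp: S_def)
            then show ?thesis using False by (auto simp: h_def indicator_def)
          qed
        qed
      qed (use h g G1op in \<open>auto intro!: borel_measurable_times borel_measurable_indicator\<close>)
      also have "\<dots> = (LINT t:{c<..<d}|lebesgue. g t) - (LINT t:?U|lebesgue. g t)"
      proof -
        have eq: "{c<..<d} = ({c<..<d} - G1) \<union> ?U" by auto
        have "(LINT t:({c<..<d} - G1) \<union> ?U|lebesgue. g t) = (LINT t:({c<..<d} - G1)|lebesgue. g t) + (LINT t:?U|lebesgue. g t)"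
          by (rule set_integral_Un) (use G1op in \<open>auto intro!: si\<close>)
        then show ?thesis using eq by simp
      qed
      also have "\<dots> = F d - F c"
        using U0 Fdiff[of c d] bnd a' \<open>c \<le> d\<close> hk(2)[of "{c<..<d}"] integral_open_interval_real[of c d g] by auto
      also have "\<dots> \<le> 0" using outside[of c d] bnd \<open>c \<le> d\<close> by auto
      finally show ?thesis .
    qed
  qed
  then have "AE x in lebesgue. x \<in> {a<..<b} - G \<longrightarrow> g x \<le> 0"
  proof eventually_elim
    case (elim x)
    show ?case
    proof
      assume x: "x \<in> {a<..<b} - G"
      then have "x \<in> S" unfolding S_def G_def by (auto simp: not_less)
      then show "g x \<le> 0" using elim by (simp add: h_def)
    qed
  qed
  then show ?thesis using that Gop Gsub compG by blast
qed

section \<open>The tangent inequality\<close>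

lemma xi_minus_props:
  assumes "C > 1"
  shows "xi_minus C < 0" "exp (- xi_minus C) = C * (1 - xi_minus C)"
proof -
  let ?P = "\<lambda>\<xi>. \<xi> \<le> 0 \<and> exp (- \<xi>) = C * (1 - \<xi>)"
  have mono: "(1 - a) * exp a < (1 - b) * exp b" if "a < b" "b \<le> 0" for a b :: real
  proof (rule DERIV_pos_imp_increasing_open[OF that(1)])
    fix y assume "a < y" "y < b"
    then have "y < 0" using that by simp
    then show "\<exists>d. ((\<lambda>x. (1 - x) * exp x) has_real_derivative d) (at y) \<and> 0 < d"
      by (intro exI[of _ "- y * exp y"]) (auto intro!: derivative_eq_intros simp: algebra_simps mult_less_0_iff)
  qed (auto intro!: continuous_intros)
  have h: "exp (- y) = C * (1 - y) \<longleftrightarrow> (1 - y) * exp y = 1 / C" for y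
    using assms by (auto simp: exp_minus field_simps)
  \<comment> \<open>The left end \<open>- 2 * C\<close> for the intermediate value theorem works
    because \<open>exp (2 * C)\<close> is at least the square of the quadratic Taylor polynomial of
    \<open>exp C\<close>, which is at least \<open>C * (1 + 2 * C)\<close>.\<close>
  have lim: "1 - y \<le> 1 / C * exp (- y)" if "y = - 2 * C" for y
  proof -
    have "1 + C + C\<^sup>2 / 2 \<le> exp C" using exp_lower_Taylor_quadratic[of C] assms by simp
    then have "(1 + C + C\<^sup>2/2)\<^sup>2 \<le> (exp C)\<^sup>2" using assms by (intro power_mono) auto
    also have "\<dots> = exp (2 * C)" by (simp add: exp_double)
    finally have "(1 + C + C\<^sup>2/2)\<^sup>2 \<le> exp (2*C)" .
    moreover have "(1 + 2*C) * C \<le> (1 + C + C\<^sup>2/2)\<^sup>2"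
      using assms by (simp add: power2_eq_square algebra_simps)
    ultimately show ?thesis using that assms by (simp add: field_simps)
  qed
  have "\<exists>z\<ge>- 2 * C. z \<le> 0 \<and> (1 - z) * exp z = 1 / C"
  proof (rule IVT')
    show "(1 - - 2 * C) * exp (- 2 * C) \<le> 1 / C"
      using lim[of "- 2 * C"] assms by (simp add: exp_minus field_simps)
  qed (use assms in \<open>auto intro!: continuous_intros\<close>)
  then obtain z where z: "z \<le> 0" "(1 - z) * exp z = 1 / C" by auto
  have "y = z" if "?P y" for y
  proof -
    have e: "(1 - y) * exp y = (1 - z) * exp z" using that h[of y] z by simp
    show ?thesis
    proof (cases y z rule: linorder_cases)
      case less then show ?thesis using e mono[of y z] z(1) by linarith
    next
      case greater then show ?thesis using e mono[of z y] that by linarith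
    qed
  qed
  then have "?P (xi_minus C)" unfolding xi_minus_def by (rule theI[of ?P z, rotated]) (use z h[of z] in auto)
  moreover from this have "xi_minus C \<noteq> 0" using assms by auto
  ultimately show "xi_minus C < 0" "exp (- xi_minus C) = C * (1 - xi_minus C)" by auto
qed

text \<open>The affine function is restricted to the lower boundary, because the points
  \<open>(\<phi> t, exp (\<phi> t))\<close> lie there; averaging over \<open>t\<close> gives its
  value at the average point. The second coordinate has coefficient 1, so the sign conventions agree
  for both tangents.\<close>

definition ell :: "real \<Rightarrow> real \<Rightarrow> real \<Rightarrow> real" where
  "ell \<xi> w s = exp s - exp w * ((s - w) / (1 - \<xi>) + 1)"

lemma ell_eq: "ell \<xi> w s = exp w * (exp (s - w) - (s - w) / (1 - \<xi>) - 1)"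
  by (simp add: ell_def exp_diff field_simps)

text \<open>By convexity only the end \<open>d = \<xi>\<close> has to be checked, and there the
  claim is \<open>exp \<xi> \<le> 1 / (1 - \<xi>)\<close>.\<close>

lemma exp_le_chord:
  fixes \<xi> d :: real
  assumes "\<xi> < 1" "d * \<xi> \<ge> 0" "\<bar>d\<bar> \<le> \<bar>\<xi>\<bar>"
  shows "exp d \<le> 1 + d / (1 - \<xi>)"
proof (cases "\<xi> = 0")
  case False
  define t where "t = d / \<xi>"
  have t: "0 \<le> t" "t \<le> 1" "d = t * \<xi>" using assms False
    by (auto simp: t_def zero_le_divide_iff zero_le_mult_iff field_simps abs_if divide_le_eq split: if_splits)
  have "exp ((1 - t) *\<^sub>R 0 + t *\<^sub>R \<xi>) \<le> (1 - t) * exp 0 + t * exp \<xi>"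
    using convex_onD[OF exp_convex t(1,2), of 0 \<xi>] by simp
  moreover have "exp \<xi> \<le> 1 / (1 - \<xi>)"
  proof -
    have "(1 - \<xi>) * exp \<xi> \<le> exp (- \<xi>) * exp \<xi>" using exp_ge_add_one_self[of "-\<xi>"] by (intro mult_right_mono) auto
    then show ?thesis using assms by (simp add: exp_minus field_simps)
  qed
  ultimately have "exp d \<le> (1 - t) + t * (1 / (1 - \<xi>))"
    using mult_left_mono[of "exp \<xi>" "1 / (1 - \<xi>)" t] t by simp
  also have "\<dots> = 1 + d / (1 - \<xi>)" using assms t by (simp add: field_simps)
  finally show ?thesis .
qed (use assms in simp)

text \<open>On the side of \<open>w\<close> away from the tangency point the line stays below the
  ordinary tangent of \<open>exp\<close> at \<open>w\<close>, hence below
  \<open>exp\<close>.\<close>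

lemma ell_nonneg:
  assumes "\<xi> < 1" "(s - w) * \<xi> \<le> 0"
  shows "0 \<le> ell \<xi> w s"
proof -
  have "(s - w) / (1 - \<xi>) - (s - w) = (s - w) * \<xi> / (1 - \<xi>)" using assms by (simp add: field_simps)
  also have "\<dots> \<le> 0" using assms by (simp add: divide_le_0_iff)
  finally have "(s - w) / (1 - \<xi>) + 1 \<le> exp (s - w)" using exp_ge_add_one_self[of "s - w"] by linarith
  then show ?thesis unfolding ell_eq by simp
qed

lemma ell_nonpos:
  assumes "\<xi> < 1" "(s - w) * \<xi> \<ge> 0" "\<bar>s - w\<bar> \<le> \<bar>\<xi>\<bar>"
  shows "ell \<xi> w s \<le> 0"
  using exp_le_chord[OF assms] unfolding ell_eq by (simp add: mult_le_0_iff)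

lemma set_integrable_const_lmeasurable:
  "A \<in> lmeasurable \<Longrightarrow> set_integrable lebesgue A (\<lambda>t. k::real)"
  unfolding set_integrable_def by (simp add: lmeasurable_iff_integrable)

text \<open>Both sides are heights over \<open>w + \<xi>\<close>, of the upper curve and of the line
  from \<open>(w, exp w)\<close>; the equation for \<open>\<xi>\<close> expresses this
  coincidence.\<close>

lemma upper_tangent_point:
  fixes \<xi> C w :: real
  assumes "\<xi> < 1" "exp (- \<xi>) = C * (1 - \<xi>)"
  shows "C * exp (w + \<xi>) = exp w / (1 - \<xi>)"
proof -
  have "C * (1 - \<xi>) * exp \<xi> = 1" unfolding assms(2)[symmetric] by (simp add: exp_minus)
  then have "(C * (1 - \<xi>) * exp \<xi>) * exp w = exp w" by simp
  then have "C * exp (w + \<xi>) * (1 - \<xi>) = exp w" by (simp add: exp_add mult_ac)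
  then show ?thesis using assms(1) by (simp add: eq_divide_eq)
qed

text \<open>Both tangents are covered at once: \<open>P\<close> selects the side of \<open>w\<close>
  on which the integral is taken. On a component of \<open>G\<close> the average point has abscissa
  \<open>w + \<xi>\<close>, and \<open>Ain\<close> puts it at or below the tangency point, so the
  integral of \<open>ell\<close> is nonpositive there. Passing from \<open>G\<close> to
  \<open>P\<close> removes nonnegative values inside \<open>G\<close> and adds nonpositive ones
  outside.\<close>

lemma ell_set_integral_nonpos:
  fixes \<phi> :: "real \<Rightarrow> real"
  assumes int: "set_integrable lebesgue {a<..<b} \<phi>" "set_integrable lebesgue {a<..<b} (\<lambda>t. exp (\<phi> t))"
    and Ain: "\<And>c d. a \<le> c \<Longrightarrow> c < d \<Longrightarrow> d \<le> b \<Longrightarrow>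
      integral {c..d} (\<lambda>t. exp (\<phi> t)) \<le> C * (d - c) * exp (integral {c..d} \<phi> / (d - c))"
    and xi: "\<xi> < 1" "exp (- \<xi>) = C * (1 - \<xi>)"
    and G: "open G" "G \<subseteq> {a<..<b}"
    and comp: "\<And>c d. c < d \<Longrightarrow> {c<..<d} \<subseteq> G \<Longrightarrow> c \<notin> G \<Longrightarrow> d \<notin> G \<Longrightarrow> integral {c..d} \<phi> = (w + \<xi>) * (d - c)"
    and off: "AE t in lebesgue. t \<in> {a<..<b} - G \<longrightarrow> P (\<phi> t) \<longrightarrow> ell \<xi> w (\<phi> t) \<le> 0"
    and nP: "\<And>s. \<not> P s \<Longrightarrow> 0 \<le> ell \<xi> w s"
    and Pm: "Measurable.pred borel P"
  shows "(LINT t:{a<..<b}|lebesgue. (if P (\<phi> t) then ell \<xi> w (\<phi> t) else 0)) \<le> 0"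
proof -
  let ?I = "{a<..<b}"
  have m1: "set_borel_measurable lebesgue ?I \<phi>" using int(1) by (auto simp: set_integrable_def set_borel_measurable_def)
  have ell_int: "set_integrable lebesgue A (\<lambda>t. ell \<xi> w (\<phi> t))" if "A \<subseteq> ?I" "A \<in> sets lebesgue" for A
  proof -
    have "set_integrable lebesgue A \<phi>" "set_integrable lebesgue A (\<lambda>t. exp (\<phi> t))"
      using int that by (auto intro: set_integrable_subset)
    moreover have "set_integrable lebesgue A (\<lambda>t. c)" for c :: real
      by (rule set_integrable_subset[of lebesgue ?I]) (use that set_integrable_const_lmeasurable[of ?I] in auto)
    ultimately show ?thesis unfolding ell_def
      by (intro set_integral_diff(1) set_integral_add(1) set_integrable_mult_right set_integrable_divide) auto
  qed
  let ?h = "\<lambda>t. indicator ?I t * ell \<xi> w (\<phi> t)"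
  have h: "integrable lebesgue ?h" using ell_int[of ?I] by (simp add: set_integrable_def)
  have Gh: "(LINT t:G|lebesgue. ?h t) \<le> 0"
  proof (rule set_integral_open_nonpos[OF G(1) _ h])
    show "bounded G" using bounded_subset[OF bounded_box(1)[of a b]] G by auto
    fix c d :: real assume cd: "c < d" "{c<..<d} \<subseteq> G" "c \<notin> G" "d \<notin> G"
    then have sub: "{c<..<d} \<subseteq> ?I" using G by auto
    then have ac: "a \<le> c" "d \<le> b" using cd greaterThanLessThan_subseteq_greaterThanLessThan[of c d a b] by auto
    have i1: "set_integrable lebesgue {c<..<d} \<phi>" "set_integrable lebesgue {c<..<d} (\<lambda>t. exp (\<phi> t))"
      using int sub by (auto intro: set_integrable_subset)
    have ic: "set_integrable lebesgue {c<..<d} (\<lambda>t. k)" for k :: real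
      using set_integrable_const_lmeasurable[of "{c<..<d}"] by auto
    have I1: "(LINT t:{c<..<d}|lebesgue. \<phi> t) = (w + \<xi>) * (d - c)"
      using set_lebesgue_integral_eq_integral(2)[OF i1(1)] comp[OF cd] by (simp add: integral_open_interval_real)
    have I2: "(LINT t:{c<..<d}|lebesgue. exp (\<phi> t)) \<le> C * (d - c) * exp (w + \<xi>)"
      using set_lebesgue_integral_eq_integral(2)[OF i1(2)] Ain[OF ac(1) cd(1) ac(2)] comp[OF cd] cd(1)
      by (simp add: integral_open_interval_real)
    have I0: "(LINT t:{c<..<d}|lebesgue. k) = k * (d - c)" for k :: real
      using cd(1) by (simp add: set_lebesgue_integral_def)
    have Cw: "C * exp (w + \<xi>) = exp w * (\<xi> / (1 - \<xi>) + 1)"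
      using upper_tangent_point[OF xi, of w] xi(1) by (simp add: divide_simps)
    have "(LINT t:{c<..<d}|lebesgue. ?h t) = (LINT t:{c<..<d}|lebesgue. ell \<xi> w (\<phi> t))"
      by (rule set_lebesgue_integral_cong) (use sub in auto)
    also have "\<dots> = (LINT t:{c<..<d}|lebesgue. exp (\<phi> t) - (exp w / (1 - \<xi>) * \<phi> t + exp w * (1 - w / (1 - \<xi>))))"
      by (rule set_lebesgue_integral_cong) (auto simp: ell_def diff_divide_distrib algebra_simps)
    also have "\<dots> = (LINT t:{c<..<d}|lebesgue. exp (\<phi> t)) - (exp w / (1 - \<xi>) * (LINT t:{c<..<d}|lebesgue. \<phi> t) + exp w * (1 - w / (1 - \<xi>)) * (d - c))"
      using i1 ic by (simp add: I0)
    also have "\<dots> \<le> C * (d - c) * exp (w + \<xi>) - (exp w / (1 - \<xi>) * ((w + \<xi>) * (d - c)) + exp w * (1 - w / (1 - \<xi>)) * (d - c))"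
      using I2 unfolding I1 by simp
    also have "\<dots> = (d - c) * (C * exp (w + \<xi>) - exp w * (\<xi> / (1 - \<xi>) + 1))"
      by (simp add: add_divide_distrib diff_divide_distrib algebra_simps)
    also have "\<dots> = 0" using Cw by simp
    finally show "(LINT t:{c<..<d}|lebesgue. ?h t) \<le> 0" .
  qed
  have "(LINT t:?I|lebesgue. (if P (\<phi> t) then ell \<xi> w (\<phi> t) else 0)) \<le> (LINT t:G|lebesgue. ?h t)"
    unfolding set_lebesgue_integral_def
  proof (rule integral_mono_AE)
    show "integrable lebesgue (\<lambda>t. indicator G t *\<^sub>R ?h t)"
      using h G(1) by (intro integrable_mult_indicator) auto
    show "AE t in lebesgue. indicator ?I t *\<^sub>R (if P (\<phi> t) then ell \<xi> w (\<phi> t) else 0) \<le> indicator G t *\<^sub>R ?h t"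
      using off by eventually_elim (use G(2) nP in \<open>auto simp: indicator_def\<close>)
    have "(\<lambda>t. if P (indicator ?I t *\<^sub>R \<phi> t) then ?h t else 0) \<in> borel_measurable lebesgue"
    proof (rule measurable_If)
      show "{x \<in> space lebesgue. P (indicator ?I x *\<^sub>R \<phi> x)} \<in> sets lebesgue"
        using measurable_sets_Collect[OF m1[unfolded set_borel_measurable_def], of P] Pm by simp
    qed (use h in auto)
    moreover have "(\<lambda>t. if P (indicator ?I t *\<^sub>R \<phi> t) then ?h t else 0) =
        (\<lambda>t. indicator ?I t *\<^sub>R (if P (\<phi> t) then ell \<xi> w (\<phi> t) else 0))" by (auto simp: indicator_def)
    ultimately have "(\<lambda>t. indicator ?I t *\<^sub>R (if P (\<phi> t) then ell \<xi> w (\<phi> t) else 0)) \<in> borel_measurable lebesgue" by simp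
    then show "integrable lebesgue (\<lambda>t. indicator ?I t *\<^sub>R (if P (\<phi> t) then ell \<xi> w (\<phi> t) else 0))"
      by (rule Bochner_Integration.integrable_bound[OF h]) (auto simp: indicator_def)
  qed
  with Gh show ?thesis by simp
qed

section \<open>Reduction to intervals with given end points\<close>

lemma bdd_interval_endpoints:
  assumes "bdd_interval Q"
  obtains a b where "a < b" "{a<..<b} \<subseteq> Q" "Q \<subseteq> {a..b}"
proof -
  have Q: "is_interval Q" "bounded Q" "interior Q \<noteq> {}" using assms by (auto simp: bdd_interval_def)
  then have ne: "Q \<noteq> {}" by auto
  have bb: "bdd_below Q" "bdd_above Q" using Q(2) bounded_imp_bdd_below bounded_imp_bdd_above by auto
  define a b where "a = Inf Q" and "b = Sup Q"
  have sup: "Q \<subseteq> {a..b}" using bb by (auto simp: a_def b_def intro: cInf_lower cSup_upper)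
  have "a \<le> b" using sup ne by fastforce
  moreover have "a \<noteq> b"
  proof
    assume "a = b"
    then have "interior Q \<subseteq> interior {a}" using sup by (intro interior_mono) auto
    with Q(3) show False by simp
  qed
  ultimately have "a < b" by simp
  moreover have "{a<..<b} \<subseteq> Q"
  proof
    fix x assume x: "x \<in> {a<..<b}"
    obtain p where p: "p \<in> Q" "p < x" using x cInf_lessD[OF ne, of x] by (auto simp: a_def)
    obtain q where q: "q \<in> Q" "x < q" using x less_cSupE[OF _ ne, of x] by (auto simp: b_def)
    show "x \<in> Q" using Q(1) p q unfolding is_interval_1 by (meson less_imp_le)
  qed
  ultimately show ?thesis using sup that by blast
qed

lemma bdd_interval_Ioo: "c < d \<Longrightarrow> bdd_interval {c<..<d}"
  by (auto simp: bdd_interval_def is_interval_oo)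

context
  fixes a b :: real and Q :: "real set"
  assumes ab: "a < b" and Q: "{a<..<b} \<subseteq> Q" "Q \<subseteq> {a..b}"
begin

lemma diff_endpoints: "(Q - {a<..<b}) \<union> ({a<..<b} - Q) \<subseteq> {a, b}" using Q ab by auto

lemma interval_sets: "Q \<in> sets lebesgue" 
proof -
  have "Q = {a<..<b} \<union> (Q \<inter> {a, b})" using Q by auto
  moreover have "Q \<inter> {a,b} \<in> sets lebesgue" by (intro negligible_imp_sets negligible_finite) auto
  moreover have "{a<..<b} \<in> sets lebesgue" by auto
  ultimately show ?thesis by (metis sets.Un)
qed

lemma AE_interval: "AE t in lebesgue. t \<in> Q \<longleftrightarrow> t \<in> {a<..<b}"
proof -
  have "AE t in lborel. t \<in> Q \<longleftrightarrow> t \<in> {a<..<b}"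
    using AE_lborel_singleton[of a] AE_lborel_singleton[of b]
    by eventually_elim (use diff_endpoints in blast)
  then show ?thesis by (rule AE_completion)
qed

lemma set_integrable_interval:
  fixes f :: "real \<Rightarrow> real"
  shows "set_integrable lebesgue Q f \<longleftrightarrow> set_integrable lebesgue {a<..<b} f"
  by (rule set_integrable_discrete_difference[of "{a, b}"]) (use diff_endpoints in auto)

lemma set_integral_interval:
  fixes f :: "real \<Rightarrow> real"
  shows "(LINT t:Q|lebesgue. f t) = (LINT t:{a<..<b}|lebesgue. f t)"
  by (rule set_integral_discrete_difference[of "{a, b}"]) (use diff_endpoints in auto)

lemma emeasure_interval: "emeasure lebesgue Q = ennreal (b - a)"
proof -
  have "emeasure lebesgue Q = emeasure lebesgue {a<..<b}"
    by (rule emeasure_eq_AE[OF AE_interval]) (use interval_sets in auto)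
  then show ?thesis using ab by simp
qed

lemma measure_interval: "measure lebesgue Q = b - a"
  using emeasure_interval ab by (simp add: measure_def)

lemma avg_interval:
  assumes "set_integrable lebesgue {a<..<b} f"
  shows "avg Q f = integral {a..b} f / (b - a)"
  unfolding avg_def set_integral_interval measure_interval
  using set_lebesgue_integral_eq_integral(2)[OF assms] by (simp add: integral_open_interval_real)

lemma eavg_interval:
  "eavg Q f = enn2ereal ((\<integral>\<^sup>+t\<in>{a<..<b}. ennreal (f t) \<partial>lebesgue) / ennreal (b - a))"
proof -
  have "(\<integral>\<^sup>+t\<in>Q. ennreal (f t) \<partial>lebesgue) = (\<integral>\<^sup>+t\<in>{a<..<b}. ennreal (f t) \<partial>lebesgue)"
    by (rule nn_integral_cong_AE) (use AE_interval in eventually_elim, auto split: split_indicator)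
  then show ?thesis unfolding eavg_def emeasure_interval by simp
qed

end

text \<open>Membership is rewritten with integrals over closed intervals, so that it no longer
  matters which end points \<open>Q\<close> or a subinterval contains.\<close>

lemma E_class_iff:
  assumes ab: "a < b" and Q: "{a<..<b} \<subseteq> Q" "Q \<subseteq> {a..b}"
  shows "\<phi> \<in> E_class x C Q \<longleftrightarrow>
    set_integrable lebesgue {a<..<b} \<phi> \<and> set_integrable lebesgue {a<..<b} (\<lambda>t. exp (\<phi> t)) \<and>
    integral {a..b} \<phi> = (b - a) * fst x \<and> integral {a..b} (\<lambda>t. exp (\<phi> t)) = (b - a) * snd x \<and>
    (\<forall>c d. a \<le> c \<longrightarrow> c < d \<longrightarrow> d \<le> b \<longrightarrow>
      integral {c..d} (\<lambda>t. exp (\<phi> t)) \<le> C * (d - c) * exp (integral {c..d} \<phi> / (d - c)))"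
  (is "?L \<longleftrightarrow> ?R")
proof (cases "set_integrable lebesgue {a<..<b} \<phi> \<and> set_integrable lebesgue {a<..<b} (\<lambda>t. exp (\<phi> t))")
  case True
  then have i: "set_integrable lebesgue {a<..<b} \<phi>" "set_integrable lebesgue {a<..<b} (\<lambda>t. exp (\<phi> t))" by auto
  have key: "avg J (\<lambda>t. exp (\<phi> t)) * exp (- avg J (\<lambda>t. ln (exp (\<phi> t)))) \<le> C \<longleftrightarrow>
      integral {c..d} (\<lambda>t. exp (\<phi> t)) \<le> C * (d - c) * exp (integral {c..d} \<phi> / (d - c))"
    if J: "c < d" "{c<..<d} \<subseteq> J" "J \<subseteq> {c..d}" "a \<le> c" "d \<le> b" for J c d
  proof -
    have sub: "{c<..<d} \<subseteq> {a<..<b}" using J by auto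
    have i': "set_integrable lebesgue {c<..<d} \<phi>" "set_integrable lebesgue {c<..<d} (\<lambda>t. exp (\<phi> t))"
      using i sub by (auto intro: set_integrable_subset)
    have "avg J (\<lambda>t. exp (\<phi> t)) * exp (- avg J (\<lambda>t. ln (exp (\<phi> t)))) =
        integral {c..d} (\<lambda>t. exp (\<phi> t)) / (d - c) * exp (- (integral {c..d} \<phi> / (d - c)))"
      using avg_interval[OF J(1-3)] i' by simp
    also have "\<dots> = integral {c..d} (\<lambda>t. exp (\<phi> t)) / ((d - c) * exp (integral {c..d} \<phi> / (d - c)))"
      by (simp add: exp_minus divide_inverse)
    finally show ?thesis using J(1) by (simp add: divide_le_eq mult_ac)
  qed
  have "Ainf Q (\<lambda>t. exp (\<phi> t)) \<le> ereal C \<longleftrightarrow> (\<forall>c d. a \<le> c \<longrightarrow> c < d \<longrightarrow> d \<le> b \<longrightarrow>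
      integral {c..d} (\<lambda>t. exp (\<phi> t)) \<le> C * (d - c) * exp (integral {c..d} \<phi> / (d - c)))" (is "?A \<longleftrightarrow> ?B")
  proof
    assume A: ?A
    show ?B
    proof (intro allI impI)
      fix c d assume cd: "a \<le> c" "c < d" "d \<le> b"
      have sub: "{c<..<d} \<subseteq> Q" using cd Q by auto
      have "ereal (avg {c<..<d} (\<lambda>t. exp (\<phi> t)) * exp (- avg {c<..<d} (\<lambda>t. ln (exp (\<phi> t))))) \<le> ereal C"
        using A bdd_interval_Ioo[OF cd(2)] sub unfolding Ainf_def SUP_le_iff by blast
      then show "integral {c..d} (\<lambda>t. exp (\<phi> t)) \<le> C * (d - c) * exp (integral {c..d} \<phi> / (d - c))"
        using key[of c d "{c<..<d}"] cd greaterThanLessThan_subseteq_atLeastAtMost_iff[of c d c d] by auto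
    qed
  next
    assume B: ?B
    show ?A unfolding Ainf_def
    proof (rule SUP_least)
      fix J assume "J \<in> {J. bdd_interval J \<and> J \<subseteq> Q}"
      then have J: "bdd_interval J" "J \<subseteq> Q" by auto
      obtain c d where cd: "c < d" "{c<..<d} \<subseteq> J" "J \<subseteq> {c..d}" using bdd_interval_endpoints[OF J(1)] .
      have "{c<..<d} \<subseteq> {a..b}" using cd J Q by blast
      then have "a \<le> c" "d \<le> b" using greaterThanLessThan_subseteq_atLeastAtMost_iff[of c d a b] cd by auto
      then show "ereal (avg J (\<lambda>t. exp (\<phi> t)) * exp (- avg J (\<lambda>t. ln (exp (\<phi> t))))) \<le> ereal C"
        using key[OF cd] B cd by auto
    qed
  qed
  then show ?thesis unfolding E_class_def
    using True ab by (auto simp: set_integrable_interval[OF ab Q] avg_interval[OF ab Q] field_simps)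
qed (auto simp: E_class_def set_integrable_interval[OF ab Q])

text \<open>Outside the rising sun cover \<open>\<phi>\<close> is at most \<open>w + \<xi>\<close>;
  where it also exceeds \<open>w\<close>, it lies between the start of the tangent and the tangency
  point, so \<open>ell\<close> is nonpositive. The hypothesis \<open>w\<close> is what the cover
  requires: a nonpositive total integral of \<open>\<phi> - (w + \<xi>)\<close>.\<close>

lemma ell_above_nonpos:
  fixes \<phi> :: "real \<Rightarrow> real"
  assumes ab: "a < b" and int: "set_integrable lebesgue {a<..<b} \<phi>" "set_integrable lebesgue {a<..<b} (\<lambda>t. exp (\<phi> t))"
    and Ain: "\<And>c d. a \<le> c \<Longrightarrow> c < d \<Longrightarrow> d \<le> b \<Longrightarrow>
      integral {c..d} (\<lambda>t. exp (\<phi> t)) \<le> C * (d - c) * exp (integral {c..d} \<phi> / (d - c))"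
    and xi: "0 < \<xi>" "\<xi> < 1" "exp (- \<xi>) = C * (1 - \<xi>)"
    and w: "integral {a..b} \<phi> \<le> (b - a) * (w + \<xi>)"
  shows "(LINT t:{a<..<b}|lebesgue. (if w < \<phi> t then ell \<xi> w (\<phi> t) else 0)) \<le> 0"
proof -
  let ?g = "\<lambda>t. indicator {a<..<b} t * (\<phi> t - (w + \<xi>))"
  have "set_integrable lebesgue {a<..<b} (\<lambda>t. \<phi> t - (w + \<xi>))"
    using int(1) set_integrable_const_lmeasurable[of "{a<..<b}"] by (intro set_integral_diff(1)) auto
  then have g: "integrable lebesgue ?g" by (simp add: set_integrable_def)
  have gI: "integral {c..d} ?g = integral {c..d} \<phi> - (w + \<xi>) * (d - c)" if "a \<le> c" "c < d" "d \<le> b" for c d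
  proof -
    have ip: "\<phi> integrable_on {c<..<d}"
      using that by (intro set_lebesgue_integral_eq_integral(1) set_integrable_subset[OF int(1)]) auto
    have "integral {c..d} ?g = integral {c<..<d} ?g" by (rule integral_open_interval_real)
    also have "\<dots> = integral {c<..<d} (\<lambda>t. \<phi> t - (w + \<xi>))"
      by (rule Henstock_Kurzweil_Integration.integral_cong) (use that in auto)
    also have "\<dots> = integral {c<..<d} \<phi> - integral {c<..<d} (\<lambda>t. w + \<xi>)"
      using ip by (intro Henstock_Kurzweil_Integration.integral_diff) (auto intro!: set_lebesgue_integral_eq_integral(1)[OF set_integrable_const_lmeasurable])
    finally show ?thesis using that by (simp flip: integral_open_interval_real add: mult.commute)
  qed
  have "integral {a..b} ?g \<le> 0" using gI[of a b] ab w by (simp add: mult.commute)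
  then obtain G where G: "open G" "G \<subseteq> {a<..<b}"
    "\<And>c d. c < d \<Longrightarrow> {c<..<d} \<subseteq> G \<Longrightarrow> c \<notin> G \<Longrightarrow> d \<notin> G \<Longrightarrow> integral {c..d} ?g = 0"
    "AE t in lebesgue. t \<in> {a<..<b} - G \<longrightarrow> ?g t \<le> 0"
    using rising_sun[OF ab g] by blast
  show ?thesis
  proof (rule ell_set_integral_nonpos[OF int Ain xi(2,3) G(1,2)])
    fix c d assume cd: "c < d" "{c<..<d} \<subseteq> G" "c \<notin> G" "d \<notin> G"
    then have "{c<..<d} \<subseteq> {a..b}" using G(2) by force
    then have "a \<le> c" "d \<le> b" using greaterThanLessThan_subseteq_atLeastAtMost_iff[of c d a b] cd by auto
    then show "integral {c..d} \<phi> = (w + \<xi>) * (d - c)" using gI[of c d] G(3)[OF cd] cd by simp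
  next
    show "AE t in lebesgue. t \<in> {a<..<b} - G \<longrightarrow> w < \<phi> t \<longrightarrow> ell \<xi> w (\<phi> t) \<le> 0"
      using G(4) by eventually_elim (use xi in \<open>auto intro!: ell_nonpos\<close>)
  next
    fix s assume "\<not> w < s"
    then show "0 \<le> ell \<xi> w s" using xi by (intro ell_nonneg) (auto simp: mult_le_0_iff)
  qed auto
qed

text \<open>The mirror image, with the rising sun lemma applied to
  \<open>(w + \<xi>) - \<phi>\<close>.\<close>

lemma ell_below_nonpos:
  fixes \<phi> :: "real \<Rightarrow> real"
  assumes ab: "a < b" and int: "set_integrable lebesgue {a<..<b} \<phi>" "set_integrable lebesgue {a<..<b} (\<lambda>t. exp (\<phi> t))"
    and Ain: "\<And>c d. a \<le> c \<Longrightarrow> c < d \<Longrightarrow> d \<le> b \<Longrightarrow>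
      integral {c..d} (\<lambda>t. exp (\<phi> t)) \<le> C * (d - c) * exp (integral {c..d} \<phi> / (d - c))"
    and xi: "\<xi> < 0" "exp (- \<xi>) = C * (1 - \<xi>)"
    and w: "(b - a) * (w + \<xi>) \<le> integral {a..b} \<phi>"
  shows "(LINT t:{a<..<b}|lebesgue. (if \<phi> t < w then ell \<xi> w (\<phi> t) else 0)) \<le> 0"
proof -
  let ?g = "\<lambda>t. indicator {a<..<b} t * ((w + \<xi>) - \<phi> t)"
  have "set_integrable lebesgue {a<..<b} (\<lambda>t. (w + \<xi>) - \<phi> t)"
    using int(1) set_integrable_const_lmeasurable[of "{a<..<b}"] by (intro set_integral_diff(1)) auto
  then have g: "integrable lebesgue ?g" by (simp add: set_integrable_def)
  have gI: "integral {c..d} ?g = (w + \<xi>) * (d - c) - integral {c..d} \<phi>" if "a \<le> c" "c < d" "d \<le> b" for c d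
  proof -
    have ip: "\<phi> integrable_on {c<..<d}"
      using that by (intro set_lebesgue_integral_eq_integral(1) set_integrable_subset[OF int(1)]) auto
    have "integral {c..d} ?g = integral {c<..<d} ?g" by (rule integral_open_interval_real)
    also have "\<dots> = integral {c<..<d} (\<lambda>t. (w + \<xi>) - \<phi> t)"
      by (rule Henstock_Kurzweil_Integration.integral_cong) (use that in auto)
    also have "\<dots> = integral {c<..<d} (\<lambda>t. w + \<xi>) - integral {c<..<d} \<phi>"
      using ip by (intro Henstock_Kurzweil_Integration.integral_diff) (auto intro!: set_lebesgue_integral_eq_integral(1)[OF set_integrable_const_lmeasurable])
    finally show ?thesis using that by (simp flip: integral_open_interval_real add: mult.commute)
  qed
  have "integral {a..b} ?g \<le> 0" using gI[of a b] ab w by (simp add: mult.commute)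
  then obtain G where G: "open G" "G \<subseteq> {a<..<b}"
    "\<And>c d. c < d \<Longrightarrow> {c<..<d} \<subseteq> G \<Longrightarrow> c \<notin> G \<Longrightarrow> d \<notin> G \<Longrightarrow> integral {c..d} ?g = 0"
    "AE t in lebesgue. t \<in> {a<..<b} - G \<longrightarrow> ?g t \<le> 0"
    using rising_sun[OF ab g] by blast
  show ?thesis
  proof (rule ell_set_integral_nonpos[OF int Ain _ xi(2) G(1,2)])
    fix c d assume cd: "c < d" "{c<..<d} \<subseteq> G" "c \<notin> G" "d \<notin> G"
    then have "{c<..<d} \<subseteq> {a..b}" using G(2) by force
    then have "a \<le> c" "d \<le> b" using greaterThanLessThan_subseteq_atLeastAtMost_iff[of c d a b] cd by auto
    then show "integral {c..d} \<phi> = (w + \<xi>) * (d - c)" using gI[of c d] G(3)[OF cd] cd by simp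
  next
    show "AE t in lebesgue. t \<in> {a<..<b} - G \<longrightarrow> \<phi> t < w \<longrightarrow> ell \<xi> w (\<phi> t) \<le> 0"
      using G(4) by eventually_elim (use xi in \<open>auto intro!: ell_nonpos simp: mult_nonpos_nonpos\<close>)
  next
    fix s assume "\<not> s < w"
    then show "0 \<le> ell \<xi> w s" using xi by (intro ell_nonneg) (auto simp: mult_le_0_iff)
  qed (use xi in auto)
qed

section \<open>Integration over families of tangents\<close>

text \<open>Fubini for a nonnegative mixture of functions with nonpositive integrals. The bound
  \<open>B\<close>, the same for all \<open>w\<close> in the compact range, gives integrability on
  the product.\<close>

lemma (in finite_measure) weighted_integral_nonpos:
  fixes \<phi> :: "'a \<Rightarrow> real" and c B :: "real \<Rightarrow> real" and \<rho> :: "real \<Rightarrow> real \<Rightarrow> real"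
  assumes [measurable]: "\<phi> \<in> borel_measurable M"
    and c: "set_integrable lborel {p..q} c" "\<And>w. w \<in> {p..q} \<Longrightarrow> 0 \<le> c w"
    and [measurable]: "c \<in> borel_measurable borel" "(\<lambda>x. \<rho> (fst x) (snd x)) \<in> borel_measurable (borel \<Otimes>\<^sub>M borel)"
    and B: "\<And>w s. w \<in> {p..q} \<Longrightarrow> \<bar>\<rho> w s\<bar> \<le> B s" "integrable M (\<lambda>t. B (\<phi> t))"
    and le: "\<And>w. w \<in> {p..q} \<Longrightarrow> (LINT t|M. \<rho> w (\<phi> t)) \<le> 0"
  shows "integrable M (\<lambda>t. (LINT w:{p..q}|lborel. c w * \<rho> w (\<phi> t)))"
    "(LINT t|M. (LINT w:{p..q}|lborel. c w * \<rho> w (\<phi> t))) \<le> 0"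
proof -
  interpret P: pair_sigma_finite M lborel ..
  let ?c = "\<lambda>w. indicator {p..q} w * c w"
  let ?f = "\<lambda>t w. ?c w * \<rho> w (\<phi> t)"
  have ci: "integrable lborel ?c" using c(1) by (simp add: set_integrable_def)
  have [measurable]: "(\<lambda>t. B (\<phi> t)) \<in> borel_measurable M" using B(2) by auto
  have prod: "integrable (M \<Otimes>\<^sub>M lborel) (\<lambda>(t, w). B (\<phi> t) * ?c w)"
  proof (rule P.Fubini_integrable)
    show "AE x in M. integrable lborel (\<lambda>y. case (x, y) of (t, w) \<Rightarrow> B (\<phi> t) * ?c w)"
      using ci by simp
    show "integrable M (\<lambda>x. LINT y|lborel. norm (case (x, y) of (t, w) \<Rightarrow> B (\<phi> t) * ?c w))"
      using B(2) by (simp add: abs_mult integrable_abs)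
  qed measurable
  have int: "integrable (M \<Otimes>\<^sub>M lborel) (\<lambda>(t, w). ?f t w)"
  proof (rule Bochner_Integration.integrable_bound[OF prod])
    have "(\<lambda>x. \<rho> (snd x) (\<phi> (fst x))) \<in> borel_measurable (M \<Otimes>\<^sub>M lborel)"
      by (rule measurable_compose[of "\<lambda>x. (snd x, \<phi> (fst x))" _ "borel \<Otimes>\<^sub>M borel" "\<lambda>x. \<rho> (fst x) (snd x)", simplified]) measurable
    then show "(\<lambda>(t, w). ?f t w) \<in> borel_measurable (M \<Otimes>\<^sub>M lborel)"
      unfolding case_prod_beta by measurable
    show "AE x in M \<Otimes>\<^sub>M lborel. norm (case x of (t, w) \<Rightarrow> ?f t w) \<le> norm (case x of (t, w) \<Rightarrow> B (\<phi> t) * ?c w)"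
    proof (intro AE_I2)
      fix x show "norm (case x of (t, w) \<Rightarrow> ?f t w) \<le> norm (case x of (t, w) \<Rightarrow> B (\<phi> t) * ?c w)"
      proof (cases x)
        case (Pair t w)
        show ?thesis
        proof (cases "w \<in> {p..q}")
          case True
          then have "\<bar>\<rho> w (\<phi> t)\<bar> \<le> \<bar>B (\<phi> t)\<bar>" using B(1)[of w "\<phi> t"] by linarith
          then show ?thesis using Pair using True by (simp add: abs_mult mult_right_mono mult.commute[of "\<bar>c w\<bar>"])
        qed (use Pair in simp)
      qed
    qed
  qed
  have eq: "(LINT w:{p..q}|lborel. c w * \<rho> w (\<phi> t)) = (LINT w|lborel. ?f t w)" for t
    by (simp add: set_lebesgue_integral_def mult.assoc)
  show "integrable M (\<lambda>t. (LINT w:{p..q}|lborel. c w * \<rho> w (\<phi> t)))"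
    unfolding eq using P.integrable_fst[OF int] by simp
  have "(LINT t|M. (LINT w|lborel. ?f t w)) = (LINT w|lborel. (LINT t|M. ?f t w))"
    using P.Fubini_integral[OF int] by simp
  also have "\<dots> \<le> (LINT w|(lborel :: real measure). 0)"
  proof (rule Bochner_Integration.integral_mono)
    show "integrable lborel (\<lambda>w. LINT t|M. ?f t w)" using P.integrable_snd[OF int] by simp
    fix w show "(LINT t|M. ?f t w) \<le> 0"
      using le[of w] c(2)[of w] by (cases "w \<in> {p..q}") (auto simp: mult_le_0_iff mult_nonneg_nonpos)
  qed auto
  finally show "(LINT t|M. (LINT w:{p..q}|lborel. c w * \<rho> w (\<phi> t))) \<le> 0" unfolding eq by simp
qed

definition fam :: "(real \<Rightarrow> real) \<Rightarrow> (real \<Rightarrow> real) \<Rightarrow> (real \<Rightarrow> real) \<Rightarrow> real \<Rightarrow> real \<Rightarrow> real \<Rightarrow> real" where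
  "fam f m1 m w y1 y2 = f w + m1 w * (y1 - w) + m w * (y2 - exp w)"

text \<open>The affine functions \<open>fam f m1 m w\<close> are the tangent planes of a function that is affine along the
  lines \<open>ell \<xi> w = 0\<close> and has boundary values \<open>f\<close>.\<close>

definition tangent_family :: "real \<Rightarrow> real \<Rightarrow> real \<Rightarrow> (real \<Rightarrow> real) \<Rightarrow> (real \<Rightarrow> real) \<Rightarrow> (real \<Rightarrow> real) \<Rightarrow> (real \<Rightarrow> real) \<Rightarrow> bool" where
  "tangent_family \<xi> p q f m1 m d \<longleftrightarrow> \<xi> < 1 \<and> d \<in> borel_measurable borel \<and>
     continuous_on {p..q} f \<and> continuous_on {p..q} m1 \<and> continuous_on {p..q} m \<and>
     (\<exists>S. finite S \<and> (\<forall>w\<in>{p<..<q} - S.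
        (f has_real_derivative m1 w + m w * exp w) (at w) \<and>
        (m has_real_derivative d w) (at w) \<and>
        (m1 has_real_derivative - (d w * exp w / (1 - \<xi>))) (at w)))"

lemma tangent_family_subset:
  "tangent_family \<xi> p q f m1 m d \<Longrightarrow> p \<le> p' \<Longrightarrow> q' \<le> q \<Longrightarrow> tangent_family \<xi> p' q' f m1 m d"
  unfolding tangent_family_def
  by (fastforce intro: continuous_on_subset)

lemma tangent_family_uminus:
  assumes "tangent_family \<xi> p q f m1 m d"
  shows "tangent_family \<xi> p q (\<lambda>w. - f w) (\<lambda>w. - m1 w) (\<lambda>w. - m w) (\<lambda>w. - d w)"
proof -
  obtain S where S: "finite S" "\<forall>w\<in>{p<..<q} - S.
        (f has_real_derivative m1 w + m w * exp w) (at w) \<and>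
        (m has_real_derivative d w) (at w) \<and>
        (m1 has_real_derivative - (d w * exp w / (1 - \<xi>))) (at w)"
    using assms unfolding tangent_family_def by blast
  have "\<forall>w\<in>{p<..<q} - S.
        ((\<lambda>w. - f w) has_real_derivative - m1 w + - m w * exp w) (at w) \<and>
        ((\<lambda>w. - m w) has_real_derivative - d w) (at w) \<and>
        ((\<lambda>w. - m1 w) has_real_derivative - (- d w * exp w / (1 - \<xi>))) (at w)"
    using S(2) by (auto intro!: derivative_eq_intros)
  then show ?thesis using assms S(1) unfolding tangent_family_def
    by (auto intro!: continuous_intros)
qed

text \<open>The density may be unbounded near an exceptional point, as happens for the power
  functions. A constant sign turns the integrability that comes from the fundamental theorem into
  absolute integrability.\<close>

lemma tangent_family_d_integrable:
  assumes tf: "tangent_family \<xi> p q f m1 m d" and sg: "(\<forall>w\<in>{p..q}. 0 \<le> d w) \<or> (\<forall>w\<in>{p..q}. d w \<le> 0)"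
  shows "set_integrable lborel {p..q} d"
proof (cases "p \<le> q")
  case True
  obtain S where S: "finite S" "\<forall>w\<in>{p<..<q} - S. (m has_real_derivative d w) (at w)"
    and cm: "continuous_on {p..q} m" and [measurable]: "d \<in> borel_measurable borel"
    using tf unfolding tangent_family_def by blast
  have "(d has_integral m q - m p) {p..q}"
    by (rule fundamental_theorem_of_calculus_interior_strong[OF S(1) True])
       (use S cm in \<open>auto simp: has_real_derivative_iff_has_vector_derivative\<close>)
  then have di: "d integrable_on {p..q}" by blast
  have "d absolutely_integrable_on {p..q}"
    using sg
  proof
    assume "\<forall>w\<in>{p..q}. d w \<le> 0"
    then have "(\<lambda>w. - d w) absolutely_integrable_on {p..q}"
      using di by (intro nonnegative_absolutely_integrable_1) (auto intro: integrable_neg)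
    then have "(\<lambda>w. - (- d w)) absolutely_integrable_on {p..q}" unfolding set_integrable_def by force
    then show ?thesis by simp
  qed (use di in \<open>auto intro!: nonnegative_absolutely_integrable_1\<close>)
  then have "integrable lebesgue (\<lambda>w. indicator {p..q} w *\<^sub>R d w)" by (simp add: set_integrable_def)
  then have "integrable lborel (\<lambda>w. indicator {p..q} w *\<^sub>R d w)" by (subst (asm) integrable_completion) auto
  then show ?thesis by (simp add: set_integrable_def)
qed (simp add: set_integrable_def)

lemma ell_bound:
  assumes "w \<in> {p..q}" "\<xi> < 1"
  shows "\<bar>ell \<xi> w s\<bar> \<le> exp s + exp q / (1 - \<xi>) * \<bar>s\<bar> + exp q * ((\<bar>p\<bar> + \<bar>q\<bar>) / (1 - \<xi>) + 1)"
proof -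
  have "\<bar>ell \<xi> w s\<bar> \<le> exp s + exp w * \<bar>(s - w) / (1 - \<xi>) + 1\<bar>"
    unfolding ell_def by (rule order_trans[OF abs_triangle_ineq4]) (simp add: abs_mult)
  also have "\<bar>(s - w) / (1 - \<xi>) + 1\<bar> \<le> (\<bar>s\<bar> + (\<bar>p\<bar> + \<bar>q\<bar>)) / (1 - \<xi>) + 1"
  proof -
    have "\<bar>(s - w) / (1 - \<xi>)\<bar> \<le> (\<bar>s\<bar> + (\<bar>p\<bar> + \<bar>q\<bar>)) / (1 - \<xi>)"
      using assms by (auto simp: abs_divide intro!: divide_right_mono)
    then show ?thesis by linarith
  qed
  also have "exp s + exp w * ((\<bar>s\<bar> + (\<bar>p\<bar> + \<bar>q\<bar>)) / (1 - \<xi>) + 1) \<le> exp s + exp q * ((\<bar>s\<bar> + (\<bar>p\<bar> + \<bar>q\<bar>)) / (1 - \<xi>) + 1)"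
    using assms by (auto intro!: mult_right_mono add_nonneg_nonneg divide_nonneg_nonneg)
  finally show ?thesis by (simp add: add_divide_distrib algebra_simps)
qed

text \<open>The three differential equations in \<open>tangent_family\<close> are designed so that
  the derivative in \<open>w\<close> of the plane, at a fixed boundary point, collapses to
  \<open>d w * ell \<xi> w s\<close>.\<close>

lemma fam_diff:
  assumes tf: "tangent_family \<xi> p q f m1 m d" and sg: "(\<forall>w\<in>{p..q}. 0 \<le> d w) \<or> (\<forall>w\<in>{p..q}. d w \<le> 0)"
    and pq: "p \<le> q"
  shows "fam f m1 m q s (exp s) - fam f m1 m p s (exp s) = (LINT w:{p..q}|lborel. d w * ell \<xi> w s)"
proof -
  obtain S where S: "finite S" "\<forall>w\<in>{p<..<q} - S.
        (f has_real_derivative m1 w + m w * exp w) (at w) \<and>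
        (m has_real_derivative d w) (at w) \<and>
        (m1 has_real_derivative - (d w * exp w / (1 - \<xi>))) (at w)"
    and cont: "continuous_on {p..q} f" "continuous_on {p..q} m1" "continuous_on {p..q} m"
    and [measurable]: "d \<in> borel_measurable borel" and xi: "\<xi> < 1"
    using tf unfolding tangent_family_def by blast
  have hi: "((\<lambda>w. d w * ell \<xi> w s) has_integral fam f m1 m q s (exp s) - fam f m1 m p s (exp s)) {p..q}"
  proof (rule fundamental_theorem_of_calculus_interior_strong[OF S(1) pq])
    show "continuous_on {p..q} (\<lambda>w. fam f m1 m w s (exp s))"
      unfolding fam_def using cont by (intro continuous_intros)
    fix w assume w: "w \<in> {p<..<q} - S"
    have "((\<lambda>w. fam f m1 m w s (exp s)) has_real_derivative
        (m1 w + m w * exp w) + (- (d w * exp w / (1 - \<xi>)) * (s - w) + m1 w * (-1)) + (d w * (exp s - exp w) + m w * (- exp w))) (at w)"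
      unfolding fam_def using S(2) w by (auto intro!: derivative_eq_intros)
    moreover have "(m1 w + m w * exp w) + (- (d w * exp w / (1 - \<xi>)) * (s - w) + m1 w * (-1)) + (d w * (exp s - exp w) + m w * (- exp w)) = d w * ell \<xi> w s"
      unfolding ell_def by (simp add: algebra_simps diff_divide_distrib)
    ultimately show "((\<lambda>w. fam f m1 m w s (exp s)) has_vector_derivative d w * ell \<xi> w s) (at w)"
      by (simp add: has_real_derivative_iff_has_vector_derivative)
  qed
  define K where "K = exp s + exp q / (1 - \<xi>) * \<bar>s\<bar> + exp q * ((\<bar>p\<bar> + \<bar>q\<bar>) / (1 - \<xi>) + 1)"
  have "set_integrable lborel {p..q} (\<lambda>w. K * d w)"
    using tangent_family_d_integrable[OF tf sg] by simp
  then have "set_integrable lborel {p..q} (\<lambda>w. d w * ell \<xi> w s)"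
  proof (rule set_integrable_bound)
    show "set_borel_measurable lborel {p..q} (\<lambda>w. d w * ell \<xi> w s)"
      unfolding set_borel_measurable_def ell_def by measurable
    show "AE w in lborel. w \<in> {p..q} \<longrightarrow> norm (d w * ell \<xi> w s) \<le> norm (K * d w)"
    proof (intro AE_I2 impI)
      fix w assume "w \<in> {p..q}"
      then have "\<bar>ell \<xi> w s\<bar> \<le> \<bar>K\<bar>" using ell_bound[of w p q \<xi> s] xi unfolding K_def by linarith
      then show "norm (d w * ell \<xi> w s) \<le> norm (K * d w)"
        using mult_left_mono[of "\<bar>ell \<xi> w s\<bar>" "\<bar>K\<bar>" "\<bar>d w\<bar>"] by (simp add: abs_mult mult.commute)
    qed
  qed
  from set_borel_integral_eq_integral(2)[OF this] hi show ?thesis by (simp add: integral_unique)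
qed

text \<open>The order structure of the interval is used only for the tangent inequalities. Once
  these are recorded as \<open>above\<close> and \<open>below\<close>, the bounds concern only the
  distribution of \<open>\<phi>\<close> on a finite measure space.\<close>

locale Ainf_sample = finite_measure M for M :: "'a measure" +
  fixes \<phi> :: "'a \<Rightarrow> real" and C V x1 x2 :: real
  assumes C: "1 < C"
    and phi_meas[measurable]: "\<phi> \<in> borel_measurable M"
    and int1: "integrable M \<phi>" and int2: "integrable M (\<lambda>t. exp (\<phi> t))"
    and V: "measure M (space M) = V" "0 < V"
    and mean1: "(LINT t|M. \<phi> t) = V * x1" and mean2: "(LINT t|M. exp (\<phi> t)) = V * x2"
    and above: "x1 \<le> w + xi_plus C \<Longrightarrow> (LINT t|M. (if w < \<phi> t then ell (xi_plus C) w (\<phi> t) else 0)) \<le> 0"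
    and below: "w + xi_minus C \<le> x1 \<Longrightarrow> (LINT t|M. (if \<phi> t < w then ell (xi_minus C) w (\<phi> t) else 0)) \<le> 0"
begin

lemma affine_integral:
  "integrable M (\<lambda>t. \<alpha> + \<beta> * \<phi> t + \<gamma> * exp (\<phi> t))"
  "(LINT t|M. \<alpha> + \<beta> * \<phi> t + \<gamma> * exp (\<phi> t)) = V * (\<alpha> + \<beta> * x1 + \<gamma> * x2)"
proof -
  show "integrable M (\<lambda>t. \<alpha> + \<beta> * \<phi> t + \<gamma> * exp (\<phi> t))" using int1 int2 by auto
  show "(LINT t|M. \<alpha> + \<beta> * \<phi> t + \<gamma> * exp (\<phi> t)) = V * (\<alpha> + \<beta> * x1 + \<gamma> * x2)"
    using int1 int2 V by (simp add: mean1 mean2 algebra_simps)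
qed

lemma fam_integral:
  "integrable M (\<lambda>t. fam f m1 m w (\<phi> t) (exp (\<phi> t)))"
  "(LINT t|M. fam f m1 m w (\<phi> t) (exp (\<phi> t))) = V * fam f m1 m w x1 x2"
proof -
  have *: "fam f m1 m w y1 y2 = (f w - m1 w * w - m w * exp w) + m1 w * y1 + m w * y2" for y1 y2
    by (simp add: fam_def algebra_simps)
  show "integrable M (\<lambda>t. fam f m1 m w (\<phi> t) (exp (\<phi> t)))"
    "(LINT t|M. fam f m1 m w (\<phi> t) (exp (\<phi> t))) = V * fam f m1 m w x1 x2"
    unfolding * by (rule affine_integral)+
qed

lemma ell_bound_integrable: "integrable M (\<lambda>t. exp (\<phi> t) + k1 * \<bar>\<phi> t\<bar> + k2)"
  using int1 int2 by auto

text \<open>Clamping the parameter gives the plane at \<open>u\<close> to the left of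
  \<open>u\<close>, the boundary value \<open>f s\<close> between \<open>u\<close> and
  \<open>T\<close>, and the plane at \<open>T\<close> beyond. The difference from the plane at
  \<open>u\<close> is an integral of tangent inequalities with weights \<open>d\<close>, all
  available because \<open>u\<close> is at least \<open>x1 - xi_plus C\<close>. The cutoff
  \<open>T\<close> keeps \<open>ell\<close> dominated by one integrable function.\<close>

lemma fam_above:
  assumes tf: "tangent_family (xi_plus C) u T f m1 m d" and uT: "u \<le> T" and d: "\<And>w. w \<in> {u..T} \<Longrightarrow> 0 \<le> d w"
    and u: "x1 - xi_plus C \<le> u"
  shows "integrable M (\<lambda>t. fam f m1 m (min (max (\<phi> t) u) T) (\<phi> t) (exp (\<phi> t)))" (is ?A)
    and "(LINT t|M. fam f m1 m (min (max (\<phi> t) u) T) (\<phi> t) (exp (\<phi> t))) \<le> V * fam f m1 m u x1 x2" (is ?B)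
proof -
  let ?\<xi> = "xi_plus C"
  let ?\<rho> = "\<lambda>w s. if w < s then ell ?\<xi> w s else 0"
  have xi: "?\<xi> < 1" using xi_plus_props[OF C] by auto
  have dm[measurable]: "d \<in> borel_measurable borel" using tf by (simp add: tangent_family_def)
  have di: "set_integrable lborel {u..T} d" using tangent_family_d_integrable[OF tf] d by blast
  have rho_meas: "(\<lambda>x. ?\<rho> (fst x) (snd x)) \<in> borel_measurable (borel \<Otimes>\<^sub>M borel)"
    unfolding ell_def by measurable
  let ?H = "\<lambda>s. (LINT w:{u..T}|lborel. d w * ?\<rho> w s)"
  have key: "fam f m1 m (min (max s u) T) s (exp s) = fam f m1 m u s (exp s) + ?H s" for s
  proof (cases "s \<le> u")
    case True
    then have "?H s = (LINT w:{u..T}|lborel. 0)" by (intro set_lebesgue_integral_cong) auto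
    then show ?thesis using True uT by (simp add: max_def min_def)
  next
    case False
    define k where "k = min s T"
    have k: "u \<le> k" "k \<le> T" "min (max s u) T = k" using False uT by (auto simp: k_def)
    have "?H s = (LINT w:{u..k}|lborel. d w * ell ?\<xi> w s)"
      unfolding set_lebesgue_integral_def
    proof (rule integral_cong_AE)
      show "AE w in lborel. indicator {u..T} w *\<^sub>R (d w * ?\<rho> w s) = indicator {u..k} w *\<^sub>R (d w * ell ?\<xi> w s)"
        using AE_lborel_singleton[of s] by eventually_elim (auto simp: k_def indicator_def)
    qed (unfold ell_def, measurable)
    also have "\<dots> = fam f m1 m k s (exp s) - fam f m1 m u s (exp s)"
      by (rule fam_diff[symmetric]) (use tangent_family_subset[OF tf _ k(2)] k d in auto)
    finally show ?thesis using k by simp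
  qed
  have bnd: "\<bar>?\<rho> w s\<bar> \<le> exp s + exp T / (1 - ?\<xi>) * \<bar>s\<bar> + exp T * ((\<bar>u\<bar> + \<bar>T\<bar>) / (1 - ?\<xi>) + 1)" if "w \<in> {u..T}" for w s
      using ell_bound[OF that xi, of s] by auto
  have le: "(LINT t|M. ?\<rho> w (\<phi> t)) \<le> 0" if "w \<in> {u..T}" for w
      using above[of w] u that by auto
  note * = weighted_integral_nonpos[OF phi_meas di d dm rho_meas bnd ell_bound_integrable le]
  show ?A unfolding key by (intro Bochner_Integration.integrable_add fam_integral *)
  have "(LINT t|M. fam f m1 m (min (max (\<phi> t) u) T) (\<phi> t) (exp (\<phi> t))) =
      V * fam f m1 m u x1 x2 + (LINT t|M. ?H (\<phi> t))"
    unfolding key by (subst Bochner_Integration.integral_add[OF fam_integral(1) *(1)]) (simp_all only: fam_integral(2))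
  then show ?B using *(2) by simp
qed

text \<open>Here the parameter runs down from \<open>u\<close> to \<open>T\<close>, which reverses
  the sign required of \<open>d\<close>.\<close>

lemma fam_below:
  assumes tf: "tangent_family (xi_minus C) T u f m1 m d" and uT: "T \<le> u" and d: "\<And>w. w \<in> {T..u} \<Longrightarrow> d w \<le> 0"
    and u: "u \<le> x1 - xi_minus C"
  shows "integrable M (\<lambda>t. fam f m1 m (max (min (\<phi> t) u) T) (\<phi> t) (exp (\<phi> t)))" (is ?A)
    and "(LINT t|M. fam f m1 m (max (min (\<phi> t) u) T) (\<phi> t) (exp (\<phi> t))) \<le> V * fam f m1 m u x1 x2" (is ?B)
proof -
  let ?\<xi> = "xi_minus C"
  let ?\<rho> = "\<lambda>w s. if s < w then ell ?\<xi> w s else 0"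
  have xi: "?\<xi> < 1" using xi_minus_props[OF C] by auto
  have dm[measurable]: "d \<in> borel_measurable borel" using tf by (simp add: tangent_family_def)
  have "set_integrable lborel {T..u} d" using tangent_family_d_integrable[OF tf] d by blast
  then have di': "set_integrable lborel {T..u} (\<lambda>w. - d w)" unfolding set_integrable_def by simp
  have dm': "(\<lambda>w. - d w) \<in> borel_measurable borel" by measurable
  have rho_meas: "(\<lambda>x. ?\<rho> (fst x) (snd x)) \<in> borel_measurable (borel \<Otimes>\<^sub>M borel)"
    unfolding ell_def by measurable
  let ?H = "\<lambda>s. (LINT w:{T..u}|lborel. - d w * ?\<rho> w s)"
  have key: "fam f m1 m (max (min s u) T) s (exp s) = fam f m1 m u s (exp s) + ?H s" for s
  proof (cases "u \<le> s")
    case True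
    then have "?H s = (LINT w:{T..u}|lborel. 0)" by (intro set_lebesgue_integral_cong) auto
    then show ?thesis using True uT by (simp add: max_def min_def)
  next
    case False
    define k where "k = max s T"
    have k: "k \<le> u" "T \<le> k" "max (min s u) T = k" using False uT by (auto simp: k_def)
    have "?H s = (LINT w:{k..u}|lborel. - (d w * ell ?\<xi> w s))"
      unfolding set_lebesgue_integral_def
    proof (rule integral_cong_AE)
      show "AE w in lborel. indicator {T..u} w *\<^sub>R (- d w * ?\<rho> w s) = indicator {k..u} w *\<^sub>R (- (d w * ell ?\<xi> w s))"
        using AE_lborel_singleton[of s] by eventually_elim (auto simp: k_def indicator_def)
    qed (unfold ell_def, measurable)
    also have "\<dots> = - (LINT w:{k..u}|lborel. d w * ell ?\<xi> w s)"
      unfolding set_lebesgue_integral_def by simp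
    also have "(LINT w:{k..u}|lborel. d w * ell ?\<xi> w s) = fam f m1 m u s (exp s) - fam f m1 m k s (exp s)"
      by (rule fam_diff[symmetric]) (use tangent_family_subset[OF tf k(2)] k d in auto)
    finally show ?thesis using k by simp
  qed
  have bnd: "\<bar>?\<rho> w s\<bar> \<le> exp s + exp u / (1 - ?\<xi>) * \<bar>s\<bar> + exp u * ((\<bar>T\<bar> + \<bar>u\<bar>) / (1 - ?\<xi>) + 1)" if "w \<in> {T..u}" for w s
      using ell_bound[OF that xi, of s] by auto
  have le: "(LINT t|M. ?\<rho> w (\<phi> t)) \<le> 0" if "w \<in> {T..u}" for w
      using below[of w] u that by auto
  have dn: "0 \<le> - d w" if "w \<in> {T..u}" for w using d[OF that] by simp
  note * = weighted_integral_nonpos[OF phi_meas di' dn dm' rho_meas bnd ell_bound_integrable le]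
  show ?A unfolding key by (intro Bochner_Integration.integrable_add fam_integral *)
  have "(LINT t|M. fam f m1 m (max (min (\<phi> t) u) T) (\<phi> t) (exp (\<phi> t))) =
      V * fam f m1 m u x1 x2 + (LINT t|M. ?H (\<phi> t))"
    unfolding key by (subst Bochner_Integration.integral_add[OF fam_integral(1) *(1)]) (simp_all only: fam_integral(2))
  then show ?B using *(2) by simp
qed

end

section \<open>Bounds for arbitrary functions of the class\<close>

lemma exp_xi_diff:
  assumes "C > 1"
  shows "exp (xi_minus C - xi_plus C) = (1 - xi_plus C) / (1 - xi_minus C)"
proof -
  have "exp (xi_minus C - xi_plus C) = exp (- xi_plus C) / exp (- xi_minus C)" by (simp flip: exp_diff)
  also have "\<dots> = (1 - xi_plus C) / (1 - xi_minus C)"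
    using xi_plus_props(3)[OF assms] xi_minus_props(2)[OF assms] assms by simp
  finally show ?thesis .
qed

lemma C_exp_xi:
  assumes "C > 1"
  shows "C * exp (xi_plus C) = 1 / (1 - xi_plus C)" "C * exp (xi_minus C) = 1 / (1 - xi_minus C)"
  using upper_tangent_point[of "xi_plus C" C 0] upper_tangent_point[of "xi_minus C" C 0]
    xi_plus_props[OF assms] xi_minus_props[OF assms] by auto

text \<open>As a function of \<open>w\<close> with \<open>x1\<close> fixed and \<open>\<xi>\<close>
  one of the two roots, this increases up to \<open>w = x1 - \<xi>\<close>, where it equals
  \<open>C * exp x1\<close>, and decreases afterwards. The equation for \<open>u_plus\<close> is
  solved on the decreasing branch, that for \<open>u_minus\<close> on the increasing one. The
  relation to \<open>ell\<close> is \<open>ell \<xi> w s = exp s - tline \<xi> s w\<close>.\<close>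

definition tline :: "real \<Rightarrow> real \<Rightarrow> real \<Rightarrow> real" where
  "tline \<xi> x1 w = exp w * ((x1 - w) / (1 - \<xi>) + 1)"

lemma tline_deriv:
  assumes "\<xi> < 1"
  shows "(tline \<xi> x1 has_real_derivative exp w * (x1 - w - \<xi>) / (1 - \<xi>)) (at w)"
proof -
  define k where "k = 1 / (1 - \<xi>)"
  have "((\<lambda>w. exp w * ((x1 - w) * k + 1)) has_real_derivative exp w * ((x1 - w) * k + 1) - exp w * k) (at w)"
    by (auto intro!: derivative_eq_intros)
  moreover have "exp w * ((x1 - w) * k + 1) - exp w * k = exp w * (x1 - w - \<xi>) / (1 - \<xi>)"
  proof -
    have "(1 - \<xi>) * k = 1" using assms by (simp add: k_def)
    then have "exp w * ((x1 - w) * k + 1) - exp w * k = exp w * (x1 - w - \<xi>) * k" by algebra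
    then show ?thesis by (simp add: k_def)
  qed
  ultimately show ?thesis unfolding tline_def[abs_def] k_def by simp
qed

lemma tline_decr:
  assumes "\<xi> < 1" "x1 - \<xi> \<le> w" "w < w'"
  shows "tline \<xi> x1 w' < tline \<xi> x1 w"
proof (rule DERIV_neg_imp_decreasing_open[OF assms(3)])
  fix y assume "w < y" "y < w'"
  then show "\<exists>d. (tline \<xi> x1 has_real_derivative d) (at y) \<and> d < 0"
    using tline_deriv[OF assms(1)] assms by (intro exI conjI) (auto simp: divide_less_0_iff mult_less_0_iff)
qed (use assms in \<open>auto simp: tline_def intro!: continuous_intros\<close>)

lemma tline_incr:
  assumes "\<xi> < 1" "w' \<le> x1 - \<xi>" "w < w'"
  shows "tline \<xi> x1 w < tline \<xi> x1 w'"
proof (rule DERIV_pos_imp_increasing_open[OF assms(3)])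
  fix y assume "w < y" "y < w'"
  then show "\<exists>d. (tline \<xi> x1 has_real_derivative d) (at y) \<and> 0 < d"
    using tline_deriv[OF assms(1)] assms by (intro exI conjI) (auto simp: zero_less_divide_iff zero_less_mult_iff)
qed (use assms in \<open>auto simp: tline_def intro!: continuous_intros\<close>)

lemma tline_end:
  assumes "\<xi> < 1" "exp (- \<xi>) = C * (1 - \<xi>)"
  shows "tline \<xi> x1 (x1 - \<xi>) = C * exp x1"
proof -
  have "tline \<xi> x1 (x1 - \<xi>) = exp (x1 - \<xi>) / (1 - \<xi>)" using assms(1) by (simp add: tline_def field_simps)
  also have "\<dots> = C * exp x1" using upper_tangent_point[OF assms, of "x1 - \<xi>"] by simp
  finally show ?thesis .
qed

lemma u_plus_props:
  assumes C: "C > 1" and x: "exp x1 \<le> x2" "x2 \<le> C * exp x1"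
  shows "x1 - xi_plus C \<le> u_plus C (x1, x2)" "u_plus C (x1, x2) \<le> x1"
    "x2 = tline (xi_plus C) x1 (u_plus C (x1, x2))"
proof -
  let ?\<xi> = "xi_plus C"
  let ?P = "\<lambda>u. x2 = exp u * ((x1 - u) / (1 - ?\<xi>) + 1) \<and> x1 - ?\<xi> \<le> u \<and> u \<le> x1"
  note xi = xi_plus_props[OF C]
  have "\<exists>u\<ge>x1 - ?\<xi>. u \<le> x1 \<and> tline ?\<xi> x1 u = x2"
    by (rule IVT2') (use x tline_end[OF xi(2,3), of x1] xi in \<open>auto simp: tline_def intro!: continuous_intros\<close>)
  then obtain u where u: "x1 - ?\<xi> \<le> u" "u \<le> x1" "tline ?\<xi> x1 u = x2" by auto
  have "\<exists>!u. ?P u"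
  proof (rule ex1I[of _ u])
    show "?P u" using u by (auto simp: tline_def)
    fix y assume "?P y"
    then have y: "x1 - ?\<xi> \<le> y" "tline ?\<xi> x1 y = x2" by (auto simp: tline_def)
    show "y = u"
      using tline_decr[OF xi(2) y(1), of u] tline_decr[OF xi(2) u(1), of y] y u by linarith
  qed
  then have "?P (u_plus C (x1, x2))" unfolding u_plus_def fst_conv snd_conv by (rule theI')
  then show "x1 - ?\<xi> \<le> u_plus C (x1, x2)" "u_plus C (x1, x2) \<le> x1"
    "x2 = tline ?\<xi> x1 (u_plus C (x1, x2))" by (auto simp: tline_def)
qed

lemma u_minus_props:
  assumes C: "C > 1" and x: "exp x1 \<le> x2" "x2 \<le> C * exp x1"
  shows "x1 \<le> u_minus C (x1, x2)" "u_minus C (x1, x2) \<le> x1 - xi_minus C"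
    "x2 = tline (xi_minus C) x1 (u_minus C (x1, x2))"
proof -
  let ?\<xi> = "xi_minus C"
  let ?P = "\<lambda>u. x2 = exp u * ((x1 - u) / (1 - ?\<xi>) + 1) \<and> x1 \<le> u \<and> u \<le> x1 - ?\<xi>"
  note xi = xi_minus_props[OF C]
  have xi1: "?\<xi> < 1" using xi by simp
  have "\<exists>u\<ge>x1. u \<le> x1 - ?\<xi> \<and> tline ?\<xi> x1 u = x2"
    by (rule IVT') (use x tline_end[OF xi1 xi(2), of x1] xi in \<open>auto simp: tline_def intro!: continuous_intros\<close>)
  then obtain u where u: "x1 \<le> u" "u \<le> x1 - ?\<xi>" "tline ?\<xi> x1 u = x2" by auto
  have "\<exists>!u. ?P u"
  proof (rule ex1I[of _ u])
    show "?P u" using u by (auto simp: tline_def)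
    fix y assume "?P y"
    then have y: "y \<le> x1 - ?\<xi>" "tline ?\<xi> x1 y = x2" by (auto simp: tline_def)
    show "y = u"
      using tline_incr[OF xi1 y(1), of u] tline_incr[OF xi1 u(2), of y] y u by linarith
  qed
  then have "?P (u_minus C (x1, x2))" unfolding u_minus_def fst_conv snd_conv by (rule theI')
  then show "x1 \<le> u_minus C (x1, x2)" "u_minus C (x1, x2) \<le> x1 - ?\<xi>"
    "x2 = tline ?\<xi> x1 (u_minus C (x1, x2))" by (auto simp: tline_def)
qed

lemma u_plus_ge:
  assumes C: "C > 1" and x: "exp x1 \<le> x2" "x2 \<le> C * exp x1" and w: "x1 - xi_plus C \<le> w \<Longrightarrow> x2 \<le> tline (xi_plus C) x1 w"
  shows "w \<le> u_plus C (x1, x2)"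
  using u_plus_props[OF C x] tline_decr[OF xi_plus_props(2)[OF C] u_plus_props(1)[OF C x], of w] w by linarith

lemma u_plus_le:
  assumes C: "C > 1" and x: "exp x1 \<le> x2" "x2 \<le> C * exp x1" and w: "x1 - xi_plus C \<le> w" "tline (xi_plus C) x1 w \<le> x2"
  shows "u_plus C (x1, x2) \<le> w"
  using u_plus_props[OF C x] tline_decr[OF xi_plus_props(2)[OF C] w(1), of "u_plus C (x1, x2)"] w by linarith

lemma u_minus_le:
  assumes C: "C > 1" and x: "exp x1 \<le> x2" "x2 \<le> C * exp x1" and w: "w \<le> x1 - xi_minus C \<Longrightarrow> x2 \<le> tline (xi_minus C) x1 w"
  shows "u_minus C (x1, x2) \<le> w"
proof -
  have "xi_minus C < 1" using xi_minus_props(1)[OF C] by simp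
  then show ?thesis
    using u_minus_props[OF C x] tline_incr[OF _ u_minus_props(2)[OF C x], of w] w by linarith
qed

text \<open>Along the tangent from \<open>u\<close> the plane is affine in \<open>x1\<close> with
  value \<open>f u\<close> at the start, which is the shape in which the candidates are
  given.\<close>

lemma fam_on_tline:
  assumes "x2 = tline \<xi> x1 u"
  shows "fam f m1 m u x1 x2 = f u + (m1 u + m u * exp u / (1 - \<xi>)) * (x1 - u)"
  unfolding fam_def assms tline_def by (simp add: algebra_simps)

lemma fam_diag: "fam f m1 m s s (exp s) = f s"
  by (simp add: fam_def)

text \<open>Replacing \<open>exp s\<close> by its tangent at \<open>w\<close> lowers the plane when
  \<open>m w\<close> is nonnegative. In a tangent family the result is the tangent line of
  \<open>f\<close> at \<open>w\<close>; it controls the plane beyond the cutoff.\<close>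

lemma fam_ge_tangent:
  assumes "0 \<le> m w"
  shows "f w + (m1 w + m w * exp w) * (s - w) \<le> fam f m1 m w s (exp s)"
proof -
  have "s - w \<le> exp (s - w) - 1" using exp_ge_add_one_self[of "s - w"] by linarith
  then have "exp w * (s - w) \<le> exp w * (exp (s - w) - 1)" by (intro mult_left_mono) auto
  also have "\<dots> = exp s - exp w" by (simp add: exp_diff algebra_simps)
  finally have "m w * (exp w * (s - w)) \<le> m w * (exp s - exp w)" using assms by (rule mult_left_mono)
  then show ?thesis unfolding fam_def by (simp add: algebra_simps)
qed

text \<open>For \<open>w \<ge> s\<close> the values \<open>ell \<xi> w s\<close> are nonnegative, so
  the planes only grow from \<open>f s\<close> as their parameter moves from \<open>s\<close> to
  \<open>u\<close>.\<close>

lemma fam_ge_diag: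
  assumes tf: "tangent_family \<xi> s u f m1 m d" and su: "s \<le> u" and xi: "0 \<le> \<xi>"
    and d: "\<And>w. w \<in> {s..u} \<Longrightarrow> 0 \<le> d w"
  shows "f s \<le> fam f m1 m u s (exp s)"
proof -
  have "0 \<le> (LINT w:{s..u}|lborel. d w * ell \<xi> w s)"
    unfolding set_lebesgue_integral_def
    using tf xi d by (intro Bochner_Integration.integral_nonneg)
      (auto simp: indicator_def tangent_family_def intro!: mult_nonneg_nonneg ell_nonneg mult_nonpos_nonneg)
  then show ?thesis using fam_diff[OF tf _ su, of s] d by (simp add: fam_diag)
qed

lemma fam_ge_diag_left:
  assumes tf: "tangent_family \<xi> u s f m1 m d" and su: "u \<le> s" and xi: "\<xi> \<le> 0"
    and d: "\<And>w. w \<in> {u..s} \<Longrightarrow> d w \<le> 0"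
  shows "f s \<le> fam f m1 m u s (exp s)"
proof -
  have pos: "0 \<le> - (d w * ell \<xi> w s)" if "w \<in> {u..s}" for w
  proof -
    have "0 \<le> ell \<xi> w s"
      by (rule ell_nonneg) (use tf that xi in \<open>auto simp: tangent_family_def mult_nonneg_nonpos\<close>)
    then show ?thesis using d[OF that] by (simp add: mult_nonpos_nonneg)
  qed
  have "0 \<le> (LINT w:{u..s}|lborel. - (d w * ell \<xi> w s))"
    unfolding set_lebesgue_integral_def
    by (rule Bochner_Integration.integral_nonneg) (use pos in \<open>auto simp: indicator_def\<close>)
  then have "(LINT w:{u..s}|lborel. d w * ell \<xi> w s) \<le> 0" unfolding set_lebesgue_integral_def by simp
  then show ?thesis using fam_diff[OF tf _ su, of s] d by (simp add: fam_diag)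
qed

text \<open>It makes finiteness of a moment a conclusion instead of a hypothesis: one constant
  serves for an increasing sequence of sets on which the integrand is truncated.\<close>

lemma nn_integral_le_exhaustion:
  assumes [measurable]: "f \<in> borel_measurable M" "\<And>n::nat. A n \<in> sets M" and A: "incseq A" "(\<Union>n. A n) = space M"
    and le: "\<And>n. (\<integral>\<^sup>+x. f x * indicator (A n) x \<partial>M) \<le> K"
  shows "(\<integral>\<^sup>+x. f x \<partial>M) \<le> K"
proof -
  have sup: "(SUP n. f x * indicator (A n) x) = f x" if "x \<in> space M" for x
  proof -
    have "x \<in> (\<Union>n. A n)" using A(2) that by simp
    then obtain k where k: "x \<in> A k" by (rule UN_E)
    show ?thesis
    proof (rule antisym)
      show "(SUP n. f x * indicator (A n) x) \<le> f x" by (rule SUP_least) (auto split: split_indicator)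
      show "f x \<le> (SUP n. f x * indicator (A n) x)" by (rule SUP_upper2[of k]) (use k in auto)
    qed
  qed
  have "(\<integral>\<^sup>+x. f x \<partial>M) = (\<integral>\<^sup>+x. (SUP n. f x * indicator (A n) x) \<partial>M)"
    by (rule nn_integral_cong) (use sup in simp)
  also have "\<dots> = (SUP n. (\<integral>\<^sup>+x. f x * indicator (A n) x \<partial>M))"
    by (rule nn_integral_monotone_convergence_SUP)
       (use A(1) in \<open>auto simp: incseq_def le_fun_def split: split_indicator\<close>)
  also have "\<dots> \<le> K" using le by (rule SUP_least)
  finally show ?thesis .
qed

section \<open>Upper bounds for the exponential and the second moment\<close>

context Ainf_sample
begin

lemma xi: "0 < xi_plus C" "xi_plus C < 1" "xi_minus C < 0" "xi_minus C < 1"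
  using xi_plus_props[OF C] xi_minus_props[OF C] by auto

lemma ell_if_integrable:
  assumes "\<xi> < 1" "Measurable.pred borel P"
  shows "integrable M (\<lambda>t. if P (\<phi> t) then ell \<xi> w (\<phi> t) else 0)"
proof (rule Bochner_Integration.integrable_bound[OF ell_bound_integrable])
  show "(\<lambda>t. if P (\<phi> t) then ell \<xi> w (\<phi> t) else 0) \<in> borel_measurable M"
    using assms(2) unfolding ell_def by measurable
  show "AE t in M. norm (if P (\<phi> t) then ell \<xi> w (\<phi> t) else 0) \<le>
      norm (exp (\<phi> t) + exp w / (1 - \<xi>) * \<bar>\<phi> t\<bar> + exp w * ((\<bar>w\<bar> + \<bar>w\<bar>) / (1 - \<xi>) + 1))"
    using ell_bound[of w w w \<xi>] assms(1) by (intro AE_I2) (smt (verit) atLeastAtMost_iff real_norm_def)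
qed

lemma A_upper:
  assumes x: "exp x1 \<le> x2" "x2 \<le> C * exp x1" and \<delta>: "1 \<le> \<delta>" "\<delta> * xi_plus C < 1"
  shows "(\<integral>\<^sup>+t. ennreal (exp (\<delta> * \<phi> t)) \<partial>M) \<le> ennreal (V * A_cand \<delta> C (x1, x2))"
proof -
  let ?\<xi> = "xi_plus C"
  define u where "u = u_plus C (x1, x2)"
  note u = u_plus_props[OF C x, folded u_def]
  \<comment> \<open>With \<open>m\<close> a multiple of \<open>exp ((\<delta> - 1) * w)\<close> and
    \<open>m1\<close> a multiple of \<open>exp (\<delta> * w)\<close>, the differential equations
    become the linear system \<open>A1 + A0 = \<delta>\<close> and
    \<open>A0 * (\<delta> - 1) / (1 - ?\<xi>) = - (A1 * \<delta>)\<close>. Eliminating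
    \<open>A1\<close> produces the factor \<open>1 - \<delta> * ?\<xi>\<close>.\<close>
  define A0 where "A0 = \<delta>\<^sup>2 * (1 - ?\<xi>) / (1 - \<delta> * ?\<xi>)"
  define A1 where "A1 = \<delta> * (1 - \<delta>) / (1 - \<delta> * ?\<xi>)"
  have A0: "0 \<le> A0" using \<delta> xi by (simp add: A0_def)
  have A01: "A1 + A0 = \<delta>"
  proof -
    have "A1 + A0 = \<delta> * (1 - \<delta> * ?\<xi>) / (1 - \<delta> * ?\<xi>)"
      unfolding A0_def A1_def add_divide_distrib[symmetric] by (simp add: power2_eq_square algebra_simps)
    then show ?thesis using \<delta> by simp
  qed
  have A02: "A0 * (\<delta> - 1) / (1 - ?\<xi>) = - (A1 * \<delta>)"
    using \<delta> xi unfolding A0_def A1_def by (simp add: power2_eq_square divide_simps) (simp add: algebra_simps)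
  let ?f = "\<lambda>w. exp (\<delta> * w)" and ?m = "\<lambda>w. A0 * exp ((\<delta> - 1) * w)" and ?m1 = "\<lambda>w. A1 * exp (\<delta> * w)"
    and ?d = "\<lambda>w. A0 * (\<delta> - 1) * exp ((\<delta> - 1) * w)"
  have ee: "exp ((\<delta> - 1) * w) * exp w = exp (\<delta> * w)" for w by (simp add: algebra_simps flip: exp_add)
  have der: "?m1 w + ?m w * exp w = \<delta> * ?f w" for w
    using ee[of w] A01 by (simp add: mult.assoc distrib_right[symmetric])
  have tf: "tangent_family ?\<xi> p q ?f ?m1 ?m ?d" for p q
    unfolding tangent_family_def
  proof (intro conjI exI[of _ "{}"] ballI)
    fix w
    show "(?f has_real_derivative ?m1 w + ?m w * exp w) (at w)"
      unfolding der by (auto intro!: derivative_eq_intros)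
    show "(?m has_real_derivative ?d w) (at w)" by (auto intro!: derivative_eq_intros)
    have "- (?d w * exp w / (1 - ?\<xi>)) = - (A0 * (\<delta> - 1) / (1 - ?\<xi>) * (exp ((\<delta> - 1) * w) * exp w))" by simp
    also have "\<dots> = A1 * \<delta> * exp (\<delta> * w)" unfolding ee A02 by simp
    finally show "(?m1 has_real_derivative - (?d w * exp w / (1 - ?\<xi>))) (at w)"
      by (auto intro!: derivative_eq_intros)
  qed (use xi in \<open>auto intro!: continuous_intros\<close>)
  have d: "0 \<le> ?d w" for w using A0 \<delta> by simp
  have val: "fam ?f ?m1 ?m u x1 x2 = A_cand \<delta> C (x1, x2)"
  proof -
    have "?m1 u + ?m u * exp u / (1 - ?\<xi>) = exp (\<delta> * u) * (A1 + A0 / (1 - ?\<xi>))"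
      using ee[of u] by (simp add: algebra_simps)
    also have "A1 + A0 / (1 - ?\<xi>) = \<delta> / (1 - \<delta> * ?\<xi>)"
    proof -
      have "A0 / (1 - ?\<xi>) = \<delta>\<^sup>2 / (1 - \<delta> * ?\<xi>)" using xi by (simp add: A0_def)
      then show ?thesis unfolding A1_def by (simp add: add_divide_distrib[symmetric] power2_eq_square algebra_simps)
    qed
    finally show ?thesis unfolding fam_on_tline[OF u(3)] using C
      by (simp add: A_cand_def Let_def u_def algebra_simps)
  qed
  show ?thesis
  proof (rule nn_integral_le_exhaustion[where A = "\<lambda>n. {t \<in> space M. \<phi> t \<le> u + real n}"])
    fix n :: nat
    let ?T = "u + real n"
    let ?F = "\<lambda>t. fam ?f ?m1 ?m (min (max (\<phi> t) u) ?T) (\<phi> t) (exp (\<phi> t))"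
    note F = fam_above[OF tf _ d u(1), of ?T]
    have pw: "exp (\<delta> * s) * (if s \<le> ?T then 1 else 0) \<le> fam ?f ?m1 ?m (min (max s u) ?T) s (exp s)" for s
    proof -
      consider "s \<le> u" | "u < s" "s \<le> ?T" | "?T < s" by linarith
      then show ?thesis
      proof cases
        case 1
        then show ?thesis using fam_ge_diag[OF tf 1 _ d] xi by (simp add: max_def min_def)
      next
        case 2
        then show ?thesis by (simp add: max_def min_def fam_diag)
      next
        \<comment> \<open>Beyond the cutoff the truncated integrand is 0, so nonnegativity of the
          plane is enough.\<close>
        case 3
        have "0 \<le> ?f ?T + (?m1 ?T + ?m ?T * exp ?T) * (s - ?T)"
          unfolding der using 3 \<delta> by (intro add_nonneg_nonneg mult_nonneg_nonneg) auto
        also have "\<dots> \<le> fam ?f ?m1 ?m ?T s (exp s)" by (rule fam_ge_tangent) (use A0 in auto)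
        finally show ?thesis using 3 by (simp add: max_def min_def)
      qed
    qed
    have "(\<integral>\<^sup>+t. ennreal (exp (\<delta> * \<phi> t)) * indicator {t \<in> space M. \<phi> t \<le> ?T} t \<partial>M) \<le> (\<integral>\<^sup>+t. ennreal (?F t) \<partial>M)"
    proof (rule nn_integral_mono)
      fix t assume "t \<in> space M"
      then show "ennreal (exp (\<delta> * \<phi> t)) * indicator {t \<in> space M. \<phi> t \<le> ?T} t \<le> ennreal (?F t)"
        using pw[of "\<phi> t"] by (auto simp: indicator_def split: if_splits intro!: ennreal_leI)
    qed
    also have "\<dots> = ennreal (LINT t|M. ?F t)"
    proof (rule nn_integral_eq_integral)
      show "AE t in M. 0 \<le> ?F t"
        using order_trans[OF _ pw] by (intro AE_I2) auto
    qed (use F in auto)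
    also have "\<dots> \<le> ennreal (V * A_cand \<delta> C (x1, x2))"
      using F(2) unfolding val by (intro ennreal_leI) auto
    finally show "(\<integral>\<^sup>+t. ennreal (exp (\<delta> * \<phi> t)) * indicator {t \<in> space M. \<phi> t \<le> ?T} t \<partial>M) \<le> ennreal (V * A_cand \<delta> C (x1, x2))" .
  next
    show "(\<Union>n. {t \<in> space M. \<phi> t \<le> u + real n}) = space M"
      proof -
      have "\<exists>n. \<phi> t \<le> u + real n" for t
        using real_arch_simple[of "\<phi> t - u"] by (auto simp: algebra_simps)
      then show ?thesis by auto
    qed
  qed (auto simp: incseq_def)
qed

lemma B2_upper:
  assumes x: "exp x1 \<le> x2" "x2 \<le> C * exp x1"
  shows "(\<integral>\<^sup>+t. ennreal ((\<phi> t)\<^sup>2) \<partial>M) \<le> ennreal (V * B2_cand C (x1, x2))"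
proof -
  let ?\<xi> = "xi_minus C"
  define u where "u = u_minus C (x1, x2)"
  note u = u_minus_props[OF C x, folded u_def]
  \<comment> \<open>For the square the density \<open>?d\<close> is negative, which is the sign that
    \<open>fam_below\<close> requires; hence \<open>xi_minus\<close> and \<open>u_minus\<close> in
    the candidate.\<close>
  let ?f = "\<lambda>w::real. w\<^sup>2" and ?m = "\<lambda>w. 2 * (1 - ?\<xi>) * exp (- w)" and ?m1 = "\<lambda>w. 2 * w - 2 * (1 - ?\<xi>)"
    and ?d = "\<lambda>w. - (2 * (1 - ?\<xi>) * exp (- w))"
  have ee: "exp (- w) * exp w = 1" for w :: real by (simp flip: exp_add)
  have der: "?m1 w + ?m w * exp w = 2 * w" for w
    using ee[of w] by (simp add: mult.assoc)
  have tf: "tangent_family ?\<xi> p q ?f ?m1 ?m ?d" for p q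
    unfolding tangent_family_def
  proof (intro conjI exI[of _ "{}"] ballI)
    fix w
    show "(?f has_real_derivative ?m1 w + ?m w * exp w) (at w)"
      unfolding der by (auto intro!: derivative_eq_intros)
    show "(?m has_real_derivative ?d w) (at w)" by (auto intro!: derivative_eq_intros)
    have "- (?d w * exp w / (1 - ?\<xi>)) = 2 * (exp (- w) * exp w)"
      using xi by (simp add: nonzero_divide_eq_eq)
    then have "- (?d w * exp w / (1 - ?\<xi>)) = 2" unfolding ee by simp
    then show "(?m1 has_real_derivative - (?d w * exp w / (1 - ?\<xi>))) (at w)"
      by (auto intro!: derivative_eq_intros)
  qed (use xi in \<open>auto intro!: continuous_intros\<close>)
  have d: "?d w \<le> 0" for w using xi by simp
  have val: "fam ?f ?m1 ?m u x1 x2 = B2_cand C (x1, x2)"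
  proof -
    have "?m u * exp u / (1 - ?\<xi>) = 2 * (exp (- u) * exp u)"
      using xi by (simp add: nonzero_divide_eq_eq)
    then have "?m1 u + ?m u * exp u / (1 - ?\<xi>) = 2 * u + 2 * ?\<xi>" unfolding ee by simp
    then show ?thesis unfolding fam_on_tline[OF u(3)] using C
      by (simp add: B2_cand_def Let_def u_def[symmetric] power2_eq_square algebra_simps)
  qed
  show ?thesis
  proof (rule nn_integral_le_exhaustion[where A = "\<lambda>n. {t \<in> space M. min u 0 - real n \<le> \<phi> t}"])
    fix n :: nat
    \<comment> \<open>The minimum with 0 makes the cutoff nonpositive, so that the tangent line of
      the square is nonnegative to its left.\<close>
    let ?T = "min u 0 - real n"
    let ?F = "\<lambda>t. fam ?f ?m1 ?m (max (min (\<phi> t) u) ?T) (\<phi> t) (exp (\<phi> t))"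
    note F = fam_below[OF tf _ d u(2), of ?T]
    have pw: "s\<^sup>2 * (if ?T \<le> s then 1 else 0) \<le> fam ?f ?m1 ?m (max (min s u) ?T) s (exp s)" for s
    proof -
      consider "u \<le> s" | "s < u" "?T \<le> s" | "s < ?T" by linarith
      then show ?thesis
      proof cases
        case 1
        have "max (min s u) ?T = u" "?T \<le> s" using 1 by linarith+
        moreover have "s\<^sup>2 \<le> fam ?f ?m1 ?m u s (exp s)"
          by (rule fam_ge_diag_left[OF tf 1 _ d]) (use xi in simp)
        ultimately show ?thesis by (simp only: if_True mult_1_right)
      next
        case 2
        then have "max (min s u) ?T = s" by linarith
        then show ?thesis by (simp add: fam_diag)
      next
        case 3
        have T0: "?T \<le> 0" by linarith
        have "0 \<le> ?f ?T + (?m1 ?T + ?m ?T * exp ?T) * (s - ?T)"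
          unfolding der using 3 T0 by (intro add_nonneg_nonneg mult_nonpos_nonpos) auto
        also have "\<dots> \<le> fam ?f ?m1 ?m ?T s (exp s)" by (rule fam_ge_tangent) (use xi in auto)
        finally have "0 \<le> fam ?f ?m1 ?m ?T s (exp s)" .
        moreover have "max (min s u) ?T = ?T" using 3 by linarith
        ultimately show ?thesis using 3 by simp
      qed
    qed
    have "(\<integral>\<^sup>+t. ennreal ((\<phi> t)\<^sup>2) * indicator {t \<in> space M. ?T \<le> \<phi> t} t \<partial>M) \<le> (\<integral>\<^sup>+t. ennreal (?F t) \<partial>M)"
    proof (rule nn_integral_mono)
      fix t assume "t \<in> space M"
      then show "ennreal ((\<phi> t)\<^sup>2) * indicator {t \<in> space M. ?T \<le> \<phi> t} t \<le> ennreal (?F t)"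
        using pw[of "\<phi> t"] by (auto simp: indicator_def split: if_splits intro!: ennreal_leI)
    qed
    also have "\<dots> = ennreal (LINT t|M. ?F t)"
    proof (rule nn_integral_eq_integral)
      show "AE t in M. 0 \<le> ?F t"
        using order_trans[OF _ pw] by (intro AE_I2) auto
    qed (use F in auto)
    also have "\<dots> \<le> ennreal (V * B2_cand C (x1, x2))"
      using F(2) unfolding val by (intro ennreal_leI) auto
    finally show "(\<integral>\<^sup>+t. ennreal ((\<phi> t)\<^sup>2) * indicator {t \<in> space M. ?T \<le> \<phi> t} t \<partial>M) \<le> ennreal (V * B2_cand C (x1, x2))" .
  next
    show "(\<Union>n. {t \<in> space M. min u 0 - real n \<le> \<phi> t}) = space M"
    proof -
      have "\<exists>n. min u 0 - real n \<le> \<phi> t" for t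
        using real_arch_simple[of "min u 0 - \<phi> t"] by (auto simp: algebra_simps)
      then show ?thesis by auto
    qed
  qed (auto simp: incseq_def)
qed

end

text \<open>The line depends on \<open>w\<close> and \<open>\<xi>\<close> only through the tangency
  abscissa \<open>w + \<xi>\<close>. Hence the two families consist of the same lines, started from
  opposite sides of the tangency point.\<close>

lemma tline_eq_tangent:
  fixes \<xi> C w s :: real
  assumes "\<xi> < 1" "exp (- \<xi>) = C * (1 - \<xi>)"
  shows "tline \<xi> s w = C * exp (w + \<xi>) * (1 + (s - (w + \<xi>)))"
  unfolding upper_tangent_point[OF assms] tline_def using assms(1) by (simp add: field_simps)

text \<open>The \<open>xi_minus\<close> tangent from \<open>lam\<close> and the
  \<open>xi_plus\<close> tangent from \<open>lam + xi_minus C - xi_plus C\<close> touch the upper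
  curve at the same point, so they are one line. A point above this line belongs to a tangent that
  starts further to the left.\<close>

lemma D_Omega1_u_plus_le:
  assumes C: "1 < C" and x: "exp x1 \<le> x2" "x2 \<le> C * exp x1" and O: "(x1, x2) \<in> D_Omega1 lam C"
  shows "u_plus C (x1, x2) \<le> lam + xi_minus C - xi_plus C"
proof (cases "x1 \<le> lam + xi_minus C - xi_plus C")
  case False
  note xi = xi_plus_props[OF C] xi_minus_props[OF C]
  have z1: "xi_minus C < 1" using xi by simp
  let ?T = "lam + xi_minus C - xi_plus C"
  have *: "x1 \<le> lam + xi_minus C" "exp lam * (C * exp (xi_minus C) * (x1 - lam) + 1) \<le> x2"
    using O False by (auto simp: D_Omega1_def)
  have "tline (xi_plus C) x1 ?T = tline (xi_minus C) x1 lam"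
    using tline_eq_tangent[OF xi(2,3), of x1 ?T] tline_eq_tangent[OF z1 xi(5), of x1 lam] by simp
  then show ?thesis using u_plus_le[OF C x, of ?T] * C_exp_xi(2)[OF C] by (simp add: tline_def)
qed (use u_plus_props(2)[OF C x] in auto)

lemma exp_gt_add_one:
  fixes x :: real
  assumes "x \<noteq> 0"
  shows "1 + x < exp x"
proof -
  have "1 + x \<noteq> exp x"
  proof
    assume e: "1 + x = exp x"
    then have "0 < 1 + x" by simp
    moreover have "ln (1 + x) = (1 + x) - 1" using arg_cong[OF e, of ln] by simp
    ultimately have "1 + x = 1" by (rule ln_eq_minus_one)
    with assms show False by simp
  qed
  then show ?thesis using exp_ge_add_one_self[of x] by linarith
qed

lemma exp_slope_strict_mono:
  fixes v v' l :: real
  assumes "v < v'" "v' < l"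
  shows "(exp v - exp l) / (v - l) < (exp v' - exp l) / (v' - l)"
proof (rule DERIV_pos_imp_increasing_open[OF assms(1)])
  fix y assume "v < y" "y < v'"
  then have y: "y < l" using assms by simp
  have "1 + (l - y) < exp (l - y)"
    by (rule exp_gt_add_one) (use y in simp)
  then have "exp y * (1 + (l - y)) < exp y * exp (l - y)" by simp
  then have "0 < exp y * (y - l) - (exp y - exp l)" by (simp add: algebra_simps flip: exp_add)
  moreover have "((\<lambda>v. (exp v - exp l) / (v - l)) has_real_derivative
      (exp y * (y - l) - (exp y - exp l)) / ((y - l) * (y - l))) (at y)"
    using y by (auto intro!: derivative_eq_intros)
  moreover have "0 < (y - l) * (y - l)" using y by (simp add: mult_neg_neg)
  ultimately show "\<exists>d. ((\<lambda>v. (exp v - exp l) / (v - l)) has_real_derivative d) (at y) \<and> 0 < d"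
    by (intro exI[of _ "(exp y * (y - l) - (exp y - exp l)) / ((y - l) * (y - l))"]) auto
qed (use assms in \<open>auto intro!: continuous_intros\<close>)

text \<open>The slope of the chord to \<open>(lam, exp lam)\<close> increases strictly with its
  other end. The line bounding the region from above is the chord from
  \<open>lam + xi_minus C - xi_plus C\<close>, and the lower curve over \<open>x1\<close> gives the
  chord from \<open>x1\<close>; the slope of the given point lies between the two.\<close>

lemma D_v_props:
  assumes C: "C > 1" and x: "(x1, x2) \<in> D_Omega2 lam C"
  shows "D_v lam (x1, x2) < lam" "lam + xi_minus C - xi_plus C \<le> D_v lam (x1, x2)" "D_v lam (x1, x2) \<le> x1"
    "x2 - exp lam = (exp (D_v lam (x1, x2)) - exp lam) / (D_v lam (x1, x2) - lam) * (x1 - lam)"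
proof -
  let ?\<xi> = "xi_plus C" and ?z = "xi_minus C"
  note xi = xi_plus_props[OF C] xi_minus_props[OF C]
  have x1: "lam + ?z - ?\<xi> \<le> x1" "x1 < lam" "exp x1 \<le> x2" "x2 \<le> exp lam * (C * exp ?z * (x1 - lam) + 1)"
    using x by (auto simp: D_Omega2_def)
  let ?S = "\<lambda>v. (exp v - exp lam) / (v - lam)"
  define s where "s = (x2 - exp lam) / (x1 - lam)"
  let ?P = "\<lambda>v. v < lam \<and> ?S v = s"
  let ?v0 = "lam + ?z - ?\<xi>"
  have v0: "?S ?v0 = exp lam * (C * exp ?z)"
  proof -
    have "exp ?v0 = exp lam * ((1 - ?\<xi>) / (1 - ?z))"
      using exp_xi_diff[OF C] by (simp add: exp_add[symmetric] add_diff_eq[symmetric] del: exp_add) (simp add: exp_add)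
    then have "exp ?v0 - exp lam = exp lam / (1 - ?z) * (?z - ?\<xi>)" using xi by (simp add: field_simps)
    then have "?S ?v0 = exp lam / (1 - ?z)" using xi by simp
    then show ?thesis using C_exp_xi(2)[OF C] by simp
  qed
  have "?S ?v0 \<le> s"
  proof -
    have "x2 - exp lam \<le> exp lam * (C * exp ?z) * (x1 - lam)" using x1(4) by (simp add: algebra_simps)
    then show ?thesis unfolding v0 s_def using x1(2) by (simp add: le_divide_eq)
  qed
  moreover have "s \<le> ?S x1" unfolding s_def using x1 by (simp add: divide_right_mono_neg)
  ultimately have "\<exists>v\<ge>?v0. v \<le> x1 \<and> ?S v = s"
    by (intro IVT') (use x1 in \<open>auto intro!: continuous_intros\<close>)
  then obtain v where v: "?v0 \<le> v" "v \<le> x1" "?S v = s" by auto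
  have un: "y = v" if "?P y" for y
    using exp_slope_strict_mono[of y v lam] exp_slope_strict_mono[of v y lam] that v x1 by linarith
  have eq: "D_v lam (x1, x2) = v" unfolding D_v_def fst_conv snd_conv s_def[symmetric]
    by (rule the_equality) (use v x1 un in auto)
  show "D_v lam (x1, x2) < lam" "lam + xi_minus C - xi_plus C \<le> D_v lam (x1, x2)" "D_v lam (x1, x2) \<le> x1"
    unfolding eq using v x1 by auto
  show "x2 - exp lam = (exp (D_v lam (x1, x2)) - exp lam) / (D_v lam (x1, x2) - lam) * (x1 - lam)"
    unfolding eq v(3) s_def using x1 by simp
qed

lemma exp_gap_pos:
  fixes v l :: real
  assumes "v < l"
  shows "0 < exp l - exp v - exp v * (l - v)"
proof -
  have "1 + (l - v) < exp (l - v)"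
    by (rule exp_gt_add_one) (use assms in simp)
  then have "exp v * (1 + (l - v)) < exp v * exp (l - v)" by simp
  then show ?thesis by (simp add: algebra_simps flip: exp_add)
qed

lemma exp_gap_nonneg: "0 \<le> exp s - exp v - exp v * (s - v)" for s v :: real
proof -
  have "exp v * (1 + (s - v)) \<le> exp v * exp (s - v)"
    using exp_ge_add_one_self[of "s - v"] by (intro mult_left_mono) auto
  then show ?thesis by (simp add: algebra_simps flip: exp_add)
qed

text \<open>The gap between \<open>exp\<close> and its tangent at \<open>v\<close>, normalised to be
  1 at \<open>l\<close>, is nonnegative everywhere and grows to the right of \<open>l\<close>. It is
  affine in \<open>s\<close> and \<open>exp s\<close>, so its mean is determined by
  \<open>x1\<close> and \<open>x2\<close>.\<close>

lemma exp_gap_ratio: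
  fixes v l s :: real
  assumes "v < l"
  shows "indicator {l..} s \<le> (exp s - exp v - exp v * (s - v)) / (exp l - exp v - exp v * (l - v))"
proof (cases "l \<le> s")
  case True
  have "exp l + exp l * (s - l) \<le> exp s" using exp_gap_nonneg[of s l] by simp
  moreover have "exp v * (s - l) \<le> exp l * (s - l)" using assms True by (intro mult_right_mono) auto
  ultimately have "exp l - exp v - exp v * (l - v) \<le> exp s - exp v - exp v * (s - v)"
    by (simp add: algebra_simps)
  then show ?thesis using exp_gap_pos[OF assms] True by (simp add: le_divide_eq)
next
  case False
  then show ?thesis using exp_gap_pos[OF assms] exp_gap_nonneg[of s v] by simp
qed

section \<open>Bounds for the first absolute moment and the level sets\<close>

context Ainf_sample
begin

text \<open>In the outer regions this is the triangle inequality. In the middle region the affine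
  candidate, taken on the lower boundary, is \<open>\<bar>s\<bar>\<close> plus a nonnegative
  multiple of \<open>ell\<close> at \<open>w = 0\<close> for the tangent on the side of
  \<open>s\<close>. Both tangent inequalities at 0 apply because \<open>x1\<close> lies between the
  two tangency points.\<close>

lemma b1_lower:
  assumes x: "exp x1 \<le> x2" "x2 \<le> C * exp x1"
  shows "V * b1_cand C (x1, x2) \<le> (LINT t|M. \<bar>\<phi> t\<bar>)"
proof -
  let ?\<xi> = "xi_plus C" and ?z = "xi_minus C"
  have abs_int: "integrable M (\<lambda>t. \<bar>\<phi> t\<bar>)" using int1 by simp
  have ge: "V * x1 \<le> (LINT t|M. \<bar>\<phi> t\<bar>)" "- (V * x1) \<le> (LINT t|M. \<bar>\<phi> t\<bar>)"
    using integral_abs_bound[of M \<phi>] unfolding mean1 by linarith+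
  show ?thesis
  proof (cases "(x1, x2) \<in> b1_Omega_minus C \<or> (x1, x2) \<in> b1_Omega_plus C")
    case True
    then show ?thesis using C ge by (auto simp: b1_cand_def)
  next
    case False
    have zero: "(x1, x2) \<in> b1_Omega_zero C"
      using False x by (auto simp: b1_Omega_minus_def b1_Omega_plus_def b1_Omega_zero_def)
    have x1: "?z \<le> x1" "x1 \<le> ?\<xi>" using zero xi by (auto simp: b1_Omega_zero_def)
    define r where "r = ?\<xi> - ?z"
    have r: "r > 0" using xi by (simp add: r_def)
    define K1 where "K1 = (1 - ?z) * (1 - ?\<xi>) / r"
    define K2 where "K2 = (?\<xi> + ?z - 2) / r"
    have K1: "K1 \<ge> 0" using xi r by (simp add: K1_def)
    have cand: "b1_cand C (x1, x2) = 2 * K1 * (x2 - 1) + K2 * x1"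
      using C False zero by (simp add: b1_cand_def K1_def K2_def r_def)
    let ?p = "\<lambda>t. if 0 < \<phi> t then ell ?\<xi> 0 (\<phi> t) else 0"
    let ?n = "\<lambda>t. if \<phi> t < 0 then ell ?z 0 (\<phi> t) else 0"
    have plus: "2 * K1 * (exp s - 1) + K2 * s = s + 2 * K1 * ell ?\<xi> 0 s" for s
    proof -
      have "K1 / (1 - ?\<xi>) = (1 - ?z) / r" using xi by (simp add: K1_def)
      moreover have "K2 = 1 - 2 * ((1 - ?z) / r)" using r by (simp add: K2_def field_simps) (simp add: r_def)
      ultimately have "K2 = 1 - 2 * (K1 / (1 - ?\<xi>))" by simp
      then have "K2 * s = (1 - 2 * (K1 / (1 - ?\<xi>))) * s" by simp
      then show ?thesis by (simp add: ell_def algebra_simps)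
    qed
    have minus: "2 * K1 * (exp s - 1) + K2 * s = - s + 2 * K1 * ell ?z 0 s" for s
    proof -
      have "K1 / (1 - ?z) = (1 - ?\<xi>) / r" using xi by (simp add: K1_def)
      moreover have "K2 = - 1 - 2 * ((1 - ?\<xi>) / r) + 2 * 0" using r by (simp add: K2_def field_simps) (simp add: r_def)
      ultimately have "K2 = - 1 - 2 * (K1 / (1 - ?z))" by simp
      then have "K2 * s = (- 1 - 2 * (K1 / (1 - ?z))) * s" by simp
      then show ?thesis by (simp add: ell_def algebra_simps)
    qed
    have pw: "- 2 * K1 + K2 * \<phi> t + 2 * K1 * exp (\<phi> t) = \<bar>\<phi> t\<bar> + 2 * K1 * ?p t + 2 * K1 * ?n t" for t
      using plus[of "\<phi> t"] minus[of "\<phi> t"]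
      by (cases "\<phi> t" "0::real" rule: linorder_cases) (auto simp: algebra_simps)
    have pi: "integrable M ?p" "integrable M ?n" using xi by (auto intro!: ell_if_integrable)
    have "V * b1_cand C (x1, x2) = (LINT t|M. - 2 * K1 + K2 * \<phi> t + 2 * K1 * exp (\<phi> t))"
      unfolding affine_integral(2) cand by (simp add: algebra_simps)
    also have "\<dots> = (LINT t|M. \<bar>\<phi> t\<bar>) + 2 * K1 * (LINT t|M. ?p t) + 2 * K1 * (LINT t|M. ?n t)"
      unfolding pw using pi abs_int by simp
    also have "\<dots> \<le> (LINT t|M. \<bar>\<phi> t\<bar>)"
      using above[of 0] below[of 0] x1 K1 by (simp add: mult_nonneg_nonpos add_nonpos_nonpos)
    finally show ?thesis .
  qed
qed

lemma indicator_level_integral: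
  "integrable M (\<lambda>t. indicator {lam..} (\<phi> t) :: real)"
  "(LINT t|M. indicat_real {lam..} (\<phi> t)) = measure M {t \<in> space M. lam \<le> \<phi> t}"
proof -
  have eq: "(indicator {lam..} (\<phi> t) :: real) = indicator {t \<in> space M. lam \<le> \<phi> t} t" if "t \<in> space M" for t
    using that by (auto simp: indicator_def)
  have i: "integrable M (indicator {t \<in> space M. lam \<le> \<phi> t} :: 'a \<Rightarrow> real)"
    by (rule integrable_real_indicator) (auto simp: less_top[symmetric])
  show "integrable M (\<lambda>t. indicator {lam..} (\<phi> t) :: real)"
    using i Bochner_Integration.integrable_cong[of M M "\<lambda>t. indicator {lam..} (\<phi> t) :: real" "indicator {t \<in> space M. lam \<le> \<phi> t}"] eq by simp
  have "(LINT t|M. indicat_real {lam..} (\<phi> t)) = (LINT t|M. indicat_real {t \<in> space M. lam \<le> \<phi> t} t)"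
    by (rule Bochner_Integration.integral_cong) (use eq in auto)
  then show "(LINT t|M. indicat_real {lam..} (\<phi> t)) = measure M {t \<in> space M. lam \<le> \<phi> t}" by simp
qed

lemma D_upper_affine:
  assumes "\<And>s. indicator {lam..} s \<le> \<alpha> + \<beta> * s + \<gamma> * exp s"
  shows "measure M {t \<in> space M. lam \<le> \<phi> t} \<le> V * (\<alpha> + \<beta> * x1 + \<gamma> * x2)"
  unfolding indicator_level_integral(2)[symmetric] affine_integral(2)[symmetric]
  by (rule Bochner_Integration.integral_mono) (use assms in \<open>auto intro: indicator_level_integral affine_integral\<close>)

text \<open>Each region has its own majorant of the indicator: a constant, the plane of the
  candidate corrected by the two tangent inequalities at \<open>lam\<close>, a gap function touching
  zero at \<open>v\<close>, and a family of planes with zero boundary values.\<close>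

lemma D_upper:
  assumes x: "exp x1 \<le> x2" "x2 \<le> C * exp x1"
  shows "measure M {t \<in> space M. lam \<le> \<phi> t} \<le> V * D_cand lam C (x1, x2)"
proof -
  let ?\<xi> = "xi_plus C" and ?z = "xi_minus C"
  define r where "r = ?\<xi> - ?z"
  have r: "r > 0" using xi by (simp add: r_def)
  have er: "exp (- r) = (1 - ?\<xi>) / (1 - ?z)" using exp_xi_diff[OF C] by (simp add: r_def)
  let ?x = "(x1, x2)"
  have cover: "?x \<in> D_Omega4 lam C \<or> ?x \<in> D_Omega3 lam C \<or> ?x \<in> D_Omega2 lam C \<or> ?x \<in> D_Omega1 lam C"
    using x xi unfolding D_Omega1_def D_Omega2_def D_Omega3_def D_Omega4_def by auto
  consider (4) "?x \<in> D_Omega4 lam C" | (3) "?x \<notin> D_Omega4 lam C" "?x \<in> D_Omega3 lam C"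
    | (2) "?x \<notin> D_Omega4 lam C" "?x \<notin> D_Omega3 lam C" "?x \<in> D_Omega2 lam C"
    | (1) "?x \<notin> D_Omega4 lam C" "?x \<notin> D_Omega3 lam C" "?x \<notin> D_Omega2 lam C" "?x \<in> D_Omega1 lam C"
    using cover by blast
  then show ?thesis
  proof cases
    case 4
    then have "D_cand lam C ?x = 1" using C by (simp add: D_cand_def)
    moreover have "measure M {t \<in> space M. lam \<le> \<phi> t} \<le> measure M (space M)" by (rule finite_measure_mono) auto
    ultimately show ?thesis using V by simp
  next
    case 3
    have x1: "lam + ?z \<le> x1" "x1 \<le> lam + ?\<xi>" using 3 xi by (auto simp: D_Omega3_def)
    define K where "K = (1 - ?z) / r\<^sup>2"
    define \<kappa> where "\<kappa> = K * (1 - ?\<xi>)"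
    \<comment> \<open>Chosen so that for \<open>s < lam\<close> the corrected plane is
      \<open>\<beta>\<close> times the gap between \<open>exp (s - lam)\<close> and its tangent at
      \<open>- r\<close>. This touches zero at \<open>s = lam - r\<close>, the low value of the
      extremal function.\<close>
    define \<beta> where "\<beta> = (1 - ?z) / (r * ?\<xi>)"
    have pos: "0 \<le> \<kappa>" "0 \<le> \<beta>" using xi r by (auto simp: \<kappa>_def K_def \<beta>_def)
    have cand: "D_cand lam C ?x = K * (x1 - lam + (1 - x2 * exp (- lam)) * (1 - ?\<xi>)) + 1"
      using 3 C by (simp add: D_cand_def K_def r_def)
    let ?p = "\<lambda>s. if lam < s then ell ?\<xi> lam s else 0"
    let ?n = "\<lambda>s. if s < lam then ell ?z lam s else 0"
    let ?L = "\<lambda>s. (K * (1 - ?\<xi>) - K * lam + 1) + K * s + (- \<kappa> * exp (- lam)) * exp s"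
    have el: "exp (- lam) * ell \<xi> lam s = exp (s - lam) - (s - lam) / (1 - \<xi>) - 1" for \<xi> s
      unfolding ell_eq by (simp add: mult.assoc[symmetric] flip: exp_add)
    have Le: "?L s = K * (s - lam) + \<kappa> * (1 - exp (s - lam)) + 1" for s
      by (simp add: \<kappa>_def exp_diff exp_minus divide_inverse algebra_simps)
    have pw: "indicator {lam..} s \<le> ?L s + \<kappa> * exp (- lam) * ?p s + (\<kappa> + \<beta>) * exp (- lam) * ?n s" for s
    proof (cases s lam rule: linorder_cases)
      case greater
      have "\<kappa> * exp (- lam) * ell ?\<xi> lam s = \<kappa> * (exp (s - lam) - 1) - \<kappa> / (1 - ?\<xi>) * (s - lam)"
        unfolding mult.assoc el by (simp add: algebra_simps)
      moreover have "\<kappa> / (1 - ?\<xi>) = K" using xi by (simp add: \<kappa>_def)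
      ultimately have "?L s + \<kappa> * exp (- lam) * ell ?\<xi> lam s = 1" unfolding Le by (simp add: algebra_simps)
      then show ?thesis using greater by simp
    next
      case equal
      then show ?thesis unfolding Le by simp
    next
      case less
      have "0 \<le> exp (s - lam) - exp (- r) - exp (- r) * ((s - lam) - (- r))" by (rule exp_gap_nonneg)
      then have "0 \<le> \<beta> * (exp (s - lam) - exp (- r) * (1 + r + (s - lam)))"
        using pos by (intro mult_nonneg_nonneg) (auto simp: algebra_simps)
      also have "\<beta> * (exp (s - lam) - exp (- r) * (1 + r + (s - lam))) = ?L s + (\<kappa> + \<beta>) * exp (- lam) * ell ?z lam s"
      proof -
        have b1: "\<beta> * exp (- r) = (\<kappa> + \<beta>) / (1 - ?z) - K"
        proof -
          have "\<beta> * exp (- r) = (1 - ?\<xi>) / (r * ?\<xi>)" using xi by (simp add: \<beta>_def er)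
          moreover have "\<kappa> / (1 - ?z) = (1 - ?\<xi>) / r\<^sup>2" using xi by (simp add: \<kappa>_def K_def)
          moreover have "\<beta> / (1 - ?z) = 1 / (r * ?\<xi>)" using xi by (simp add: \<beta>_def)
          moreover have "K = (1 - ?\<xi>) / r\<^sup>2 + 1 / r"
            using r by (simp add: K_def field_simps power2_eq_square) (simp add: r_def algebra_simps)
          moreover have "(1 - ?\<xi>) / (r * ?\<xi>) = 1 / (r * ?\<xi>) - 1 / r" using xi r by (simp add: field_simps)
          ultimately show ?thesis by (simp add: add_divide_distrib)
        qed
        have b2: "\<beta> * exp (- r) * (1 + r) = \<beta> - 1"
        proof -
          have "\<beta> * exp (- r) * (1 + r) = (1 - ?\<xi>) * (1 + r) / (r * ?\<xi>)" using xi by (simp add: \<beta>_def er)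
          also have "(1 - ?\<xi>) * (1 + r) = (1 - ?z) - r * ?\<xi>" by (simp add: r_def algebra_simps)
          also have "((1 - ?z) - r * ?\<xi>) / (r * ?\<xi>) = \<beta> - 1" using xi r by (simp add: \<beta>_def diff_divide_distrib)
          finally show ?thesis .
        qed
        have "\<beta> * (exp (s - lam) - exp (- r) * (1 + r + (s - lam))) =
            \<beta> * exp (s - lam) - \<beta> * exp (- r) * (1 + r) - \<beta> * exp (- r) * (s - lam)" by (simp add: algebra_simps)
        also have "\<dots> = \<beta> * exp (s - lam) - (\<beta> - 1) - ((\<kappa> + \<beta>) / (1 - ?z) - K) * (s - lam)" unfolding b2 unfolding b1 by simp
        also have "\<dots> = ?L s + (\<kappa> + \<beta>) * exp (- lam) * ell ?z lam s"
          unfolding Le unfolding mult.assoc el by (simp add: algebra_simps)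
        finally show ?thesis .
      qed
      finally show ?thesis using less by simp
    qed
    have pi: "integrable M (\<lambda>t. ?p (\<phi> t))" "integrable M (\<lambda>t. ?n (\<phi> t))" using xi by (auto intro!: ell_if_integrable)
    have "measure M {t \<in> space M. lam \<le> \<phi> t} \<le> (LINT t|M. ?L (\<phi> t) + \<kappa> * exp (- lam) * ?p (\<phi> t) + (\<kappa> + \<beta>) * exp (- lam) * ?n (\<phi> t))"
      unfolding indicator_level_integral(2)[symmetric]
    proof (rule Bochner_Integration.integral_mono)
      show "integrable M (\<lambda>t. ?L (\<phi> t) + \<kappa> * exp (- lam) * ?p (\<phi> t) + (\<kappa> + \<beta>) * exp (- lam) * ?n (\<phi> t))"
        by (intro Bochner_Integration.integrable_add affine_integral integrable_mult_right pi)
    qed (use pw indicator_level_integral in auto)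
    also have "\<dots> = (LINT t|M. ?L (\<phi> t)) + \<kappa> * exp (- lam) * (LINT t|M. ?p (\<phi> t)) + (\<kappa> + \<beta>) * exp (- lam) * (LINT t|M. ?n (\<phi> t))"
      by (subst Bochner_Integration.integral_add, intro Bochner_Integration.integrable_add affine_integral integrable_mult_right pi,
          intro integrable_mult_right pi, subst Bochner_Integration.integral_add,
          intro affine_integral, intro integrable_mult_right pi, simp)
    also have "\<dots> \<le> (LINT t|M. ?L (\<phi> t))"
      using above[of lam] below[of lam] x1 pos by (simp add: mult_nonneg_nonpos add_nonpos_nonpos)
    also have "\<dots> = V * D_cand lam C ?x"
      unfolding affine_integral(2) cand by (simp add: \<kappa>_def algebra_simps)
    finally show ?thesis .
  next
    case 2
    define v where "v = D_v lam ?x"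
    note v = D_v_props[OF C 2(3), folded v_def]
    define G where "G = exp lam - exp v - exp v * (lam - v)"
    have G: "G > 0" using exp_gap_pos[OF v(1)] by (simp add: G_def)
    have cand: "D_cand lam C ?x = (x1 - v) / (lam - v)"
      using 2 C by (simp add: D_cand_def v_def)
    \<comment> \<open>The majorant is 0 at \<open>v\<close> and 1 at \<open>lam\<close>; being
      affine, it equals the fraction \<open>(x1 - v) / (lam - v)\<close> at a point of the chord
      between these boundary points.\<close>
    have "measure M {t \<in> space M. lam \<le> \<phi> t} \<le> V * ((- exp v + exp v * v) / G + (- exp v / G) * x1 + (1 / G) * x2)"
    proof (rule D_upper_affine)
      fix s
      have "(exp s - exp v - exp v * (s - v)) / G = (- exp v + exp v * v) / G + (- exp v / G) * s + (1 / G) * exp s"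
        by (simp add: diff_divide_distrib add_divide_distrib algebra_simps)
      then show "indicator {lam..} s \<le> (- exp v + exp v * v) / G + (- exp v / G) * s + (1 / G) * exp s"
        using exp_gap_ratio[OF v(1), of s] by (simp add: G_def)
    qed
    also have "(- exp v + exp v * v) / G + (- exp v / G) * x1 + (1 / G) * x2 = D_cand lam C ?x"
    proof -
      have "(lam - v) * (x2 - exp lam) = (exp lam - exp v) * (x1 - lam)"
        using v(4) v(1) by (simp add: field_simps)
      then have "(lam - v) * (x2 - exp v - exp v * (x1 - v)) = G * (x1 - v)" unfolding G_def by algebra
      then have "(x2 - exp v - exp v * (x1 - v)) / G = (x1 - v) / (lam - v)"
        using G v(1) by (simp add: field_simps)
      then show ?thesis unfolding cand by (simp add: diff_divide_distrib add_divide_distrib algebra_simps)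
    qed
    finally show ?thesis .
  next
    case 1
    define u where "u = u_plus C ?x"
    note u = u_plus_props[OF C x, folded u_def]
    define T where "T = lam - r"
    have uT: "u \<le> T" using D_Omega1_u_plus_le[OF C x 1(4)] by (simp add: u_def T_def r_def)
    \<comment> \<open>With zero boundary values the differential equations make
      \<open>m w * exp w\<close> a multiple of \<open>exp (w / ?\<xi>)\<close>. The constant is
      fixed in \<open>mT\<close>: the plane at \<open>T\<close> has the value 1 at
      \<open>(lam, exp lam)\<close>.\<close>
    define m where "m w = (1 - ?\<xi>) / (r * ?\<xi>) * exp ((r + w - lam) / ?\<xi>) * exp (- w)" for w
    have m0: "0 \<le> m w" for w using xi r by (simp add: m_def)
    have ew: "exp (- w) * exp w = 1" for w :: real by (simp flip: exp_add)
    have mder: "(m has_real_derivative m w * (1 / ?\<xi> - 1)) (at w)" for w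
    proof -
      define k0 i where "k0 = (1 - ?\<xi>) / (r * ?\<xi>)" and "i = 1 / ?\<xi>"
      have "((\<lambda>w. k0 * exp ((r + w - lam) * i) * exp (- w)) has_real_derivative
          k0 * exp ((r + w - lam) * i) * exp (- w) * (i - 1)) (at w)"
        by (auto intro!: derivative_eq_intros simp: algebra_simps)
      then show ?thesis unfolding m_def[abs_def] k0_def i_def by simp
    qed
    have mcont: "continuous_on S m" for S
      using mder by (meson DERIV_isCont continuous_at_imp_continuous_on)
    have tf: "tangent_family ?\<xi> u T (\<lambda>w. 0) (\<lambda>w. - (m w * exp w)) m (\<lambda>w. m w * (1 / ?\<xi> - 1))"
      unfolding tangent_family_def
    proof (intro conjI exI[of _ "{}"] ballI)
      fix w
      have "((\<lambda>w. - (m w * exp w)) has_real_derivative - (m w * (1 / ?\<xi> - 1) * exp w + exp w * m w)) (at w)"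
        by (auto intro!: derivative_eq_intros mder)
      moreover have "- (m w * (1 / ?\<xi> - 1) * exp w + exp w * m w) = - (m w * (1 / ?\<xi> - 1) * exp w / (1 - ?\<xi>))"
      proof -
        have "(1 / ?\<xi> - 1) / (1 - ?\<xi>) = 1 / ?\<xi>" using xi by (simp add: divide_simps)
        then have "m w * (1 / ?\<xi> - 1) * exp w / (1 - ?\<xi>) = m w * exp w * (1 / ?\<xi>)"
          by (metis (no_types, lifting) mult.assoc mult.commute times_divide_eq_right)
        then show ?thesis by (simp add: algebra_simps)
      qed
      ultimately show "((\<lambda>w. - (m w * exp w)) has_real_derivative - (m w * (1 / ?\<xi> - 1) * exp w / (1 - ?\<xi>))) (at w)"
        by simp
    qed (use xi mder mcont in \<open>auto intro!: continuous_intros borel_measurable_continuous_onI\<close>)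
    have d: "0 \<le> m w * (1 / ?\<xi> - 1)" for w
      using m0[of w] xi by (intro mult_nonneg_nonneg) auto
    let ?F = "\<lambda>t. fam (\<lambda>w. 0) (\<lambda>w. - (m w * exp w)) m (min (max (\<phi> t) u) T) (\<phi> t) (exp (\<phi> t))"
    note F = fam_above[OF tf uT d u(1)]
    have famG: "fam (\<lambda>w. 0) (\<lambda>w. - (m w * exp w)) m w s (exp s) = m w * (exp s - exp w - exp w * (s - w))" for w s
      by (simp add: fam_def algebra_simps)
    have mT: "m T * (exp lam - exp T - exp T * (lam - T)) = 1"
    proof -
      have "m T * exp T = (1 - ?\<xi>) / (r * ?\<xi>) * (exp (- T) * exp T)" by (simp add: m_def T_def)
      then have mT1: "m T * exp T = (1 - ?\<xi>) / (r * ?\<xi>)" unfolding ew by simp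
      have "exp lam = exp T * exp r" by (simp add: T_def flip: exp_add)
      moreover have "exp r = (1 - ?z) / (1 - ?\<xi>)" using er xi by (simp add: exp_minus field_simps)
      ultimately have "m T * (exp lam - exp T - exp T * (lam - T)) = (m T * exp T) * ((1 - ?z) / (1 - ?\<xi>) - 1 - r)"
        by (simp add: T_def algebra_simps)
      also have "(1 - ?z) / (1 - ?\<xi>) - 1 - r = r * ?\<xi> / (1 - ?\<xi>)" using xi by (simp add: r_def field_simps)
      finally show ?thesis unfolding mT1 using xi r by simp
    qed
    have pw: "indicator {lam..} s \<le> fam (\<lambda>w. 0) (\<lambda>w. - (m w * exp w)) m (min (max s u) T) s (exp s)" for s
    proof (cases "s \<le> T")
      case True
      then have "s < lam" using r by (simp add: T_def)
      then show ?thesis unfolding famG using m0 exp_gap_nonneg by simp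
    next
      case False
      \<comment> \<open>Beyond \<open>T\<close> the clamped plane is the normalised gap function
        with contact at \<open>T\<close>.\<close>
      then have "min (max s u) T = T" by simp
      moreover have "T < lam" using r by (simp add: T_def)
      then have "indicator {lam..} s \<le> (exp s - exp T - exp T * (s - T)) / (exp lam - exp T - exp T * (lam - T))"
        by (rule exp_gap_ratio)
      moreover have "m T = 1 / (exp lam - exp T - exp T * (lam - T))"
        using mT by (metis nonzero_eq_divide_eq mult_eq_0_iff zero_neq_one)
      ultimately show ?thesis unfolding famG by simp
    qed
    have "measure M {t \<in> space M. lam \<le> \<phi> t} \<le> (LINT t|M. ?F t)"
      unfolding indicator_level_integral(2)[symmetric]
      by (rule Bochner_Integration.integral_mono) (use pw F indicator_level_integral in auto)
    also have "\<dots> \<le> V * fam (\<lambda>w. 0) (\<lambda>w. - (m w * exp w)) m u x1 x2" by (rule F)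
    also have "fam (\<lambda>w. 0) (\<lambda>w. - (m w * exp w)) m u x1 x2 = D_cand lam C ?x"
    proof -
      have k: "m u * exp u = (1 - ?\<xi>) / (r * ?\<xi>) * exp ((r + u - lam) / ?\<xi>)"
        using ew[of u] by (simp add: m_def)
      have "1 / (1 - ?\<xi>) - 1 = ?\<xi> / (1 - ?\<xi>)" using xi by (simp add: field_simps)
      then have "- (m u * exp u) + m u * exp u / (1 - ?\<xi>) = (m u * exp u) * (?\<xi> / (1 - ?\<xi>))"
        by (metis (no_types, opaque_lifting) diff_conv_add_uminus add.commute mult.right_neutral right_diff_distrib' times_divide_eq_right)
      also have "\<dots> = 1 / r * exp ((r + u - lam) / ?\<xi>)" unfolding k using xi by simp
      finally show ?thesis unfolding fam_on_tline[OF u(3)] using 1 C by (simp add: D_cand_def u_def r_def)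
    qed
    finally show ?thesis .
  qed
qed

end

section \<open>Powers with exponent between one and two\<close>

lemma powr_le_tangent:
  fixes a s \<theta> :: real
  assumes "0 < a" "0 < s" "0 \<le> \<theta>" "\<theta> \<le> 1"
  shows "s powr \<theta> \<le> a powr \<theta> + \<theta> * a powr (\<theta> - 1) * (s - a)"
proof -
  have "(s / a) powr \<theta> * 1 powr (1 - \<theta>) \<le> \<theta> * (s / a) + (1 - \<theta>) * 1"
    by (rule Youngs_inequality_0) (use assms in auto)
  then have "a powr \<theta> * (s / a) powr \<theta> \<le> a powr \<theta> * (\<theta> * (s / a) + (1 - \<theta>))"
    by (intro mult_left_mono) auto
  moreover have "a powr \<theta> * (s / a) powr \<theta> = s powr \<theta>" using assms by (simp add: powr_divide)
  moreover have "a powr \<theta> * (\<theta> * (s / a) + (1 - \<theta>)) = a powr \<theta> + \<theta> * a powr (\<theta> - 1) * (s - a)"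
    using assms by (simp add: powr_diff field_simps)
  ultimately show ?thesis by simp
qed

lemma powr_ge_tangent:
  fixes a s p :: real
  assumes "0 < a" "a \<le> s" "1 \<le> p"
  shows "a powr p + p * a powr (p - 1) * (s - a) \<le> s powr p"
proof -
  have "a powr p - p * a powr (p - 1) * a \<le> s powr p - p * a powr (p - 1) * s"
  proof (rule DERIV_nonneg_imp_nondecreasing[OF assms(2)])
    fix y assume y: "a \<le> y" "y \<le> s"
    have "((\<lambda>y. y powr p - p * a powr (p - 1) * y) has_real_derivative p * y powr (p - 1) - p * a powr (p - 1)) (at y)"
      using assms y by (auto intro!: derivative_eq_intros)
    moreover have "a powr (p - 1) \<le> y powr (p - 1)" using assms y by (intro powr_mono2) auto
    ultimately show "\<exists>d. ((\<lambda>y. y powr p - p * a powr (p - 1) * y) has_real_derivative d) (at y) \<and> 0 \<le> d"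
      using assms by (intro exI[of _ "p * y powr (p - 1) - p * a powr (p - 1)"]) (auto simp: mult_left_mono)
  qed
  then show ?thesis by (simp add: algebra_simps)
qed

lemma exp_tail_integral:
  fixes \<xi> w A B :: real
  assumes pos: "0 < \<xi>"
  shows "has_bochner_integral lborel (\<lambda>s. (A + B * (s - w)) * exp (- s / \<xi>) * indicator {w..} s)
    ((A * \<xi> + B * \<xi>\<^sup>2) * exp (- w / \<xi>))"
proof -
  have scale: "filterlim (\<lambda>s. s / \<xi>) at_top at_top"
    using filterlim_tendsto_pos_mult_at_top[OF tendsto_const _ filterlim_ident, of "1/\<xi>"] pos
    by simp
  then have lim0: "((\<lambda>s. exp (- s / \<xi>)) \<longlongrightarrow> 0) at_top"
    by (intro filterlim_compose[OF exp_at_bot]) (simp add: filterlim_uminus_at_bot)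
  have "((\<lambda>y. y ^ 1 / exp y) \<longlongrightarrow> (0::real)) at_top" by (rule tendsto_power_div_exp_0)
  then have "((\<lambda>s. (s / \<xi>) ^ 1 / exp (s / \<xi>)) \<longlongrightarrow> 0) at_top"
    using scale by (rule filterlim_compose)
  from tendsto_mult_left[OF this, of \<xi>]
  have lim1: "((\<lambda>s. s * exp (- s / \<xi>)) \<longlongrightarrow> 0) at_top"
    using pos by (simp add: exp_minus field_simps)
  have I1: "has_bochner_integral lborel (\<lambda>s. exp (- s / \<xi>) * indicator {w..} s)
      (0 - (- \<xi> * exp (- w / \<xi>)))"
    by (rule has_bochner_integral_FTC_atLeast[where F = "\<lambda>s. - \<xi> * exp (- s / \<xi>)"])
       (use pos tendsto_mult_left[OF lim0, of "- \<xi>"] in \<open>auto intro!: derivative_eq_intros\<close>)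
  have I2: "has_bochner_integral lborel (\<lambda>s. (s - w) * exp (- s / \<xi>) * indicator {w..} s)
      (0 - (- \<xi> * (w - w + \<xi>) * exp (- w / \<xi>)))"
  proof (rule has_bochner_integral_FTC_atLeast[where F = "\<lambda>s. - \<xi> * (s - w + \<xi>) * exp (- s / \<xi>)"])
    fix s :: real
    show "((\<lambda>s. - \<xi> * (s - w + \<xi>) * exp (- s / \<xi>)) has_real_derivative
        (s - w) * exp (- s / \<xi>)) (at s)"
      using pos by (auto intro!: derivative_eq_intros simp: field_simps)
    have "((\<lambda>s. - \<xi> * (s * exp (- s / \<xi>)) + \<xi> * (w - \<xi>) * exp (- s / \<xi>)) \<longlongrightarrow>
        - \<xi> * 0 + \<xi> * (w - \<xi>) * 0) at_top"
      by (intro tendsto_intros lim0 lim1)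
    then show "((\<lambda>s. - \<xi> * (s - w + \<xi>) * exp (- s / \<xi>)) \<longlongrightarrow> 0) at_top"
      by (simp add: algebra_simps)
  qed auto
  from has_bochner_integral_add[OF has_bochner_integral_mult_right[OF I1, of A] has_bochner_integral_mult_right[OF I2, of B]]
  show ?thesis by (simp add: algebra_simps power2_eq_square)
qed

text \<open>For \<open>p > 1\<close>, \<open>p * pder p\<close> is the derivative of
  \<open>\<bar>s\<bar> powr p\<close>, also at 0. It is the factor weighted by an exponential in
  \<open>b_cand\<close>.\<close>

definition pder :: "real \<Rightarrow> real \<Rightarrow> real" where
  "pder p s = \<bar>s\<bar> powr (p - 1) * sgn s"

lemma pder_alt:
  assumes "1 < p"
  shows "pder p s = max s 0 powr (p - 1) - max (- s) 0 powr (p - 1)"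
  using assms by (cases s "0::real" rule: linorder_cases) (auto simp: pder_def)

lemma pder_cont:
  assumes "1 < p"
  shows "continuous_on S (pder p)"
proof -
  have "continuous_on S (\<lambda>s. max s 0 powr (p - 1) - max (- s) 0 powr (p - 1))"
    using assms by (intro continuous_intros continuous_on_powr') auto
  then show ?thesis using pder_alt[OF assms] by (simp cong: continuous_on_cong)
qed

lemma pder_bound:
  assumes "1 < p" "p \<le> 2"
  shows "\<bar>pder p s\<bar> \<le> 1 + \<bar>s\<bar>"
proof -
  have "\<bar>s\<bar> powr (p - 1) \<le> 1 + \<bar>s\<bar>"
  proof (cases "\<bar>s\<bar> \<le> 1")
    case True
    then have "\<bar>s\<bar> powr (p - 1) \<le> 1" using assms by (intro powr_le1) auto
    then show ?thesis by simp
  next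
    case False
    then have "\<bar>s\<bar> powr (p - 1) \<le> \<bar>s\<bar> powr 1" using assms by (intro powr_mono) auto
    then show ?thesis by simp
  qed
  then show ?thesis by (cases "s = 0") (auto simp: pder_def abs_mult sgn_if)
qed

lemma pder_deriv:
  assumes "w \<noteq> 0"
  shows "((\<lambda>w. \<bar>w\<bar> powr p) has_real_derivative p * pder p w) (at w)"
    "(pder p has_real_derivative (p - 1) * \<bar>w\<bar> powr (p - 2)) (at w)"
proof -
  consider "w > 0" | "w < 0" using assms by linarith
  then show "((\<lambda>w. \<bar>w\<bar> powr p) has_real_derivative p * pder p w) (at w)"
  proof cases
    case 1
    have "((\<lambda>w. w powr p) has_real_derivative p * pder p w) (at w)"
      using 1 by (auto intro!: derivative_eq_intros simp: pder_def)
    moreover have ev: "\<forall>\<^sub>F y in nhds w. \<bar>y\<bar> powr p = y powr p"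
      using eventually_nhds_in_open[of "{0<..}" w] 1 by (auto elim!: eventually_mono)
    ultimately show ?thesis by (subst DERIV_cong_ev[OF refl ev refl])
  next
    case 2
    have "((\<lambda>w. (- w) powr p) has_real_derivative p * pder p w) (at w)"
      using 2 by (auto intro!: derivative_eq_intros simp: pder_def)
    moreover have ev: "\<forall>\<^sub>F y in nhds w. \<bar>y\<bar> powr p = (- y) powr p"
      using eventually_nhds_in_open[of "{..<0}" w] 2 by (auto elim!: eventually_mono)
    ultimately show ?thesis by (subst DERIV_cong_ev[OF refl ev refl])
  qed
  consider "w > 0" | "w < 0" using assms by linarith
  then show "(pder p has_real_derivative (p - 1) * \<bar>w\<bar> powr (p - 2)) (at w)"
  proof cases
    case 1
    have "((\<lambda>w. w powr (p - 1)) has_real_derivative (p - 1) * \<bar>w\<bar> powr (p - 2)) (at w)"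
      using 1 by (auto intro!: derivative_eq_intros)
    moreover have ev: "\<forall>\<^sub>F y in nhds w. pder p y = y powr (p - 1)"
      using eventually_nhds_in_open[of "{0<..}" w] 1 by (auto elim!: eventually_mono simp: pder_def)
    ultimately show ?thesis by (subst DERIV_cong_ev[OF refl ev refl])
  next
    case 2
    have "((\<lambda>w. - ((- w) powr (p - 1))) has_real_derivative (p - 1) * \<bar>w\<bar> powr (p - 2)) (at w)"
      using 2 by (auto intro!: derivative_eq_intros)
    moreover have ev: "\<forall>\<^sub>F y in nhds w. pder p y = - ((- y) powr (p - 1))"
      using eventually_nhds_in_open[of "{..<0}" w] 2 by (auto elim!: eventually_mono simp: pder_def)
    ultimately show ?thesis by (subst DERIV_cong_ev[OF refl ev refl])
  qed
qed

context
  fixes p \<xi> :: real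
  assumes p: "1 < p" "p \<le> 2" and xi: "0 < \<xi>" "\<xi> < 1"
begin

definition ptail :: "real \<Rightarrow> real" where
  "ptail w = (LINT s:{w..}|lebesgue. \<bar>s\<bar> powr (p - 1) * sgn s * exp (- s / \<xi>))"

lemma ptail_meas [measurable]: "pder p \<in> borel_measurable borel"
  using borel_measurable_continuous_onI[OF pder_cont[OF p(1), of UNIV]] .

lemma ptail_integrable: "integrable lborel (\<lambda>s. pder p s * exp (- s / \<xi>) * indicator {w..} s)"
proof -
  have "integrable lborel (\<lambda>s. ((1 + \<bar>w\<bar>) + 1 * (s - w)) * exp (- s / \<xi>) * indicator {w..} s)"
    using exp_tail_integral[OF xi(1), of "1 + \<bar>w\<bar>" 1 w] by (simp add: has_bochner_integral_iff)
  then show ?thesis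
  proof (rule Bochner_Integration.integrable_bound)
    show "AE s in lborel. norm (pder p s * exp (- s / \<xi>) * indicator {w..} s)
        \<le> norm (((1 + \<bar>w\<bar>) + 1 * (s - w)) * exp (- s / \<xi>) * indicator {w..} s)"
    proof (intro AE_I2)
      fix s
      show "norm (pder p s * exp (- s / \<xi>) * indicator {w..} s)
        \<le> norm (((1 + \<bar>w\<bar>) + 1 * (s - w)) * exp (- s / \<xi>) * indicator {w..} s)"
      proof (cases "w \<le> s")
        case True
        then have "\<bar>s\<bar> \<le> \<bar>w\<bar> + (s - w)" by linarith
        then have "\<bar>pder p s\<bar> \<le> \<bar>(1 + \<bar>w\<bar>) + 1 * (s - w)\<bar>" using pder_bound[OF p, of s] by simp
        then show ?thesis using True by (simp add: abs_mult mult_right_mono)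
      qed simp
    qed
  qed measurable
qed

lemma ptail_eq: "ptail w = (LINT s|lborel. pder p s * exp (- s / \<xi>) * indicator {w..} s)"
proof -
  have "ptail w = (LINT s|lebesgue. pder p s * exp (- s / \<xi>) * indicator {w..} s)"
    unfolding ptail_def set_lebesgue_integral_def pder_def by (simp add: mult_ac)
  also have "\<dots> = (LINT s|lborel. pder p s * exp (- s / \<xi>) * indicator {w..} s)"
    by (rule integral_completion) measurable
  finally show ?thesis .
qed

lemma ptail_split:
  assumes "w0 \<le> w"
  shows "ptail w = ptail w0 - integral {w0..w} (\<lambda>s. pder p s * exp (- s / \<xi>))"
proof -
  let ?g = "\<lambda>s. pder p s * exp (- s / \<xi>)"
  have cont: "continuous_on {w0..w} ?g" using xi by (intro continuous_intros pder_cont[OF p(1)]) auto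
  have si: "set_integrable lborel {w0..w} ?g" using borel_integrable_atLeastAtMost'[OF cont] .
  have "(LINT s|lborel. ?g s * indicator {w0..} s) = (LINT s|lborel. indicator {w0..w} s *\<^sub>R ?g s + ?g s * indicator {w..} s)"
  proof (rule integral_cong_AE)
    show "AE s in lborel. ?g s * indicator {w0..} s = indicator {w0..w} s *\<^sub>R ?g s + ?g s * indicator {w..} s"
      using AE_lborel_singleton[of w] by eventually_elim (use assms in \<open>auto simp: indicator_def\<close>)
  qed measurable
  also have "\<dots> = (LINT s:{w0..w}|lborel. ?g s) + ptail w"
    unfolding ptail_eq set_lebesgue_integral_def
    by (rule Bochner_Integration.integral_add) (use si ptail_integrable in \<open>auto simp: set_integrable_def\<close>)
  also have "(LINT s:{w0..w}|lborel. ?g s) = integral {w0..w} ?g"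
    by (rule set_borel_integral_eq_integral(2)[OF si])
  finally show ?thesis unfolding ptail_eq by simp
qed

lemma ptail_deriv: "(ptail has_real_derivative - (pder p w * exp (- w / \<xi>))) (at w)"
proof -
  let ?g = "\<lambda>s. pder p s * exp (- s / \<xi>)"
  have cont: "continuous_on {w - 1..w + 1} ?g" using xi by (intro continuous_intros pder_cont[OF p(1)]) auto
  have "((\<lambda>y. integral {w - 1..y} ?g) has_real_derivative ?g w) (at w within {w - 1..w + 1})"
    by (rule integral_has_real_derivative[OF cont]) auto
  then have "((\<lambda>y. integral {w - 1..y} ?g) has_real_derivative ?g w) (at w)"
    by (simp add: at_within_Icc_at)
  then have "((\<lambda>y. ptail (w - 1) - integral {w - 1..y} ?g) has_real_derivative - ?g w) (at w)"
    by (auto intro!: derivative_eq_intros)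
  moreover have ev: "\<forall>\<^sub>F y in nhds w. ptail y = ptail (w - 1) - integral {w - 1..y} ?g"
  proof -
    have "\<forall>\<^sub>F y in nhds w. y \<in> {w - 1<..}" by (rule eventually_nhds_in_open) auto
    then show ?thesis by (rule eventually_mono) (rule ptail_split, simp)
  qed
  ultimately show ?thesis by (subst DERIV_cong_ev[OF refl ev refl])
qed

text \<open>\<open>pk w\<close> is the slope of the candidate along the tangent from
  \<open>(w, exp w)\<close>. With \<open>f w = \<bar>w\<bar> powr p\<close> it solves
  \<open>\<xi> * pk' = pk - f'\<close>; \<open>pn\<close> is the right-hand side, and
  \<open>pf2\<close> is the second derivative of \<open>f\<close> away from 0.\<close>

definition pk :: "real \<Rightarrow> real" where "pk w = p / \<xi> * exp (w / \<xi>) * ptail w"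
definition pn :: "real \<Rightarrow> real" where "pn w = pk w - p * pder p w"
definition pf2 :: "real \<Rightarrow> real" where "pf2 w = p * (p - 1) * \<bar>w\<bar> powr (p - 2)"

lemma pk_deriv: "(pk has_real_derivative pn w / \<xi>) (at w)"
proof -
  define i where "i = 1 / \<xi>"
  have "((\<lambda>w. p * i * exp (w * i) * ptail w) has_real_derivative
      p * i * (exp (w * i) * i) * ptail w + - (pder p w * exp (- w / \<xi>)) * (p * i * exp (w * i))) (at w)"
    by (auto intro!: derivative_eq_intros ptail_deriv)
  moreover have "exp (- w / \<xi>) * exp (w * i) = 1" by (simp add: i_def flip: exp_add)
  then have "p * i * (exp (w * i) * i) * ptail w + - (pder p w * exp (- w / \<xi>)) * (p * i * exp (w * i)) = pn w * i"
    unfolding pn_def pk_def i_def[symmetric] by (simp add: i_def[symmetric] divide_inverse) (simp add: i_def divide_inverse algebra_simps)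
  ultimately show ?thesis unfolding pk_def[abs_def] i_def by simp
qed

lemma pk_cont: "continuous_on S pk"
  using pk_deriv by (meson DERIV_isCont continuous_at_imp_continuous_on)

lemma pn_cont: "continuous_on S pn"
  unfolding pn_def[abs_def] by (intro continuous_intros pk_cont pder_cont[OF p(1)])

lemma pn_deriv:
  assumes "w \<noteq> 0"
  shows "(pn has_real_derivative pn w / \<xi> - pf2 w) (at w)"
  unfolding pn_def[abs_def] pf2_def using pk_deriv[of w] pder_deriv(2)[OF assms, of p]
  by (auto intro!: derivative_eq_intros simp: pn_def)

text \<open>If \<open>p * pder p\<close> has a piecewise linear majorant whose formula changes once,
  at \<open>w'\<close>, the exponentially weighted integral of each linear piece is
  explicit.\<close>

lemma ptail_le:
  assumes "\<And>s. w \<le> s \<Longrightarrow> p * pder p s \<le> A + B * (s - w) + (if w' \<le> s then A' + B' * (s - w') else 0)" and ww: "w \<le> w'"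
  shows "pk w \<le> A + B * \<xi> + exp ((w - w') / \<xi>) * (A' + B' * \<xi>)"
proof -
  note i1 = exp_tail_integral[OF xi(1), of A B w] and i2 = exp_tail_integral[OF xi(1), of A' B' w']
  note i = has_bochner_integral_add[OF i1 i2]
  have "p * ptail w = (LINT s|lborel. p * (pder p s * exp (- s / \<xi>) * indicator {w..} s))"
    unfolding ptail_eq by simp
  also have "\<dots> \<le> (LINT s|lborel. (A + B * (s - w)) * exp (- s / \<xi>) * indicator {w..} s + (A' + B' * (s - w')) * exp (- s / \<xi>) * indicator {w'..} s)"
  proof (rule Bochner_Integration.integral_mono)
    show "integrable lborel (\<lambda>s. p * (pder p s * exp (- s / \<xi>) * indicator {w..} s))" using ptail_integrable by simp
    show "integrable lborel (\<lambda>s. (A + B * (s - w)) * exp (- s / \<xi>) * indicator {w..} s + (A' + B' * (s - w')) * exp (- s / \<xi>) * indicator {w'..} s)"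
      using i by (simp add: has_bochner_integral_iff)
    fix s :: real
    show "p * (pder p s * exp (- s / \<xi>) * indicator {w..} s) \<le> (A + B * (s - w)) * exp (- s / \<xi>) * indicator {w..} s + (A' + B' * (s - w')) * exp (- s / \<xi>) * indicator {w'..} s"
    proof (cases "w \<le> s")
      case True
      have "p * pder p s * exp (- s / \<xi>) \<le> (A + B * (s - w) + (if w' \<le> s then A' + B' * (s - w') else 0)) * exp (- s / \<xi>)"
        using assms(1)[OF True] by (intro mult_right_mono) auto
      then show ?thesis using True by (auto simp: algebra_simps split: if_splits)
    next
      case False
      then show ?thesis using ww by simp
    qed
  qed
  also have "\<dots> = (A * \<xi> + B * \<xi>\<^sup>2) * exp (- w / \<xi>) + (A' * \<xi> + B' * \<xi>\<^sup>2) * exp (- w' / \<xi>)"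
    using i by (simp add: has_bochner_integral_iff)
  finally have "1 / \<xi> * exp (w / \<xi>) * (p * ptail w) \<le> 1 / \<xi> * exp (w / \<xi>) * ((A * \<xi> + B * \<xi>\<^sup>2) * exp (- w / \<xi>) + (A' * \<xi> + B' * \<xi>\<^sup>2) * exp (- w' / \<xi>))"
    using xi by (intro mult_left_mono) auto
  also have "\<dots> = (A + B * \<xi>) * (exp (w / \<xi>) * exp (- w / \<xi>)) + (A' + B' * \<xi>) * (exp (w / \<xi>) * exp (- w' / \<xi>))"
    using xi by (simp add: field_simps power2_eq_square)
  also have "exp (w / \<xi>) * exp (- w / \<xi>) = 1" by (simp flip: exp_add)
  also have "exp (w / \<xi>) * exp (- w' / \<xi>) = exp ((w - w') / \<xi>)" by (simp add: diff_divide_distrib flip: exp_add)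
  finally show ?thesis by (simp add: pk_def algebra_simps)
qed

text \<open>This is the sign of the density, and the place where \<open>2 - p \<le> \<xi>\<close> is
  used. Since \<open>pder p\<close> is concave only to the right of 0, three ranges of
  \<open>w\<close> need different arguments.\<close>

lemma pn_bound:
  assumes w: "w \<noteq> 0" and q: "2 - p \<le> \<xi>"
  shows "pn w * (1 - \<xi>) / \<xi> \<le> pf2 w"
proof -
  have pf2_pos: "0 \<le> pf2 w" for w using p by (simp add: pf2_def)
  have right: "pn w * (1 - \<xi>) / \<xi> \<le> pf2 w" if w: "w > 0" for w
  proof -
    \<comment> \<open>For positive \<open>w\<close> concavity makes the tangent of
      \<open>p * pder p\<close> at \<open>w\<close> a majorant; the second piece is zero.\<close>
    have "pk w \<le> p * pder p w + pf2 w * \<xi> + exp ((w - w) / \<xi>) * (0 + 0 * \<xi>)"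
    proof (rule ptail_le)
      fix s assume s: "w \<le> s"
      have "s powr (p - 1) \<le> w powr (p - 1) + (p - 1) * w powr (p - 1 - 1) * (s - w)"
        by (rule powr_le_tangent) (use w s p in auto)
      then have "p * s powr (p - 1) \<le> p * (w powr (p - 1) + (p - 1) * w powr (p - 2) * (s - w))"
        using p by (intro mult_left_mono) auto
      then show "p * pder p s \<le> p * pder p w + pf2 w * (s - w) + (if w \<le> s then 0 + 0 * (s - w) else 0)"
        using w s by (simp add: pder_def pf2_def algebra_simps)
    qed simp
    then have "pn w \<le> pf2 w * \<xi>" by (simp add: pn_def)
    then have "pn w * (1 - \<xi>) / \<xi> \<le> pf2 w * \<xi> * (1 - \<xi>) / \<xi>"
      using xi by (intro divide_right_mono mult_right_mono) auto
    also have "\<dots> \<le> pf2 w" using xi pf2_pos[of w] by (simp add: mult_left_le)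
    finally show ?thesis .
  qed
  have near: "pn (- a) * (1 - \<xi>) / \<xi> \<le> pf2 (- a)" if a: "0 < a" "a \<le> \<xi>" for a
  proof -
    \<comment> \<open>The slope of the chord of \<open>p * pder p\<close> from \<open>- a\<close> to
      0. The majorant is \<open>K * s\<close> for negative \<open>s\<close> and the tangent at
      \<open>a\<close> for positive \<open>s\<close>; the passage from one line to the other
      contributes a nonpositive amount because \<open>a \<le> \<xi>\<close>.\<close>
    define K where "K = p * a powr (p - 2)"
    have K: "0 \<le> K" using p by (simp add: K_def)
    have Ka: "K * a = p * a powr (p - 1)" using a by (simp add: K_def powr_diff power2_eq_square field_simps)
    have "pk (- a) \<le> K * (- a) + K * \<xi> + exp ((- a - 0) / \<xi>) * (K * (2 - p) * a + (- (K * (2 - p))) * \<xi>)"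
    proof (rule ptail_le)
      fix s assume s: "- a \<le> s"
      show "p * pder p s \<le> K * (- a) + K * (s - - a) + (if 0 \<le> s then K * (2 - p) * a + (- (K * (2 - p))) * (s - 0) else 0)"
      proof (cases s "0::real" rule: linorder_cases)
        case less
        have "a powr (p - 2) \<le> (- s) powr (p - 2)" using less s p by (intro powr_mono2') auto
        then have "p * (a powr (p - 2) * (- s)) \<le> p * ((- s) powr (p - 2) * (- s))"
          using less p by (intro mult_left_mono mult_right_mono) auto
        also have "(- s) powr (p - 2) * (- s) = (- s) powr (p - 1)"
          using less by (simp add: powr_diff power2_eq_square field_simps)
        finally have "K * (- s) \<le> p * (- s) powr (p - 1)" by (simp add: K_def)
        then show ?thesis using less by (simp add: pder_def algebra_simps)
      next
        case equal
        then show ?thesis using K p a by (simp add: pder_def)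
      next
        case greater
        have "s powr (p - 1) \<le> a powr (p - 1) + (p - 1) * a powr (p - 1 - 1) * (s - a)"
          by (rule powr_le_tangent) (use greater a p in auto)
        then have "p * s powr (p - 1) \<le> p * (a powr (p - 1) + (p - 1) * a powr (p - 2) * (s - a))"
          using p by (intro mult_left_mono) auto
        also have "\<dots> = K * a + (p - 1) * K * (s - a)" unfolding Ka by (simp add: K_def algebra_simps)
        finally show ?thesis using greater by (simp add: pder_def algebra_simps)
      qed
    qed (use a in simp)
    also have "\<dots> \<le> K * (- a) + K * \<xi>"
    proof -
      have "K * (2 - p) * a + (- (K * (2 - p))) * \<xi> = - (K * (2 - p) * (\<xi> - a))" by (simp add: algebra_simps)
      also have "\<dots> \<le> 0" using K p a by simp
      finally have "exp ((- a - 0) / \<xi>) * (K * (2 - p) * a + (- (K * (2 - p))) * \<xi>) \<le> 0"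
        by (simp add: mult_le_0_iff)
      then show ?thesis by linarith
    qed
    finally have "pn (- a) \<le> K * \<xi>" using Ka a by (simp add: pn_def pder_def)
    then have "pn (- a) * (1 - \<xi>) / \<xi> \<le> K * \<xi> * (1 - \<xi>) / \<xi>"
      using xi by (intro divide_right_mono mult_right_mono) auto
    also have "\<dots> = K * (1 - \<xi>)" using xi by simp
    \<comment> \<open>This is \<open>1 - \<xi> \<le> p - 1\<close>, the hypothesis
      \<open>q\<close>.\<close>
    also have "\<dots> \<le> K * (p - 1)" using K q by (intro mult_left_mono) auto
    also have "\<dots> = pf2 (- a)" using a by (simp add: K_def pf2_def)
    finally show ?thesis .
  qed
  have far: "pn w * (1 - \<xi>) / \<xi> \<le> pf2 w" if w: "w < - \<xi>" for w
  proof -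
    \<comment> \<open>The integrating factor \<open>exp (- w / \<xi>)\<close> removes
      \<open>pn\<close> from the derivative, leaving a positive multiple of \<open>f3 - f2\<close>.
      This is nonpositive to the left of \<open>- \<xi>\<close>, where
      \<open>- y \<ge> \<xi> \<ge> 2 - p\<close>, so the bound at \<open>- \<xi>\<close> propagates
      to the left.\<close>
    define \<psi> where "\<psi> w = exp (- w / \<xi>) * (p * (p - 1) * (- w) powr (p - 2) * (\<xi> / (1 - \<xi>)) - pn w)" for w
    have "\<psi> (- \<xi>) \<le> \<psi> w"
    proof (rule DERIV_nonpos_imp_nonincreasing[of w "- \<xi>"])
      fix y assume y: "w \<le> y" "y \<le> - \<xi>"
      define f2 where "f2 = p * (p - 1) * (- y) powr (p - 2)"
      define f3 where "f3 = p * (p - 1) * ((2 - p) * (- y) powr (p - 2 - 1))"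
      have yn: "y < 0" "y \<noteq> 0" using y xi by auto
      have fy: "pf2 y = f2" using yn by (simp add: pf2_def f2_def)
      have "((\<lambda>w. p * (p - 1) * (- w) powr (p - 2)) has_real_derivative f3) (at y)"
        unfolding f3_def using yn by (auto intro!: derivative_eq_intros simp: algebra_simps)
      note D = this pn_deriv[OF yn(2), unfolded fy]
      define i where "i = 1 / \<xi>"
      have "((\<lambda>w. exp (- w * i) * (p * (p - 1) * (- w) powr (p - 2) * (\<xi> / (1 - \<xi>)) - pn w)) has_real_derivative
          (exp (- y * i) * (- i)) * (f2 * (\<xi> / (1 - \<xi>)) - pn y) + (f3 * (\<xi> / (1 - \<xi>)) - (pn y / \<xi> - f2)) * exp (- y * i)) (at y)"
        unfolding f2_def by (rule DERIV_mult) (rule derivative_eq_intros D refl | simp add: f2_def)+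
      moreover have "(exp (- y * i) * (- i)) * (f2 * (\<xi> / (1 - \<xi>)) - pn y) + (f3 * (\<xi> / (1 - \<xi>)) - (pn y / \<xi> - f2)) * exp (- y * i)
          = exp (- y * i) * (\<xi> / (1 - \<xi>)) * (f3 - f2)"
      proof -
        have "i * (f2 * (\<xi> / (1 - \<xi>))) - f2 = (\<xi> / (1 - \<xi>)) * f2"
          using xi by (simp add: i_def divide_simps) (simp add: algebra_simps)
        moreover have "pn y / \<xi> = i * pn y" by (simp add: i_def)
        moreover have "(E * (- i)) * (f2 * c - n) + (f3 * c - (N - f2)) * E = E * c * (f3 - f2)"
          if "i * (f2 * c) - f2 = c * f2" "N = i * n" for E c n N using that by algebra
        ultimately show ?thesis by blast
      qed
      moreover have "f3 \<le> f2"
      proof -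
        have "(2 - p) * (- y) powr (p - 2 - 1) \<le> (- y) * (- y) powr (p - 2 - 1)"
          using q y by (intro mult_right_mono) auto
        also have "\<dots> = (- y) powr (p - 2)" using powr_mult_base[of "- y" "p - 2 - 1"] yn by simp
        finally show ?thesis unfolding f3_def f2_def using p by (intro mult_left_mono) auto
      qed
      then have "exp (- y * i) * (\<xi> / (1 - \<xi>)) * (f3 - f2) \<le> 0"
        by (intro mult_nonneg_nonpos mult_nonneg_nonneg) (use xi in auto)
      ultimately show "\<exists>d. (\<psi> has_real_derivative d) (at y) \<and> d \<le> 0"
        unfolding \<psi>_def[abs_def] i_def by auto
    qed (use w in simp)
    moreover have "0 \<le> \<psi> (- \<xi>)"
    proof -
      have "pn (- \<xi>) * (1 - \<xi>) / \<xi> \<le> p * (p - 1) * \<xi> powr (p - 2)" using near[of \<xi>] xi by (simp add: pf2_def)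
      then have "pn (- \<xi>) \<le> p * (p - 1) * \<xi> powr (p - 2) * (\<xi> / (1 - \<xi>))" using xi by (simp add: field_simps)
      then show ?thesis by (simp add: \<psi>_def)
    qed
    ultimately have "0 \<le> \<psi> w" by linarith
    then have "pn w \<le> pf2 w * (\<xi> / (1 - \<xi>))" using w xi by (simp add: \<psi>_def pf2_def zero_le_mult_iff)
    then show ?thesis using xi by (simp add: field_simps)
  qed
  consider "w > 0" | "- \<xi> \<le> w" "w < 0" | "w < - \<xi>" using w by linarith
  then show ?thesis using right[of w] near[of "- w"] far[of w] by cases auto
qed

end


text \<open>The density has the sign opposite to that in \<open>A_upper\<close>, so
  \<open>fam_above\<close> is applied to the negated family and yields a lower bound. Beyond the
  cutoff the plane may exceed the power by a multiple of \<open>exp s\<close>; the factor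
  \<open>exp (- T)\<close> makes this error vanish in the limit.\<close>

lemma (in Ainf_sample) bp_lower:
  assumes x: "exp x1 \<le> x2" "x2 \<le> C * exp x1" and p: "1 < p" "p \<le> 2" and q: "2 - p \<le> xi_plus C"
  shows "ennreal (V * b_cand p C (x1, x2)) \<le> (\<integral>\<^sup>+t. ennreal (\<bar>\<phi> t\<bar> powr p) \<partial>M)"
proof (cases "integrable M (\<lambda>t. \<bar>\<phi> t\<bar> powr p)")
  case False
  have "(\<lambda>t. \<bar>\<phi> t\<bar> powr p) \<in> borel_measurable M" by measurable
  with False have "(\<integral>\<^sup>+t. ennreal (\<bar>\<phi> t\<bar> powr p) \<partial>M) = \<infinity>"
    by (simp add: integrable_iff_bounded less_top[symmetric])
  then show ?thesis by simp
next
  case int: True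
  define \<xi> where "\<xi> = xi_plus C"
  have xi': "0 < \<xi>" "\<xi> < 1" using xi by (auto simp: \<xi>_def)
  define u where "u = u_plus C (x1, x2)"
  note u = u_plus_props[OF C x, folded u_def]
  note P = p xi'
  define i where "i = 1 / \<xi>"
  define K where "K = i - 1"
  have K: "K = (1 - \<xi>) / \<xi>" "K / (1 - \<xi>) = i" "0 \<le> K" using xi' by (auto simp: K_def i_def field_simps)
  let ?n = "pn p \<xi>" and ?f2 = "pf2 p"
  let ?f = "\<lambda>w. \<bar>w\<bar> powr p"
  define m where "m w = exp (- w) * ?n w * K" for w
  define m1 where "m1 w = p * pder p w - ?n w * K" for w
  \<comment> \<open>The value at 0 is set to 0 because \<open>pn_bound\<close> excludes that point,
    while the sign is required on the whole interval.\<close>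
  define d where "d w = indicator (- {0}) w * (exp (- w) * K * (?n w * K - ?f2 w))" for w
  have ee: "exp (- w) * exp w = 1" for w :: real by (simp flip: exp_add)
  have mexp: "m w * exp w = ?n w * K" for w
    unfolding m_def using ee[of w] by (simp add: mult.assoc mult.left_commute)
  have nK: "?n w * K \<le> ?f2 w" if "w \<noteq> 0" for w
    using pn_bound[OF P that] q by (simp add: K \<xi>_def)
  have d0: "d w \<le> 0" for w using nK[of w] K(3) by (auto simp: d_def indicator_def intro!: mult_nonneg_nonpos mult_nonneg_nonneg)
  have [measurable]: "?n \<in> borel_measurable borel" by (rule borel_measurable_continuous_onI[OF pn_cont[OF P]])
  have dm: "d \<in> borel_measurable borel" unfolding d_def[abs_def] pf2_def[OF P, abs_def] by measurable
  have fc: "continuous_on S ?f" for S using p by (intro continuous_on_powr' continuous_intros) auto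
  have m1c: "continuous_on S m1" for S unfolding m1_def[abs_def] by (intro continuous_intros pder_cont[OF p(1)] pn_cont[OF P])
  have mc: "continuous_on S m" for S unfolding m_def[abs_def] by (intro continuous_intros pn_cont[OF P])
  have tf: "tangent_family \<xi> a b ?f m1 m d" for a b
    unfolding tangent_family_def
  proof (intro conjI exI[of _ "{0}"] ballI)
    fix w assume "w \<in> {a<..<b} - {0}"
    then have w: "w \<noteq> 0" by auto
    have i: "?n w / \<xi> = i * ?n w" by (simp add: i_def)
    note D = pn_deriv[OF P w, unfolded i]
    show "(?f has_real_derivative m1 w + m w * exp w) (at w)"
      using pder_deriv(1)[OF w, of p] by (simp add: m1_def mexp)
    have "(m has_real_derivative exp (- w) * (- 1) * (?n w * K) + exp (- w) * ((i * ?n w - ?f2 w) * K)) (at w)"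
      unfolding m_def[abs_def] mult.assoc using D by (auto intro!: derivative_eq_intros)
    moreover have "exp (- w) * (- 1) * (?n w * K) + exp (- w) * ((i * ?n w - ?f2 w) * K) = d w"
      using w by (simp add: d_def K_def algebra_simps)
    ultimately show "(m has_real_derivative d w) (at w)" by simp
    have "(m1 has_real_derivative ?f2 w - (i * ?n w - ?f2 w) * K) (at w)"
      unfolding m1_def[abs_def] pf2_def[OF P] using D[unfolded pf2_def[OF P]] pder_deriv(2)[OF w, of p] by (auto intro!: derivative_eq_intros)
    moreover have "?f2 w - (i * ?n w - ?f2 w) * K = - (d w * exp w / (1 - \<xi>))"
    proof -
      have "d w * exp w / (1 - \<xi>) = (exp (- w) * exp w) * (K / (1 - \<xi>)) * (?n w * K - ?f2 w)"
        using w by (simp add: d_def)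
      also have "\<dots> = i * (?n w * K - ?f2 w)" unfolding K(2) ee by simp
      finally show ?thesis by (simp add: K_def algebra_simps)
    qed
    ultimately show "(m1 has_real_derivative - (d w * exp w / (1 - \<xi>))) (at w)" by simp
  qed (use xi' dm fc m1c mc in auto)
  note tf' = tangent_family_uminus[OF tf]
  have famneg: "fam (\<lambda>w. - ?f w) (\<lambda>w. - m1 w) (\<lambda>w. - m w) w y1 y2 = - fam ?f m1 m w y1 y2" for w y1 y2
    by (simp add: fam_def)
  have val: "fam ?f m1 m u x1 x2 = b_cand p C (x1, x2)"
  proof -
    have "m1 u + m u * exp u / (1 - \<xi>) = p * pder p u + ?n u * (K / (1 - \<xi>) - K)"
      unfolding mexp m1_def by (simp add: algebra_simps)
    also have "\<dots> = pk p \<xi> u" unfolding K(2) by (simp add: K_def pn_def[OF P])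
    finally have "m1 u + m u * exp u / (1 - \<xi>) = pk p \<xi> u" .
    then show ?thesis unfolding fam_on_tline[OF u(3), folded \<xi>_def] using C
      by (simp add: b_cand_def Let_def u_def[symmetric] \<xi>_def[symmetric] pk_def[OF P] ptail_def[OF P])
  qed
  have bound: "V * b_cand p C (x1, x2) \<le> (LINT t|M. \<bar>\<phi> t\<bar> powr p) + 2 * V * x2 * exp (- T)"
    if T: "u \<le> T" "1 \<le> T" for T
  proof -
    let ?k = "\<lambda>s. min (max s u) T"
    \<comment> \<open>The sign of the density itself bounds \<open>?n T * K\<close> by
      \<open>?f2 T\<close>, which is at most 2 for \<open>T \<ge> 1\<close>.\<close>
    have mT: "m T \<le> 2 * exp (- T)"
    proof -
      have "?f2 T = p * (p - 1) * T powr (p - 2)" using T by (simp add: pf2_def[OF P])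
      also have "\<dots> \<le> 2 * 1 * 1"
      proof (intro mult_mono)
        have "T powr (p - 2) \<le> T powr 0" using T p by (intro powr_mono) auto
        then show "T powr (p - 2) \<le> 1" using T by simp
      qed (use p in auto)
      finally have "?n T * K \<le> 2" using nK[of T] T by simp
      then show ?thesis unfolding m_def by (simp add: mult.assoc mult.commute[of 2])
    qed
    have pw: "fam ?f m1 m (?k s) s (exp s) \<le> \<bar>s\<bar> powr p + 2 * exp (- T) * exp s" for s
    proof -
      consider "s \<le> u" | "u < s" "s \<le> T" | "T < s" by linarith
      then show ?thesis
      proof cases
        case 1
        have "- (\<bar>s\<bar> powr p) \<le> fam (\<lambda>w. - ?f w) (\<lambda>w. - m1 w) (\<lambda>w. - m w) u s (exp s)"
          by (rule fam_ge_diag[OF tf' 1]) (use xi' d0 in auto)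
        moreover have k: "?k s = u" using 1 T by auto
        moreover have "0 \<le> 2 * exp (- T) * exp s" by simp
        ultimately show ?thesis unfolding famneg k by linarith
      next
        case 2
        then have "?k s = s" by auto
        then show ?thesis by (simp add: fam_diag)
      next
        case 3
        have "fam ?f m1 m T s (exp s) = (T powr p + p * T powr (p - 1) * (s - T)) + m T * (exp s - exp T - exp T * (s - T))"
        proof -
          have m1T: "m1 T = p * T powr (p - 1) - m T * exp T" unfolding mexp m1_def using T by (simp add: pder_def)
          show ?thesis unfolding fam_def m1T using T by (simp add: algebra_simps)
        qed
        also have "\<dots> \<le> s powr p + 2 * exp (- T) * exp s"
        proof (rule add_mono)
          show "T powr p + p * T powr (p - 1) * (s - T) \<le> s powr p"
            by (rule powr_ge_tangent) (use 3 T p in auto)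
          have "m T * (exp s - exp T - exp T * (s - T)) \<le> 2 * exp (- T) * (exp s - exp T - exp T * (s - T))"
            using mT exp_gap_nonneg[of s T] by (intro mult_right_mono) auto
          also have "\<dots> \<le> 2 * exp (- T) * exp s"
          proof (rule mult_left_mono)
            have "0 \<le> exp T * (s - T)" using 3 by simp
            then show "exp s - exp T - exp T * (s - T) \<le> exp s" using exp_ge_zero[of T] by linarith
          qed simp
          finally show "m T * (exp s - exp T - exp T * (s - T)) \<le> 2 * exp (- T) * exp s" .
        qed
        finally show ?thesis using 3 T by simp
      qed
    qed
    have u': "x1 - xi_plus C \<le> u" using u by simp
    note F = fam_above[OF tf'[unfolded \<xi>_def] T(1) _ u', unfolded famneg val]
    have d0': "0 \<le> - d w" for w using d0[of w] by simp
    have Fi: "integrable M (\<lambda>t. fam ?f m1 m (?k (\<phi> t)) (\<phi> t) (exp (\<phi> t)))"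
      using Bochner_Integration.integrable_minus[OF F(1)[OF d0']] by simp
    have "V * b_cand p C (x1, x2) \<le> (LINT t|M. fam ?f m1 m (?k (\<phi> t)) (\<phi> t) (exp (\<phi> t)))"
      using F(2)[OF d0'] by simp
    also have "\<dots> \<le> (LINT t|M. \<bar>\<phi> t\<bar> powr p + 2 * exp (- T) * exp (\<phi> t))"
      by (rule Bochner_Integration.integral_mono) (use Fi pw int int2 in auto)
    also have "\<dots> = (LINT t|M. \<bar>\<phi> t\<bar> powr p) + 2 * V * x2 * exp (- T)"
      using int int2 by (simp add: mean2)
    finally show ?thesis .
  qed
  have "V * b_cand p C (x1, x2) \<le> (LINT t|M. \<bar>\<phi> t\<bar> powr p)"
  proof (rule tendsto_lowerbound)
    have "filterlim (\<lambda>T::real. - T) at_bot at_top" by (simp add: filterlim_uminus_at_bot_at_top)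
    then have "((\<lambda>T. exp (- T)) \<longlongrightarrow> (0::real)) at_top" by (rule filterlim_compose[OF exp_at_bot])
    then have "((\<lambda>T. (LINT t|M. \<bar>\<phi> t\<bar> powr p) + 2 * V * x2 * exp (- T)) \<longlongrightarrow> (LINT t|M. \<bar>\<phi> t\<bar> powr p) + 2 * V * x2 * 0) at_top"
      by (intro tendsto_intros)
    then show "((\<lambda>T. (LINT t|M. \<bar>\<phi> t\<bar> powr p) + 2 * V * x2 * exp (- T)) \<longlongrightarrow> (LINT t|M. \<bar>\<phi> t\<bar> powr p)) at_top" by simp
    show "\<forall>\<^sub>F T in at_top. V * b_cand p C (x1, x2) \<le> (LINT t|M. \<bar>\<phi> t\<bar> powr p) + 2 * V * x2 * exp (- T)"
      using eventually_ge_at_top[of "max u 1"] by eventually_elim (use bound in auto)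
  qed simp
  moreover have "(\<integral>\<^sup>+t. ennreal (\<bar>\<phi> t\<bar> powr p) \<partial>M) = ennreal (LINT t|M. \<bar>\<phi> t\<bar> powr p)"
    by (rule nn_integral_eq_integral[OF int]) auto
  ultimately show ?thesis by (simp add: ennreal_leI)
qed

section \<open>Test functions\<close>

lemma tline_le_upper:
  assumes "\<xi> < 1" "exp (- \<xi>) = C * (1 - \<xi>)"
  shows "tline \<xi> y w \<le> C * exp y"
proof (cases w "y - \<xi>" rule: linorder_cases)
  case less
  then show ?thesis using tline_incr[OF assms(1) _ less, of y] tline_end[OF assms, of y] by simp
next
  case greater
  then show ?thesis using tline_decr[OF assms(1) _ greater, of y] tline_end[OF assms, of y] by simp
qed (use tline_end[OF assms, of y] in simp)

section \<open>Calculus of the logarithmic tail\<close>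

lemma set_integrable_lborel_lebesgue:
  fixes f :: "real \<Rightarrow> real"
  assumes "set_integrable lborel S f"
  shows "set_integrable lebesgue S f"
  using assms unfolding set_integrable_def by (subst integrable_completion) auto

text \<open>The integrand may be unbounded at the left end; the limit 0 of the primitive there
  replaces its value.\<close>

lemma FTC_nonneg_right_end:
  fixes f F :: "real \<Rightarrow> real"
  assumes "a < d" and F: "\<And>t. a < t \<Longrightarrow> t \<le> d \<Longrightarrow> (F has_real_derivative f t) (at t)"
    and f: "\<And>t. a < t \<Longrightarrow> t < d \<Longrightarrow> isCont f t" "\<And>t. a < t \<Longrightarrow> t < d \<Longrightarrow> 0 \<le> f t"
    and lim: "(F \<longlongrightarrow> 0) (at_right a)"
  shows "set_integrable lebesgue {a<..<d} f" "integral {a..d} f = F d"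
    "(\<integral>\<^sup>+t\<in>{a<..<d}. ennreal (f t) \<partial>lebesgue) = ennreal (F d)"
proof -
  have B: "(F \<longlongrightarrow> F d) (at_left d)"
    using DERIV_isCont[OF F[of d]] assms(1) by (simp add: isCont_def filterlim_at_split)
  have ae: "AE x in lborel. ereal a < ereal x \<longrightarrow> ereal x < ereal d \<longrightarrow> 0 \<le> f x" using f(2) by auto
  have F': "(F has_real_derivative f x) (at x)" if "ereal a < ereal x" "ereal x < ereal d" for x using F[of x] that by simp
  have f': "isCont f x" if "ereal a < ereal x" "ereal x < ereal d" for x using f(1)[of x] that by simp
  have A: "((F \<circ> real_of_ereal) \<longlongrightarrow> 0) (at_right (ereal a))" using lim by (simp add: ereal_tendsto_simps)
  have B': "((F \<circ> real_of_ereal) \<longlongrightarrow> F d) (at_left (ereal d))" using B by (simp add: ereal_tendsto_simps)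
  have ad: "ereal a < ereal d" using assms(1) by simp
  note i = interval_integral_FTC_nonneg[OF ad F' f' ae A B']
  have ein: "einterval (ereal a) (ereal d) = {a<..<d}" by (auto simp: einterval_def)
  have s: "set_integrable lborel {a<..<d} f" using i(1) unfolding ein .
  have l: "(LINT x:{a<..<d}|lborel. f x) = F d"
    using i(2) assms(1) by (simp add: interval_lebesgue_integral_def ein)
  show s': "set_integrable lebesgue {a<..<d} f" by (rule set_integrable_lborel_lebesgue[OF s])
  show "integral {a..d} f = F d"
    using set_borel_integral_eq_integral(2)[OF s] l by (simp add: integral_open_interval_real)
  have le: "(LINT x|lebesgue. indicator {a<..<d} x *\<^sub>R f x) = F d"
    using l s unfolding set_lebesgue_integral_def set_integrable_def by (subst integral_completion) auto
  have "(\<integral>\<^sup>+t\<in>{a<..<d}. ennreal (f t) \<partial>lebesgue) = (\<integral>\<^sup>+t. ennreal (indicator {a<..<d} t *\<^sub>R f t) \<partial>lebesgue)"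
    by (rule nn_integral_cong) (auto simp: indicator_def)
  also have "\<dots> = ennreal (LINT x|lebesgue. indicator {a<..<d} x *\<^sub>R f x)"
    by (rule nn_integral_eq_integral) (use s' f(2) in \<open>auto simp: set_integrable_def indicator_def\<close>)
  finally show "(\<integral>\<^sup>+t\<in>{a<..<d}. ennreal (f t) \<partial>lebesgue) = ennreal (F d)" unfolding le .
qed

lemma ln_tail_at_right:
  fixes a \<tau> :: real
  assumes "0 < \<tau>"
  shows "filterlim (\<lambda>t. ln (\<tau> / (t - a))) at_top (at_right a)"
proof -
  have "filterlim (\<lambda>t. t - a) (at_right 0) (at_right a)"
    by (simp add: at_right_to_0[of a] filterlim_filtermap filterlim_ident)
  then have "filterlim (\<lambda>t. ln (t - a)) at_bot (at_right a)" by (rule filterlim_compose[OF ln_at_0])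
  then have "filterlim (\<lambda>t. - ln (t - a)) at_top (at_right a)" by (simp add: filterlim_uminus_at_top)
  then have "filterlim (\<lambda>t. ln \<tau> + - ln (t - a)) at_top (at_right a)"
    by (rule filterlim_tendsto_add_at_top[OF tendsto_const])
  moreover have "\<forall>\<^sub>F t in at_right a. ln \<tau> + - ln (t - a) = ln (\<tau> / (t - a))"
    using assms by (auto simp: eventually_at_filter ln_div)
  ultimately show ?thesis by (rule filterlim_cong[OF refl refl, THEN iffD1, rotated])
qed

lemma ln_tail_limits:
  fixes a \<tau> :: real
  assumes "0 < \<tau>"
  shows "((\<lambda>t. (t - a) * ln (\<tau> / (t - a)) ^ k) \<longlongrightarrow> 0) (at_right a)"
    and "c < 1 \<Longrightarrow> ((\<lambda>t. (t - a) * exp (c * ln (\<tau> / (t - a)))) \<longlongrightarrow> 0) (at_right a)"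
proof -
  let ?T = "\<lambda>t. ln (\<tau> / (t - a))"
  note T = ln_tail_at_right[OF assms, of a]
  \<comment> \<open>In terms of \<open>y = ln (\<tau> / (t - a))\<close> the factor
    \<open>t - a\<close> is \<open>\<tau> / exp y\<close>, and both limits reduce to the decay of an
    exponential at infinity.\<close>
  have ev: "\<forall>\<^sub>F t in at_right a. t - a = \<tau> / exp (?T t)"
    using assms by (auto simp: eventually_at_filter)
  have "((\<lambda>t. \<tau> * (?T t ^ k / exp (?T t))) \<longlongrightarrow> \<tau> * 0) (at_right a)"
    by (intro tendsto_mult tendsto_const filterlim_compose[OF tendsto_power_div_exp_0 T])
  moreover have "\<forall>\<^sub>F t in at_right a. \<tau> * (?T t ^ k / exp (?T t)) = (t - a) * ?T t ^ k"
    using ev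
  proof eventually_elim
    case (elim t)
    have "(\<tau> / exp (?T t)) * ?T t ^ k = \<tau> * (?T t ^ k / exp (?T t))" by simp
    then show ?case using elim by metis
  qed
  ultimately show "((\<lambda>t. (t - a) * ?T t ^ k) \<longlongrightarrow> 0) (at_right a)"
    by (simp add: tendsto_cong)
  assume c: "c < 1"
  have "filterlim (\<lambda>t. (1 - c) * ?T t) at_top (at_right a)"
    by (rule filterlim_tendsto_pos_mult_at_top[OF tendsto_const _ T]) (use c in simp)
  then have "filterlim (\<lambda>t. - ((1 - c) * ?T t)) at_bot (at_right a)" by (simp add: filterlim_uminus_at_bot)
  then have "((\<lambda>t. exp (- ((1 - c) * ?T t))) \<longlongrightarrow> 0) (at_right a)"
    by (rule filterlim_compose[OF exp_at_bot])
  then have "((\<lambda>t. \<tau> * exp (- ((1 - c) * ?T t))) \<longlongrightarrow> \<tau> * 0) (at_right a)"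
    by (intro tendsto_mult tendsto_const)
  moreover have "\<forall>\<^sub>F t in at_right a. \<tau> * exp (- ((1 - c) * ?T t)) = (t - a) * exp (c * ?T t)"
    using ev
  proof eventually_elim
    case (elim t)
    have "(\<tau> / exp (?T t)) * exp (c * ?T t) = \<tau> * exp (- ((1 - c) * ?T t))"
      by (simp add: algebra_simps exp_diff)
    then show ?case using elim by metis
  qed
  ultimately show "((\<lambda>t. (t - a) * exp (c * ?T t)) \<longlongrightarrow> 0) (at_right a)"
    by (simp add: tendsto_cong)
qed

lemma ln_tail_deriv:
  fixes a \<tau> t :: real
  assumes "0 < \<tau>" "a < t"
  shows "((\<lambda>t. ln (\<tau> / (t - a))) has_real_derivative - (1 / (t - a))) (at t)"
proof -
  have "((\<lambda>t. ln (\<tau> / (t - a))) has_real_derivative 1 / (\<tau> / (t - a)) * (- \<tau> / ((t - a) * (t - a)))) (at t)"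
    using assms by (auto intro!: derivative_eq_intros)
  moreover have "1 / (\<tau> / (t - a)) * (- \<tau> / ((t - a) * (t - a))) = - (1 / (t - a))"
    using assms by simp
  ultimately show ?thesis by simp
qed

lemma deriv_shift_mult:
  fixes G :: "real \<Rightarrow> real"
  assumes "(G has_real_derivative G') (at t)"
  shows "((\<lambda>t. (t - a) * G t) has_real_derivative G t + G' * (t - a)) (at t)"
  using assms by (auto intro!: derivative_eq_intros)

lemma ln_tail_nonneg: "a < t \<Longrightarrow> t \<le> a + \<tau> \<Longrightarrow> 0 \<le> ln (\<tau> / (t - a))" for a t \<tau> :: real
  by (intro ln_ge_zero) simp

lemma ln_tail_isCont: "0 < \<tau> \<Longrightarrow> a < t \<Longrightarrow> isCont (\<lambda>t. ln (\<tau> / (t - a))) t" for a t \<tau> :: real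
  using DERIV_isCont[OF ln_tail_deriv] .

lemma ln_tail_integral:
  fixes a d \<tau> :: real
  assumes "0 < \<tau>" "a < d" "d \<le> a + \<tau>"
  shows "set_integrable lebesgue {a<..<d} (\<lambda>t. ln (\<tau> / (t - a)))"
    "integral {a..d} (\<lambda>t. ln (\<tau> / (t - a))) = (d - a) * (ln (\<tau> / (d - a)) + 1)"
proof -
  let ?T = "\<lambda>t. ln (\<tau> / (t - a))"
  let ?F = "\<lambda>t. (t - a) * (?T t + 1)"
  have F: "(?F has_real_derivative ?T t) (at t)" if "a < t" for t
    using deriv_shift_mult[OF DERIV_add[OF ln_tail_deriv[OF assms(1) that] DERIV_const], of a 1] that by simp
  have "((\<lambda>t. (t - a) * ?T t ^ 1 + (t - a) * ?T t ^ 0) \<longlongrightarrow> 0 + 0) (at_right a)"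
    by (intro tendsto_add ln_tail_limits assms)
  then have lim: "(?F \<longlongrightarrow> 0) (at_right a)" by (simp add: algebra_simps)
  have nn: "0 \<le> ?T t" if "a < t" "t < d" for t using that assms ln_tail_nonneg[of a t \<tau>] by simp
  have ct: "isCont ?T t" if "a < t" for t using assms that by (intro ln_tail_isCont)
  note R = FTC_nonneg_right_end[OF assms(2), of ?F ?T, OF F ct nn lim]
  show "set_integrable lebesgue {a<..<d} ?T" "integral {a..d} ?T = (d - a) * (?T d + 1)"
    using R by auto
qed

lemma ln_tail_sq_integral:
  fixes a \<tau> \<xi> u :: real
  assumes "0 < \<tau>"
  shows "(\<integral>\<^sup>+t\<in>{a<..<a + \<tau>}. ennreal ((u + \<xi> * ln (\<tau> / (t - a)))\<^sup>2) \<partial>lebesgue) = ennreal (\<tau> * (u\<^sup>2 + 2 * \<xi> * u + 2 * \<xi>\<^sup>2))"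
proof -
  let ?T = "\<lambda>t. ln (\<tau> / (t - a))"
  let ?F = "\<lambda>t. (t - a) * ((u + \<xi> * ?T t)\<^sup>2 + 2 * \<xi> * (u + \<xi> * ?T t) + 2 * \<xi>\<^sup>2)"
  have F: "(?F has_real_derivative (u + \<xi> * ?T t)\<^sup>2) (at t)" if "a < t" for t
  proof -
    let ?q = "\<lambda>y. (u + \<xi> * y)\<^sup>2 + 2 * \<xi> * (u + \<xi> * y) + 2 * \<xi>\<^sup>2"
    have q: "(?q has_real_derivative (2 * (u + \<xi> * y) * \<xi> + 2 * \<xi> * \<xi>)) (at y)" for y
      by (auto intro!: derivative_eq_intros simp: algebra_simps)
    have k: "K * - (1 / (t - a)) * (t - a) = - K" for K using that by simp
    show ?thesis
      by (rule DERIV_cong[OF deriv_shift_mult[OF DERIV_chain2[OF q ln_tail_deriv[OF assms(1) that]]]])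
         (unfold k, simp add: algebra_simps power2_eq_square)
  qed
  have "((\<lambda>t. \<xi>\<^sup>2 * ((t - a) * ?T t ^ 2) + (2 * u * \<xi> + 2 * \<xi>\<^sup>2) * ((t - a) * ?T t ^ 1) + (u\<^sup>2 + 2 * \<xi> * u + 2 * \<xi>\<^sup>2) * ((t - a) * ?T t ^ 0))
      \<longlongrightarrow> \<xi>\<^sup>2 * 0 + (2 * u * \<xi> + 2 * \<xi>\<^sup>2) * 0 + (u\<^sup>2 + 2 * \<xi> * u + 2 * \<xi>\<^sup>2) * 0) (at_right a)"
    by (intro tendsto_add tendsto_mult tendsto_const ln_tail_limits assms)
  then have lim: "(?F \<longlongrightarrow> 0) (at_right a)" by (simp add: algebra_simps power2_eq_square)
  have ct: "isCont (\<lambda>t. (u + \<xi> * ?T t)\<^sup>2) t" if "a < t" for t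
    by (rule isCont_o2[OF ln_tail_isCont[OF assms that], of "\<lambda>y. (u + \<xi> * y)\<^sup>2"]) (intro continuous_intros)
  have ad: "a < a + \<tau>" using assms by simp
  have "(\<integral>\<^sup>+t\<in>{a<..<a + \<tau>}. ennreal ((u + \<xi> * ?T t)\<^sup>2) \<partial>lebesgue) = ennreal (?F (a + \<tau>))"
    by (rule FTC_nonneg_right_end(3)[OF ad]) (use F ct lim in auto)
  then show ?thesis using assms by simp
qed

lemma exp_tail_FTC:
  fixes a d \<tau> c :: real
  assumes "0 < \<tau>" "a < d" "c < 1"
  shows "set_integrable lebesgue {a<..<d} (\<lambda>t. exp (c * ln (\<tau> / (t - a))))"
    "integral {a..d} (\<lambda>t. exp (c * ln (\<tau> / (t - a)))) = (d - a) * exp (c * ln (\<tau> / (d - a))) / (1 - c)"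
    "(\<integral>\<^sup>+t\<in>{a<..<d}. ennreal (exp (c * ln (\<tau> / (t - a)))) \<partial>lebesgue) = ennreal ((d - a) * exp (c * ln (\<tau> / (d - a))) / (1 - c))"
proof -
  let ?T = "\<lambda>t. ln (\<tau> / (t - a))"
  let ?F = "\<lambda>t. (t - a) * exp (c * ?T t) / (1 - c)"
  have F: "(?F has_real_derivative exp (c * ?T t)) (at t)" if "a < t" for t
  proof -
    have "((\<lambda>t. (t - a) * exp (c * ?T t)) has_real_derivative 1 * exp (c * ?T t) + exp (c * ?T t) * (c * - (1 / (t - a))) * (t - a)) (at t)"
    proof -
      have e: "((\<lambda>y. exp (c * y)) has_real_derivative exp (c * y) * c) (at y)" for y
        by (auto intro!: derivative_eq_intros)
      from deriv_shift_mult[OF DERIV_chain2[OF e ln_tail_deriv[OF assms(1) that]], of a]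
      show ?thesis by (simp add: mult_ac)
    qed
    moreover have "1 * exp (c * ?T t) + exp (c * ?T t) * (c * - (1 / (t - a))) * (t - a) = exp (c * ?T t) * (1 - c)"
    proof -
      have "exp (c * ?T t) * (c * - (1 / (t - a))) * (t - a) = exp (c * ?T t) * (c * (- (1 / (t - a)) * (t - a)))"
        by (simp only: mult.assoc)
      also have "- (1 / (t - a)) * (t - a) = - 1" using that by simp
      finally have X: "exp (c * ?T t) * (c * - (1 / (t - a))) * (t - a) = exp (c * ?T t) * (c * - 1)" .
      show ?thesis unfolding X by (simp add: algebra_simps)
    qed
    ultimately have "((\<lambda>t. (t - a) * exp (c * ?T t)) has_real_derivative exp (c * ?T t) * (1 - c)) (at t)" by simp
    from DERIV_cdivide[OF this, of "1 - c"] show ?thesis using assms(3) by simp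
  qed
  have "((\<lambda>t. (t - a) * exp (c * ?T t) / (1 - c)) \<longlongrightarrow> 0 / (1 - c)) (at_right a)"
    by (intro tendsto_divide tendsto_const ln_tail_limits assms) (use assms in auto)
  then have lim: "(?F \<longlongrightarrow> 0) (at_right a)" by simp
  have ct: "isCont (\<lambda>t. exp (c * ?T t)) t" if "a < t" for t
    by (rule isCont_o2[OF ln_tail_isCont[OF assms(1) that], of "\<lambda>y. exp (c * y)"]) (intro continuous_intros)
  note R = FTC_nonneg_right_end[OF assms(2), of ?F "\<lambda>t. exp (c * ?T t)", OF F ct _ lim]
  show "set_integrable lebesgue {a<..<d} (\<lambda>t. exp (c * ?T t))"
    "integral {a..d} (\<lambda>t. exp (c * ?T t)) = (d - a) * exp (c * ?T d) / (1 - c)"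
    "(\<integral>\<^sup>+t\<in>{a<..<d}. ennreal (exp (c * ?T t)) \<partial>lebesgue) = ennreal ((d - a) * exp (c * ?T d) / (1 - c))"
    using R by auto
qed

section \<open>Criteria for membership in the class\<close>

definition good :: "real \<Rightarrow> (real \<Rightarrow> real) \<Rightarrow> real \<Rightarrow> real \<Rightarrow> bool" where
  "good C \<phi> c d \<longleftrightarrow> integral {c..d} (\<lambda>t. exp (\<phi> t)) \<le> C * (d - c) * exp (integral {c..d} \<phi> / (d - c))"

text \<open>Read \<open>A1, A2\<close> and \<open>B1, B2\<close> as the integrals of \<open>\<phi>\<close> and \<open>exp \<phi>\<close> over adjacent intervals of lengths \<open>la\<close> and \<open>lb\<close>:
  the \<open>A_\<infinity>\<close> bound on all subintervals then only has to be checked for those sharing an endpoint with the whole.\<close>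

lemma ray:
  fixes h :: "real \<Rightarrow> real"
  assumes supp: "\<And>X. \<exists>k. \<forall>y. h X + k * (y - X) \<le> h y"
    and l: "0 < la" "0 < lb" and A: "la * h (A1 / la) \<le> A2"
    and AB: "A2 + B2 \<le> (la + lb) * h ((A1 + B1) / (la + lb))"
  shows "B2 \<le> lb * h (B1 / lb)"
proof -
  define X where "X = (A1 + B1) / (la + lb)"
  obtain k where k: "\<And>y. h X + k * (y - X) \<le> h y" using supp[of X] by blast
  have "la * (h X + k * (A1 / la - X)) \<le> la * h (A1 / la)" using k l by (intro mult_left_mono) auto
  moreover have "lb * (h X + k * (B1 / lb - X)) \<le> lb * h (B1 / lb)" using k l by (intro mult_left_mono) auto
  moreover have "la * (h X + k * (A1 / la - X)) + lb * (h X + k * (B1 / lb - X)) = (la + lb) * h X + k * (A1 + B1 - (la + lb) * X)"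
    using l by (simp add: algebra_simps)
  moreover have "(la + lb) * X = A1 + B1" using l by (simp add: X_def)
  ultimately show ?thesis using A AB unfolding X_def[symmetric] by simp
qed

lemma exp_supporting: "\<exists>k. \<forall>y. C * exp X + k * (y - X) \<le> C * exp y" if "0 \<le> C" for C X :: real
proof (intro exI allI)
  fix y
  have "C * (exp X + exp X * (y - X)) \<le> C * exp y" using exp_gap_nonneg[of y X] that by (intro mult_left_mono) auto
  then show "C * exp X + C * exp X * (y - X) \<le> C * exp y" by (simp add: algebra_simps)
qed

text \<open>\<open>h\<close> is a convex minorant of the upper curve. If the average point of
  \<open>{a..c}\<close> is on or above its graph and that of \<open>{a..d}\<close> on or below it,
  then the average point of \<open>{c..d}\<close>, which lies on the ray from the first through the
  second and past the second, is on or below it. So for \<open>c < N\<close> only initial intervals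
  need inspection; \<open>rest\<close> treats those beyond \<open>N\<close>, where the test
  functions are simple.\<close>

lemma E_classI:
  fixes \<phi> :: "real \<Rightarrow> real" and h :: "real \<Rightarrow> real"
  assumes C: "1 \<le> C" and ab: "a < b" and Q: "{a<..<b} \<subseteq> Q" "Q \<subseteq> {a..b}"
    and int: "set_integrable lebesgue {a<..<b} \<phi>" "set_integrable lebesgue {a<..<b} (\<lambda>t. exp (\<phi> t))"
    and x: "integral {a..b} \<phi> = (b - a) * x1" "integral {a..b} (\<lambda>t. exp (\<phi> t)) = (b - a) * x2"
    and h: "\<And>X. \<exists>k. \<forall>y. h X + k * (y - X) \<le> h y" "\<And>y. h y \<le> C * exp y"
    and lo: "\<And>c. a < c \<Longrightarrow> c \<le> N \<Longrightarrow> (c - a) * h (integral {a..c} \<phi> / (c - a)) \<le> integral {a..c} (\<lambda>t. exp (\<phi> t))"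
    and hi: "\<And>d. a < d \<Longrightarrow> d \<le> b \<Longrightarrow> integral {a..d} (\<lambda>t. exp (\<phi> t)) \<le> (d - a) * h (integral {a..d} \<phi> / (d - a))"
    and rest: "\<And>c d. a \<le> c \<Longrightarrow> N \<le> c \<Longrightarrow> c < d \<Longrightarrow> d \<le> b \<Longrightarrow> good C \<phi> c d"
  shows "\<phi> \<in> E_class (x1, x2) C Q"
proof -
  have hk: "f integrable_on {a..b}" if "set_integrable lebesgue {a<..<b} f" for f :: "real \<Rightarrow> real"
    using set_lebesgue_integral_eq_integral(1)[OF that] integrable_on_open_interval_real[of f a b] by simp
  have split: "integral {a..c} f + integral {c..d} f = integral {a..d} f"
    if "a \<le> c" "c \<le> d" "d \<le> b" "set_integrable lebesgue {a<..<b} f" for c d and f :: "real \<Rightarrow> real"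
    by (rule Henstock_Kurzweil_Integration.integral_combine[OF that(1,2)])
       (rule integrable_on_subinterval[OF hk[OF that(4)]], use that in auto)
  have "good C \<phi> c d" if cd: "a \<le> c" "c < d" "d \<le> b" for c d
  proof -
    have "integral {c..d} (\<lambda>t. exp (\<phi> t)) \<le> (d - c) * h (integral {c..d} \<phi> / (d - c))" if cN: "c < N" "a < c"
    proof (rule ray[OF h(1), where la = "c - a" and ?A1.0 = "integral {a..c} \<phi>" and ?A2.0 = "integral {a..c} (\<lambda>t. exp (\<phi> t))"])
      show "(c - a) * h (integral {a..c} \<phi> / (c - a)) \<le> integral {a..c} (\<lambda>t. exp (\<phi> t))"
        using lo[of c] cN by simp
      show "integral {a..c} (\<lambda>t. exp (\<phi> t)) + integral {c..d} (\<lambda>t. exp (\<phi> t))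
          \<le> (c - a + (d - c)) * h ((integral {a..c} \<phi> + integral {c..d} \<phi>) / (c - a + (d - c)))"
        using split[OF cd(1) _ cd(3) int(1)] split[OF cd(1) _ cd(3) int(2)] hi[of d] cd by simp
    qed (use cN cd in auto)
    then consider "c = a" | "N \<le> c" | "integral {c..d} (\<lambda>t. exp (\<phi> t)) \<le> (d - c) * h (integral {c..d} \<phi> / (d - c))"
      using cd by fastforce
    then show ?thesis
    proof cases
      case 1
      have "integral {c..d} (\<lambda>t. exp (\<phi> t)) \<le> (d - c) * h (integral {c..d} \<phi> / (d - c))" using 1 hi[of d] cd by simp
      also have "\<dots> \<le> (d - c) * (C * exp (integral {c..d} \<phi> / (d - c)))" using h(2) cd by (intro mult_left_mono) auto
      finally show ?thesis by (simp add: good_def mult_ac)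
    next
      case 2
      then show ?thesis using rest cd by simp
    next
      case 3
      also have "(d - c) * h (integral {c..d} \<phi> / (d - c)) \<le> (d - c) * (C * exp (integral {c..d} \<phi> / (d - c)))"
        using h(2) cd by (intro mult_left_mono) auto
      finally show ?thesis by (simp add: good_def mult_ac)
    qed
  qed
  then show ?thesis unfolding E_class_iff[OF ab Q] using int x by (auto simp: good_def)
qed

text \<open>If all points \<open>(\<phi> t, exp (\<phi> t))\<close> lie on or below one tangent of
  the upper curve, so does their average, and the tangent lies below the upper curve.\<close>

lemma good_pointwise:
  assumes xi: "\<xi> < 1" "exp (- \<xi>) = C * (1 - \<xi>)" and cd: "c < d"
    and int: "\<phi> integrable_on {c..d}" "(\<lambda>t. exp (\<phi> t)) integrable_on {c..d}"
    and le: "\<And>t. c < t \<Longrightarrow> t < d \<Longrightarrow> exp (\<phi> t) \<le> tline \<xi> (\<phi> t) w"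
  shows "good C \<phi> c d"
proof -
  define k where "k = exp w / (1 - \<xi>)"
  define k0 where "k0 = exp w * (1 - w / (1 - \<xi>))"
  have tl: "tline \<xi> y w = k * y + k0" for y
    unfolding tline_def k_def k0_def by (simp add: diff_divide_distrib algebra_simps)
  have "integral {c..d} (\<lambda>t. exp (\<phi> t)) = integral {c<..<d} (\<lambda>t. exp (\<phi> t))" by (rule integral_open_interval_real)
  also have "\<dots> \<le> integral {c<..<d} (\<lambda>t. k * \<phi> t + k0)"
  proof (rule integral_le)
    show "(\<lambda>t. exp (\<phi> t)) integrable_on {c<..<d}" using int by (simp add: integrable_on_open_interval_real)
    have "(\<lambda>t. k * \<phi> t + k0) integrable_on {c..d}"
      using int by (intro integrable_add integrable_on_mult_right) auto
    then show "(\<lambda>t. k * \<phi> t + k0) integrable_on {c<..<d}" by (simp add: integrable_on_open_interval_real)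
  qed (use le tl in auto)
  also have "\<dots> = integral {c..d} (\<lambda>t. k * \<phi> t + k0)" by (rule integral_open_interval_real[symmetric])
  also have "\<dots> = k * integral {c..d} \<phi> + k0 * (d - c)"
    using int cd by (subst Henstock_Kurzweil_Integration.integral_add) (auto intro: integrable_on_mult_right)
  also have "\<dots> = (d - c) * tline \<xi> (integral {c..d} \<phi> / (d - c)) w" unfolding tl using cd by (simp add: field_simps)
  also have "\<dots> \<le> (d - c) * (C * exp (integral {c..d} \<phi> / (d - c)))"
    using tline_le_upper[OF xi] cd by (intro mult_left_mono) auto
  finally show ?thesis by (simp add: good_def mult_ac)
qed

lemma set_integrable_concat:
  fixes f :: "real \<Rightarrow> real"
  assumes "set_integrable lebesgue {a<..<n} f" "set_integrable lebesgue {n<..<b} f" "a \<le> n" "n \<le> b"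
  shows "set_integrable lebesgue {a<..<b} f"
proof -
  have "set_integrable lebesgue ({a<..<n} \<union> {n<..<b}) f" using assms by (intro set_integrable_Un) auto
  moreover have "set_integrable lebesgue {a<..<b} f \<longleftrightarrow> set_integrable lebesgue ({a<..<n} \<union> {n<..<b}) f"
    by (rule set_integrable_discrete_difference[of "{n}"]) (use assms in auto)
  ultimately show ?thesis by simp
qed

lemma set_integrable_Ioo_integrable_on:
  fixes f :: "real \<Rightarrow> real"
  assumes "set_integrable lebesgue {a<..<b} f" "a \<le> c" "d \<le> b"
  shows "f integrable_on {c..d}"
proof -
  have "set_integrable lebesgue {c<..<d} f" by (rule set_integrable_subset[OF assms(1)]) (use assms in auto)
  then show ?thesis using set_lebesgue_integral_eq_integral(1) integrable_on_open_interval_real by blast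
qed

lemma integral_concat:
  fixes f :: "real \<Rightarrow> real"
  assumes "set_integrable lebesgue {a<..<b} f" "a \<le> n" "n \<le> d" "d \<le> b"
  shows "integral {a..d} f = integral {a..n} f + integral {n..d} f"
  using Henstock_Kurzweil_Integration.integral_combine[of a n d f] assms
    set_integrable_Ioo_integrable_on[OF assms(1), of a d] by simp

lemma integral_const_Ico:
  fixes f :: "real \<Rightarrow> real"
  assumes "c \<le> d" "\<And>t. c < t \<Longrightarrow> t < d \<Longrightarrow> f t = k"
  shows "integral {c..d} f = k * (d - c)" "set_integrable lebesgue {c<..<d} f"
proof -
  have "integral {c..d} f = integral {c<..<d} f" by (rule integral_open_interval_real)
  also have "\<dots> = integral {c<..<d} (\<lambda>t. k)" by (rule Henstock_Kurzweil_Integration.integral_cong) (use assms in auto)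
  also have "\<dots> = integral {c..d} (\<lambda>t. k)" by (rule integral_open_interval_real[symmetric])
  finally show "integral {c..d} f = k * (d - c)" using assms(1) by simp
  show "set_integrable lebesgue {c<..<d} f"
    by (rule set_integrable_cong[THEN iffD1, OF refl refl _ set_integrable_const_lmeasurable[of _ k]]) (use assms in auto)
qed

lemma integral_const_ext:
  fixes f :: "real \<Rightarrow> real"
  assumes f: "set_integrable lebesgue {a<..<n} f" and nb: "a \<le> n" "n \<le> b" and k: "\<And>t. n < t \<Longrightarrow> t < b \<Longrightarrow> f t = k"
  shows "set_integrable lebesgue {a<..<b} f"
    "n \<le> d \<Longrightarrow> d \<le> b \<Longrightarrow> integral {a..d} f = integral {a..n} f + k * (d - n)"
proof -
  show i: "set_integrable lebesgue {a<..<b} f"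
    by (rule set_integrable_concat[OF f integral_const_Ico(2)]) (use nb k in auto)
  show "integral {a..d} f = integral {a..n} f + k * (d - n)" if "n \<le> d" "d \<le> b"
    using integral_concat[OF i nb(1) that] integral_const_Ico(1)[of n d f k] that k by simp
qed

lemma integral_cong_Ioo:
  fixes f g :: "real \<Rightarrow> real"
  assumes "\<And>t. c < t \<Longrightarrow> t < d \<Longrightarrow> f t = g t"
  shows "integral {c..d} f = integral {c..d} g" "set_integrable lebesgue {c<..<d} g \<Longrightarrow> set_integrable lebesgue {c<..<d} f"
proof -
  have "integral {c<..<d} f = integral {c<..<d} g"
    by (rule Henstock_Kurzweil_Integration.integral_cong) (use assms in auto)
  then show "integral {c..d} f = integral {c..d} g" by (simp flip: integral_open_interval_real)
  show "set_integrable lebesgue {c<..<d} g \<Longrightarrow> set_integrable lebesgue {c<..<d} f"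
    by (subst set_integrable_cong[OF refl refl, of _ f g]) (use assms in auto)
qed

text \<open>Up to \<open>a + \<tau>\<close> the average point over an initial interval is the
  tangency point of the tangent from the current value, so it moves along the upper curve. A
  negative \<open>\<xi>\<close> gives a tail towards minus infinity. The maximum with 0 ends the
  tail at \<open>a + \<tau>\<close> and bounds the function by \<open>u\<close> on one side for
  every \<open>t\<close>.\<close>

definition tailf :: "real \<Rightarrow> real \<Rightarrow> real \<Rightarrow> real \<Rightarrow> real \<Rightarrow> real" where
  "tailf u \<xi> a \<tau> t = u + \<xi> * max 0 (ln (\<tau> / (t - a)))"

lemma tailf_left: "a < t \<Longrightarrow> t \<le> a + \<tau> \<Longrightarrow> tailf u \<xi> a \<tau> t = u + \<xi> * ln (\<tau> / (t - a))"
  using ln_tail_nonneg[of a t \<tau>] by (simp add: tailf_def)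

lemma tailf_right: "0 < \<tau> \<Longrightarrow> a + \<tau> \<le> t \<Longrightarrow> tailf u \<xi> a \<tau> t = u"
  by (simp add: tailf_def max_def ln_le_zero_iff)

lemma tailf_integral_left:
  fixes a d \<tau> u \<xi> :: real
  assumes "0 < \<tau>" "a < d" "d \<le> a + \<tau>" "\<xi> < 1"
  shows "set_integrable lebesgue {a<..<d} (tailf u \<xi> a \<tau>)"
    "set_integrable lebesgue {a<..<d} (\<lambda>t. exp (tailf u \<xi> a \<tau> t))"
    "integral {a..d} (tailf u \<xi> a \<tau>) = (d - a) * (tailf u \<xi> a \<tau> d + \<xi>)"
    "integral {a..d} (\<lambda>t. exp (tailf u \<xi> a \<tau> t)) = (d - a) * exp (tailf u \<xi> a \<tau> d) / (1 - \<xi>)"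
proof -
  let ?T = "\<lambda>t. ln (\<tau> / (t - a))"
  note i = ln_tail_integral[OF assms(1-3)] and e = exp_tail_FTC[OF assms(1,2,4)]
  have ic: "set_integrable lebesgue {a<..<d} (\<lambda>t. u)" by (rule set_integrable_const_lmeasurable) simp
  have g: "set_integrable lebesgue {a<..<d} (\<lambda>t. u + \<xi> * ?T t)" using i(1) ic by auto
  have c1: "tailf u \<xi> a \<tau> t = u + \<xi> * ?T t" if "a < t" "t < d" for t using that assms by (intro tailf_left) auto
  have c2: "exp (tailf u \<xi> a \<tau> t) = exp u * exp (\<xi> * ?T t)" if "a < t" "t < d" for t using c1[OF that] by (simp add: exp_add)
  show "set_integrable lebesgue {a<..<d} (tailf u \<xi> a \<tau>)" by (rule integral_cong_Ioo(2)[OF c1 g])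
  show "set_integrable lebesgue {a<..<d} (\<lambda>t. exp (tailf u \<xi> a \<tau> t))"
    by (rule integral_cong_Ioo(2)[OF c2]) (use e(1) in auto)
  have Ti: "?T integrable_on {a..d}" by (rule set_integrable_Ioo_integrable_on[OF i(1)]) auto
  have "integral {a..d} (tailf u \<xi> a \<tau>) = integral {a..d} (\<lambda>t. u + \<xi> * ?T t)" by (rule integral_cong_Ioo(1)[OF c1])
  also have "\<dots> = u * (d - a) + \<xi> * integral {a..d} ?T"
    using Ti assms(2) by (subst Henstock_Kurzweil_Integration.integral_add) (auto intro: integrable_on_mult_right)
  also have "\<dots> = (d - a) * (tailf u \<xi> a \<tau> d + \<xi>)" unfolding i(2) using tailf_left[of a d \<tau> u \<xi>] assms by (simp add: algebra_simps)
  finally show "integral {a..d} (tailf u \<xi> a \<tau>) = (d - a) * (tailf u \<xi> a \<tau> d + \<xi>)" .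
  have "integral {a..d} (\<lambda>t. exp (tailf u \<xi> a \<tau> t)) = integral {a..d} (\<lambda>t. exp u * exp (\<xi> * ?T t))" by (rule integral_cong_Ioo(1)[OF c2])
  also have "\<dots> = exp u * integral {a..d} (\<lambda>t. exp (\<xi> * ?T t))" by simp
  also have "\<dots> = (d - a) * exp (tailf u \<xi> a \<tau> d) / (1 - \<xi>)" unfolding e(2) using tailf_left[of a d \<tau> u \<xi>] assms by (simp add: exp_add)
  finally show "integral {a..d} (\<lambda>t. exp (tailf u \<xi> a \<tau> t)) = (d - a) * exp (tailf u \<xi> a \<tau> d) / (1 - \<xi>)" .
qed

lemma tailf_integral:
  fixes a b \<tau> u \<xi> :: real
  assumes "0 < \<tau>" "a + \<tau> \<le> b" "\<xi> < 1"
  shows "set_integrable lebesgue {a<..<b} (tailf u \<xi> a \<tau>)"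
    "set_integrable lebesgue {a<..<b} (\<lambda>t. exp (tailf u \<xi> a \<tau> t))"
    "a + \<tau> \<le> d \<Longrightarrow> d \<le> b \<Longrightarrow> integral {a..d} (tailf u \<xi> a \<tau>) = u * (d - a) + \<xi> * \<tau>"
    "a + \<tau> \<le> d \<Longrightarrow> d \<le> b \<Longrightarrow> integral {a..d} (\<lambda>t. exp (tailf u \<xi> a \<tau> t)) = exp u * (d - a + \<tau> * (1 / (1 - \<xi>) - 1))"
proof -
  have ad: "a < a + \<tau>" using assms by simp
  note L = tailf_integral_left[OF assms(1) ad order_refl assms(3), of u]
  have k: "tailf u \<xi> a \<tau> t = u" if "a + \<tau> < t" for t using tailf_right[of \<tau> a t u \<xi>] assms that by simp
  have fin: "tailf u \<xi> a \<tau> (a + \<tau>) = u" using tailf_right[of \<tau> a "a + \<tau>" u \<xi>] assms by simp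
  note E1 = integral_const_ext[OF L(1) _ assms(2), of u] and E2 = integral_const_ext[OF L(2) _ assms(2), of "exp u"]
  show "set_integrable lebesgue {a<..<b} (tailf u \<xi> a \<tau>)" "set_integrable lebesgue {a<..<b} (\<lambda>t. exp (tailf u \<xi> a \<tau> t))"
    using E1(1) E2(1) k assms by auto
  show "integral {a..d} (tailf u \<xi> a \<tau>) = u * (d - a) + \<xi> * \<tau>" if "a + \<tau> \<le> d" "d \<le> b"
    using E1(2)[OF _ _ that] k assms L(3) fin by (simp add: algebra_simps)
  show "integral {a..d} (\<lambda>t. exp (tailf u \<xi> a \<tau> t)) = exp u * (d - a + \<tau> * (1 / (1 - \<xi>) - 1))" if "a + \<tau> \<le> d" "d \<le> b"
    using E2(2)[OF _ _ that] k assms L(4) fin by (simp add: algebra_simps)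
qed

lemma tline_at_tangent: "\<xi> < 1 \<Longrightarrow> tline \<xi> (w + \<xi>) w = exp w / (1 - \<xi>)"
  by (simp add: tline_def field_simps)

text \<open>As \<open>d\<close> grows, the average point first moves along the upper curve and then,
  once the function is constant, slides along the tangent towards \<open>(u, exp u)\<close>. The
  equality of the first phase provides \<open>lo\<close> in \<open>E_classI\<close>.\<close>

lemma tailf_prefix:
  fixes a b \<tau> u \<xi> :: real
  assumes "0 < \<tau>" "a + \<tau> \<le> b" and xi: "\<xi> < 1" "exp (- \<xi>) = C * (1 - \<xi>)" and d: "a < d" "d \<le> b"
  shows "integral {a..d} (\<lambda>t. exp (tailf u \<xi> a \<tau> t)) = (d - a) * tline \<xi> (integral {a..d} (tailf u \<xi> a \<tau>) / (d - a)) (if d \<le> a + \<tau> then tailf u \<xi> a \<tau> d else u)"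
    "d \<le> a + \<tau> \<Longrightarrow> integral {a..d} (\<lambda>t. exp (tailf u \<xi> a \<tau> t)) = (d - a) * (C * exp (integral {a..d} (tailf u \<xi> a \<tau>) / (d - a)))"
proof -
  have A: "integral {a..d} (tailf u \<xi> a \<tau>) / (d - a) = tailf u \<xi> a \<tau> d + \<xi>"
      "integral {a..d} (\<lambda>t. exp (tailf u \<xi> a \<tau> t)) = (d - a) * (exp (tailf u \<xi> a \<tau> d) / (1 - \<xi>))" if "d \<le> a + \<tau>"
    using tailf_integral_left[OF assms(1) d(1) that xi(1), of u] d by auto
  show "integral {a..d} (\<lambda>t. exp (tailf u \<xi> a \<tau> t)) = (d - a) * tline \<xi> (integral {a..d} (tailf u \<xi> a \<tau>) / (d - a)) (if d \<le> a + \<tau> then tailf u \<xi> a \<tau> d else u)"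
  proof (cases "d \<le> a + \<tau>")
    case True
    then show ?thesis using A tline_at_tangent[OF xi(1)] by simp
  next
    case False
    define l where "l = d - a"
    have l: "l > 0" using d by (simp add: l_def)
    have B: "integral {a..d} (tailf u \<xi> a \<tau>) = u * l + \<xi> * \<tau>"
      "integral {a..d} (\<lambda>t. exp (tailf u \<xi> a \<tau> t)) = exp u * (l + \<tau> * (1 / (1 - \<xi>) - 1))"
      using tailf_integral(3,4)[OF assms(1,2) xi(1), of d u] False d by (auto simp: l_def)
    have "1 / (1 - \<xi>) - 1 = \<xi> / (1 - \<xi>)" using xi by (simp add: field_simps)
    moreover have "(u * l + \<xi> * \<tau>) / l - u = \<xi> * \<tau> / l" using l by (simp add: add_divide_distrib)
    moreover have "l * (\<xi> * \<tau> / l / (1 - \<xi>)) = \<tau> * (\<xi> / (1 - \<xi>))" using l by simp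
    then have "l * (exp u * (\<xi> * \<tau> / l / (1 - \<xi>) + 1)) = exp u * (l + \<tau> * (\<xi> / (1 - \<xi>)))" by algebra
    ultimately show ?thesis unfolding B l_def[symmetric] tline_def using False by simp
  qed
  show "integral {a..d} (\<lambda>t. exp (tailf u \<xi> a \<tau> t)) = (d - a) * (C * exp (integral {a..d} (tailf u \<xi> a \<tau>) / (d - a)))"
    if "d \<le> a + \<tau>"
    using A[OF that] upper_tangent_point[OF xi, of "tailf u \<xi> a \<tau> d"] by simp
qed

section \<open>Members of the class\<close>

lemma const_in_E_class:
  assumes C: "1 \<le> C" and ab: "a < b" and Q: "{a<..<b} \<subseteq> Q" "Q \<subseteq> {a..b}"
  shows "(\<lambda>t. u) \<in> E_class (u, exp u) C Q"
  unfolding E_class_iff[OF ab Q] using ab C by (auto intro!: set_integrable_const_lmeasurable)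

text \<open>The length \<open>\<tau>\<close> is adjusted to the first average only; the second is
  then right automatically, because the average point of the whole interval stays on the tangent
  from \<open>u\<close>.\<close>

lemma tailf_in_E_class:
  assumes C: "1 < C" and ab: "a < b" and Q: "{a<..<b} \<subseteq> Q" "Q \<subseteq> {a..b}"
    and xi: "\<xi> < 1" "exp (- \<xi>) = C * (1 - \<xi>)" and tau: "0 < \<tau>" "a + \<tau> \<le> b"
    and x1: "x1 = u + \<xi> * \<tau> / (b - a)"
  shows "tailf u \<xi> a \<tau> \<in> E_class (x1, tline \<xi> x1 u) C Q"
proof (rule E_classI[OF _ ab Q, where h = "\<lambda>y. C * exp y" and N = "a + \<tau>"])
  note I = tailf_integral[OF tau xi(1), where u = u]
  show "set_integrable lebesgue {a<..<b} (tailf u \<xi> a \<tau>)" "set_integrable lebesgue {a<..<b} (\<lambda>t. exp (tailf u \<xi> a \<tau> t))"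
    using I by auto
  show i1: "integral {a..b} (tailf u \<xi> a \<tau>) = (b - a) * x1"
    using I(3)[of b] tau ab unfolding x1 by (simp add: distrib_left mult.commute)
  show "integral {a..b} (\<lambda>t. exp (tailf u \<xi> a \<tau> t)) = (b - a) * tline \<xi> x1 u"
    using tailf_prefix(1)[OF tau xi ab order_refl, of u] tailf_right[of \<tau> a b u \<xi>] tau ab unfolding i1
    by (cases "b \<le> a + \<tau>") auto
  show "\<exists>k. \<forall>y. C * exp X + k * (y - X) \<le> C * exp y" for X by (rule exp_supporting) (use C in simp)
  show "(c - a) * (C * exp (integral {a..c} (tailf u \<xi> a \<tau>) / (c - a))) \<le> integral {a..c} (\<lambda>t. exp (tailf u \<xi> a \<tau> t))"
    if "a < c" "c \<le> a + \<tau>" for c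
    using tailf_prefix(2)[OF tau xi that(1) _ that(2), of u] tau that by simp
  show "integral {a..d} (\<lambda>t. exp (tailf u \<xi> a \<tau> t)) \<le> (d - a) * (C * exp (integral {a..d} (tailf u \<xi> a \<tau>) / (d - a)))"
    if "a < d" "d \<le> b" for d
    unfolding tailf_prefix(1)[OF tau xi that, of u] using tline_le_upper[OF xi] that by (intro mult_left_mono) auto
  show "good C (tailf u \<xi> a \<tau>) c d" if "a \<le> c" "a + \<tau> \<le> c" "c < d" "d \<le> b" for c d
  proof (rule good_pointwise[OF xi that(3), where w = u])
    show "tailf u \<xi> a \<tau> integrable_on {c..d}" "(\<lambda>t. exp (tailf u \<xi> a \<tau> t)) integrable_on {c..d}"
      using I(1,2) that by (auto intro: set_integrable_Ioo_integrable_on)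
    show "exp (tailf u \<xi> a \<tau> t) \<le> tline \<xi> (tailf u \<xi> a \<tau> t) u" if "c < t" "t < d" for t
      using tailf_right[of \<tau> a t u \<xi>] that tau \<open>a + \<tau> \<le> c\<close> by (simp add: tline_def)
  qed
qed (use C in auto)

text \<open>Both values have their boundary points on or below the \<open>xi_minus\<close> tangent
  from \<open>lam\<close>, so \<open>good_pointwise\<close> settles all subintervals at once. The
  lower bound on \<open>v\<close> is the second crossing of this tangent with the lower
  curve.\<close>

lemma two_valued_in_E_class:
  assumes C: "1 < C" and ab: "a < b" and Q: "{a<..<b} \<subseteq> Q" "Q \<subseteq> {a..b}"
    and v: "lam + xi_minus C - xi_plus C \<le> v" "v \<le> lam" and g: "a \<le> \<gamma>" "\<gamma> \<le> b"
    and x: "(b - a) * x1 = (\<gamma> - a) * lam + (b - \<gamma>) * v" "(b - a) * x2 = (\<gamma> - a) * exp lam + (b - \<gamma>) * exp v"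
  shows "(\<lambda>t. if t < \<gamma> then lam else v) \<in> E_class (x1, x2) C Q"
proof -
  let ?\<phi> = "\<lambda>t. if t < \<gamma> then lam else v"
  let ?z = "xi_minus C"
  note xi = xi_plus_props[OF C] xi_minus_props[OF C]
  have z1: "?z < 1" using xi by simp
  have i0: "set_integrable lebesgue {a<..<\<gamma>} ?\<phi>" "integral {a..\<gamma>} ?\<phi> = lam * (\<gamma> - a)"
    "set_integrable lebesgue {a<..<\<gamma>} (\<lambda>t. exp (?\<phi> t))" "integral {a..\<gamma>} (\<lambda>t. exp (?\<phi> t)) = exp lam * (\<gamma> - a)"
    using g by (auto intro!: integral_const_Ico)
  note E1 = integral_const_ext[OF i0(1) g, of v] and E2 = integral_const_ext[OF i0(3) g, of "exp v"]
  have int: "set_integrable lebesgue {a<..<b} ?\<phi>" "set_integrable lebesgue {a<..<b} (\<lambda>t. exp (?\<phi> t))"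
    by (rule E1 E2, simp)+
  have tot: "integral {a..b} ?\<phi> = (b - a) * x1" "integral {a..b} (\<lambda>t. exp (?\<phi> t)) = (b - a) * x2"
    unfolding x using E1(2)[of b] E2(2)[of b] g i0 by (auto simp: algebra_simps)
  \<comment> \<open>By convexity of \<open>exp\<close> only the ends of the range of
    \<open>v\<close> matter: \<open>lam\<close>, where the tangent starts, and
    \<open>lam - r\<close>, where it meets the lower curve again.\<close>
  have ev: "exp v \<le> tline ?z v lam"
  proof -
    define r where "r = xi_plus C - ?z"
    have r: "0 < r" using xi by (simp add: r_def)
    define s where "s = (lam - v) / r"
    have s: "0 \<le> s" "s \<le> 1" using v r by (auto simp: s_def r_def divide_le_eq)
    have vs: "v - lam = (1 - s) * 0 + s * (- r)" using r by (simp add: s_def)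
    have "exp (v - lam) \<le> (1 - s) * exp 0 + s * exp (- r)"
      unfolding vs using convex_onD[OF exp_convex s, of 0 "- r"] by simp
    also have "exp (- r) = 1 - r / (1 - ?z)" using exp_xi_diff[OF C] xi by (simp add: r_def field_simps)
    also have "(1 - s) * exp 0 + s * (1 - r / (1 - ?z)) = (v - lam) / (1 - ?z) + 1"
      unfolding vs by (simp add: algebra_simps)
    finally have "exp lam * exp (v - lam) \<le> tline ?z v lam" unfolding tline_def by (intro mult_left_mono) auto
    then show ?thesis by (simp flip: exp_add)
  qed
  show ?thesis
    unfolding E_class_iff[OF ab Q] fst_conv snd_conv
  proof (intro conjI allI impI int tot)
    fix c d assume cd: "a \<le> c" "c < d" "d \<le> b"
    have "good C ?\<phi> c d"
      by (rule good_pointwise[OF z1 xi(5) cd(2), where w = lam])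
         (use int cd ev in \<open>auto intro: set_integrable_Ioo_integrable_on simp: tline_def\<close>)
    then show "integral {c..d} (\<lambda>t. exp (?\<phi> t)) \<le> C * (d - c) * exp (integral {c..d} ?\<phi> / (d - c))"
      by (simp add: good_def)
  qed
qed

lemma exp_tangent_le: "exp X * (1 + (y - X)) \<le> exp y" for X y :: real
  using exp_gap_nonneg[of y X] by (simp add: algebra_simps)

text \<open>The graph is the upper curve up to \<open>s0\<close>, continued by its tangent there: a
  convex minorant adapted to test functions whose initial averages begin on that tangent.\<close>

lemma exp_then_line_supporting:
  fixes C s0 X :: real
  assumes C: "0 \<le> C"
  shows "\<exists>k. \<forall>y. (if X \<le> s0 then C * exp X else C * exp s0 * (1 + (X - s0))) + k * (y - X)
     \<le> (if y \<le> s0 then C * exp y else C * exp s0 * (1 + (y - s0)))"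
proof -
  have e: "C * exp X * (1 + (y - X)) \<le> C * exp y" for X y
    using mult_left_mono[OF exp_tangent_le[of X y] C] by (simp add: mult.assoc)
  show ?thesis
  proof (cases "X \<le> s0")
    case True
    show ?thesis
    proof (intro exI[of _ "C * exp X"] allI)
      fix y
      have "C * exp X * (y - s0) \<le> C * exp s0 * (y - s0)" if "s0 < y"
        using True C that by (intro mult_right_mono mult_left_mono) auto
      then show "(if X \<le> s0 then C * exp X else C * exp s0 * (1 + (X - s0))) + C * exp X * (y - X)
        \<le> (if y \<le> s0 then C * exp y else C * exp s0 * (1 + (y - s0)))"
        using True e[of X y] e[of X s0] by (auto simp: algebra_simps)
    qed
  next
    case False
    then show ?thesis using e[of s0] by (intro exI[of _ "C * exp s0"]) (auto simp: algebra_simps)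
  qed
qed

lemma line_then_exp_supporting:
  fixes C s0 X :: real
  assumes C: "0 \<le> C"
  shows "\<exists>k. \<forall>y. (if s0 \<le> X then C * exp X else C * exp s0 * (1 + (X - s0))) + k * (y - X)
     \<le> (if s0 \<le> y then C * exp y else C * exp s0 * (1 + (y - s0)))"
proof -
  have e: "C * exp X * (1 + (y - X)) \<le> C * exp y" for X y
    using mult_left_mono[OF exp_tangent_le[of X y] C] by (simp add: mult.assoc)
  show ?thesis
  proof (cases "s0 \<le> X")
    case True
    show ?thesis
    proof (intro exI[of _ "C * exp X"] allI)
      fix y
      have "C * exp X * (y - s0) \<le> C * exp s0 * (y - s0)" if "y < s0"
        using True C that by (intro mult_right_mono_neg mult_left_mono) auto
      then show "(if s0 \<le> X then C * exp X else C * exp s0 * (1 + (X - s0))) + C * exp X * (y - X)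
        \<le> (if s0 \<le> y then C * exp y else C * exp s0 * (1 + (y - s0)))"
        using True e[of X y] e[of X s0] by (auto simp: algebra_simps)
    qed
  next
    case False
    then show ?thesis using e[of s0] by (intro exI[of _ "C * exp s0"]) (auto simp: algebra_simps)
  qed
qed

text \<open>This explains the constant in the regions of \<open>D_cand\<close>: it is the abscissa
  at which the tangent drawn from \<open>lam\<close> to the left crosses the lower curve a second
  time.\<close>

lemma tline_lower_point:
  assumes "C > 1"
  shows "exp (lam + xi_minus C - xi_plus C) = tline (xi_minus C) (lam + xi_minus C - xi_plus C) lam"
proof -
  have "exp (lam + xi_minus C - xi_plus C) = exp lam * exp (xi_minus C - xi_plus C)" by (simp flip: exp_add)
  also have "exp (xi_minus C - xi_plus C) = (xi_minus C - xi_plus C) / (1 - xi_minus C) + 1"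
    unfolding exp_xi_diff[OF assms] using xi_minus_props[OF assms] by (simp add: field_simps)
  finally show ?thesis by (simp add: tline_def)
qed

lemma integral_tline:
  assumes cd: "c < d" and int: "\<phi> integrable_on {c..d}"
    and eq: "\<And>t. c < t \<Longrightarrow> t < d \<Longrightarrow> exp (\<phi> t) = tline \<xi> (\<phi> t) w"
  shows "integral {c..d} (\<lambda>t. exp (\<phi> t)) = (d - c) * tline \<xi> (integral {c..d} \<phi> / (d - c)) w"
proof -
  define k where "k = exp w / (1 - \<xi>)"
  define k0 where "k0 = exp w * (1 - w / (1 - \<xi>))"
  have tl: "tline \<xi> y w = k * y + k0" for y
    unfolding tline_def k_def k0_def by (simp add: diff_divide_distrib algebra_simps)
  have "integral {c..d} (\<lambda>t. exp (\<phi> t)) = integral {c..d} (\<lambda>t. k * \<phi> t + k0)"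
    by (rule integral_cong_Ioo(1)) (use eq tl in auto)
  also have "\<dots> = k * integral {c..d} \<phi> + k0 * (d - c)"
    using int cd by (subst Henstock_Kurzweil_Integration.integral_add) (auto intro: integrable_on_mult_right)
  also have "\<dots> = (d - c) * tline \<xi> (integral {c..d} \<phi> / (d - c)) w" unfolding tl using cd by (simp add: field_simps)
  finally show ?thesis .
qed

text \<open>The extremal function for the angle at \<open>lam\<close>: a tail, then the constant
  \<open>lam\<close>, then the low value at which the left tangent recrosses the lower curve. The
  last two boundary points lie on that tangent, so only initial intervals need care.\<close>

lemma tail_step_in_E_class:
  assumes C: "1 < C" and ab: "a < b" and Q: "{a<..<b} \<subseteq> Q" "Q \<subseteq> {a..b}"
  defines "\<xi> \<equiv> xi_plus C" and "z \<equiv> xi_minus C"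
  assumes al: "0 < \<alpha>" "a + \<alpha> \<le> \<gamma>" "\<gamma> \<le> b"
    and x: "(b - a) * x1 = lam * (b - a) + \<xi> * \<alpha> + (z - \<xi>) * (b - \<gamma>)"
      "(b - a) * x2 = exp lam * (\<gamma> - a + \<alpha> * (1 / (1 - \<xi>) - 1)) + exp (lam + z - \<xi>) * (b - \<gamma>)"
    and xO: "x2 \<le> C * exp x1" "lam + z \<le> x1"
  shows "(\<lambda>t. if t < \<gamma> then tailf lam \<xi> a \<alpha> t else lam + z - \<xi>) \<in> E_class (x1, x2) C Q" (is "?\<phi> \<in> _")
proof -
  note xi = xi_plus_props[OF C, folded \<xi>_def] xi_minus_props[OF C, folded z_def]
  have z1: "z < 1" using xi by simp
  define v where "v = lam + z - \<xi>"
  note I = tailf_integral[OF al(1,2) xi(2), where u = lam]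
  have i0: "set_integrable lebesgue {a<..<\<gamma>} ?\<phi>" "set_integrable lebesgue {a<..<\<gamma>} (\<lambda>t. exp (?\<phi> t))"
    by (rule integral_cong_Ioo(2)[OF _ I(1)], simp, rule integral_cong_Ioo(2)[OF _ I(2)], simp)
  have pre: "integral {a..d} ?\<phi> = integral {a..d} (tailf lam \<xi> a \<alpha>)"
    "integral {a..d} (\<lambda>t. exp (?\<phi> t)) = integral {a..d} (\<lambda>t. exp (tailf lam \<xi> a \<alpha> t))" if "d \<le> \<gamma>" for d
    by (rule integral_cong_Ioo(1), use that in auto)+
  have ag: "a \<le> \<gamma>" using al by simp
  note E1 = integral_const_ext[OF i0(1) ag al(3), of v] and E2 = integral_const_ext[OF i0(2) ag al(3), of "exp v"]
  have int: "set_integrable lebesgue {a<..<b} ?\<phi>" "set_integrable lebesgue {a<..<b} (\<lambda>t. exp (?\<phi> t))"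
    by (rule E1 E2, simp add: v_def)+
  have tot: "integral {a..b} ?\<phi> = (b - a) * x1" "integral {a..b} (\<lambda>t. exp (?\<phi> t)) = (b - a) * x2"
    unfolding x using E1(2)[of b] E2(2)[of b] al I(3)[of \<gamma>] I(4)[of \<gamma>] pre[of \<gamma>] by (auto simp: v_def algebra_simps)
  have upper: "integral {a..d} (\<lambda>t. exp (tailf lam \<xi> a \<alpha> t)) \<le> (d - a) * (C * exp (integral {a..d} (tailf lam \<xi> a \<alpha>) / (d - a)))"
    if "a < d" "d \<le> \<gamma>" for d
    unfolding tailf_prefix(1)[OF al(1,2) xi(2,3) that, of lam] using tline_le_upper[OF xi(2,3)] that by (intro mult_left_mono) auto
  show ?thesis
  proof (rule E_classI[OF _ ab Q int tot, where h = "\<lambda>y. C * exp y" and N = "a + \<alpha>"])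
    show "\<exists>k. \<forall>y. C * exp X + k * (y - X) \<le> C * exp y" for X by (rule exp_supporting) (use C in simp)
    show "(c - a) * (C * exp (integral {a..c} ?\<phi> / (c - a))) \<le> integral {a..c} (\<lambda>t. exp (?\<phi> t))"
      if "a < c" "c \<le> a + \<alpha>" for c
      using tailf_prefix(2)[OF al(1,2) xi(2,3) that(1) _ that(2), of lam] pre[of c] that al by simp
    show "integral {a..d} (\<lambda>t. exp (?\<phi> t)) \<le> (d - a) * (C * exp (integral {a..d} ?\<phi> / (d - a)))"
      if d: "a < d" "d \<le> b" for d
    proof -
      consider "d \<le> \<gamma>" | "d = b" | "\<gamma> < d" "d < b" using d by linarith
      then show ?thesis
      proof cases
        case 1
        then show ?thesis using upper[OF d(1) 1] pre[OF 1] by simp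
      next
        case 2
        then show ?thesis using tot xO(1) ab by simp
      next
        case 3
        \<comment> \<open>For an initial interval ending inside the last step, \<open>ray\<close> is
          used from the right: the remaining piece \<open>{d..b}\<close> gives a point on the graph
          of \<open>h\<close>, the whole interval a point on or below it. \<open>h\<close> follows
          the tangent to the left of \<open>lam + z\<close> so that it passes through
          \<open>(v, exp v)\<close>.\<close>
        define h where "h y = (if lam + z \<le> y then C * exp y else C * exp (lam + z) * (1 + (y - (lam + z))))" for y
        have hv: "h v = exp v"
          using tline_lower_point[OF C, of lam, folded \<xi>_def z_def] xi tline_eq_tangent[OF z1 xi(5), of v lam]
          by (simp add: h_def v_def)
        have hx: "h x1 = C * exp x1" using xO(2) by (simp add: h_def)
        have hle: "h y \<le> C * exp y" for y
          using mult_left_mono[OF exp_tangent_le[of "lam + z" y], of C] C by (simp add: h_def mult.assoc)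
        have last: "integral {d..b} ?\<phi> = v * (b - d)" "integral {d..b} (\<lambda>t. exp (?\<phi> t)) = exp v * (b - d)"
          using 3 by (auto intro!: integral_const_Ico(1) simp: v_def)
        have sp: "integral {a..b} ?\<phi> = integral {a..d} ?\<phi> + integral {d..b} ?\<phi>"
          "integral {a..b} (\<lambda>t. exp (?\<phi> t)) = integral {a..d} (\<lambda>t. exp (?\<phi> t)) + integral {d..b} (\<lambda>t. exp (?\<phi> t))"
          using integral_concat[OF int(1), of d b] integral_concat[OF int(2), of d b] d by auto
        have "integral {a..d} (\<lambda>t. exp (?\<phi> t)) \<le> (d - a) * h (integral {a..d} ?\<phi> / (d - a))"
        proof (rule ray[where la = "b - d" and ?A1.0 = "v * (b - d)" and ?A2.0 = "exp v * (b - d)"])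
          show "\<exists>k. \<forall>y. h X + k * (y - X) \<le> h y" for X
            unfolding h_def by (rule line_then_exp_supporting) (use C in simp)
          show "(b - d) * h (v * (b - d) / (b - d)) \<le> exp v * (b - d)" using 3 hv by simp
          have "exp v * (b - d) + integral {a..d} (\<lambda>t. exp (?\<phi> t)) = (b - a) * x2" using sp(2) last(2) tot(2) by simp
          also have "\<dots> \<le> (b - a) * h x1" unfolding hx using xO(1) ab by (intro mult_left_mono) auto
          also have "x1 = (v * (b - d) + integral {a..d} ?\<phi>) / (b - d + (d - a))"
            using sp(1) last(1) tot(1) ab by (simp add: eq_divide_eq mult.commute)
          finally show "exp v * (b - d) + integral {a..d} (\<lambda>t. exp (?\<phi> t))
            \<le> (b - d + (d - a)) * h ((v * (b - d) + integral {a..d} ?\<phi>) / (b - d + (d - a)))" by simp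
        qed (use 3 d in auto)
        also have "\<dots> \<le> (d - a) * (C * exp (integral {a..d} ?\<phi> / (d - a)))" using hle d by (intro mult_left_mono) auto
        finally show ?thesis .
      qed
    qed
    show "good C ?\<phi> c d" if "a \<le> c" "a + \<alpha> \<le> c" "c < d" "d \<le> b" for c d
    proof (rule good_pointwise[OF z1 xi(5) that(3), where w = lam])
      show "?\<phi> integrable_on {c..d}" "(\<lambda>t. exp (?\<phi> t)) integrable_on {c..d}"
        using int that by (auto intro!: set_integrable_Ioo_integrable_on)
      show "exp (?\<phi> t) \<le> tline z (?\<phi> t) lam" if "c < t" "t < d" for t
        using tailf_right[of \<alpha> a t lam \<xi>] that al \<open>a + \<alpha> \<le> c\<close> tline_lower_point[OF C, of lam, folded \<xi>_def z_def]
        by (simp add: tline_def)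
    qed
  qed (use C in auto)
qed

text \<open>Over \<open>{a..a + \<alpha>}\<close> the tail stays above \<open>lam - r\<close> and
  its average point is the tangency point over \<open>lam + z\<close>. The boundary points of
  \<open>lam\<close> and \<open>lam - r\<close> lie on that same tangent, so a
  \<open>\<kappa>\<close> that matches the average of the function also matches the average of its
  exponential, and longer initial intervals do not notice the replacement.\<close>

lemma capped_tail_in_E_class:
  assumes C: "1 < C" and ab: "a < b" and Q: "{a<..<b} \<subseteq> Q" "Q \<subseteq> {a..b}"
  defines "\<xi> \<equiv> xi_plus C" and "z \<equiv> xi_minus C"
  defines "r \<equiv> \<xi> - z"
  assumes tau: "0 < \<tau>" "a + \<tau> \<le> b" and x1: "x1 = u + \<xi> * \<tau> / (b - a)" and u: "u \<le> lam - r"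
  defines "\<alpha> \<equiv> \<tau> * exp ((u + r - lam) / \<xi>)"
  defines "\<kappa> \<equiv> \<alpha> * \<xi> / r"
  shows "(\<lambda>t. if t < a + \<kappa> then lam else if t < a + \<alpha> then lam - r else tailf u \<xi> a \<tau> t) \<in> E_class (x1, tline \<xi> x1 u) C Q" (is "?\<phi> \<in> _")
    "0 < \<kappa>" "\<kappa> < \<alpha>" "\<alpha> \<le> \<tau>" "\<And>t. a + \<alpha> \<le> t \<Longrightarrow> tailf u \<xi> a \<tau> t \<le> lam - r"
proof -
  note xi = xi_plus_props[OF C, folded \<xi>_def] xi_minus_props[OF C, folded z_def]
  have z1: "z < 1" using xi by simp
  have r: "\<xi> < r" "0 < r" using xi by (auto simp: r_def)
  have al: "0 < \<alpha>" using tau by (simp add: \<alpha>_def)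
  show ka: "0 < \<kappa>" using al xi r by (simp add: \<kappa>_def)
  show ka2: "\<kappa> < \<alpha>" using al xi r by (simp add: \<kappa>_def divide_less_eq)
  have "(u + r - lam) / \<xi> \<le> 0" using u xi by (simp add: divide_le_0_iff)
  then show at: "\<alpha> \<le> \<tau>" using tau unfolding \<alpha>_def by (simp add: mult_left_le)
  \<comment> \<open>\<open>\<alpha>\<close> is the distance from \<open>a\<close> at which the tail
    passes the level \<open>lam - r\<close>.\<close>
  have Tal: "tailf u \<xi> a \<tau> (a + \<alpha>) = lam - r"
  proof -
    have "tailf u \<xi> a \<tau> (a + \<alpha>) = u + \<xi> * ln (\<tau> / \<alpha>)" using tailf_left[of a "a + \<alpha>" \<tau> u \<xi>] al at by simp
    also have "\<tau> / \<alpha> = exp (- ((u + r - lam) / \<xi>))" using tau by (simp add: \<alpha>_def exp_minus divide_inverse)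
    finally show ?thesis using xi(1) by simp
  qed
  show mono: "tailf u \<xi> a \<tau> t \<le> lam - r" if "a + \<alpha> \<le> t" for t
  proof -
    have "max 0 (ln (\<tau> / (t - a))) \<le> max 0 (ln (\<tau> / (a + \<alpha> - a)))"
      using that al tau by (intro max.mono order_refl) (auto intro!: divide_left_mono)
    then have "tailf u \<xi> a \<tau> t \<le> tailf u \<xi> a \<tau> (a + \<alpha>)" unfolding tailf_def using xi by (simp add: mult_left_mono)
    then show ?thesis using Tal by simp
  qed
  note I = tailf_integral[OF tau xi(2), where u = u]
  have k0: "set_integrable lebesgue {a<..<a + \<kappa>} ?\<phi>" "integral {a..a + \<kappa>} ?\<phi> = lam * \<kappa>"
    "set_integrable lebesgue {a<..<a + \<kappa>} (\<lambda>t. exp (?\<phi> t))"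
    using ka integral_const_Ico[of a "a + \<kappa>" ?\<phi> lam] integral_const_Ico[of a "a + \<kappa>" "\<lambda>t. exp (?\<phi> t)" "exp lam"] by auto
  have kk: "a \<le> a + \<kappa>" "a + \<kappa> \<le> a + \<alpha>" using ka ka2 by auto
  note E1 = integral_const_ext[OF k0(1) kk, of "lam - r"] and E2 = integral_const_ext[OF k0(3) kk, of "exp (lam - r)"]
  have al_int: "set_integrable lebesgue {a<..<a + \<alpha>} ?\<phi>" "set_integrable lebesgue {a<..<a + \<alpha>} (\<lambda>t. exp (?\<phi> t))"
    by (rule E1 E2, simp)+
  have ri: "set_integrable lebesgue {a + \<alpha><..<b} ?\<phi>" "set_integrable lebesgue {a + \<alpha><..<b} (\<lambda>t. exp (?\<phi> t))"
  proof -
    have s: "{a + \<alpha><..<b} \<subseteq> {a<..<b}" using al by auto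
    have t: "set_integrable lebesgue {a + \<alpha><..<b} (tailf u \<xi> a \<tau>)" "set_integrable lebesgue {a + \<alpha><..<b} (\<lambda>t. exp (tailf u \<xi> a \<tau> t))"
      using I(1,2) s by (auto intro: set_integrable_subset)
    show "set_integrable lebesgue {a + \<alpha><..<b} ?\<phi>"
      by (rule integral_cong_Ioo(2)[OF _ t(1)]) (use ka2 in simp)
    show "set_integrable lebesgue {a + \<alpha><..<b} (\<lambda>t. exp (?\<phi> t))"
      by (rule integral_cong_Ioo(2)[OF _ t(2)]) (use ka2 in simp)
  qed
  have int: "set_integrable lebesgue {a<..<b} ?\<phi>" "set_integrable lebesgue {a<..<b} (\<lambda>t. exp (?\<phi> t))"
    using set_integrable_concat[OF al_int(1) ri(1)] set_integrable_concat[OF al_int(2) ri(2)] al at tau by auto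
  have val: "exp (?\<phi> t) = tline z (?\<phi> t) lam" if "a < t" "t < a + \<alpha>" for t
    using that tline_lower_point[OF C, of lam, folded \<xi>_def z_def] by (auto simp: tline_def r_def algebra_simps)
  have I1: "integral {a..c} ?\<phi> = (if c \<le> a + \<kappa> then lam * (c - a) else lam * \<kappa> + (lam - r) * (c - (a + \<kappa>)))"
    if "a < c" "c \<le> a + \<alpha>" for c
    using E1(2)[of c] k0(2) that integral_const_Ico(1)[of a c ?\<phi> lam] by auto
  have I2: "integral {a..c} (\<lambda>t. exp (?\<phi> t)) = (c - a) * tline z (integral {a..c} ?\<phi> / (c - a)) lam" if "a < c" "c \<le> a + \<alpha>" for c
    by (rule integral_tline) (use that val set_integrable_Ioo_integrable_on[OF al_int(1), of a c] in auto)
  have low: "lam + z \<le> integral {a..c} ?\<phi> / (c - a)" if "a < c" "c \<le> a + \<alpha>" for c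
  proof -
    have "(lam + z) * (c - a) \<le> integral {a..c} ?\<phi>"
    proof (cases "c \<le> a + \<kappa>")
      case True
      have "z * (c - a) \<le> 0" using xi that by (simp add: mult_nonpos_nonneg)
      then show ?thesis unfolding I1[OF that] using True by (simp add: algebra_simps)
    next
      case False
      have "r * \<kappa> = \<alpha> * \<xi>" using r by (simp add: \<kappa>_def)
      moreover have "\<xi> * (c - a) \<le> \<xi> * \<alpha>" using that xi by (intro mult_left_mono) auto
      ultimately have "(r + z) * (c - a) \<le> r * \<kappa>" unfolding r_def by (simp add: mult.commute)
      then show ?thesis unfolding I1[OF that] using False by (simp add: algebra_simps)
    qed
    then show ?thesis using that by (simp add: le_divide_eq)
  qed
  have aal: "integral {a..a + \<alpha>} ?\<phi> = integral {a..a + \<alpha>} (tailf u \<xi> a \<tau>)"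
    "integral {a..a + \<alpha>} (\<lambda>t. exp (?\<phi> t)) = integral {a..a + \<alpha>} (\<lambda>t. exp (tailf u \<xi> a \<tau> t))"
  proof -
    have aa: "a < a + \<alpha>" "a + \<alpha> \<le> a + \<tau>" using al at by auto
    note L = tailf_integral_left[OF tau(1) aa xi(2), of u, unfolded Tal]
    have "r * \<kappa> = \<alpha> * \<xi>" using r by (simp add: \<kappa>_def)
    moreover have "integral {a..a + \<alpha>} ?\<phi> = lam * \<kappa> + (lam - r) * (\<alpha> - \<kappa>)" using I1[of "a + \<alpha>"] al ka2 by auto
    ultimately have i1: "integral {a..a + \<alpha>} ?\<phi> = \<alpha> * (lam - r + \<xi>)" by (simp add: algebra_simps)
    then show "integral {a..a + \<alpha>} ?\<phi> = integral {a..a + \<alpha>} (tailf u \<xi> a \<tau>)" unfolding L by simp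
    have "integral {a..a + \<alpha>} (\<lambda>t. exp (?\<phi> t)) = \<alpha> * tline z (lam + z) lam"
    proof -
      have "integral {a..a + \<alpha>} ?\<phi> / (a + \<alpha> - a) = lam + z" unfolding i1 using al by (simp add: r_def)
      then show ?thesis using I2[OF aa(1) order_refl] by simp
    qed
    also have "tline z (lam + z) lam = exp lam / (1 - z)" by (rule tline_at_tangent[OF z1])
    also have "exp lam / (1 - z) = exp (lam - r) / (1 - \<xi>)"
    proof -
      have "exp (lam - r) = exp lam * exp (z - \<xi>)" by (simp add: r_def flip: exp_add)
      also have "exp (z - \<xi>) = (1 - \<xi>) / (1 - z)" using exp_xi_diff[OF C] by (simp add: \<xi>_def z_def)
      finally show ?thesis using xi by simp
    qed
    finally show "integral {a..a + \<alpha>} (\<lambda>t. exp (?\<phi> t)) = integral {a..a + \<alpha>} (\<lambda>t. exp (tailf u \<xi> a \<tau> t))" unfolding L by simp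
  qed
  have same: "integral {a..d} ?\<phi> = integral {a..d} (tailf u \<xi> a \<tau>)"
    "integral {a..d} (\<lambda>t. exp (?\<phi> t)) = integral {a..d} (\<lambda>t. exp (tailf u \<xi> a \<tau> t))" if "a + \<alpha> \<le> d" "d \<le> b" for d
  proof -
    have aa: "a \<le> a + \<alpha>" using al by simp
    have "integral {a + \<alpha>..d} ?\<phi> = integral {a + \<alpha>..d} (tailf u \<xi> a \<tau>)"
      "integral {a + \<alpha>..d} (\<lambda>t. exp (?\<phi> t)) = integral {a + \<alpha>..d} (\<lambda>t. exp (tailf u \<xi> a \<tau> t))"
      by (rule integral_cong_Ioo(1), use ka2 in auto)+
    then show "integral {a..d} ?\<phi> = integral {a..d} (tailf u \<xi> a \<tau>)"
      "integral {a..d} (\<lambda>t. exp (?\<phi> t)) = integral {a..d} (\<lambda>t. exp (tailf u \<xi> a \<tau> t))"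
      using integral_concat[OF int(1) aa that] integral_concat[OF int(2) aa that]
        integral_concat[OF I(1) aa that] integral_concat[OF I(2) aa that] aal by auto
  qed
  \<comment> \<open>Initial averages of the two-valued part move on the tangent to the right of
    \<open>lam + z\<close>; those of longer intervals lie on or under the upper curve to its left.
    \<open>h\<close> joins these two pieces.\<close>
  define h where "h y = (if y \<le> lam + z then C * exp y else C * exp (lam + z) * (1 + (y - (lam + z))))" for y
  have h_line: "h y = tline z y lam" if "lam + z \<le> y" for y
    using that tline_eq_tangent[OF z1 xi(5), of y lam] by (auto simp: h_def)
  have h_exp: "h y = C * exp y" if "y \<le> lam + z" for y using that by (simp add: h_def)
  have hle: "h y \<le> C * exp y" for y
    using mult_left_mono[OF exp_tangent_le[of "lam + z" y], of C] C by (simp add: h_def mult.assoc)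
  have tail_y: "integral {a..d} (tailf u \<xi> a \<tau>) / (d - a) \<le> lam + z" if "a + \<alpha> \<le> d" "d \<le> b" for d
  proof (cases "d \<le> a + \<tau>")
    case True
    have "integral {a..d} (tailf u \<xi> a \<tau>) / (d - a) = tailf u \<xi> a \<tau> d + \<xi>"
      using tailf_integral_left(3)[OF tau(1) _ True xi(2), of u] that al by simp
    then show ?thesis using mono[OF that(1)] by (simp add: r_def)
  next
    case False
    then have d: "\<tau> < d - a" by simp
    have "integral {a..d} (tailf u \<xi> a \<tau>) / (d - a) = u + \<xi> * (\<tau> / (d - a))"
      using I(3)[of d] False that d tau by (simp add: add_divide_distrib)
    also have "\<dots> \<le> u + \<xi> * 1" using d tau xi by (intro add_left_mono mult_left_mono) auto
    finally show ?thesis using u by (simp add: r_def)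
  qed
  show "?\<phi> \<in> E_class (x1, tline \<xi> x1 u) C Q"
  proof (rule E_classI[OF _ ab Q int, where h = h and N = "a + \<tau>"])
    have bb: "a + \<alpha> \<le> b" using at tau by simp
    show i1: "integral {a..b} ?\<phi> = (b - a) * x1"
      unfolding same(1)[OF bb order_refl] using I(3)[of b] tau ab unfolding x1 by (simp add: distrib_left mult.commute)
    show "integral {a..b} (\<lambda>t. exp (?\<phi> t)) = (b - a) * tline \<xi> x1 u"
      unfolding same(2)[OF bb order_refl]
      using tailf_prefix(1)[OF tau xi(2,3) ab order_refl, of u] tailf_right[of \<tau> a b u \<xi>] tau ab i1[unfolded same(1)[OF bb order_refl]]
      by (cases "b \<le> a + \<tau>") auto
    show "\<exists>k. \<forall>y. h X + k * (y - X) \<le> h y" for X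
      unfolding h_def by (rule exp_then_line_supporting) (use C in simp)
    show "h y \<le> C * exp y" for y by (rule hle)
    show "(c - a) * h (integral {a..c} ?\<phi> / (c - a)) \<le> integral {a..c} (\<lambda>t. exp (?\<phi> t))" if c: "a < c" "c \<le> a + \<tau>" for c
    proof (cases "c \<le> a + \<alpha>")
      case True
      then show ?thesis using I2[OF c(1) True] h_line[OF low[OF c(1) True]] by simp
    next
      case False
      then have c': "a + \<alpha> \<le> c" "c \<le> b" using c tau by auto
      show ?thesis unfolding same[OF c'] h_exp[OF tail_y[OF c']]
        using tailf_prefix(2)[OF tau xi(2,3) c(1) c'(2) c(2), of u] by simp
    qed
    show "integral {a..d} (\<lambda>t. exp (?\<phi> t)) \<le> (d - a) * h (integral {a..d} ?\<phi> / (d - a))" if d: "a < d" "d \<le> b" for d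
    proof (cases "d \<le> a + \<alpha>")
      case True
      then show ?thesis using I2[OF d(1) True] h_line[OF low[OF d(1) True]] by simp
    next
      case False
      then have d': "a + \<alpha> \<le> d" "d \<le> b" using d by auto
      show ?thesis unfolding same[OF d'] h_exp[OF tail_y[OF d']] tailf_prefix(1)[OF tau xi(2,3) d, of u]
        using tline_le_upper[OF xi(2,3)] d by (intro mult_left_mono) auto
    qed
    show "good C ?\<phi> c d" if cd: "a \<le> c" "a + \<tau> \<le> c" "c < d" "d \<le> b" for c d
    proof (rule good_pointwise[OF xi(2,3) cd(3), where w = u])
      show "?\<phi> integrable_on {c..d}" "(\<lambda>t. exp (?\<phi> t)) integrable_on {c..d}"
        using int cd by (auto intro!: set_integrable_Ioo_integrable_on)
      show "exp (?\<phi> t) \<le> tline \<xi> (?\<phi> t) u" if "c < t" "t < d" for t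
        using tailf_right[of \<tau> a t u \<xi>] that tau cd at ka2 by (simp add: tline_def)
    qed
  qed (use C in auto)
qed

section \<open>The Bellman functions\<close>

lemma nn_integral_Ioo_restrict:
  fixes a b :: real
  shows "(\<integral>\<^sup>+t. f t \<partial>restrict_space lebesgue {a<..<b}) = (\<integral>\<^sup>+t\<in>{a<..<b}. f t \<partial>lebesgue)"
  by (subst nn_integral_restrict_space) auto

lemma integrable_Ioo_restrict:
  fixes f :: "real \<Rightarrow> real"
  shows "integrable (restrict_space lebesgue {a<..<b}) f \<longleftrightarrow> set_integrable lebesgue {a<..<b} f"
  unfolding set_integrable_def by (rule integrable_restrict_space) auto

lemma E_class_sample:
  assumes C: "1 < C" and ab: "a < b" and Q: "{a<..<b} \<subseteq> Q" "Q \<subseteq> {a..b}" and phi: "\<phi> \<in> E_class (x1, x2) C Q"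
  shows "Ainf_sample (restrict_space lebesgue {a<..<b}) \<phi> C (b - a) x1 x2"
proof -
  let ?M = "restrict_space lebesgue {a<..<b}"
  have E: "set_integrable lebesgue {a<..<b} \<phi>" "set_integrable lebesgue {a<..<b} (\<lambda>t. exp (\<phi> t))"
    "integral {a..b} \<phi> = (b - a) * x1" "integral {a..b} (\<lambda>t. exp (\<phi> t)) = (b - a) * x2"
    "\<And>c d. a \<le> c \<Longrightarrow> c < d \<Longrightarrow> d \<le> b \<Longrightarrow>
      integral {c..d} (\<lambda>t. exp (\<phi> t)) \<le> C * (d - c) * exp (integral {c..d} \<phi> / (d - c))"
    using phi unfolding E_class_iff[OF ab Q] by auto
  have li: "(LINT t|?M. f t) = (LINT t:{a<..<b}|lebesgue. f t)" for f :: "real \<Rightarrow> real"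
    unfolding set_lebesgue_integral_def by (rule integral_restrict_space) auto
  have sp: "emeasure ?M (space ?M) = ennreal (b - a)"
    using ab by (simp add: emeasure_restrict_space space_restrict_space)
  note xp = xi_plus_props[OF C] and xm = xi_minus_props[OF C]
  show ?thesis
  proof (rule Ainf_sample.intro)
    show "finite_measure ?M" by (rule finite_measureI) (unfold sp, simp)
    show "Ainf_sample_axioms ?M \<phi> C (b - a) x1 x2"
  proof (rule Ainf_sample_axioms.intro)
    show "integrable ?M \<phi>" "integrable ?M (\<lambda>t. exp (\<phi> t))" unfolding integrable_Ioo_restrict using E by auto
    then show "\<phi> \<in> borel_measurable ?M" by auto
    show "measure ?M (space ?M) = b - a" using sp ab by (simp add: measure_def)
    show "(LINT t|?M. \<phi> t) = (b - a) * x1" "(LINT t|?M. exp (\<phi> t)) = (b - a) * x2"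
      unfolding li using E set_lebesgue_integral_eq_integral(2)[OF E(1)] set_lebesgue_integral_eq_integral(2)[OF E(2)]
      by (auto simp flip: integral_open_interval_real)
    fix w
    show "(LINT t|?M. (if w < \<phi> t then ell (xi_plus C) w (\<phi> t) else 0)) \<le> 0" if "x1 \<le> w + xi_plus C"
      unfolding li by (rule ell_above_nonpos[OF ab E(1,2,5) xp]) (use that E(3) ab in auto)
    show "(LINT t|?M. (if \<phi> t < w then ell (xi_minus C) w (\<phi> t) else 0)) \<le> 0" if "w + xi_minus C \<le> x1"
      unfolding li by (rule ell_below_nonpos[OF ab E(1,2,5) xm]) (use that E(3) ab in auto)
  qed (use C ab in auto)
  qed
qed

context
  fixes a b :: real and Q :: "real set"
  assumes ab: "a < b" and Q: "{a<..<b} \<subseteq> Q" "Q \<subseteq> {a..b}"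
begin

lemma eavg_le:
  assumes "(\<integral>\<^sup>+t\<in>{a<..<b}. ennreal (f t) \<partial>lebesgue) \<le> ennreal ((b - a) * K)" "0 \<le> K"
  shows "eavg Q f \<le> ereal K"
proof -
  have "(\<integral>\<^sup>+t\<in>{a<..<b}. ennreal (f t) \<partial>lebesgue) / ennreal (b - a) \<le> ennreal ((b - a) * K) / ennreal (b - a)"
    using assms(1) by (rule divide_right_mono_ennreal)
  also have "\<dots> = ennreal K" using ab assms(2) by (simp add: divide_ennreal)
  finally show ?thesis unfolding eavg_interval[OF ab Q] using assms(2)
    by (metis enn2ereal_ennreal less_eq_ennreal.rep_eq)
qed

lemma eavg_ge:
  assumes "ennreal ((b - a) * K) \<le> (\<integral>\<^sup>+t\<in>{a<..<b}. ennreal (f t) \<partial>lebesgue)"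
  shows "ereal K \<le> eavg Q f"
proof (cases "0 \<le> K")
  case True
  have "ennreal K = ennreal ((b - a) * K) / ennreal (b - a)" using ab True by (simp add: divide_ennreal)
  also have "\<dots> \<le> (\<integral>\<^sup>+t\<in>{a<..<b}. ennreal (f t) \<partial>lebesgue) / ennreal (b - a)"
    using assms(1) by (rule divide_right_mono_ennreal)
  finally show ?thesis unfolding eavg_interval[OF ab Q] using True
    by (metis enn2ereal_ennreal less_eq_ennreal.rep_eq)
next
  case False
  then have "ereal K \<le> 0" by simp
  also have "0 \<le> eavg Q f" unfolding eavg_interval[OF ab Q] by simp
  finally show ?thesis .
qed

lemma level_sets:
  fixes \<phi> :: "real \<Rightarrow> real" and lam :: real
  assumes "set_integrable lebesgue {a<..<b} \<phi>"
  shows "measure lebesgue {t \<in> Q. lam \<le> \<phi> t} = measure (restrict_space lebesgue {a<..<b}) {t \<in> space (restrict_space lebesgue {a<..<b}). lam \<le> \<phi> t}"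
    "{t \<in> {a<..<b}. lam \<le> \<phi> t} \<in> sets lebesgue" "{t \<in> Q. lam \<le> \<phi> t} \<in> sets lebesgue"
proof -
  let ?M = "restrict_space lebesgue {a<..<b}"
  have "integrable ?M \<phi>" unfolding integrable_Ioo_restrict by (rule assms)
  then have [measurable]: "\<phi> \<in> borel_measurable ?M" by auto
  have "{t \<in> space ?M. lam \<le> \<phi> t} \<in> sets ?M" by measurable
  then have "{t \<in> {a<..<b}. lam \<le> \<phi> t} \<in> sets ?M" by (simp add: space_restrict_space)
  then show s1: "{t \<in> {a<..<b}. lam \<le> \<phi> t} \<in> sets lebesgue"
    by (subst (asm) sets_restrict_space_iff) auto
  have eq: "{t \<in> Q. lam \<le> \<phi> t} = {t \<in> {a<..<b}. lam \<le> \<phi> t} \<union> ({t \<in> Q. lam \<le> \<phi> t} \<inter> {a, b})" using Q by auto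
  have n: "{t \<in> Q. lam \<le> \<phi> t} \<inter> {a, b} \<in> sets lebesgue" by (intro negligible_imp_sets negligible_finite) auto
  show s2: "{t \<in> Q. lam \<le> \<phi> t} \<in> sets lebesgue" by (subst eq) (rule sets.Un[OF s1 n])
  have "measure lebesgue {t \<in> Q. lam \<le> \<phi> t} = measure lebesgue {t \<in> {a<..<b}. lam \<le> \<phi> t}"
  proof (rule measure_eq_AE)
    show "AE t in lebesgue. t \<in> {t \<in> Q. lam \<le> \<phi> t} \<longleftrightarrow> t \<in> {t \<in> {a<..<b}. lam \<le> \<phi> t}"
      using AE_interval[OF ab Q] by eventually_elim auto
  qed (fact s1 s2)+
  also have "\<dots> = measure ?M {t \<in> space ?M. lam \<le> \<phi> t}"
    by (subst measure_restrict_space) (auto simp: space_restrict_space)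
  finally show "measure lebesgue {t \<in> Q. lam \<le> \<phi> t} = measure ?M {t \<in> space ?M. lam \<le> \<phi> t}" .
qed

lemma level_measure_prefix:
  fixes \<phi> :: "real \<Rightarrow> real" and lam :: real
  assumes "a \<le> \<gamma>" "\<gamma> \<le> b" "\<And>t. t \<in> Q \<Longrightarrow> lam \<le> \<phi> t \<longleftrightarrow> t < \<gamma>"
  shows "measure lebesgue {t \<in> Q. lam \<le> \<phi> t} = \<gamma> - a"
proof -
  have "emeasure lebesgue {t \<in> Q. lam \<le> \<phi> t} = emeasure lebesgue {a<..<\<gamma>}"
  proof (rule emeasure_eq_AE)
    have eq: "{t \<in> Q. lam \<le> \<phi> t} = Q \<inter> {..<\<gamma>}" using assms(3) by auto
    show "{t \<in> Q. lam \<le> \<phi> t} \<in> sets lebesgue" unfolding eq using interval_sets[OF ab Q] by auto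
    show "AE t in lebesgue. t \<in> {t \<in> Q. lam \<le> \<phi> t} \<longleftrightarrow> t \<in> {a<..<\<gamma>}"
      using AE_interval[OF ab Q] unfolding eq by eventually_elim (use assms in auto)
  qed auto
  then show ?thesis using assms by (simp add: measure_def)
qed

text \<open>Equality in Jensen's inequality: the gap between \<open>exp\<close> and its tangent at
  \<open>x1\<close> is nonnegative, has integral zero, and vanishes only at
  \<open>x1\<close>.\<close>

lemma E_class_boundary_AE:
  assumes "\<phi> \<in> E_class (x1, exp x1) C Q"
  shows "AE t in lebesgue. t \<in> {a<..<b} \<longrightarrow> \<phi> t = x1"
proof -
  have E: "set_integrable lebesgue {a<..<b} \<phi>" "set_integrable lebesgue {a<..<b} (\<lambda>t. exp (\<phi> t))"
    "integral {a..b} \<phi> = (b - a) * x1" "integral {a..b} (\<lambda>t. exp (\<phi> t)) = (b - a) * exp x1"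
    using assms unfolding E_class_iff[OF ab Q] by auto
  let ?g = "\<lambda>t. exp (\<phi> t) - exp x1 - exp x1 * (\<phi> t - x1)"
  have c: "set_integrable lebesgue {a<..<b} (\<lambda>t. k)" for k :: real by (rule set_integrable_const_lmeasurable) simp
  have g: "set_integrable lebesgue {a<..<b} ?g" using E c by (intro set_integral_diff(1) set_integrable_mult_right) auto
  have e0: "(LINT t:{a<..<b}|lebesgue. k) = k * (b - a)" for k :: real
    using ab by (simp add: set_lebesgue_integral_def)
  have e1: "(LINT t:{a<..<b}|lebesgue. \<phi> t) = (b - a) * x1" "(LINT t:{a<..<b}|lebesgue. exp (\<phi> t)) = (b - a) * exp x1"
    using E(3,4) set_lebesgue_integral_eq_integral(2)[OF E(1)] set_lebesgue_integral_eq_integral(2)[OF E(2)]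
    by (auto simp flip: integral_open_interval_real)
  have "(LINT t:{a<..<b}|lebesgue. ?g t) = 0"
    using E c by (simp add: set_integral_diff e0 e1)
  then have z: "(LINT t|lebesgue. indicator {a<..<b} t *\<^sub>R ?g t) = 0" by (simp add: set_lebesgue_integral_def)
  have nn: "0 \<le> indicator {a<..<b} t *\<^sub>R ?g t" for t using exp_gap_nonneg[of "\<phi> t" x1] by (simp add: indicator_def)
  have "AE t in lebesgue. indicator {a<..<b} t *\<^sub>R ?g t = 0"
    using integral_nonneg_eq_0_iff_AE[of lebesgue "\<lambda>t. indicator {a<..<b} t *\<^sub>R ?g t"] g nn z by (auto simp: set_integrable_def)
  then show ?thesis
  proof eventually_elim
    case (elim t)
    show ?case
    proof
      assume "t \<in> {a<..<b}"
      then have t0: "?g t = 0" using elim by simp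
      show "\<phi> t = x1"
      proof (rule ccontr)
        assume "\<phi> t \<noteq> x1"
        then have "1 + (\<phi> t - x1) < exp (\<phi> t - x1)" by (intro exp_gt_add_one) simp
        then have "exp x1 * (1 + (\<phi> t - x1)) < exp x1 * exp (\<phi> t - x1)" by simp
        then show False using t0 by (simp add: algebra_simps flip: exp_add)
      qed
    qed
  qed
qed

lemma eavg_AE_const:
  assumes "AE t in lebesgue. t \<in> {a<..<b} \<longrightarrow> f t = k" "0 \<le> k"
  shows "eavg Q f = ereal k"
proof -
  have "(\<integral>\<^sup>+t\<in>{a<..<b}. ennreal (f t) \<partial>lebesgue) = (\<integral>\<^sup>+t\<in>{a<..<b}. ennreal k \<partial>lebesgue)"
    by (rule nn_integral_cong_AE) (use assms(1) in \<open>eventually_elim, auto simp: indicator_def\<close>)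
  also have "\<dots> = ennreal ((b - a) * k)" using ab assms(2) by (simp add: nn_integral_cmult_indicator ennreal_mult' mult.commute)
  finally show ?thesis using eavg_le[of f k] eavg_ge[of k f] assms(2) by (simp add: antisym)
qed

text \<open>This settles \<open>C = 1\<close> completely and the boundary case of several equalities
  for \<open>C > 1\<close>.\<close>

lemma boundary_values:
  assumes C: "1 \<le> C"
  shows "bell_b p C Q (x1, exp x1) = ereal (\<bar>x1\<bar> powr p)"
    "bell_B2 C Q (x1, exp x1) = ereal (x1\<^sup>2)"
    "bell_A \<delta> C Q (x1, exp x1) = ereal (exp (\<delta> * x1))"
    "bell_D lam C Q (x1, exp x1) = ereal (indicator {lam..} x1)"
proof -
  let ?E = "E_class (x1, exp x1) C Q"
  have ne: "?E \<noteq> {}" using const_in_E_class[OF C ab Q] by blast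
  have f: "eavg Q (\<lambda>t. F (\<phi> t)) = ereal (F x1)" if "\<phi> \<in> ?E" "0 \<le> F x1" for \<phi> and F :: "real \<Rightarrow> real"
    by (rule eavg_AE_const) (use E_class_boundary_AE[OF that(1)] that(2) in \<open>auto elim!: eventually_mono\<close>)
  show "bell_b p C Q (x1, exp x1) = ereal (\<bar>x1\<bar> powr p)"
    unfolding bell_b_def by (rule INF_eq_const[OF ne]) (use f[of _ "\<lambda>s. \<bar>s\<bar> powr p"] in auto)
  show "bell_B2 C Q (x1, exp x1) = ereal (x1\<^sup>2)"
    unfolding bell_B2_def by (rule SUP_eq_const[OF ne]) (use f[of _ "\<lambda>s. s\<^sup>2"] in auto)
  show "bell_A \<delta> C Q (x1, exp x1) = ereal (exp (\<delta> * x1))"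
    unfolding bell_A_def by (rule SUP_eq_const[OF ne]) (use f[of _ "\<lambda>s. exp (\<delta> * s)"] in auto)
  show "bell_D lam C Q (x1, exp x1) = ereal (indicator {lam..} x1)"
    unfolding bell_D_def
  proof (rule SUP_eq_const[OF ne])
    fix \<phi> assume phi: "\<phi> \<in> ?E"
    have i: "set_integrable lebesgue {a<..<b} \<phi>" using phi unfolding E_class_iff[OF ab Q] by auto
    have "measure lebesgue {t \<in> Q. lam \<le> \<phi> t} = measure lebesgue {t \<in> Q. lam \<le> x1}"
    proof (rule measure_eq_AE)
      have ae: "AE t in lebesgue. t \<in> Q \<longrightarrow> \<phi> t = x1"
        using AE_interval[OF ab Q] E_class_boundary_AE[OF phi] by eventually_elim auto
      show "AE t in lebesgue. t \<in> {t \<in> Q. lam \<le> \<phi> t} \<longleftrightarrow> t \<in> {t \<in> Q. lam \<le> x1}"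
        using ae by eventually_elim auto
      show "{t \<in> Q. lam \<le> \<phi> t} \<in> sets lebesgue" by (rule level_sets(3)[OF i])
      show "{t \<in> Q. lam \<le> x1} \<in> sets lebesgue" using interval_sets[OF ab Q] by (cases "lam \<le> x1") auto
    qed
    then show "ereal (measure lebesgue {t \<in> Q. lam \<le> \<phi> t} / measure lebesgue Q) = ereal (indicator {lam..} x1)"
      using measure_interval[OF ab Q] ab by (cases "lam \<le> x1") auto
  qed
qed

end

lemma tailf_nn_integral:
  fixes f :: "real \<Rightarrow> real"
  assumes tau: "0 < \<tau>" "a + \<tau> \<le> b" and f: "0 \<le> f u" "f \<in> borel_measurable borel"
  shows "(\<integral>\<^sup>+t\<in>{a<..<b}. ennreal (f (tailf u \<xi> a \<tau> t)) \<partial>lebesgue) =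
    (\<integral>\<^sup>+t\<in>{a<..<a + \<tau>}. ennreal (f (u + \<xi> * ln (\<tau> / (t - a)))) \<partial>lebesgue) + ennreal ((b - a - \<tau>) * f u)"
proof -
  have [measurable]: "f \<in> borel_measurable borel" by (rule f)
  have m: "(\<lambda>t. ennreal (f (u + \<xi> * ln (\<tau> / (t - a)))) * indicator {a<..<a + \<tau>} t) \<in> borel_measurable lebesgue"
    by (rule measurable_completion) measurable
  have "(\<integral>\<^sup>+t\<in>{a<..<b}. ennreal (f (tailf u \<xi> a \<tau> t)) \<partial>lebesgue) =
      (\<integral>\<^sup>+t. ennreal (f (u + \<xi> * ln (\<tau> / (t - a)))) * indicator {a<..<a + \<tau>} t + ennreal (f u) * indicator {a + \<tau>..<b} t \<partial>lebesgue)"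
  proof (rule nn_integral_cong)
    fix t
    show "ennreal (f (tailf u \<xi> a \<tau> t)) * indicator {a<..<b} t =
      ennreal (f (u + \<xi> * ln (\<tau> / (t - a)))) * indicator {a<..<a + \<tau>} t + ennreal (f u) * indicator {a + \<tau>..<b} t"
      using tailf_left[of a t \<tau> u \<xi>] tailf_right[of \<tau> a t u \<xi>] tau by (auto simp: indicator_def)
  qed
  also have "\<dots> = (\<integral>\<^sup>+t\<in>{a<..<a + \<tau>}. ennreal (f (u + \<xi> * ln (\<tau> / (t - a)))) \<partial>lebesgue) + (\<integral>\<^sup>+t. ennreal (f u) * indicator {a + \<tau>..<b} t \<partial>lebesgue)"
    by (rule nn_integral_add[OF m]) (rule measurable_completion, measurable)
  also have "(\<integral>\<^sup>+t. ennreal (f u) * indicator {a + \<tau>..<b} t \<partial>lebesgue) = ennreal ((b - a - \<tau>) * f u)"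
    using tau f(1) by (simp add: nn_integral_cmult_indicator ennreal_mult' diff_diff_eq mult.commute)
  finally show ?thesis .
qed

text \<open>\<open>\<tau>\<close> is the length that brings the first average to \<open>x1\<close>.
  The case \<open>u = x1\<close> is excluded because the tail would have length zero.\<close>

lemma tail_plus:
  assumes C: "1 < C" and ab: "a < b" and Q: "{a<..<b} \<subseteq> Q" "Q \<subseteq> {a..b}"
    and x: "exp x1 \<le> x2" "x2 \<le> C * exp x1"
  defines "u \<equiv> u_plus C (x1, x2)" and "\<tau> \<equiv> (b - a) * (x1 - u_plus C (x1, x2)) / xi_plus C"
  assumes ne: "u \<noteq> x1"
  shows "0 < \<tau>" "a + \<tau> \<le> b" "tailf u (xi_plus C) a \<tau> \<in> E_class (x1, x2) C Q" "xi_plus C * \<tau> = (b - a) * (x1 - u)"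
proof -
  note xi = xi_plus_props[OF C] and up = u_plus_props[OF C x, folded u_def]
  have lt: "0 < x1 - u" using ne up(2) by simp
  show t: "0 < \<tau>" unfolding \<tau>_def u_def[symmetric] using ab lt xi by simp
  show xt: "xi_plus C * \<tau> = (b - a) * (x1 - u)" unfolding \<tau>_def u_def[symmetric] using xi by simp
  have "xi_plus C * \<tau> \<le> xi_plus C * (b - a)" unfolding xt using up(1) ab by (simp add: mult.commute mult_right_mono)
  then show t2: "a + \<tau> \<le> b" using xi by simp
  have "x1 = u + xi_plus C * \<tau> / (b - a)" unfolding xt using ab by simp
  from tailf_in_E_class[OF C ab Q xi(2,3) t t2 this] up(3)
  show "tailf u (xi_plus C) a \<tau> \<in> E_class (x1, x2) C Q" by simp
qed

lemma tail_minus: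
  assumes C: "1 < C" and ab: "a < b" and Q: "{a<..<b} \<subseteq> Q" "Q \<subseteq> {a..b}"
    and x: "exp x1 \<le> x2" "x2 \<le> C * exp x1"
  defines "u \<equiv> u_minus C (x1, x2)" and "\<tau> \<equiv> (b - a) * (x1 - u_minus C (x1, x2)) / xi_minus C"
  assumes ne: "u \<noteq> x1"
  shows "0 < \<tau>" "a + \<tau> \<le> b" "tailf u (xi_minus C) a \<tau> \<in> E_class (x1, x2) C Q" "xi_minus C * \<tau> = (b - a) * (x1 - u)"
proof -
  note xi = xi_minus_props[OF C] and up = u_minus_props[OF C x, folded u_def]
  have z1: "xi_minus C < 1" using xi by simp
  have lt: "x1 - u < 0" using ne up(1) by simp
  show t: "0 < \<tau>" unfolding \<tau>_def u_def[symmetric] using ab lt xi by (simp add: zero_less_divide_iff mult_less_0_iff)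
  show xt: "xi_minus C * \<tau> = (b - a) * (x1 - u)" unfolding \<tau>_def u_def[symmetric] using xi by simp
  have "xi_minus C * (b - a) \<le> xi_minus C * \<tau>" unfolding xt using up(2) ab by (simp add: mult.commute mult_right_mono)
  then show t2: "a + \<tau> \<le> b" using xi by simp
  have "x1 = u + xi_minus C * \<tau> / (b - a)" unfolding xt using ab by simp
  from tailf_in_E_class[OF C ab Q z1 xi(2) t t2 this] up(3)
  show "tailf u (xi_minus C) a \<tau> \<in> E_class (x1, x2) C Q" by simp
qed

text \<open>The point 0 is included because the values of a tail may pass through it.\<close>

lemma abs_powr_deriv:
  assumes p: "1 < p"
  shows "((\<lambda>w. \<bar>w\<bar> powr p) has_real_derivative p * pder p w) (at w)"
proof (cases "w = 0")
  case True
  have "((\<lambda>h. (\<bar>0 + h\<bar> powr p - \<bar>0\<bar> powr p) / h) \<longlongrightarrow> 0) (at (0::real))"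
  proof (rule Lim_null_comparison)
    show "\<forall>\<^sub>F h in at (0::real). norm ((\<bar>0 + h\<bar> powr p - \<bar>0\<bar> powr p) / h) \<le> \<bar>h\<bar> powr (p - 1)"
      unfolding eventually_at_filter by (auto intro!: always_eventually simp: powr_diff)
    have "continuous_on UNIV (\<lambda>h::real. \<bar>h\<bar> powr (p - 1))" using p by (intro continuous_on_powr' continuous_intros) auto
    then have "isCont (\<lambda>h::real. \<bar>h\<bar> powr (p - 1)) 0" by (simp add: continuous_on_eq_continuous_at)
    then show "((\<lambda>h::real. \<bar>h\<bar> powr (p - 1)) \<longlongrightarrow> 0) (at 0)" using p by (simp add: isCont_def)
  qed
  then show ?thesis using True by (simp add: DERIV_def pder_def)
qed (rule pder_deriv)

text \<open>For a test function in an infimum an upper estimate suffices, so the primitive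
  \<open>F\<close> need not tend to 0 at \<open>a\<close>; its nonnegativity near \<open>a\<close>
  is enough.\<close>

lemma powr_tail_nn_integral:
  fixes a \<tau> u \<xi> p :: real
  assumes p: "1 < p" "p \<le> 2" and xi: "0 < \<xi>" "\<xi> < 1" and tau: "0 < \<tau>"
  shows "(\<integral>\<^sup>+t\<in>{a<..<a + \<tau>}. ennreal (\<bar>u + \<xi> * ln (\<tau> / (t - a))\<bar> powr p) \<partial>lebesgue) \<le> ennreal (\<tau> * (\<bar>u\<bar> powr p + \<xi> * pk p \<xi> u))"
proof -
  note P = p xi
  let ?T = "\<lambda>t. ln (\<tau> / (t - a))"
  let ?f = "\<lambda>t. \<bar>u + \<xi> * ?T t\<bar> powr p"
  \<comment> \<open>Chosen with \<open>G - G'\<close> equal to the power of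
    \<open>u + \<xi> * y\<close>, so that \<open>(t - a) * G (ln (\<tau> / (t - a)))\<close> is a
    primitive of the integrand.\<close>
  define G where "G y = \<bar>u + \<xi> * y\<bar> powr p + \<xi> * pk p \<xi> (u + \<xi> * y)" for y
  have Gd: "(G has_real_derivative \<xi> * pk p \<xi> (u + \<xi> * y)) (at y)" for y
  proof -
    have l: "((\<lambda>y. u + \<xi> * y) has_real_derivative \<xi>) (at y)" by (auto intro!: derivative_eq_intros)
    have "(G has_real_derivative p * pder p (u + \<xi> * y) * \<xi> + \<xi> * (pn p \<xi> (u + \<xi> * y) / \<xi> * \<xi>)) (at y)"
      unfolding G_def[abs_def]
      by (intro DERIV_add DERIV_cmult DERIV_chain2[OF abs_powr_deriv[OF p(1)] l] DERIV_chain2[OF pk_deriv[OF P] l])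
    moreover have "p * pder p (u + \<xi> * y) * \<xi> + \<xi> * (pn p \<xi> (u + \<xi> * y) / \<xi> * \<xi>) = \<xi> * pk p \<xi> (u + \<xi> * y)"
    proof -
      have "pn p \<xi> (u + \<xi> * y) / \<xi> * \<xi> = pk p \<xi> (u + \<xi> * y) - p * pder p (u + \<xi> * y)"
        using xi by (simp add: pn_def[OF P])
      then show ?thesis by (simp only:) (simp add: algebra_simps)
    qed
    ultimately show ?thesis by simp
  qed
  define F where "F t = (t - a) * G (?T t)" for t
  have Fd: "(F has_real_derivative ?f t) (at t)" if "a < t" for t
  proof -
    have k: "K * - (1 / (t - a)) * (t - a) = - K" for K using that by simp
    show ?thesis unfolding F_def[abs_def]
      by (rule DERIV_cong[OF deriv_shift_mult[OF DERIV_chain2[OF Gd ln_tail_deriv[OF tau that]]]])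
         (unfold k, simp add: G_def)
  qed
  have pk0: "0 \<le> pk p \<xi> s" if "0 \<le> s" for s
  proof -
    have "0 \<le> ptail p \<xi> s" unfolding ptail_eq[OF P]
      by (rule Bochner_Integration.integral_nonneg) (use that in \<open>auto simp: pder_def indicator_def\<close>)
    then show ?thesis using p xi by (simp add: pk_def[OF P])
  qed
  \<comment> \<open>Up to \<open>a + \<epsilon>\<close> the term \<open>\<xi> * ?T t\<close> is at
    least \<open>\<bar>u\<bar>\<close>, so the argument of \<open>pk\<close> is nonnegative, and
    with it \<open>F\<close>.\<close>
  define \<epsilon> where "\<epsilon> = \<tau> * exp (- (\<bar>u\<bar> / \<xi>))"
  have eps: "0 < \<epsilon>" "\<epsilon> \<le> \<tau>" using tau xi by (auto simp: \<epsilon>_def mult_left_le)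
  have F0: "0 \<le> F t" if "a < t" "t \<le> a + \<epsilon>" for t
  proof -
    have "\<tau> / \<epsilon> = exp (\<bar>u\<bar> / \<xi>)" using tau by (simp add: \<epsilon>_def exp_minus divide_inverse)
    then have "\<bar>u\<bar> / \<xi> = ln (\<tau> / \<epsilon>)" by simp
    also have "\<dots> \<le> ?T t" using that tau eps by (auto intro!: divide_left_mono)
    finally have "\<bar>u\<bar> \<le> \<xi> * ?T t" using xi by (simp add: divide_le_eq mult.commute)
    then have "0 \<le> u + \<xi> * ?T t" by linarith
    then show ?thesis using that xi pk0 by (simp add: F_def G_def)
  qed
  have Fend: "F (a + \<tau>) = \<tau> * (\<bar>u\<bar> powr p + \<xi> * pk p \<xi> u)" using tau by (simp add: F_def G_def)
  have "(\<integral>\<^sup>+t\<in>{a<..<a + \<tau>}. ennreal (?f t) \<partial>lborel) \<le> ennreal (F (a + \<tau>))"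
  proof (rule nn_integral_le_exhaustion[where A = "\<lambda>n. - {a<..<a + \<epsilon> / real (Suc n)}"])
    fix n :: nat
    define e where "e = \<epsilon> / real (Suc n)"
    have e: "0 < e" "e \<le> \<epsilon>" using eps by (auto simp: e_def divide_le_eq)
    have "(\<integral>\<^sup>+t. ennreal (?f t) * indicator {a<..<a + \<tau>} t * indicator (- {a<..<a + e}) t \<partial>lborel)
        \<le> (\<integral>\<^sup>+t. ennreal (?f t) * indicator {a + e..a + \<tau>} t \<partial>lborel)"
      by (rule nn_integral_mono) (auto simp: indicator_def)
    also have "\<dots> = ennreal (F (a + \<tau>) - F (a + e))"
      by (rule nn_integral_FTC_Icc) (use Fd e eps in auto)
    also have "\<dots> \<le> ennreal (F (a + \<tau>))" using F0[of "a + e"] e by (intro ennreal_leI) auto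
    finally show "(\<integral>\<^sup>+t. ennreal (?f t) * indicator {a<..<a + \<tau>} t * indicator (- {a<..<a + \<epsilon> / real (Suc n)}) t \<partial>lborel) \<le> ennreal (F (a + \<tau>))" unfolding e_def .
  next
    show "(\<Union>n. - {a<..<a + \<epsilon> / real (Suc n)}) = space lborel"
    proof -
      have "\<exists>n. t \<notin> {a<..<a + \<epsilon> / real (Suc n)}" for t
      proof (cases "a < t")
        case True
        obtain n where "inverse (real (Suc n)) < (t - a) / \<epsilon>" using reals_Archimedean[of "(t - a) / \<epsilon>"] True eps by auto
        then have "\<epsilon> / real (Suc n) < t - a" using eps by (simp add: field_simps)
        then show ?thesis by (intro exI[of _ n]) auto
      qed auto
      then show ?thesis by auto
    qed
    show "incseq (\<lambda>n. - {a<..<a + \<epsilon> / real (Suc n)})"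
    proof (rule incseq_SucI, rule Compl_anti_mono)
      fix n
      have "\<epsilon> / real (Suc (Suc n)) \<le> \<epsilon> / real (Suc n)" using eps by (intro divide_left_mono) auto
      then show "{a<..<a + \<epsilon> / real (Suc (Suc n))} \<subseteq> {a<..<a + \<epsilon> / real (Suc n)}" by auto
    qed
  qed (auto intro!: borel_measurable_times)
  then show ?thesis unfolding Fend nn_integral_completion .
qed

text \<open>The integrand is at least \<open>\<tau> / (t - a)\<close>, whose integral from
  \<open>a + \<tau> * exp (- n)\<close> to \<open>a + \<tau>\<close> is
  \<open>\<tau> * n\<close>.\<close>

lemma tail_nn_integral_infinite:
  fixes a \<tau> c :: real
  assumes tau: "0 < \<tau>" and c: "1 \<le> c"
  shows "(\<integral>\<^sup>+t\<in>{a<..<a + \<tau>}. ennreal (exp (c * ln (\<tau> / (t - a)))) \<partial>lebesgue) = \<infinity>"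
proof -
  let ?I = "\<integral>\<^sup>+t\<in>{a<..<a + \<tau>}. ennreal (exp (c * ln (\<tau> / (t - a)))) \<partial>lborel"
  have "ennreal (\<tau> * real n) \<le> ?I" for n
  proof -
    define e where "e = \<tau> * exp (- real n)"
    have e: "0 < e" "e \<le> \<tau>" using tau by (auto simp: e_def mult_left_le)
    have "ennreal (\<tau> * real n) = ennreal (\<tau> * ln (a + \<tau> - a) - \<tau> * ln (a + e - a))"
      using tau by (simp add: e_def ln_mult algebra_simps)
    also have "\<dots> = (\<integral>\<^sup>+t. ennreal (\<tau> / (t - a)) * indicator {a + e..a + \<tau>} t \<partial>lborel)"
      by (rule nn_integral_FTC_Icc[symmetric, where F = "\<lambda>t. \<tau> * ln (t - a)"]) (use e tau in \<open>auto intro!: derivative_eq_intros\<close>)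
    also have "\<dots> \<le> ?I"
    proof (rule nn_integral_mono_AE)
      show "AE t in lborel. ennreal (\<tau> / (t - a)) * indicator {a + e..a + \<tau>} t \<le> ennreal (exp (c * ln (\<tau> / (t - a)))) * indicator {a<..<a + \<tau>} t"
        using AE_lborel_singleton[of "a + \<tau>"]
      proof eventually_elim
        case (elim t)
        show ?case
        proof (cases "t \<in> {a + e..a + \<tau>}")
          case True
          then have t: "a < t" "t < a + \<tau>" using e elim by auto
          have T: "0 \<le> ln (\<tau> / (t - a))" using ln_tail_nonneg[of a t \<tau>] t by simp
          have "\<tau> / (t - a) = exp (ln (\<tau> / (t - a)))" using t tau by simp
          also have "\<dots> \<le> exp (c * ln (\<tau> / (t - a)))" using mult_right_mono[OF c T] by simp
          finally show ?thesis using t by (auto simp: indicator_def intro!: ennreal_leI)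
        qed simp
      qed
    qed
    finally show ?thesis .
  qed
  then have le: "ennreal (\<tau> * real n) \<le> ?I" for n .
  have "?I = \<infinity>"
  proof (rule ccontr)
    assume "?I \<noteq> \<infinity>"
    then obtain R where R: "0 \<le> R" "?I = ennreal R" by (cases ?I) auto
    obtain n where "R / \<tau> < real n" using reals_Archimedean2 by blast
    then have "R < \<tau> * real n" using tau by (simp add: divide_less_eq mult.commute)
    then show False using le[of n] R by (simp add: ennreal_le_iff)
  qed
  then show ?thesis unfolding nn_integral_completion .
qed

lemma tline_xi_eq:
  assumes "C > 1"
  shows "exp lam * (C * exp (xi_plus C) * (x1 - lam) + 1) = tline (xi_plus C) x1 lam"
    "exp lam * (C * exp (xi_minus C) * (x1 - lam) + 1) = tline (xi_minus C) x1 lam"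
  using C_exp_xi[OF assms] by (auto simp: tline_def)

lemma tline_xi_eq_0:
  assumes "C > 1"
  shows "C * exp (xi_plus C) * x1 + 1 = tline (xi_plus C) x1 0"
    "C * exp (xi_minus C) * x1 + 1 = tline (xi_minus C) x1 0"
  using tline_xi_eq[OF assms, of 0 x1] by auto

lemma tline_le_exp:
  assumes "\<xi> < 1" "(s - w) * \<xi> \<le> 0"
  shows "tline \<xi> s w \<le> exp s"
  using ell_nonneg[OF assms] by (simp add: ell_def tline_def)

lemma exp_tail_scaled:
  fixes a \<tau> u \<xi> \<delta> :: real
  shows "(\<integral>\<^sup>+t\<in>{a<..<a + \<tau>}. ennreal (exp (\<delta> * (u + \<xi> * ln (\<tau> / (t - a))))) \<partial>lebesgue) =
    ennreal (exp (\<delta> * u)) * (\<integral>\<^sup>+t\<in>{a<..<a + \<tau>}. ennreal (exp (\<delta> * \<xi> * ln (\<tau> / (t - a)))) \<partial>lebesgue)"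
proof -
  have "(\<integral>\<^sup>+t\<in>{a<..<a + \<tau>}. ennreal (exp (\<delta> * (u + \<xi> * ln (\<tau> / (t - a))))) \<partial>lebesgue) =
    (\<integral>\<^sup>+t. ennreal (exp (\<delta> * u)) * (ennreal (exp (\<delta> * \<xi> * ln (\<tau> / (t - a)))) * indicator {a<..<a + \<tau>} t) \<partial>lebesgue)"
    by (rule nn_integral_cong) (auto simp: indicator_def ennreal_mult'[symmetric] exp_add[symmetric] algebra_simps)
  also have "\<dots> = ennreal (exp (\<delta> * u)) * (\<integral>\<^sup>+t\<in>{a<..<a + \<tau>}. ennreal (exp (\<delta> * \<xi> * ln (\<tau> / (t - a)))) \<partial>lebesgue)"
    by (rule nn_integral_cmult) (rule measurable_completion, measurable)
  finally show ?thesis .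
qed

section \<open>Equalities at a point of the domain for \<open>C > 1\<close>\<close>

locale bellman_point =
  fixes a b :: real and Q :: "real set" and C x1 x2 :: real
  assumes ab: "a < b" and Q: "{a<..<b} \<subseteq> Q" "Q \<subseteq> {a..b}" and C: "1 < C"
    and x: "exp x1 \<le> x2" "x2 \<le> C * exp x1"
begin

abbreviation "\<xi> \<equiv> xi_plus C"
abbreviation "z \<equiv> xi_minus C"

lemma xi: "0 < \<xi>" "\<xi> < 1" "z < 0" "z < 1"
  using xi_plus_props[OF C] xi_minus_props[OF C] by auto

lemma u_eq: "x2 = exp x1 \<Longrightarrow> u_plus C (x1, x2) = x1" "u_plus C (x1, x2) = x1 \<Longrightarrow> x2 = exp x1"
proof -
  note u = u_plus_props[OF C x]
  show "u_plus C (x1, x2) = x1 \<Longrightarrow> x2 = exp x1" using u(3) by (simp add: tline_def)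
  show "u_plus C (x1, x2) = x1" if "x2 = exp x1"
    using tline_decr[OF xi(2) u(1), of x1] u that by (force simp: tline_def)
qed

lemma u_minus_eq: "x2 = exp x1 \<Longrightarrow> u_minus C (x1, x2) = x1" "u_minus C (x1, x2) = x1 \<Longrightarrow> x2 = exp x1"
proof -
  note u = u_minus_props[OF C x]
  show "u_minus C (x1, x2) = x1 \<Longrightarrow> x2 = exp x1" using u(3) by (simp add: tline_def)
  show "u_minus C (x1, x2) = x1" if "x2 = exp x1"
    using tline_incr[OF xi(4) u(2), of x1] u that by (force simp: tline_def)
qed

text \<open>The first absolute moment and the level sets need only this one-sided bound from the
  test function, not its formula.\<close>

lemma plus_optimizer: "\<exists>\<phi>\<in>E_class (x1, x2) C Q. \<forall>t. u_plus C (x1, x2) \<le> \<phi> t"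
proof (cases "u_plus C (x1, x2) = x1")
  case True
  then have "x2 = exp x1" by (rule u_eq)
  then show ?thesis using const_in_E_class[OF _ ab Q, of C x1] C True by auto
next
  case False
  note T = tail_plus[OF C ab Q x False]
  show ?thesis by (rule bexI[OF _ T(3)]) (use xi in \<open>auto simp: tailf_def\<close>)
qed

lemma minus_optimizer: "\<exists>\<phi>\<in>E_class (x1, x2) C Q. \<forall>t. \<phi> t \<le> u_minus C (x1, x2)"
proof (cases "u_minus C (x1, x2) = x1")
  case True
  then have "x2 = exp x1" by (rule u_minus_eq)
  then show ?thesis using const_in_E_class[OF _ ab Q, of C x1] C True by auto
next
  case False
  note T = tail_minus[OF C ab Q x False]
  show ?thesis by (rule bexI[OF _ T(3)]) (use xi in \<open>auto simp: tailf_def mult_le_0_iff\<close>)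
qed

lemma bell_A_eq:
  assumes \<delta>: "1 \<le> \<delta>" "\<delta> * \<xi> < 1"
  shows "bell_A \<delta> C Q (x1, x2) = ereal (A_cand \<delta> C (x1, x2))"
proof (cases "x2 = exp x1")
  case True
  then show ?thesis using boundary_values(3)[OF ab Q, of C \<delta> x1] C u_eq(1)[OF True]
    by (simp add: A_cand_def Let_def)
next
  case False
  define u where "u = u_plus C (x1, x2)"
  note up = u_plus_props[OF C x, folded u_def]
  have ne: "u \<noteq> x1" using u_eq(2) False by (auto simp: u_def)
  define \<tau> where "\<tau> = (b - a) * (x1 - u) / \<xi>"
  note T = tail_plus[OF C ab Q x ne[unfolded u_def], folded u_def, folded \<tau>_def]
  have cand: "A_cand \<delta> C (x1, x2) = exp (\<delta> * u) * (\<delta> / (1 - \<delta> * \<xi>) * (x1 - u) + 1)"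
    using C by (simp add: A_cand_def Let_def u_def)
  have nn: "0 \<le> A_cand \<delta> C (x1, x2)" unfolding cand using \<delta> up by simp
  show ?thesis unfolding bell_A_def
  proof (rule antisym[OF SUP_least SUP_upper2[OF T(3)]])
    fix \<phi> assume "\<phi> \<in> E_class (x1, x2) C Q"
    then interpret S: Ainf_sample "restrict_space lebesgue {a<..<b}" \<phi> C "b - a" x1 x2
      by (rule E_class_sample[OF C ab Q])
    show "eavg Q (\<lambda>t. exp (\<delta> * \<phi> t)) \<le> ereal (A_cand \<delta> C (x1, x2))"
      by (rule eavg_le[OF ab Q]) (use S.A_upper[OF x \<delta>] nn in \<open>auto simp: nn_integral_Ioo_restrict\<close>)
  next
    have "(\<integral>\<^sup>+t\<in>{a<..<b}. ennreal (exp (\<delta> * tailf u \<xi> a \<tau> t)) \<partial>lebesgue) =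
        (\<integral>\<^sup>+t\<in>{a<..<a + \<tau>}. ennreal (exp (\<delta> * (u + \<xi> * ln (\<tau> / (t - a))))) \<partial>lebesgue) + ennreal ((b - a - \<tau>) * exp (\<delta> * u))"
      by (rule tailf_nn_integral[OF T(1,2), of "\<lambda>s. exp (\<delta> * s)"]) auto
    also have "\<dots> = ennreal (exp (\<delta> * u)) * ennreal (\<tau> / (1 - \<delta> * \<xi>)) + ennreal ((b - a - \<tau>) * exp (\<delta> * u))"
      unfolding exp_tail_scaled using exp_tail_FTC(3)[OF T(1) _ \<delta>(2), of a "a + \<tau>"] T(1) by simp
    also have "\<dots> = ennreal (exp (\<delta> * u) * (\<tau> / (1 - \<delta> * \<xi>)) + (b - a - \<tau>) * exp (\<delta> * u))"
    proof -
      have "0 \<le> \<tau> / (1 - \<delta> * \<xi>)" "0 \<le> (b - a - \<tau>) * exp (\<delta> * u)" using T(1,2) \<delta> by auto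
      then show ?thesis by (subst ennreal_mult[symmetric]) (auto simp del: times_divide_eq_right intro!: ennreal_plus[symmetric])
    qed
    also have "exp (\<delta> * u) * (\<tau> / (1 - \<delta> * \<xi>)) + (b - a - \<tau>) * exp (\<delta> * u) = (b - a) * A_cand \<delta> C (x1, x2)"
    proof -
      have k: "\<tau> / (1 - \<delta> * \<xi>) - \<tau> = \<delta> * (\<xi> * \<tau>) / (1 - \<delta> * \<xi>)" using \<delta> by (simp add: field_simps)
      have "exp (\<delta> * u) * (\<tau> / (1 - \<delta> * \<xi>)) + (b - a - \<tau>) * exp (\<delta> * u) = exp (\<delta> * u) * ((\<tau> / (1 - \<delta> * \<xi>) - \<tau>) + (b - a))"
        by (simp add: algebra_simps)
      also have "\<dots> = (b - a) * A_cand \<delta> C (x1, x2)" unfolding k T(4) cand by (simp add: algebra_simps)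
      finally show ?thesis .
    qed
    finally show "ereal (A_cand \<delta> C (x1, x2)) \<le> eavg Q (\<lambda>t. exp (\<delta> * tailf u \<xi> a \<tau> t))"
      by (intro eavg_ge[OF ab Q]) simp
  qed
qed

text \<open>Up to a constant, the exponential of \<open>\<delta>\<close> times the tail is
  \<open>\<tau> / (t - a)\<close> to the power \<open>\<delta> * \<xi>\<close>, which is not
  integrable at \<open>a\<close> when the exponent is at least 1.\<close>

lemma bell_A_infinite:
  assumes \<delta>: "1 \<le> \<delta> * \<xi>" and ne: "exp x1 < x2"
  shows "bell_A \<delta> C Q (x1, x2) = \<infinity>"
proof -
  define u where "u = u_plus C (x1, x2)"
  have ne: "u \<noteq> x1" using u_eq(2) ne by (auto simp: u_def)
  define \<tau> where "\<tau> = (b - a) * (x1 - u) / \<xi>"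
  note T = tail_plus[OF C ab Q x ne[unfolded u_def], folded u_def, folded \<tau>_def]
  have "(\<integral>\<^sup>+t\<in>{a<..<b}. ennreal (exp (\<delta> * tailf u \<xi> a \<tau> t)) \<partial>lebesgue) =
        (\<integral>\<^sup>+t\<in>{a<..<a + \<tau>}. ennreal (exp (\<delta> * (u + \<xi> * ln (\<tau> / (t - a))))) \<partial>lebesgue) + ennreal ((b - a - \<tau>) * exp (\<delta> * u))"
    by (rule tailf_nn_integral[OF T(1,2), of "\<lambda>s. exp (\<delta> * s)"]) auto
  also have "\<dots> = \<infinity>"
    unfolding exp_tail_scaled tail_nn_integral_infinite[OF T(1) \<delta>] by (simp add: ennreal_mult_top)
  finally have "eavg Q (\<lambda>t. exp (\<delta> * tailf u \<xi> a \<tau> t)) = \<infinity>"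
    unfolding eavg_interval[OF ab Q] using ab by (simp add: ennreal_top_divide)
  then have "\<infinity> \<le> bell_A \<delta> C Q (x1, x2)" unfolding bell_A_def by (intro SUP_upper2[OF T(3)]) simp
  then show ?thesis by simp
qed

lemma bell_B2_eq: "bell_B2 C Q (x1, x2) = ereal (B2_cand C (x1, x2))"
proof (cases "x2 = exp x1")
  case True
  then show ?thesis using boundary_values(2)[OF ab Q, of C x1] C u_minus_eq(1)[OF True]
    by (simp add: B2_cand_def Let_def power2_eq_square)
next
  case False
  define u where "u = u_minus C (x1, x2)"
  have ne: "u \<noteq> x1" using u_minus_eq(2) False by (auto simp: u_def)
  define \<tau> where "\<tau> = (b - a) * (x1 - u) / z"
  note T = tail_minus[OF C ab Q x ne[unfolded u_def], folded u_def, folded \<tau>_def]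
  have val: "\<tau> * (u\<^sup>2 + 2 * z * u + 2 * z\<^sup>2) + (b - a - \<tau>) * u\<^sup>2 = (b - a) * B2_cand C (x1, x2)"
  proof -
    have "\<tau> * (u\<^sup>2 + 2 * z * u + 2 * z\<^sup>2) + (b - a - \<tau>) * u\<^sup>2 = (b - a) * u\<^sup>2 + 2 * (z * \<tau>) * (u + z)"
      by (simp add: algebra_simps power2_eq_square)
    also have "\<dots> = (b - a) * B2_cand C (x1, x2)"
      unfolding T(4) using C by (simp add: B2_cand_def Let_def u_def[symmetric] algebra_simps power2_eq_square)
    finally show ?thesis .
  qed
  have sq: "u\<^sup>2 + 2 * z * u + 2 * z\<^sup>2 = (u + z)\<^sup>2 + z\<^sup>2" by (simp add: power2_eq_square algebra_simps)
  have "0 \<le> (b - a) * B2_cand C (x1, x2)" unfolding val[symmetric] sq using T(1,2) by simp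
  then have nn: "0 \<le> B2_cand C (x1, x2)" using ab by (simp add: zero_le_mult_iff)
  show ?thesis unfolding bell_B2_def
  proof (rule antisym[OF SUP_least SUP_upper2[OF T(3)]])
    fix \<phi> assume "\<phi> \<in> E_class (x1, x2) C Q"
    then interpret S: Ainf_sample "restrict_space lebesgue {a<..<b}" \<phi> C "b - a" x1 x2
      by (rule E_class_sample[OF C ab Q])
    show "eavg Q (\<lambda>t. (\<phi> t)\<^sup>2) \<le> ereal (B2_cand C (x1, x2))"
      by (rule eavg_le[OF ab Q]) (use S.B2_upper[OF x] nn in \<open>auto simp: nn_integral_Ioo_restrict\<close>)
  next
    have "(\<integral>\<^sup>+t\<in>{a<..<b}. ennreal ((tailf u z a \<tau> t)\<^sup>2) \<partial>lebesgue) =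
        (\<integral>\<^sup>+t\<in>{a<..<a + \<tau>}. ennreal ((u + z * ln (\<tau> / (t - a)))\<^sup>2) \<partial>lebesgue) + ennreal ((b - a - \<tau>) * u\<^sup>2)"
      by (rule tailf_nn_integral[OF T(1,2), of "\<lambda>s. s\<^sup>2"]) auto
    also have "\<dots> = ennreal (\<tau> * (u\<^sup>2 + 2 * z * u + 2 * z\<^sup>2) + (b - a - \<tau>) * u\<^sup>2)"
      unfolding ln_tail_sq_integral[OF T(1)] sq using T(1,2) by (simp add: ennreal_plus)
    finally show "ereal (B2_cand C (x1, x2)) \<le> eavg Q (\<lambda>t. (tailf u z a \<tau> t)\<^sup>2)"
      unfolding val by (intro eavg_ge[OF ab Q]) simp
  qed
qed

lemma bell_bp_eq:
  assumes p: "1 < p" "p \<le> 2" and q: "2 - p \<le> \<xi>"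
  shows "bell_b p C Q (x1, x2) = ereal (b_cand p C (x1, x2))"
proof (cases "x2 = exp x1")
  case True
  then show ?thesis using boundary_values(1)[OF ab Q, of C p x1] C u_eq(1)[OF True]
    by (simp add: b_cand_def Let_def)
next
  case False
  define u where "u = u_plus C (x1, x2)"
  have ne: "u \<noteq> x1" using u_eq(2) False by (auto simp: u_def)
  define \<tau> where "\<tau> = (b - a) * (x1 - u) / \<xi>"
  note T = tail_plus[OF C ab Q x ne[unfolded u_def], folded u_def, folded \<tau>_def]
  note P = p xi(1,2)
  have cand: "b_cand p C (x1, x2) = pk p \<xi> u * (x1 - u) + \<bar>u\<bar> powr p"
    using C by (simp add: b_cand_def Let_def u_def pk_def[OF P] ptail_def[OF P])
  have "(\<integral>\<^sup>+t\<in>{a<..<b}. ennreal (\<bar>tailf u \<xi> a \<tau> t\<bar> powr p) \<partial>lebesgue) =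
      (\<integral>\<^sup>+t\<in>{a<..<a + \<tau>}. ennreal (\<bar>u + \<xi> * ln (\<tau> / (t - a))\<bar> powr p) \<partial>lebesgue) + ennreal ((b - a - \<tau>) * \<bar>u\<bar> powr p)"
    by (rule tailf_nn_integral[OF T(1,2), of "\<lambda>s. \<bar>s\<bar> powr p"]) auto
  also have "\<dots> \<le> ennreal (\<tau> * (\<bar>u\<bar> powr p + \<xi> * pk p \<xi> u)) + ennreal ((b - a - \<tau>) * \<bar>u\<bar> powr p)"
    by (intro add_right_mono powr_tail_nn_integral[OF P T(1)])
  finally have le: "(\<integral>\<^sup>+t\<in>{a<..<b}. ennreal (\<bar>tailf u \<xi> a \<tau> t\<bar> powr p) \<partial>lebesgue)
      \<le> ennreal (\<tau> * (\<bar>u\<bar> powr p + \<xi> * pk p \<xi> u)) + ennreal ((b - a - \<tau>) * \<bar>u\<bar> powr p)" .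
  have val: "\<tau> * (\<bar>u\<bar> powr p + \<xi> * pk p \<xi> u) + (b - a - \<tau>) * \<bar>u\<bar> powr p = (b - a) * b_cand p C (x1, x2)"
  proof -
    have "\<tau> * (\<bar>u\<bar> powr p + \<xi> * pk p \<xi> u) + (b - a - \<tau>) * \<bar>u\<bar> powr p = (b - a) * \<bar>u\<bar> powr p + (\<xi> * \<tau>) * pk p \<xi> u"
      by (simp add: algebra_simps)
    also have "\<dots> = (b - a) * b_cand p C (x1, x2)" unfolding T(4) cand by (simp add: algebra_simps)
    finally show ?thesis .
  qed
  \<comment> \<open>\<open>ennreal\<close> maps negative numbers to 0, so the sign is needed before
    the two terms can be added. A negative value would force the tail integral to be 0 and hence the
    tail to vanish almost everywhere, but it has at most one zero.\<close>
  have G0: "0 \<le> \<bar>u\<bar> powr p + \<xi> * pk p \<xi> u"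
  proof (rule ccontr)
    assume neg: "\<not> ?thesis"
    then have z0: "(\<integral>\<^sup>+t\<in>{a<..<a + \<tau>}. ennreal (\<bar>u + \<xi> * ln (\<tau> / (t - a))\<bar> powr p) \<partial>lebesgue) = 0"
      using powr_tail_nn_integral[OF P T(1), of u a] T(1) by (simp add: ennreal_neg mult_nonneg_nonpos)
    have "(\<lambda>t. ennreal (\<bar>u + \<xi> * ln (\<tau> / (t - a))\<bar> powr p) * indicator {a<..<a + \<tau>} t) \<in> borel_measurable lebesgue"
      by (rule measurable_completion) measurable
    then have "AE t in lebesgue. ennreal (\<bar>u + \<xi> * ln (\<tau> / (t - a))\<bar> powr p) * indicator {a<..<a + \<tau>} t = 0"
      using z0 by (simp add: nn_integral_0_iff_AE)
    then have "AE t in lebesgue. t \<notin> {a<..<a + \<tau>}"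
    proof -
      have "AE t in lborel. t \<noteq> a + \<tau> * exp (u / \<xi>)" by (rule AE_lborel_singleton)
      then have "AE t in lebesgue. t \<noteq> a + \<tau> * exp (u / \<xi>)" by (rule AE_completion)
      with \<open>AE t in lebesgue. _ = 0\<close> show ?thesis
      proof eventually_elim
        case (elim t)
        show ?case
        proof
          assume t: "t \<in> {a<..<a + \<tau>}"
          then have "u + \<xi> * ln (\<tau> / (t - a)) = 0" using elim(1) p by (auto simp: indicator_def split: if_splits)
          then have "ln (\<tau> / (t - a)) = - (u / \<xi>)" using xi by (simp add: field_simps)
          then have "\<tau> / (t - a) = exp (- (u / \<xi>))" using t T(1) by (metis divide_pos_pos diff_gt_0_iff_gt exp_ln greaterThanLessThan_iff)
          then have "t - a = \<tau> * exp (u / \<xi>)" using t by (simp add: exp_minus field_simps)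
          with elim(2) show False by simp
        qed
      qed
    qed
    then have "emeasure lebesgue {a<..<a + \<tau>} = 0" by (rule AE_iff_measurable[THEN iffD1, rotated 2]) auto
    then show False using T(1) by simp
  qed
  have nn: "0 \<le> b_cand p C (x1, x2)"
  proof -
    have "0 \<le> (b - a) * b_cand p C (x1, x2)" unfolding val[symmetric] using G0 T(1,2) by simp
    then show ?thesis using ab by (simp add: zero_le_mult_iff)
  qed
  show ?thesis unfolding bell_b_def
  proof (rule antisym[OF INF_lower2[OF T(3)] INF_greatest])
    have "(\<integral>\<^sup>+t\<in>{a<..<b}. ennreal (\<bar>tailf u \<xi> a \<tau> t\<bar> powr p) \<partial>lebesgue) \<le> ennreal ((b - a) * b_cand p C (x1, x2))"
      using le G0 T(1,2) unfolding val[symmetric] by (simp add: ennreal_plus)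
    then show "eavg Q (\<lambda>t. \<bar>tailf u \<xi> a \<tau> t\<bar> powr p) \<le> ereal (b_cand p C (x1, x2))"
      by (rule eavg_le[OF ab Q _ nn])
  next
    fix \<phi> assume "\<phi> \<in> E_class (x1, x2) C Q"
    then interpret S: Ainf_sample "restrict_space lebesgue {a<..<b}" \<phi> C "b - a" x1 x2
      by (rule E_class_sample[OF C ab Q])
    show "ereal (b_cand p C (x1, x2)) \<le> eavg Q (\<lambda>t. \<bar>\<phi> t\<bar> powr p)"
      by (rule eavg_ge[OF ab Q]) (use S.bp_lower[OF x p q] in \<open>auto simp: nn_integral_Ioo_restrict\<close>)
  qed
qed

end

section \<open>The angle between the two tangents from one boundary point\<close>

lemma exp_chord:
  fixes C \<xi> z X :: real
  assumes C: "0 \<le> C" and X: "z \<le> X" "X \<le> \<xi>" "z < \<xi>"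
  shows "(\<xi> - z) * (C * exp X) \<le> (X - z) * (C * exp \<xi>) + (\<xi> - X) * (C * exp z)"
proof -
  define t where "t = (X - z) / (\<xi> - z)"
  have t: "0 \<le> t" "t \<le> 1" using X by (auto simp: t_def divide_le_eq)
  have tr: "t * (\<xi> - z) = X - z" using X by (simp add: t_def)
  have Xt: "X = (1 - t) * z + t * \<xi>" using tr by (simp add: algebra_simps)
  have "exp X \<le> (1 - t) * exp z + t * exp \<xi>"
    unfolding Xt using convex_onD[OF exp_convex t, of z \<xi>] by simp
  then have "(\<xi> - z) * C * exp X \<le> (\<xi> - z) * C * ((1 - t) * exp z + t * exp \<xi>)"
    using C X by (intro mult_left_mono) auto
  also have "\<dots> = ((\<xi> - z) - t * (\<xi> - z)) * (C * exp z) + (t * (\<xi> - z)) * (C * exp \<xi>)" by (simp add: algebra_simps)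
  finally show ?thesis unfolding tr by (simp add: algebra_simps)
qed

context bellman_point
begin

text \<open>Relative to the vertex \<open>(lam, exp lam)\<close>, with the second coordinate scaled
  by \<open>exp (- lam)\<close>, the point is \<open>A\<close> times the direction of the right
  tangent minus \<open>R\<close> times that of the left one. A tail realises the first part, the low
  value the second; \<open>R\<close> is the solution of this linear system.\<close>

lemma angle_optimizer:
  assumes lines: "tline z x1 lam \<le> x2" "tline \<xi> x1 lam \<le> x2" and x1: "lam + z \<le> x1" "x1 \<le> lam + \<xi>"
  defines "R \<equiv> (x2 * exp (- lam) - 1 - (x1 - lam) / (1 - \<xi>)) * ((1 - \<xi>) * (1 - z) / (\<xi> - z))"
  shows "\<exists>\<phi>\<in>E_class (x1, x2) C Q. \<exists>\<gamma>. a \<le> \<gamma> \<and> \<gamma> \<le> b \<and> b - \<gamma> = (b - a) * R / (\<xi> - z) \<and>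
    (\<forall>t. (t < \<gamma> \<longrightarrow> lam \<le> \<phi> t) \<and> (\<gamma> \<le> t \<longrightarrow> \<phi> t = lam + z - \<xi>))"
proof -
  define r where "r = \<xi> - z"
  have r: "0 < r" "\<xi> < r" "- z < r" using xi by (auto simp: r_def)
  define p where "p = 1 / (1 - \<xi>)"
  define q where "q = 1 / (1 - z)"
  have pq: "p * (1 - \<xi>) = 1" "q * (1 - z) = 1" "0 < p" "0 < q" using xi by (auto simp: p_def q_def)
  have pqr: "p - q = r * p * q" using pq(1,2) unfolding r_def by algebra
  define X where "X = x1 - lam"
  define y where "y = x2 * exp (- lam) - 1"
  define M where "M = 1 / (p - q)"
  have pq_pos: "0 < p - q" unfolding pqr using r pq by simp
  have M: "M * (p - q) = 1" "0 < M" using pq_pos by (auto simp: M_def)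
  have Meq: "M = (1 - \<xi>) * (1 - z) / r" unfolding M_def pqr unfolding p_def q_def by simp
  define A where "A = M * (y - X * q)"
  have Req: "R = M * (y - X * p)" unfolding R_def Meq y_def X_def p_def r_def by (simp add: mult.commute)
  have el: "exp (- lam) * exp lam = 1" by (simp flip: exp_add)
  have x2y: "x2 = exp lam * (y + 1)" unfolding y_def using el by (simp add: algebra_simps)
  have A0: "0 \<le> A"
  proof -
    have "exp lam * (X * q + 1) \<le> exp lam * (y + 1)" using lines(1) unfolding x2y tline_def X_def q_def by simp
    then show ?thesis unfolding A_def using M by simp
  qed
  have R0: "0 \<le> R"
  proof -
    have "exp lam * (X * p + 1) \<le> exp lam * (y + 1)" using lines(2) unfolding x2y tline_def X_def p_def by simp
    then show ?thesis unfolding Req using M by simp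
  qed
  have AR: "A - R = X" unfolding A_def Req using M(1) by algebra
  have AR2: "A * p - R * q = y"
  proof -
    have "A * p - R * q = M * (p - q) * y" unfolding A_def Req by (simp add: algebra_simps)
    then show ?thesis using M(1) by simp
  qed
  have Xb: "z \<le> X" "X \<le> \<xi>" using x1 by (auto simp: X_def)
  \<comment> \<open>The point lies on or below the chord of the upper curve between the tangency
    points over \<open>lam + z\<close> and \<open>lam + \<xi>\<close>. This makes the two lengths
    \<open>\<alpha>\<close> and \<open>\<rho>\<close> fit into the interval.\<close>
  have upper: "r * (y + 1) \<le> (X - z) * p + (\<xi> - X) * q"
  proof -
    have "exp lam * (y + 1) \<le> exp lam * (C * exp X)" using x(2) unfolding x2y X_def by (simp add: exp_diff field_simps)
    then have "y + 1 \<le> C * exp X" by simp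
    then have "r * (y + 1) \<le> r * (C * exp X)" using r by simp
    also have "\<dots> \<le> (X - z) * (C * exp \<xi>) + (\<xi> - X) * (C * exp z)"
      unfolding r_def by (rule exp_chord) (use C xi Xb in auto)
    finally show ?thesis using C_exp_xi[OF C] by (simp add: p_def q_def)
  qed
  have Ale: "r * A \<le> \<xi> * (X - z)"
  proof -
    have "r * (y - X * q) \<le> (X - z) * p + (\<xi> - X) * q - r - r * X * q" using upper by (simp add: algebra_simps)
    also have "\<dots> = (p - q) * (\<xi> * (X - z))" using pq(1,2) unfolding r_def by algebra
    finally have "M * (r * (y - X * q)) \<le> M * ((p - q) * (\<xi> * (X - z)))" using M(2) by (intro mult_left_mono) auto
    also have "\<dots> = \<xi> * (X - z)" using M(1) by (metis mult.assoc mult_1)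
    finally show ?thesis unfolding A_def by (simp add: mult_ac)
  qed
  have Rle: "r * R \<le> - z * (\<xi> - X)"
  proof -
    have "R = A - X" using AR by simp
    then have "r * R \<le> \<xi> * (X - z) - r * X" using Ale by (simp add: right_diff_distrib)
    also have "\<dots> = - z * (\<xi> - X)" unfolding r_def by algebra
    finally show ?thesis .
  qed
  \<comment> \<open>A tail of length \<open>\<alpha>\<close> raises the integral of the constant
    \<open>lam\<close> by \<open>\<xi> * \<alpha>\<close>, and a step of length
    \<open>\<rho>\<close> down to \<open>lam - r\<close> lowers it by \<open>r * \<rho>\<close>;
    these are set equal to \<open>(b - a) * A\<close> and \<open>(b - a) * R\<close>.\<close>
  define \<alpha> where "\<alpha> = (b - a) * A / \<xi>"
  define \<rho> where "\<rho> = (b - a) * R / r"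
  have al0: "0 \<le> \<alpha>" "0 \<le> \<rho>" using A0 R0 ab xi r by (auto simp: \<alpha>_def \<rho>_def)
  have ax: "\<xi> * \<alpha> = (b - a) * A" "r * \<rho> = (b - a) * R" using xi r by (auto simp: \<alpha>_def \<rho>_def)
  have alr: "\<alpha> + \<rho> \<le> b - a"
  proof -
    have "A / \<xi> \<le> (X - z) / r" using Ale xi r by (simp add: field_simps)
    moreover have "R / r \<le> (\<xi> - X) / r"
    proof -
      have "r * R \<le> r * (\<xi> - X)"
        using Rle mult_right_mono[of "- z" r "\<xi> - X"] r Xb by linarith
      then show ?thesis using r by (simp add: divide_right_mono)
    qed
    moreover have "(X - z) / r + (\<xi> - X) / r = 1" using r by (simp add: r_def add_divide_distrib[symmetric])
    ultimately have "A / \<xi> + R / r \<le> 1" by linarith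
    then have "(b - a) * (A / \<xi> + R / r) \<le> (b - a) * 1" using ab by (intro mult_left_mono) auto
    then show ?thesis by (simp add: \<alpha>_def \<rho>_def distrib_left)
  qed
  define \<gamma> where "\<gamma> = b - \<rho>"
  have ga: "a + \<alpha> \<le> \<gamma>" "\<gamma> \<le> b" "a \<le> \<gamma>" using alr al0 by (auto simp: \<gamma>_def)
  have e1: "(b - a) * x1 = lam * (b - a) + \<xi> * \<alpha> + (z - \<xi>) * (b - \<gamma>)"
  proof -
    have x1e: "x1 = lam + (A - R)" unfolding AR X_def by simp
    have "(b - a) * x1 = lam * (b - a) + (b - a) * A - (b - a) * R" by (subst x1e) (simp add: algebra_simps)
    also have "\<dots> = lam * (b - a) + \<xi> * \<alpha> - r * \<rho>" unfolding ax ..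
    finally show ?thesis by (simp add: \<gamma>_def r_def algebra_simps)
  qed
  have er: "exp (lam + z - \<xi>) = exp lam * (1 - r * q)"
  proof -
    have "(z - \<xi>) / (1 - z) = - (r * q)" unfolding q_def r_def by (simp add: minus_divide_left)
    then show ?thesis unfolding tline_lower_point[OF C] tline_def by simp
  qed
  have e2: "(b - a) * x2 = exp lam * (\<gamma> - a + \<alpha> * (1 / (1 - \<xi>) - 1)) + exp (lam + z - \<xi>) * (b - \<gamma>)"
  proof -
    have "1 / (1 - \<xi>) - 1 = \<xi> * p" using pq(1) unfolding p_def[symmetric] by algebra
    then have "exp lam * (\<gamma> - a + \<alpha> * (1 / (1 - \<xi>) - 1)) + exp (lam + z - \<xi>) * (b - \<gamma>)
        = exp lam * ((b - a) + (\<xi> * \<alpha>) * p - (r * \<rho>) * q)"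
      unfolding er by (simp add: \<gamma>_def algebra_simps)
    also have "\<dots> = exp lam * ((b - a) * (1 + (A * p - R * q)))" unfolding ax by (simp add: algebra_simps)
    also have "\<dots> = (b - a) * x2" unfolding AR2 x2y by (simp add: algebra_simps)
    finally show ?thesis by simp
  qed
  have gam: "b - \<gamma> = (b - a) * R / (\<xi> - z)" by (simp add: \<gamma>_def \<rho>_def r_def)
  show ?thesis
  proof (cases "\<alpha> = 0")
    \<comment> \<open>Without a tail the function has just two values, and
      \<open>tail_step_in_E_class\<close>, which asks for a positive length, is replaced by the
      two-valued lemma.\<close>
    case True
    have "(\<lambda>t. if t < \<gamma> then lam else lam + z - \<xi>) \<in> E_class (x1, x2) C Q"
    proof (rule two_valued_in_E_class[OF C ab Q _ _ ga(3,2)])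
      show "(b - a) * x1 = (\<gamma> - a) * lam + (b - \<gamma>) * (lam + z - \<xi>)" using e1 True by (simp add: algebra_simps)
      show "(b - a) * x2 = (\<gamma> - a) * exp lam + (b - \<gamma>) * exp (lam + z - \<xi>)" using e2 True by (simp add: algebra_simps)
    qed (use xi in auto)
    then show ?thesis using ga gam by (intro bexI[of _ "\<lambda>t. if t < \<gamma> then lam else lam + z - \<xi>"] exI[of _ \<gamma>]) auto
  next
    case False
    then have "0 < \<alpha>" using al0 by simp
    from tail_step_in_E_class[OF C ab Q this ga(1,2) e1 e2 x(2) x1(1)]
    have "(\<lambda>t. if t < \<gamma> then tailf lam \<xi> a \<alpha> t else lam + z - \<xi>) \<in> E_class (x1, x2) C Q" .
    then show ?thesis using ga gam xi
      by (intro bexI[of _ "\<lambda>t. if t < \<gamma> then tailf lam \<xi> a \<alpha> t else lam + z - \<xi>"] exI[of _ \<gamma>]) (auto simp: tailf_def)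
  qed
qed

text \<open>Where the function equals \<open>- k\<close>, its absolute value is
  \<open>\<phi> + 2 * k\<close>, so the first absolute moment follows from \<open>x1\<close> and the
  length of that part. Nonnegative functions are the case \<open>\<gamma> = b\<close>,
  \<open>k = 0\<close>.\<close>

lemma eavg_abs:
  assumes phi: "\<phi> \<in> E_class (x1, x2) C Q" and g: "a \<le> \<gamma>" "\<gamma> \<le> b"
    and sg: "\<And>t. a < t \<Longrightarrow> t < \<gamma> \<Longrightarrow> 0 \<le> \<phi> t" "\<And>t. \<gamma> \<le> t \<Longrightarrow> t < b \<Longrightarrow> \<phi> t = - k" and k: "0 \<le> k"
  shows "eavg Q (\<lambda>t. \<bar>\<phi> t\<bar> powr 1) \<le> ereal (x1 + 2 * k * (b - \<gamma>) / (b - a))"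
proof -
  have E: "set_integrable lebesgue {a<..<b} \<phi>" "integral {a..b} \<phi> = (b - a) * x1"
    using phi unfolding E_class_iff[OF ab Q] by auto
  define h where "h t = (if t < \<gamma> then 0 else 2 * k)" for t
  have h0: "set_integrable lebesgue {a<..<\<gamma>} h" "integral {a..\<gamma>} h = 0 * (\<gamma> - a)"
    using g integral_const_Ico[of a \<gamma> h 0] by (auto simp: h_def)
  note H = integral_const_ext[OF h0(1) g, of "2 * k"]
  have hi: "set_integrable lebesgue {a<..<b} h" by (rule H(1)) (simp add: h_def)
  have hI: "integral {a..b} h = 2 * k * (b - \<gamma>)" using H(2)[of b] h0 g by (simp add: h_def)
  have pw: "\<bar>\<phi> t\<bar> powr 1 = \<phi> t + h t" if "a < t" "t < b" for t
    using sg[of t] that k by (cases "t < \<gamma>") (auto simp: h_def)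
  have s: "set_integrable lebesgue {a<..<b} (\<lambda>t. \<phi> t + h t)" using E(1) hi by (rule set_integral_add(1))
  have "(\<integral>\<^sup>+t\<in>{a<..<b}. ennreal (\<bar>\<phi> t\<bar> powr 1) \<partial>lebesgue) = (\<integral>\<^sup>+t. ennreal (indicator {a<..<b} t *\<^sub>R (\<phi> t + h t)) \<partial>lebesgue)"
    by (rule nn_integral_cong) (use pw in \<open>auto simp: indicator_def\<close>)
  also have "\<dots> = ennreal (LINT t|lebesgue. indicator {a<..<b} t *\<^sub>R (\<phi> t + h t))"
  proof (rule nn_integral_eq_integral)
    show "integrable lebesgue (\<lambda>t. indicator {a<..<b} t *\<^sub>R (\<phi> t + h t))" using s by (simp add: set_integrable_def)
    have "0 \<le> \<phi> t + h t" if "a < t" "t < b" for t unfolding pw[OF that, symmetric] by simp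
    then show "AE t in lebesgue. 0 \<le> indicator {a<..<b} t *\<^sub>R (\<phi> t + h t)" by (auto simp: indicator_def)
  qed
  also have "(LINT t|lebesgue. indicator {a<..<b} t *\<^sub>R (\<phi> t + h t)) = (b - a) * (x1 + 2 * k * (b - \<gamma>) / (b - a))"
  proof -
    have "(LINT t:{a<..<b}|lebesgue. \<phi> t + h t) = (LINT t:{a<..<b}|lebesgue. \<phi> t) + (LINT t:{a<..<b}|lebesgue. h t)"
      by (rule set_integral_add(2)[OF E(1) hi])
    also have "(LINT t:{a<..<b}|lebesgue. \<phi> t) = (b - a) * x1"
      using set_lebesgue_integral_eq_integral(2)[OF E(1)] E(2) by (simp flip: integral_open_interval_real)
    also have "(LINT t:{a<..<b}|lebesgue. h t) = 2 * k * (b - \<gamma>)"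
      using set_lebesgue_integral_eq_integral(2)[OF hi] hI by (simp flip: integral_open_interval_real)
    finally show ?thesis using ab unfolding set_lebesgue_integral_def by (simp add: distrib_left)
  qed
  finally have I: "(\<integral>\<^sup>+t\<in>{a<..<b}. ennreal (\<bar>\<phi> t\<bar> powr 1) \<partial>lebesgue) = ennreal ((b - a) * (x1 + 2 * k * (b - \<gamma>) / (b - a)))" .
  have nn: "0 \<le> x1 + 2 * k * (b - \<gamma>) / (b - a)"
  proof -
    have "0 \<le> integral {a<..<b} (\<lambda>t. \<phi> t + h t)"
    proof (rule Henstock_Kurzweil_Integration.integral_nonneg)
      show "(\<lambda>t. \<phi> t + h t) integrable_on {a<..<b}" by (rule set_lebesgue_integral_eq_integral(1)[OF s])
      show "0 \<le> \<phi> t + h t" if "t \<in> {a<..<b}" for t using pw[of t] that powr_ge_zero[of "\<bar>\<phi> t\<bar>" 1] by simp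
    qed
    also have "\<dots> = integral {a..b} \<phi> + integral {a..b} h"
      using set_lebesgue_integral_eq_integral(1)[OF E(1)] set_lebesgue_integral_eq_integral(1)[OF hi]
      by (subst Henstock_Kurzweil_Integration.integral_add) (auto simp: integral_open_interval_real)
    finally have "0 \<le> (b - a) * x1 + 2 * k * (b - \<gamma>)" unfolding E(2) hI .
    then have "0 \<le> ((b - a) * x1 + 2 * k * (b - \<gamma>)) / (b - a)" using ab by simp
    then show ?thesis using ab by (simp add: add_divide_distrib)
  qed
  show ?thesis by (rule eavg_le[OF ab Q _ nn]) (use I in simp)
qed

lemma eavg_abs_nonpos:
  assumes phi: "\<phi> \<in> E_class (x1, x2) C Q" and sg: "\<And>t. \<phi> t \<le> 0"
  shows "eavg Q (\<lambda>t. \<bar>\<phi> t\<bar> powr 1) \<le> ereal (- x1)"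
proof -
  have E: "set_integrable lebesgue {a<..<b} \<phi>" "integral {a..b} \<phi> = (b - a) * x1"
    using phi unfolding E_class_iff[OF ab Q] by auto
  have L: "(LINT t:{a<..<b}|lebesgue. \<phi> t) = (b - a) * x1"
    using set_lebesgue_integral_eq_integral(2)[OF E(1)] E(2) by (simp flip: integral_open_interval_real)
  have "(\<integral>\<^sup>+t\<in>{a<..<b}. ennreal (\<bar>\<phi> t\<bar> powr 1) \<partial>lebesgue) = (\<integral>\<^sup>+t. ennreal (- (indicator {a<..<b} t *\<^sub>R \<phi> t)) \<partial>lebesgue)"
    by (rule nn_integral_cong) (use sg in \<open>auto simp: indicator_def\<close>)
  also have "\<dots> = ennreal (LINT t|lebesgue. - (indicator {a<..<b} t *\<^sub>R \<phi> t))"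
    by (rule nn_integral_eq_integral) (use E(1) sg in \<open>auto simp: set_integrable_def indicator_def\<close>)
  also have "(LINT t|lebesgue. - (indicator {a<..<b} t *\<^sub>R \<phi> t)) = (b - a) * (- x1)"
    using L unfolding set_lebesgue_integral_def by simp
  finally have I: "(\<integral>\<^sup>+t\<in>{a<..<b}. ennreal (\<bar>\<phi> t\<bar> powr 1) \<partial>lebesgue) = ennreal ((b - a) * (- x1))" .
  have "(LINT t:{a<..<b}|lebesgue. \<phi> t) \<le> 0"
  proof -
    have "0 \<le> (LINT t|lebesgue. - (indicator {a<..<b} t *\<^sub>R \<phi> t))"
      by (rule Bochner_Integration.integral_nonneg) (use sg in \<open>auto simp: indicator_def\<close>)
    then show ?thesis unfolding set_lebesgue_integral_def by simp
  qed
  then have "x1 \<le> 0" unfolding L using ab by (simp add: mult_le_0_iff)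
  then show ?thesis by (intro eavg_le[OF ab Q]) (use I in auto)
qed

lemma bell_b1_eq: "bell_b 1 C Q (x1, x2) = ereal (b1_cand C (x1, x2))"
proof (rule antisym)
  show "ereal (b1_cand C (x1, x2)) \<le> bell_b 1 C Q (x1, x2)" unfolding bell_b_def
  proof (rule INF_greatest)
    fix \<phi> assume "\<phi> \<in> E_class (x1, x2) C Q"
    then interpret S: Ainf_sample "restrict_space lebesgue {a<..<b}" \<phi> C "b - a" x1 x2
      by (rule E_class_sample[OF C ab Q])
    have "(\<integral>\<^sup>+t\<in>{a<..<b}. ennreal (\<bar>\<phi> t\<bar> powr 1) \<partial>lebesgue) = (\<integral>\<^sup>+t. ennreal \<bar>\<phi> t\<bar> \<partial>restrict_space lebesgue {a<..<b})"
      by (simp add: nn_integral_Ioo_restrict)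
    also have "\<dots> = ennreal (LINT t|restrict_space lebesgue {a<..<b}. \<bar>\<phi> t\<bar>)"
      by (rule nn_integral_eq_integral) (use S.int1 in auto)
    finally show "ereal (b1_cand C (x1, x2)) \<le> eavg Q (\<lambda>t. \<bar>\<phi> t\<bar> powr 1)"
      by (intro eavg_ge[OF ab Q]) (use S.b1_lower[OF x] in \<open>simp add: ennreal_leI\<close>)
  qed
  show "bell_b 1 C Q (x1, x2) \<le> ereal (b1_cand C (x1, x2))"
  proof -
    consider (m) "(x1, x2) \<in> b1_Omega_minus C" | (p) "(x1, x2) \<notin> b1_Omega_minus C" "(x1, x2) \<in> b1_Omega_plus C"
      | (z) "(x1, x2) \<notin> b1_Omega_minus C" "(x1, x2) \<notin> b1_Omega_plus C" "(x1, x2) \<in> b1_Omega_zero C"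
      using x unfolding b1_Omega_minus_def b1_Omega_plus_def b1_Omega_zero_def by fastforce
    then show ?thesis
    proof cases
      case m
      obtain \<phi> where phi: "\<phi> \<in> E_class (x1, x2) C Q" "\<And>t. \<phi> t \<le> u_minus C (x1, x2)" using minus_optimizer by blast
      \<comment> \<open>The point lies under the left tangent from 0 or to the left of its tangency
        point, so the tail towards minus infinity starts at a nonpositive value and the triangle
        inequality becomes an equality.\<close>
      have "u_minus C (x1, x2) \<le> 0"
        by (rule u_minus_le[OF C x])
           (use m x tline_end[OF xi(4) xi_minus_props(2)[OF C], of z] in \<open>auto simp: b1_Omega_minus_def tline_xi_eq_0[OF C]\<close>)
      then have "eavg Q (\<lambda>t. \<bar>\<phi> t\<bar> powr 1) \<le> ereal (- x1)"
        by (intro eavg_abs_nonpos[OF phi(1)] order_trans[OF phi(2)])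
      then show ?thesis unfolding bell_b_def using m C by (intro INF_lower2[OF phi(1)]) (simp add: b1_cand_def)
    next
      case p
      obtain \<phi> where phi: "\<phi> \<in> E_class (x1, x2) C Q" "\<And>t. u_plus C (x1, x2) \<le> \<phi> t" using plus_optimizer by blast
      have "0 \<le> u_plus C (x1, x2)"
        by (rule u_plus_ge[OF C x])
           (use p x tline_end[OF xi(2) xi_plus_props(3)[OF C], of \<xi>] in \<open>auto simp: b1_Omega_plus_def tline_xi_eq_0[OF C]\<close>)
      then have "eavg Q (\<lambda>t. \<bar>\<phi> t\<bar> powr 1) \<le> ereal (x1 + 2 * 0 * (b - b) / (b - a))"
        by (intro eavg_abs[OF phi(1)] order_trans[OF _ phi(2)]) (use ab in auto)
      then show ?thesis unfolding bell_b_def using p C by (intro INF_lower2[OF phi(1)]) (simp add: b1_cand_def)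
    next
      case z
      have lines: "tline z x1 0 \<le> x2" "tline \<xi> x1 0 \<le> x2" "0 + z \<le> x1" "x1 \<le> 0 + \<xi>"
      proof -
        have "tline z x1 0 \<le> exp x1" if "0 \<le> x1" by (rule tline_le_exp) (use xi that in \<open>auto simp: mult_le_0_iff\<close>)
        moreover have "tline \<xi> x1 0 \<le> exp x1" if "x1 \<le> 0" by (rule tline_le_exp) (use xi that in \<open>auto simp: mult_le_0_iff\<close>)
        ultimately show "tline z x1 0 \<le> x2" "tline \<xi> x1 0 \<le> x2" "0 + z \<le> x1" "x1 \<le> 0 + \<xi>"
          using z(3) x xi unfolding b1_Omega_zero_def tline_xi_eq_0[OF C] by auto
      qed
      define R where "R = (x2 * exp (- 0) - 1 - (x1 - 0) / (1 - \<xi>)) * ((1 - \<xi>) * (1 - z) / (\<xi> - z))"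
      obtain \<phi> \<gamma> where phi: "\<phi> \<in> E_class (x1, x2) C Q" and g: "a \<le> \<gamma>" "\<gamma> \<le> b" "b - \<gamma> = (b - a) * R / (\<xi> - z)"
        and v: "\<And>t. t < \<gamma> \<Longrightarrow> 0 \<le> \<phi> t" "\<And>t. \<gamma> \<le> t \<Longrightarrow> \<phi> t = 0 + z - \<xi>"
        using angle_optimizer[OF lines] unfolding R_def by metis
      have "eavg Q (\<lambda>t. \<bar>\<phi> t\<bar> powr 1) \<le> ereal (x1 + 2 * (\<xi> - z) * (b - \<gamma>) / (b - a))"
        by (rule eavg_abs[OF phi g(1,2)]) (use v xi in auto)
      also have "x1 + 2 * (\<xi> - z) * (b - \<gamma>) / (b - a) = x1 + 2 * R"
      proof -
        have "2 * r * (l * R / r) / l = 2 * R" if "r \<noteq> 0" "l \<noteq> 0" for r l :: real using that by simp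
        from this[of "\<xi> - z" "b - a"] show ?thesis unfolding g(3) using ab xi by simp
      qed
      also have "\<dots> = b1_cand C (x1, x2)"
      proof -
        define K where "K = (1 - \<xi>) * (1 - z) / (\<xi> - z)"
        have k: "K / (1 - \<xi>) = (1 - z) / (\<xi> - z)" using xi by (simp add: K_def)
        have "R = K * (x2 - 1) - x1 * (K / (1 - \<xi>))"
          unfolding R_def K_def[symmetric] by (simp add: algebra_simps)
        then have R: "R = (1 - z) * (1 - \<xi>) / (\<xi> - z) * (x2 - 1) - x1 * ((1 - z) / (\<xi> - z))"
          unfolding k by (simp add: K_def mult.commute)
        define r where "r = \<xi> - z"
        have "r \<noteq> 0" using xi by (simp add: r_def)
        then have "x1 - 2 * (x1 * ((1 - z) / r)) = (x1 * r - 2 * x1 * (1 - z)) / r" by (simp add: field_simps)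
        also have "x1 * r - 2 * x1 * (1 - z) = (\<xi> + z - 2) * x1" by (simp add: r_def algebra_simps)
        finally have "x1 - 2 * (x1 * ((1 - z) / (\<xi> - z))) = (\<xi> + z - 2) / (\<xi> - z) * x1" by (simp add: r_def)
        then show ?thesis using z C unfolding R by (simp add: b1_cand_def)
      qed
      finally show ?thesis unfolding bell_b_def by (rule INF_lower2[OF phi])
    qed
  qed
qed

end

section \<open>Level sets\<close>

context bellman_point
begin

lemma D_regions:
  "(x1, x2) \<in> D_Omega4 lam C \<or> (x1, x2) \<in> D_Omega3 lam C \<or> (x1, x2) \<in> D_Omega2 lam C \<or> (x1, x2) \<in> D_Omega1 lam C"
  using x xi unfolding D_Omega1_def D_Omega2_def D_Omega3_def D_Omega4_def by auto

lemma ratio_le_bell_D: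
  "\<phi> \<in> E_class (x1, x2) C Q \<Longrightarrow> ereal (measure lebesgue {t \<in> Q. lam \<le> \<phi> t} / (b - a)) \<le> bell_D lam C Q (x1, x2)"
  unfolding bell_D_def measure_interval[OF ab Q] by (rule SUP_upper)

lemma bell_D_lower: "ereal (D_cand lam C (x1, x2)) \<le> bell_D lam C Q (x1, x2)"
proof -
  let ?x = "(x1, x2)"
  consider (4) "?x \<in> D_Omega4 lam C" | (3) "?x \<notin> D_Omega4 lam C" "?x \<in> D_Omega3 lam C"
    | (2) "?x \<notin> D_Omega4 lam C" "?x \<notin> D_Omega3 lam C" "?x \<in> D_Omega2 lam C"
    | (1) "?x \<notin> D_Omega4 lam C" "?x \<notin> D_Omega3 lam C" "?x \<notin> D_Omega2 lam C" "?x \<in> D_Omega1 lam C"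
    using D_regions by blast
  then show ?thesis
  proof cases
    case 4
    obtain \<phi> where phi: "\<phi> \<in> E_class (x1, x2) C Q" "\<And>t. u_plus C (x1, x2) \<le> \<phi> t" using plus_optimizer by blast
    \<comment> \<open>The point lies under the right tangent from \<open>lam\<close> or beyond its
      tangency point, so the tail starts at least at \<open>lam\<close> and never goes below
      it.\<close>
    have "lam \<le> u_plus C (x1, x2)"
    proof (cases "lam + \<xi> \<le> x1")
      case True
      then show ?thesis using u_plus_props(1)[OF C x] by simp
    next
      case False
      then show ?thesis
        by (intro u_plus_ge[OF C x]) (use 4 in \<open>auto simp: D_Omega4_def tline_xi_eq[OF C]\<close>)
    qed
    then have "{t \<in> Q. lam \<le> \<phi> t} = Q" using phi(2) order_trans by blast
    then have "measure lebesgue {t \<in> Q. lam \<le> \<phi> t} / (b - a) = 1" using measure_interval[OF ab Q] ab by simp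
    then show ?thesis using ratio_le_bell_D[OF phi(1), of lam] 4 C by (simp add: D_cand_def)
  next
    case 3
    have lines: "tline z x1 lam \<le> x2" "tline \<xi> x1 lam \<le> x2" "lam + z \<le> x1" "x1 \<le> lam + \<xi>"
    proof -
      have "tline z x1 lam \<le> exp x1" if "lam \<le> x1" by (rule tline_le_exp) (use xi that in \<open>auto simp: mult_le_0_iff\<close>)
      moreover have "tline \<xi> x1 lam \<le> exp x1" if "x1 \<le> lam" by (rule tline_le_exp) (use xi that in \<open>auto simp: mult_le_0_iff\<close>)
      ultimately show "tline z x1 lam \<le> x2" "tline \<xi> x1 lam \<le> x2" "lam + z \<le> x1" "x1 \<le> lam + \<xi>"
        using 3(2) x xi unfolding D_Omega3_def tline_xi_eq[OF C] by auto
    qed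
    define R where "R = (x2 * exp (- lam) - 1 - (x1 - lam) / (1 - \<xi>)) * ((1 - \<xi>) * (1 - z) / (\<xi> - z))"
    obtain \<phi> \<gamma> where phi: "\<phi> \<in> E_class (x1, x2) C Q" and g: "a \<le> \<gamma>" "\<gamma> \<le> b" "b - \<gamma> = (b - a) * R / (\<xi> - z)"
      and v: "\<And>t. t < \<gamma> \<Longrightarrow> lam \<le> \<phi> t" "\<And>t. \<gamma> \<le> t \<Longrightarrow> \<phi> t = lam + z - \<xi>"
      using angle_optimizer[OF lines] unfolding R_def by metis
    have "lam \<le> \<phi> t \<longleftrightarrow> t < \<gamma>" for t using v[of t] xi by (cases "t < \<gamma>") auto
    then have "measure lebesgue {t \<in> Q. lam \<le> \<phi> t} = \<gamma> - a" using level_measure_prefix[OF ab Q g(1,2)] by blast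
    moreover have "(\<gamma> - a) / (b - a) = 1 - R / (\<xi> - z)"
    proof -
      have "\<gamma> - a = (b - a) * (1 - R / (\<xi> - z))" using g(3) by (simp add: algebra_simps)
      then show ?thesis using ab by (simp del: right_diff_distrib)
    qed
    moreover have "1 - R / (\<xi> - z) = D_cand lam C ?x"
    proof -
      define r where "r = \<xi> - z"
      define K where "K = (1 - z) / r\<^sup>2"
      have "R / r = (x2 * exp (- lam) - 1 - (x1 - lam) / (1 - \<xi>)) * (K * (1 - \<xi>))"
        unfolding R_def K_def r_def[symmetric] by (simp add: power2_eq_square)
      also have "\<dots> = K * ((x2 * exp (- lam) - 1) * (1 - \<xi>) - (x1 - lam) / (1 - \<xi>) * (1 - \<xi>))" by (simp add: algebra_simps)
      also have "(x1 - lam) / (1 - \<xi>) * (1 - \<xi>) = x1 - lam" using xi by simp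
      finally have "1 - R / (\<xi> - z) = K * (x1 - lam + (1 - x2 * exp (- lam)) * (1 - \<xi>)) + 1"
        by (simp add: r_def algebra_simps)
      then show ?thesis using 3 C by (simp add: D_cand_def K_def r_def)
    qed
    ultimately show ?thesis using ratio_le_bell_D[OF phi, of lam] by simp
  next
    case 2
    define v where "v = D_v lam ?x"
    note v = D_v_props[OF C 2(3), folded v_def]
    \<comment> \<open>The point divides the chord from \<open>(v, exp v)\<close> to
      \<open>(lam, exp lam)\<close> in this ratio.\<close>
    define \<gamma> where "\<gamma> = a + (b - a) * ((x1 - v) / (lam - v))"
    have th: "0 \<le> (x1 - v) / (lam - v)" "(x1 - v) / (lam - v) \<le> 1" using v 2(3) by (auto simp: D_Omega2_def divide_le_eq)
    have g: "a \<le> \<gamma>" "\<gamma> \<le> b" using th ab mult_left_le[OF th(2), of "b - a"] mult_nonneg_nonneg[OF _ th(1), of "b - a"] by (auto simp: \<gamma>_def)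
    have ga: "\<gamma> - a = (b - a) * ((x1 - v) / (lam - v))" by (simp add: \<gamma>_def)
    have gl: "(\<gamma> - a) * (lam - v) = (b - a) * (x1 - v)" unfolding ga using v(1) by simp
    have "(\<lambda>t. if t < \<gamma> then lam else v) \<in> E_class (x1, x2) C Q"
    proof (rule two_valued_in_E_class[OF C ab Q v(2) _ g])
      show "v \<le> lam" using v by simp
      show "(b - a) * x1 = (\<gamma> - a) * lam + (b - \<gamma>) * v" using gl by (simp add: algebra_simps)
      have "(x2 - exp lam) * (v - lam) = (exp v - exp lam) * (x1 - lam)" using v(1,4) by simp
      then have "(b - a) * ((x2 - exp lam) * (v - lam)) = (exp v - exp lam) * ((b - a) * (x1 - lam))" by simp
      also have "(b - a) * (x1 - lam) = (\<gamma> - b) * (lam - v)" using gl by (simp add: algebra_simps)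
      finally have "((b - a) * (x2 - exp lam) + (exp v - exp lam) * (\<gamma> - b)) * (v - lam) = 0" by (simp add: algebra_simps)
      then have "(b - a) * (x2 - exp lam) + (exp v - exp lam) * (\<gamma> - b) = 0" using v(1) by simp
      then show "(b - a) * x2 = (\<gamma> - a) * exp lam + (b - \<gamma>) * exp v" by (simp add: algebra_simps)
    qed
    from ratio_le_bell_D[OF this, of lam]
    have "ereal ((\<gamma> - a) / (b - a)) \<le> bell_D lam C Q (x1, x2)"
      using level_measure_prefix[OF ab Q g, of lam "\<lambda>t. if t < \<gamma> then lam else v"] v(1) by simp
    moreover have "(\<gamma> - a) / (b - a) = D_cand lam C ?x" unfolding ga using 2 C ab by (simp add: D_cand_def v_def)
    ultimately show ?thesis by simp
  next
    case 1
    define u where "u = u_plus C ?x"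
    note up = u_plus_props[OF C x, folded u_def]
    define r where "r = \<xi> - z"
    have r: "0 < r" using xi by (simp add: r_def)
    have cand: "D_cand lam C ?x = 1 / r * exp ((r + u - lam) / \<xi>) * (x1 - u)"
      using 1 C by (simp add: D_cand_def u_def r_def)
    show ?thesis
    proof (cases "u = x1")
      \<comment> \<open>On the lower boundary the candidate is 0 in this region, so any member of
        the class will do.\<close>
      case True
      obtain \<phi> where phi: "\<phi> \<in> E_class (x1, x2) C Q" using plus_optimizer by blast
      have "0 \<le> measure lebesgue {t \<in> Q. lam \<le> \<phi> t} / (b - a)" using ab by simp
      moreover have "D_cand lam C ?x = 0" unfolding cand True by simp
      ultimately have "ereal (D_cand lam C ?x) \<le> ereal (measure lebesgue {t \<in> Q. lam \<le> \<phi> t} / (b - a))" by simp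
      also have "\<dots> \<le> bell_D lam C Q (x1, x2)" by (rule ratio_le_bell_D[OF phi])
      finally show ?thesis .
    next
      case False
      define \<tau> where "\<tau> = (b - a) * (x1 - u) / \<xi>"
      note T = tail_plus[OF C ab Q x False[unfolded u_def], folded u_def, folded \<tau>_def]
      have x1e: "x1 = u + \<xi> * \<tau> / (b - a)" unfolding T(4) using ab by simp
      have ul: "u \<le> lam - (\<xi> - z)" unfolding u_def using D_Omega1_u_plus_le[OF C x 1(4)] by simp
      define \<alpha> where "\<alpha> = \<tau> * exp ((u + (\<xi> - z) - lam) / \<xi>)"
      define \<kappa> where "\<kappa> = \<alpha> * \<xi> / (\<xi> - z)"
      \<comment> \<open>Cutting the tail at the level \<open>lam\<close> leaves length
        \<open>\<kappa>\<close> at that level; everything else stays at or below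
        \<open>lam - r\<close>.\<close>
      note K = capped_tail_in_E_class[OF C ab Q T(1,2) x1e ul, folded \<alpha>_def, folded \<kappa>_def]
      let ?\<phi> = "\<lambda>t. if t < a + \<kappa> then lam else if t < a + \<alpha> then lam - (\<xi> - z) else tailf u \<xi> a \<tau> t"
      have phi: "?\<phi> \<in> E_class (x1, x2) C Q" using K(1) up(3) by simp
      have g: "a \<le> a + \<kappa>" "a + \<kappa> \<le> b" using K(2-4) T(2) by auto
      have "lam \<le> ?\<phi> t \<longleftrightarrow> t < a + \<kappa>" for t
      proof (cases "t < a + \<kappa>")
        case False
        then have "?\<phi> t \<le> lam - (\<xi> - z)" using K(5)[of t] by simp
        then show ?thesis using False r unfolding r_def by linarith
      qed simp
      from level_measure_prefix[OF ab Q g this]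
      have m: "measure lebesgue {t \<in> Q. lam \<le> ?\<phi> t} = a + \<kappa> - a" .
      have q: "\<kappa> / (b - a) = D_cand lam C ?x"
      proof -
        have "\<kappa> = (\<xi> * \<tau>) * exp ((r + u - lam) / \<xi>) / r" unfolding \<kappa>_def \<alpha>_def r_def by (simp add: algebra_simps)
        then have "\<kappa> = (b - a) * (exp ((r + u - lam) / \<xi>) * (x1 - u) / r)" unfolding T(4) by (simp add: mult_ac)
        then show ?thesis unfolding cand using ab by simp
      qed
      show ?thesis using ratio_le_bell_D[OF phi, of lam] unfolding m q[symmetric] add_diff_cancel_left' .
    qed
  qed
qed

lemma bell_D_eq: "bell_D lam C Q (x1, x2) = ereal (D_cand lam C (x1, x2))"
proof (rule antisym[OF _ bell_D_lower])
  show "bell_D lam C Q (x1, x2) \<le> ereal (D_cand lam C (x1, x2))" unfolding bell_D_def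
  proof (rule SUP_least)
    fix \<phi> assume phi: "\<phi> \<in> E_class (x1, x2) C Q"
    then interpret S: Ainf_sample "restrict_space lebesgue {a<..<b}" \<phi> C "b - a" x1 x2
      by (rule E_class_sample[OF C ab Q])
    have "set_integrable lebesgue {a<..<b} \<phi>" using phi unfolding E_class_iff[OF ab Q] by auto
    from level_sets(1)[OF ab Q this, of lam] S.D_upper[OF x, of lam]
    have "measure lebesgue {t \<in> Q. lam \<le> \<phi> t} \<le> (b - a) * D_cand lam C (x1, x2)" by simp
    then show "ereal (measure lebesgue {t \<in> Q. lam \<le> \<phi> t} / measure lebesgue Q) \<le> ereal (D_cand lam C (x1, x2))"
      using ab by (simp add: measure_interval[OF ab Q] divide_le_eq mult.commute)
  qed
qed

end

text \<open>The function \<open>(1 - q) * exp q\<close> decreases for positive \<open>q\<close> and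
  has the value \<open>1 / C\<close> at \<open>xi_plus C\<close>. With \<open>q = 2 - p\<close> the
  last hypothesis is the bound on \<open>C\<close> in the theorem.\<close>

lemma xi_plus_ge:
  assumes C: "1 < C" and q: "0 \<le> q" "q < 1" "exp (- q) / (1 - q) \<le> C"
  shows "q \<le> xi_plus C"
proof (rule ccontr)
  note xi = xi_plus_props[OF C]
  assume "\<not> q \<le> xi_plus C"
  then have lt: "xi_plus C < q" by simp

  have "(1 - q) * exp q < (1 - xi_plus C) * exp (xi_plus C)"
  proof (rule DERIV_neg_imp_decreasing_open[OF lt])
    fix y assume "xi_plus C < y" "y < q"
    then have "y > 0" using xi by simp
    then show "\<exists>d. ((\<lambda>x. (1 - x) * exp x) has_real_derivative d) (at y) \<and> d < 0"
      by (intro exI[of _ "- y * exp y"]) (auto intro!: derivative_eq_intros simp: algebra_simps)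
  qed (auto intro!: continuous_intros)
  also have "(1 - xi_plus C) * exp (xi_plus C) = 1 / C"
    using xi(3) C by (simp add: exp_minus field_simps)
  finally have "C * ((1 - q) * exp q) < 1" using C by (simp add: field_simps)
  moreover have "1 \<le> C * ((1 - q) * exp q)"
  proof -
    have "exp (- q) / (1 - q) * ((1 - q) * exp q) \<le> C * ((1 - q) * exp q)"
      using q by (intro mult_right_mono) auto
    moreover have "exp (- q) / (1 - q) * ((1 - q) * exp q) = 1" using q by (simp flip: exp_add)
    ultimately show ?thesis by simp
  qed
  ultimately show False by simp
qed

theorem theorem2p1:
  fixes C :: real and Q :: "real set"
  assumes "C \<ge> 1" and "bdd_interval Q"
  shows
    "(\<forall>p. 1 < p \<and> p \<le> 2 \<and> C \<ge> exp (p - 2) / (p - 1) \<longrightarrow>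
        (\<forall>x\<in>Omega C. bell_b p C Q x = ereal (b_cand p C x))) \<and>
     (\<forall>x\<in>Omega C. bell_b 2 C Q x = ereal (b_cand 2 C x)) \<and>
     (\<forall>x\<in>Omega C. bell_b 1 C Q x = ereal (b1_cand C x)) \<and>
     (\<forall>x\<in>Omega C. bell_B2 C Q x = ereal (B2_cand C x)) \<and>
     (\<forall>\<delta>. 1 \<le> \<delta> \<and> ereal \<delta> < 1 / ereal (xi_plus C) \<longrightarrow>
        (\<forall>x\<in>Omega C. bell_A \<delta> C Q x = ereal (A_cand \<delta> C x))) \<and>
     (\<forall>\<delta>. 1 \<le> \<delta> \<and> ereal \<delta> \<ge> 1 / ereal (xi_plus C) \<longrightarrow>
        (\<forall>x\<in>Omega C.
           (snd x = exp (fst x) \<longrightarrow> bell_A \<delta> C Q x = ereal (exp (\<delta> * fst x))) \<and>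
           (snd x > exp (fst x) \<longrightarrow> bell_A \<delta> C Q x = \<infinity>))) \<and>
     (\<forall>lam. \<forall>x\<in>Omega C. bell_D lam C Q x = ereal (D_cand lam C x))"
proof -
  obtain a b where ab: "a < b" and Q: "{a<..<b} \<subseteq> Q" "Q \<subseteq> {a..b}"
    using bdd_interval_endpoints[OF assms(2)] .
  note bv = boundary_values[OF ab Q assms(1)]
  show ?thesis
  proof (cases "C = 1")
    case True
    have O: "\<exists>s. x = (s, exp s)" if "x \<in> Omega C" for x
      using that True by (auto simp: Omega_def)
    have bp: "bell_b p C Q x = ereal (b_cand p C x)" if "x \<in> Omega C" for p x
      using O[OF that] bv(1) True by (auto simp: b_cand_def)
    have b1: "bell_b 1 C Q x = ereal (b1_cand C x)" if "x \<in> Omega C" for x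
      using O[OF that] bv(1)[of 1] True by (auto simp: b1_cand_def)
    have B2: "bell_B2 C Q x = ereal (B2_cand C x)" if "x \<in> Omega C" for x
      using O[OF that] bv(2) True by (auto simp: B2_cand_def)
    have A: "bell_A \<delta> C Q x = ereal (A_cand \<delta> C x)" if "x \<in> Omega C" for \<delta> x
      using O[OF that] bv(3) True by (auto simp: A_cand_def)
    have D: "bell_D lam C Q x = ereal (D_cand lam C x)" if "x \<in> Omega C" for lam x
      using O[OF that] bv(4) True by (auto simp: D_cand_def)
    \<comment> \<open>With \<open>xi_plus 1 = 0\<close> the reciprocal is infinite, so for
      \<open>C = 1\<close> no \<open>\<delta>\<close> falls under the divergent case.\<close>
    have inf: "1 / ereal (xi_plus C) = \<infinity>" using inverse_xi_plus_1 True by simp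
    show ?thesis using bp b1 B2 A D by (auto simp: inf)
  next
    case False
    then have C: "1 < C" using assms(1) by simp
    note xi = xi_plus_props[OF C]
    have P: "bellman_point a b Q C (fst x) (snd x)" if "x \<in> Omega C" for x
      using that ab Q C by (auto simp: bellman_point_def Omega_def)
    have quot: "1 / ereal (xi_plus C) = ereal (1 / xi_plus C)" using xi by (simp add: divide_ereal_def inverse_eq_divide)
    have bp: "bell_b p C Q x = ereal (b_cand p C x)"
      if "1 < p" "p \<le> 2" "exp (p - 2) / (p - 1) \<le> C" "x \<in> Omega C" for p x
    proof -
      have "2 - p \<le> xi_plus C" by (rule xi_plus_ge[OF C]) (use that in auto)
      then show ?thesis using bellman_point.bell_bp_eq[OF P[OF that(4)] that(1,2)] by simp
    qed
    \<comment> \<open>For \<open>p = 2\<close> the condition on \<open>C\<close> reads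
      \<open>1 \<le> C\<close>.\<close>
    have b2: "bell_b 2 C Q x = ereal (b_cand 2 C x)" if "x \<in> Omega C" for x
      by (rule bp) (use that assms(1) in auto)
    have A: "bell_A \<delta> C Q x = ereal (A_cand \<delta> C x)" if "1 \<le> \<delta>" "ereal \<delta> < 1 / ereal (xi_plus C)" "x \<in> Omega C" for \<delta> x
    proof -
      have "\<delta> * xi_plus C < 1" using that(2) xi unfolding quot by (simp add: less_divide_eq)
      then show ?thesis using bellman_point.bell_A_eq[OF P[OF that(3)] that(1)] by simp
    qed
    have Ai: "bell_A \<delta> C Q x = \<infinity>" if "1 / ereal (xi_plus C) \<le> ereal \<delta>" "x \<in> Omega C" "exp (fst x) < snd x" for \<delta> x
    proof -
      have "1 \<le> \<delta> * xi_plus C" using that(1) xi unfolding quot by (simp add: divide_le_eq)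
      then show ?thesis using bellman_point.bell_A_infinite[OF P[OF that(2)] _ that(3)] by simp
    qed
    have Ab: "bell_A \<delta> C Q x = ereal (exp (\<delta> * fst x))" if "snd x = exp (fst x)" for \<delta> x
      using bv(3)[of \<delta> "fst x"] that by (metis prod.collapse)
    have b1: "bell_b 1 C Q x = ereal (b1_cand C x)" if "x \<in> Omega C" for x
      using bellman_point.bell_b1_eq[OF P[OF that]] by simp
    have B2: "bell_B2 C Q x = ereal (B2_cand C x)" if "x \<in> Omega C" for x
      using bellman_point.bell_B2_eq[OF P[OF that]] by simp
    have D: "bell_D lam C Q x = ereal (D_cand lam C x)" if "x \<in> Omega C" for lam x
      using bellman_point.bell_D_eq[OF P[OF that]] by simp
    show ?thesis using bp b2 b1 B2 A Ai Ab D by blast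
  qed
qed

end
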